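(* Let $(G,\pi_G)$ be a Poisson Lie group with Drinfeld double Lie algebra $(\mathfrak d=\mathfrak g\oplus\mathfrak g^*,\langle\cdot,\cdot\rangle)$, and assume that $(G,\pi_G)$ admits a Drinfeld double $(D,\phi_G)$, $\phi_G:G\to D$, $g\mapsto\bar g$. Let $\mathfrak l$ be any lagrangian Lie subalgebra of $(\mathfrak d,\langle\cdot,\cdot\rangle)$, and let $\phi_{G^*}:G^*\to D$, $k\mapsto\bar k$, and $\phi_L:L\to D$, $l\mapsto\bar l$, be any integrations of the Lie algebra inclusions $\mathfrak g^*\to\mathfrak d$ and $\mathfrak l\to\mathfrak d$, respectively. Consider the Lie groupoid over $G$ $$\mathcal G(L)=\{(k,g_1,g_2,l)\in G^*\times G\times G\times L\mid\bar k\bar g_1=\bar g_2\bar l^{-1}\}.$$ Then the $2$-form $$\omega_L=\tfrac12\langle\theta^{\mathsf l}_{G,1}\wedge\theta^{\mathsf r}_L\rangle+\tfrac12\langle\theta^{\mathsf r}_{G^*}\wedge\theta^{\mathsf r}_{G,2}\rangle\in\Omega^2(\mathcal G(L))$$ is multiplicative and closed, and $(\mathcal G(L),\omega_L)$ is a pre-symplectic groupoid integrating the Dirac structure $\mathbf e(\mathfrak l_G)$ on $G$.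
   Context: Conventions: the bracket of the Lie algebra $\mathfrak g=T_eG$ of a Lie group is defined via right-invariant vector fields, $[u_1,u_2]^{\mathsf r}=[u_1^{\mathsf r},u_2^{\mathsf r}]$. Superscripts $\mathsf l,\mathsf r$ denote left/right-invariant tensor fields with given value at $e$; $\mathsf l_g,\mathsf r_g$ are left/right translations (also their differentials). An integration of a Lie algebra homomorphism $\mathfrak s\to\mathfrak t$ is a Lie group homomorphism $S\to T$ of (not necessarily connected) Lie groups with these Lie algebras whose differential is the given map. Poisson Lie group: a Lie group $G$ with a Poisson structure $\pi_G$ such that multiplication $G\times G\to G$ is Poisson. Set $\delta_*(u)=\frac{d}{d\epsilon}|_{0}\mathsf r_{\exp(-\epsilon u)}(\pi_G|_{\exp(\epsilon u)})\in\wedge^2\mathfrak g$; $\mathfrak g^*$ is a Lie algebra via $\delta_*(u)(\xi,\eta)=-u([\xi,\eta]_{\mathfrak g^*})$. The Drinfeld double Lie algebra is $\mathfrak d=\mathfrak g\oplus\mathfrak g^*$ with $\langle u+\xi,w+\eta\rangle=\eta(u)+\xi(w)$ and the unique Lie bracket for which $\langle\cdot,\cdot\rangle$ is ad-invariant and $\mathfrak g,\mathfrak g^*$ are Lie subalgebras. $G$ acts on $\mathfrak d$ by $\mathrm{Ad}_g(u+\xi)=\mathrm{Ad}_gu+i_{\mathrm{Ad}^*_{g^{-1}}\xi}(\mathsf r_{g^{-1}}(\pi_G|_g))+\mathrm{Ad}^*_{g^{-1}}\xi$, where $g\mapsto\mathrm{Ad}^*_{g^{-1}}$ is the coadjoint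 representation. A Drinfeld double of $(G,\pi_G)$ is a pair $(D,\phi_G)$ where $D$ is a Lie group with Lie algebra $\mathfrak d$ whose adjoint action preserves $\langle\cdot,\cdot\rangle$, and $\phi_G:G\to D$, $g\mapsto\bar g$, is an integration of $\mathfrak g\hookrightarrow\mathfrak d$ with $\mathrm{Ad}_g=\mathrm{Ad}_{\bar g}$ on $\mathfrak d$ for all $g\in G$. A Lie subalgebra $\mathfrak l\subset\mathfrak d$ is lagrangian if it equals its orthogonal for $\langle\cdot,\cdot\rangle$. Groupoid structure of $\mathcal G(L)\rightrightarrows G$: $\mathbf s(k,g_1,g_2,l)=g_2$, $\mathbf t(k,g_1,g_2,l)=g_1$, $1_g=(e,g,g,e)$, $(k,g_1,g_2,l)^{-1}=(k^{-1},g_2,g_1,l^{-1})$, $(k_1,g_1,g,l_1)(k_2,g,g_2,l_2)=(k_2k_1,g_1,g_2,l_1l_2)$. Forms: $\theta^{\mathsf r}_{G^*},\theta^{\mathsf l}_{G,1},\theta^{\mathsf r}_{G,2},\theta^{\mathsf r}_L$ are the pullbacks to $\mathcal G(L)$ of the right (resp. left, right, right) invariant Maurer–Cartan forms of $G^*$, of the first factor $G$ (variable $g_1$), of the second factor $G$ (variable $g_2$), and of $L$, viewed as $\mathfrak d$-valued $1$-forms. For $\mathfrak d$-valued $1$-forms, $\langle\theta_1\wedge\theta_2\rangle(v_1,v_2)=\langle\theta_1(v_1),\theta_2(v_2)\rangle-\langle\theta_2(v_1),\theta_1(v_2)\rangle$. Dirac structures on a manifold $M$: subbundles of $\mathbb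 TM=TM\oplus T^*M$ lagrangian for $\langle(X,\alpha),(Y,\beta)\rangle=\beta(X)+\alpha(Y)$ and involutive for $[\![(X,\alpha),(Y,\beta)]\!]=([X,Y],\mathcal L_X\beta-i_Yd\alpha)$. Here $\mathbf e(\mathfrak l_G)|_g=\{-(u^{\mathsf l}+\pi_G^\sharp(\xi^{\mathsf l}),\xi^{\mathsf l})|_g: u\in\mathfrak g,\xi\in\mathfrak g^*,u+\xi\in\mathfrak l\}$, where $u^{\mathsf l}$ is a left-invariant vector field, $\xi^{\mathsf l}$ a left-invariant $1$-form, and $\pi_G^\sharp(\alpha)=i_\alpha\pi_G$; this is a Dirac structure on $G$. Pre-symplectic groupoids: for a Lie groupoid $\mathcal G\rightrightarrows M$ with Lie algebroid $A=\ker(d\mathbf s)|_M$, anchor $\rho=d\mathbf t|_A$, and $\omega\in\Omega^2(\mathcal G)$, let $\mu_\omega(a)=(i_a\omega)|_{TM}$, $\delta_\omega=(\rho,\mu_\omega):A\to\mathbb TM$. $\omega$ is multiplicative if $m^*\omega=\mathrm p_1^*\omega+\mathrm p_2^*\omega$ on composable pairs. $(\mathcal G,\omega)$ is a pre-symplectic groupoid if $\omega$ is closed and multiplicative, $\dim\mathcal G=2\dim M$, and $\delta_\omega$ is injective; it integrates the Dirac structure $\delta_\omega(A)$. *)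

theory Defs
  imports "HOL-Analysis.Analysis" "HOL-Algebra.Group"
begin

section \<open>Smooth manifolds\<close>

text \<open>
  Model spaces are finite-dimensional normed spaces. The class \<^class>\<open>euclidean_space\<close> would
  force the dimension to be positive and so exclude discrete groups.
\<close>

primrec Ck_on :: "nat \<Rightarrow> 'a::real_normed_vector set \<Rightarrow> ('a \<Rightarrow> 'b::real_normed_vector) \<Rightarrow> bool" where
  "Ck_on 0 U f \<longleftrightarrow> continuous_on U f"
| "Ck_on (Suc k) U f \<longleftrightarrow>
     (\<forall>x\<in>U. f differentiable (at x)) \<and> (\<forall>v. Ck_on k U (\<lambda>x. frechet_derivative f (at x) v))"

text \<open>Only used for open \<open>U\<close>.\<close>

definition smooth_on :: "'a::real_normed_vector set \<Rightarrow> ('a \<Rightarrow> 'b::real_normed_vector) \<Rightarrow> bool" where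
  "smooth_on U f \<longleftrightarrow> (\<forall>k. Ck_on k U f)"

text \<open>
  The atlas of a manifold is indexed by its points: \<open>chart M p\<close>, with domain \<open>chart_dom M p\<close>, is a
  chart around \<open>p\<close>. Every atlas contains such a family defining the same smooth structure. The
  tangent space at \<open>p\<close> is the model space \<open>'e\<close>, through the coordinates of \<open>chart M p\<close>, and the
  cotangent space at \<open>p\<close> is \<open>'e \<Rightarrow>\<^sub>L real\<close>.
\<close>

record ('a, 'e) manifold =
  points :: "'a set"
  chart_dom :: "'a \<Rightarrow> 'a set"
  chart :: "'a \<Rightarrow> 'a \<Rightarrow> 'e"

type_synonym 'e covector = "'e \<Rightarrow>\<^sub>L real"

definition chart_inv :: "('a, 'e) manifold \<Rightarrow> 'a \<Rightarrow> 'e \<Rightarrow> 'a" where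
  "chart_inv M p = inv_into (chart_dom M p) (chart M p)"

definition mtopology :: "('a, 'e::real_normed_vector) manifold \<Rightarrow> 'a topology" where
  "mtopology M = topology (\<lambda>U. U \<subseteq> points M \<and>
     (\<forall>p\<in>points M. open (chart M p ` (U \<inter> chart_dom M p))))"

definition manifold :: "('a, 'e::real_normed_vector) manifold \<Rightarrow> bool" where
  "manifold M \<longleftrightarrow>
     (\<exists>B :: 'e set. finite B \<and> span B = UNIV) \<and>
     (\<forall>p\<in>points M. p \<in> chart_dom M p \<and> chart_dom M p \<subseteq> points M \<and>
        inj_on (chart M p) (chart_dom M p) \<and> open (chart M p ` chart_dom M p)) \<and>
     (\<forall>p\<in>points M. \<forall>q\<in>points M.
        open (chart M p ` (chart_dom M p \<inter> chart_dom M q)) \<and>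
        smooth_on (chart M p ` (chart_dom M p \<inter> chart_dom M q)) (chart M q \<circ> chart_inv M p)) \<and>
     Hausdorff_space (mtopology M) \<and> second_countable (mtopology M)"

definition vspace :: "('e, 'e) manifold" where
  "vspace = \<lparr>points = UNIV, chart_dom = (\<lambda>_. UNIV), chart = (\<lambda>_ x. x)\<rparr>"

definition prod_manifold ::
  "('a, 'e) manifold \<Rightarrow> ('b, 'f) manifold \<Rightarrow> ('a \<times> 'b, 'e \<times> 'f) manifold" (infixr "\<times>\<^sub>m" 80) where
  "M \<times>\<^sub>m N =
     \<lparr>points = points M \<times> points N,
      chart_dom = (\<lambda>(p, q). chart_dom M p \<times> chart_dom N q),
      chart = (\<lambda>(p, q) (x, y). (chart M p x, chart N q y))\<rparr>"

definition smooth_map ::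
  "('a, 'e::real_normed_vector) manifold \<Rightarrow> ('b, 'f::real_normed_vector) manifold \<Rightarrow> ('a \<Rightarrow> 'b) \<Rightarrow> bool"
where
  "smooth_map M N f \<longleftrightarrow> f ` points M \<subseteq> points N \<and>
     (\<forall>p\<in>points M. \<exists>U. openin (mtopology M) U \<and> p \<in> U \<and> U \<subseteq> chart_dom M p \<and>
        f ` U \<subseteq> chart_dom N (f p) \<and>
        smooth_on (chart M p ` U) (chart N (f p) \<circ> f \<circ> chart_inv M p))"

text \<open>\<open>tangent_map M N f p\<close> is the differential \<open>T\<^sub>pM \<rightarrow> T\<^bsub>f p\<^esub>N\<close>.\<close>

definition tangent_map ::
  "('a, 'e::real_normed_vector) manifold \<Rightarrow> ('b, 'f::real_normed_vector) manifold \<Rightarrow> ('a \<Rightarrow> 'b) \<Rightarrow>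
   'a \<Rightarrow> 'e \<Rightarrow> 'f" where
  "tangent_map M N f p = frechet_derivative (chart N (f p) \<circ> f \<circ> chart_inv M p) (at (chart M p p))"

definition embedded_submanifold ::
  "('a, 's::real_normed_vector) manifold \<Rightarrow> ('a, 'e::real_normed_vector) manifold \<Rightarrow> bool" where
  "embedded_submanifold S M \<longleftrightarrow> manifold S \<and> manifold M \<and> points S \<subseteq> points M \<and>
     mtopology S = subtopology (mtopology M) (points S) \<and>
     smooth_map S M (\<lambda>x. x) \<and> (\<forall>p\<in>points S. inj (tangent_map S M (\<lambda>x. x) p))"


section \<open>Tensor fields\<close>

text \<open>
  A vector field assigns to \<open>q\<close> an element of \<open>T\<^sub>qM = 'e\<close>, which is expressed in the coordinates of
  \<open>chart M q\<close>. \<open>to_chart M p q\<close> turns it into its components in the fixed chart at \<open>p\<close>, and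
  \<open>from_chart M p q\<close> is the inverse change of components. The functions \<open>vf_rep\<close>, \<open>form_rep\<close>, ...
  are the component functions of tensor fields in the chart at \<open>p\<close>; at the point \<open>p\<close> itself they
  agree with the tensor.
\<close>

definition to_chart :: "('a, 'e::real_normed_vector) manifold \<Rightarrow> 'a \<Rightarrow> 'a \<Rightarrow> 'e \<Rightarrow> 'e" where
  "to_chart M p q = frechet_derivative (chart M p \<circ> chart_inv M q) (at (chart M q q))"

definition from_chart :: "('a, 'e::real_normed_vector) manifold \<Rightarrow> 'a \<Rightarrow> 'a \<Rightarrow> 'e \<Rightarrow> 'e" where
  "from_chart M p q = frechet_derivative (chart M q \<circ> chart_inv M p) (at (chart M p q))"

text \<open>The transpose of a linear map.\<close>

definition cov_pull ::
  "('e::real_normed_vector \<Rightarrow> 'f::real_normed_vector) \<Rightarrow> 'f covector \<Rightarrow> 'e covector" where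
  "cov_pull A \<alpha> = Blinfun (\<lambda>v. blinfun_apply \<alpha> (A v))"

definition differential ::
  "('a, 'e::real_normed_vector) manifold \<Rightarrow> ('a \<Rightarrow> real) \<Rightarrow> 'a \<Rightarrow> 'e covector" where
  "differential M f p = Blinfun (tangent_map M vspace f p)"

definition vf_rep ::
  "('a, 'e::real_normed_vector) manifold \<Rightarrow> 'a \<Rightarrow> ('a \<Rightarrow> 'e) \<Rightarrow> 'e \<Rightarrow> 'e" where
  "vf_rep M p X x = (let q = chart_inv M p x in to_chart M p q (X q))"

definition form_rep ::
  "('a, 'e::real_normed_vector) manifold \<Rightarrow> 'a \<Rightarrow> ('a \<Rightarrow> 'e covector) \<Rightarrow> 'e \<Rightarrow> 'e covector" where
  "form_rep M p \<alpha> x = (let q = chart_inv M p x in cov_pull (from_chart M p q) (\<alpha> q))"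

definition form2_rep ::
  "('a, 'e::real_normed_vector) manifold \<Rightarrow> 'a \<Rightarrow> ('a \<Rightarrow> 'e \<Rightarrow> 'e \<Rightarrow> real) \<Rightarrow> 'e \<Rightarrow> 'e \<Rightarrow> 'e \<Rightarrow> real" where
  "form2_rep M p \<omega> x u v =
     (let q = chart_inv M p x in \<omega> q (from_chart M p q u) (from_chart M p q v))"

text \<open>Elements of \<open>\<And>\<^sup>2 V\<close> are represented as alternating bilinear forms on the dual of \<open>V\<close>.\<close>

type_synonym 'e bivector = "'e covector \<Rightarrow> 'e covector \<Rightarrow> real"

definition push_bivector ::
  "('e::real_normed_vector \<Rightarrow> 'f::real_normed_vector) \<Rightarrow> 'e bivector \<Rightarrow> 'f bivector" where
  "push_bivector A P \<alpha> \<beta> = P (cov_pull A \<alpha>) (cov_pull A \<beta>)"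

text \<open>\<open>sharp P \<alpha>\<close> is the contraction \<open>i\<^sub>\<alpha> P\<close>.\<close>

definition sharp :: "'e::real_normed_vector bivector \<Rightarrow> 'e covector \<Rightarrow> 'e" where
  "sharp P \<alpha> = (THE w. \<forall>\<beta>. blinfun_apply \<beta> w = P \<alpha> \<beta>)"

definition bivec_rep ::
  "('a, 'e::real_normed_vector) manifold \<Rightarrow> 'a \<Rightarrow> ('a \<Rightarrow> 'e bivector) \<Rightarrow> 'e \<Rightarrow> 'e bivector" where
  "bivec_rep M p \<pi> x = (let q = chart_inv M p x in push_bivector (to_chart M p q) (\<pi> q))"

definition lie_bracket ::
  "('a, 'e::real_normed_vector) manifold \<Rightarrow> ('a \<Rightarrow> 'e) \<Rightarrow> ('a \<Rightarrow> 'e) \<Rightarrow> 'a \<Rightarrow> 'e" where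
  "lie_bracket M X Y p =
     frechet_derivative (vf_rep M p Y) (at (chart M p p)) (X p) -
     frechet_derivative (vf_rep M p X) (at (chart M p p)) (Y p)"

definition ext_deriv1 ::
  "('a, 'e::real_normed_vector) manifold \<Rightarrow> ('a \<Rightarrow> 'e covector) \<Rightarrow> 'a \<Rightarrow> 'e \<Rightarrow> 'e \<Rightarrow> real" where
  "ext_deriv1 M \<alpha> p u v =
     blinfun_apply (frechet_derivative (form_rep M p \<alpha>) (at (chart M p p)) u) v -
     blinfun_apply (frechet_derivative (form_rep M p \<alpha>) (at (chart M p p)) v) u"

definition ext_deriv2 ::
  "('a, 'e::real_normed_vector) manifold \<Rightarrow> ('a \<Rightarrow> 'e \<Rightarrow> 'e \<Rightarrow> real) \<Rightarrow> 'a \<Rightarrow> 'e \<Rightarrow> 'e \<Rightarrow> 'e \<Rightarrow> real" where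
  "ext_deriv2 M \<omega> p u v w =
     frechet_derivative (\<lambda>x. form2_rep M p \<omega> x v w) (at (chart M p p)) u -
     frechet_derivative (\<lambda>x. form2_rep M p \<omega> x u w) (at (chart M p p)) v +
     frechet_derivative (\<lambda>x. form2_rep M p \<omega> x u v) (at (chart M p p)) w"

text \<open>In coordinates, \<open>(\<L>\<^sub>X \<beta>)(v) = (D\<beta> X)(v) + \<beta>(DX v)\<close>.\<close>

definition lie_deriv_form ::
  "('a, 'e::real_normed_vector) manifold \<Rightarrow> ('a \<Rightarrow> 'e) \<Rightarrow> ('a \<Rightarrow> 'e covector) \<Rightarrow> 'a \<Rightarrow> 'e covector" where
  "lie_deriv_form M X \<beta> p = Blinfun (\<lambda>v.
     blinfun_apply (frechet_derivative (form_rep M p \<beta>) (at (chart M p p)) (X p)) v +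
     blinfun_apply (\<beta> p) (frechet_derivative (vf_rep M p X) (at (chart M p p)) v))"

definition two_form ::
  "('a, 'e::real_normed_vector) manifold \<Rightarrow> ('a \<Rightarrow> 'e \<Rightarrow> 'e \<Rightarrow> real) \<Rightarrow> bool" where
  "two_form M \<omega> \<longleftrightarrow>
     (\<forall>p\<in>points M. bilinear (\<omega> p) \<and> (\<forall>v. \<omega> p v v = 0)) \<and>
     (\<forall>p\<in>points M. \<forall>u v. smooth_on (chart M p ` chart_dom M p) (\<lambda>x. form2_rep M p \<omega> x u v))"

definition closed_form ::
  "('a, 'e::real_normed_vector) manifold \<Rightarrow> ('a \<Rightarrow> 'e \<Rightarrow> 'e \<Rightarrow> real) \<Rightarrow> bool" where
  "closed_form M \<omega> \<longleftrightarrow> (\<forall>p\<in>points M. \<forall>u v w. ext_deriv2 M \<omega> p u v w = 0)"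

definition bivector_field ::
  "('a, 'e::real_normed_vector) manifold \<Rightarrow> ('a \<Rightarrow> 'e bivector) \<Rightarrow> bool" where
  "bivector_field M \<pi> \<longleftrightarrow>
     (\<forall>p\<in>points M. bilinear (\<pi> p) \<and> (\<forall>\<alpha>. \<pi> p \<alpha> \<alpha> = 0)) \<and>
     (\<forall>p\<in>points M. \<forall>\<alpha> \<beta>. smooth_on (chart M p ` chart_dom M p) (\<lambda>x. bivec_rep M p \<pi> x \<alpha> \<beta>))"


section \<open>Poisson and Dirac structures\<close>

definition poisson_bracket ::
  "('a, 'e::real_normed_vector) manifold \<Rightarrow> ('a \<Rightarrow> 'e bivector) \<Rightarrow> ('a \<Rightarrow> real) \<Rightarrow> ('a \<Rightarrow> real) \<Rightarrow> 'a \<Rightarrow> real"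
where
  "poisson_bracket M \<pi> f h p = \<pi> p (differential M f p) (differential M h p)"

definition poisson ::
  "('a, 'e::real_normed_vector) manifold \<Rightarrow> ('a \<Rightarrow> 'e bivector) \<Rightarrow> bool" where
  "poisson M \<pi> \<longleftrightarrow> bivector_field M \<pi> \<and>
     (\<forall>f g h. smooth_map M vspace f \<longrightarrow> smooth_map M vspace g \<longrightarrow> smooth_map M vspace h \<longrightarrow>
       (\<forall>p\<in>points M.
          poisson_bracket M \<pi> f (poisson_bracket M \<pi> g h) p +
          poisson_bracket M \<pi> g (poisson_bracket M \<pi> h f) p +
          poisson_bracket M \<pi> h (poisson_bracket M \<pi> f g) p = 0))"

definition prod_poisson ::
  "('a \<Rightarrow> 'e::real_normed_vector bivector) \<Rightarrow> ('b \<Rightarrow> 'f::real_normed_vector bivector) \<Rightarrow>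
   'a \<times> 'b \<Rightarrow> ('e \<times> 'f) bivector" where
  "prod_poisson \<pi>\<^sub>1 \<pi>\<^sub>2 = (\<lambda>(p, q) \<alpha> \<beta>.
     push_bivector (\<lambda>v. (v, 0)) (\<pi>\<^sub>1 p) \<alpha> \<beta> + push_bivector (\<lambda>v. (0, v)) (\<pi>\<^sub>2 q) \<alpha> \<beta>)"

definition poisson_map ::
  "('a, 'e::real_normed_vector) manifold \<Rightarrow> ('a \<Rightarrow> 'e bivector) \<Rightarrow>
   ('b, 'f::real_normed_vector) manifold \<Rightarrow> ('b \<Rightarrow> 'f bivector) \<Rightarrow> ('a \<Rightarrow> 'b) \<Rightarrow> bool" where
  "poisson_map M \<pi> N \<rho> f \<longleftrightarrow> smooth_map M N f \<and>
     (\<forall>p\<in>points M. push_bivector (tangent_map M N f p) (\<pi> p) = \<rho> (f p))"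

text \<open>
  The pairing on \<open>V \<oplus> V\<^sup>*\<close>; it serves both for the double Lie algebra and for the fibres of
  \<open>TM \<oplus> T\<^sup>*M\<close>.
\<close>

fun pairing ::
  "'e::real_normed_vector \<times> 'e covector \<Rightarrow> 'e \<times> 'e covector \<Rightarrow> real" where
  "pairing (u, \<xi>) (w, \<eta>) = blinfun_apply \<eta> u + blinfun_apply \<xi> w"

definition lagrangian :: "('e::real_normed_vector \<times> 'e covector) set \<Rightarrow> bool" where
  "lagrangian W \<longleftrightarrow> W = {x. \<forall>y\<in>W. pairing x y = 0}"

definition smooth_section ::
  "('a, 'e::real_normed_vector) manifold \<Rightarrow> 'a set \<Rightarrow> ('a \<Rightarrow> 'e \<times> 'e covector) \<Rightarrow> bool" where
  "smooth_section M U \<sigma> \<longleftrightarrow> (\<forall>p\<in>points M.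
     smooth_on (chart M p ` (U \<inter> chart_dom M p)) (vf_rep M p (fst \<circ> \<sigma>)) \<and>
     smooth_on (chart M p ` (U \<inter> chart_dom M p)) (form_rep M p (snd \<circ> \<sigma>)))"

definition subbundle ::
  "('a, 'e::real_normed_vector) manifold \<Rightarrow> ('a \<Rightarrow> ('e \<times> 'e covector) set) \<Rightarrow> bool" where
  "subbundle M E \<longleftrightarrow> (\<exists>r::nat. \<forall>p\<in>points M. \<exists>U \<sigma>.
     openin (mtopology M) U \<and> p \<in> U \<and> (\<forall>i<r. smooth_section M U (\<sigma> i)) \<and>
     (\<forall>q\<in>U. inj_on (\<lambda>i. \<sigma> i q) {..<r} \<and> independent ((\<lambda>i. \<sigma> i q) ` {..<r}) \<and>
        span ((\<lambda>i. \<sigma> i q) ` {..<r}) = E q))"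

definition courant_bracket ::
  "('a, 'e::real_normed_vector) manifold \<Rightarrow> ('a \<Rightarrow> 'e \<times> 'e covector) \<Rightarrow> ('a \<Rightarrow> 'e \<times> 'e covector) \<Rightarrow>
   'a \<Rightarrow> 'e \<times> 'e covector" where
  "courant_bracket M \<sigma> \<tau> p =
     (lie_bracket M (fst \<circ> \<sigma>) (fst \<circ> \<tau>) p,
      lie_deriv_form M (fst \<circ> \<sigma>) (snd \<circ> \<tau>) p -
      Blinfun (ext_deriv1 M (snd \<circ> \<sigma>) p (fst (\<tau> p))))"

definition dirac_structure ::
  "('a, 'e::real_normed_vector) manifold \<Rightarrow> ('a \<Rightarrow> ('e \<times> 'e covector) set) \<Rightarrow> bool" where
  "dirac_structure M E \<longleftrightarrow> subbundle M E \<and> (\<forall>p\<in>points M. lagrangian (E p)) \<and>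
     (\<forall>\<sigma> \<tau>. smooth_section M (points M) \<sigma> \<longrightarrow> smooth_section M (points M) \<tau> \<longrightarrow>
        (\<forall>p\<in>points M. \<sigma> p \<in> E p \<and> \<tau> p \<in> E p) \<longrightarrow>
        (\<forall>p\<in>points M. courant_bracket M \<sigma> \<tau> p \<in> E p))"


section \<open>Lie groups\<close>

record ('a, 'e) lie_group = "'a monoid" +
  mfd :: "('a, 'e) manifold"

definition lie_group :: "('a, 'e::real_normed_vector) lie_group \<Rightarrow> bool" where
  "lie_group G \<longleftrightarrow> group G \<and> manifold (mfd G) \<and> points (mfd G) = carrier G \<and>
     smooth_map (mfd G \<times>\<^sub>m mfd G) (mfd G) (\<lambda>(g, h). g \<otimes>\<^bsub>G\<^esub> h) \<and>
     smooth_map (mfd G) (mfd G) (\<lambda>g. inv\<^bsub>G\<^esub> g)"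

text \<open>\<open>dL G g h\<close> and \<open>dR G g h\<close>: differentials at \<open>h\<close> of left and right translation by \<open>g\<close>.\<close>

definition dL :: "('a, 'e::real_normed_vector) lie_group \<Rightarrow> 'a \<Rightarrow> 'a \<Rightarrow> 'e \<Rightarrow> 'e" where
  "dL G g h = tangent_map (mfd G) (mfd G) (\<lambda>x. g \<otimes>\<^bsub>G\<^esub> x) h"

definition dR :: "('a, 'e::real_normed_vector) lie_group \<Rightarrow> 'a \<Rightarrow> 'a \<Rightarrow> 'e \<Rightarrow> 'e" where
  "dR G g h = tangent_map (mfd G) (mfd G) (\<lambda>x. x \<otimes>\<^bsub>G\<^esub> g) h"

definition left_inv_vf :: "('a, 'e::real_normed_vector) lie_group \<Rightarrow> 'e \<Rightarrow> 'a \<Rightarrow> 'e" where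
  "left_inv_vf G u g = dL G g \<one>\<^bsub>G\<^esub> u"

definition right_inv_vf :: "('a, 'e::real_normed_vector) lie_group \<Rightarrow> 'e \<Rightarrow> 'a \<Rightarrow> 'e" where
  "right_inv_vf G u g = dR G g \<one>\<^bsub>G\<^esub> u"

definition left_inv_form ::
  "('a, 'e::real_normed_vector) lie_group \<Rightarrow> 'e covector \<Rightarrow> 'a \<Rightarrow> 'e covector" where
  "left_inv_form G \<xi> g = cov_pull (dL G (inv\<^bsub>G\<^esub> g) g) \<xi>"

text \<open>Maurer--Cartan forms.\<close>

definition mc_left :: "('a, 'e::real_normed_vector) lie_group \<Rightarrow> 'a \<Rightarrow> 'e \<Rightarrow> 'e" where
  "mc_left G g v = dL G (inv\<^bsub>G\<^esub> g) g v"

definition mc_right :: "('a, 'e::real_normed_vector) lie_group \<Rightarrow> 'a \<Rightarrow> 'e \<Rightarrow> 'e" where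
  "mc_right G g v = dR G (inv\<^bsub>G\<^esub> g) g v"

text \<open>
  The bracket on \<open>T\<^sub>eG\<close> comes from right-invariant vector fields, so it is the opposite of the one
  given by left-invariant vector fields.
\<close>

definition lie_alg_bracket :: "('a, 'e::real_normed_vector) lie_group \<Rightarrow> 'e \<Rightarrow> 'e \<Rightarrow> 'e" where
  "lie_alg_bracket G u w = lie_bracket (mfd G) (right_inv_vf G u) (right_inv_vf G w) \<one>\<^bsub>G\<^esub>"

definition Ad :: "('a, 'e::real_normed_vector) lie_group \<Rightarrow> 'a \<Rightarrow> 'e \<Rightarrow> 'e" where
  "Ad G g = tangent_map (mfd G) (mfd G) (\<lambda>x. g \<otimes>\<^bsub>G\<^esub> x \<otimes>\<^bsub>G\<^esub> inv\<^bsub>G\<^esub> g) \<one>\<^bsub>G\<^esub>"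

definition one_param_subgroup ::
  "('a, 'e::real_normed_vector) lie_group \<Rightarrow> 'e \<Rightarrow> (real \<Rightarrow> 'a) \<Rightarrow> bool" where
  "one_param_subgroup G u \<gamma> \<longleftrightarrow> smooth_map vspace (mfd G) \<gamma> \<and>
     (\<forall>s t. \<gamma> (s + t) = \<gamma> s \<otimes>\<^bsub>G\<^esub> \<gamma> t) \<and> tangent_map vspace (mfd G) \<gamma> 0 1 = u"

definition lie_exp :: "('a, 'e::real_normed_vector) lie_group \<Rightarrow> 'e \<Rightarrow> 'a" where
  "lie_exp G u = (THE \<gamma>. one_param_subgroup G u \<gamma>) 1"

definition lie_hom ::
  "('a, 'e::real_normed_vector) lie_group \<Rightarrow> ('b, 'f::real_normed_vector) lie_group \<Rightarrow> ('a \<Rightarrow> 'b) \<Rightarrow> bool"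
where
  "lie_hom S T \<phi> \<longleftrightarrow> \<phi> \<in> hom S T \<and> smooth_map (mfd S) (mfd T) \<phi>"

text \<open>
  \<open>S\<close> is a Lie group with Lie algebra the subspace \<open>\<ss>\<close> with bracket \<open>b\<close>; the map \<open>\<iota>\<close> is the
  identification of \<open>T\<^sub>eS\<close> with \<open>\<ss>\<close>.
\<close>

definition has_lie_algebra ::
  "('a, 'e::real_normed_vector) lie_group \<Rightarrow> ('e \<Rightarrow> 'v::real_normed_vector) \<Rightarrow> 'v set \<Rightarrow> ('v \<Rightarrow> 'v \<Rightarrow> 'v) \<Rightarrow> bool"
where
  "has_lie_algebra S \<iota> \<ss> b \<longleftrightarrow> lie_group S \<and> linear \<iota> \<and> inj \<iota> \<and> range \<iota> = \<ss> \<and>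
     (\<forall>u w. \<iota> (lie_alg_bracket S u w) = b (\<iota> u) (\<iota> w))"

text \<open>\<open>\<phi> : S \<rightarrow> T\<close> integrates \<open>f\<close>, the Lie algebras being identified through \<open>\<iota>\<close> and \<open>\<kappa>\<close>.\<close>

definition integration ::
  "('a, 'e::real_normed_vector) lie_group \<Rightarrow> ('e \<Rightarrow> 'v) \<Rightarrow>
   ('b, 'f::real_normed_vector) lie_group \<Rightarrow> ('f \<Rightarrow> 'w) \<Rightarrow> ('v \<Rightarrow> 'w) \<Rightarrow> ('a \<Rightarrow> 'b) \<Rightarrow> bool" where
  "integration S \<iota> T \<kappa> f \<phi> \<longleftrightarrow> lie_hom S T \<phi> \<and>
     (\<forall>u. \<kappa> (tangent_map (mfd S) (mfd T) \<phi> \<one>\<^bsub>S\<^esub> u) = f (\<iota> u))"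


section \<open>Poisson Lie groups and their doubles\<close>

definition poisson_lie_group ::
  "('a, 'e::real_normed_vector) lie_group \<Rightarrow> ('a \<Rightarrow> 'e bivector) \<Rightarrow> bool" where
  "poisson_lie_group G \<pi> \<longleftrightarrow> lie_group G \<and> poisson (mfd G) \<pi> \<and>
     poisson_map (mfd G \<times>\<^sub>m mfd G) (prod_poisson \<pi> \<pi>) (mfd G) \<pi> (\<lambda>(g, h). g \<otimes>\<^bsub>G\<^esub> h)"

definition delta_star ::
  "('a, 'e::real_normed_vector) lie_group \<Rightarrow> ('a \<Rightarrow> 'e bivector) \<Rightarrow> 'e \<Rightarrow> 'e bivector" where
  "delta_star G \<pi> u \<xi> \<eta> = deriv (\<lambda>\<epsilon>::real.
     push_bivector (dR G (lie_exp G (- (\<epsilon> *\<^sub>R u))) (lie_exp G (\<epsilon> *\<^sub>R u)))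
       (\<pi> (lie_exp G (\<epsilon> *\<^sub>R u))) \<xi> \<eta>) 0"

definition dual_bracket ::
  "('a, 'e::real_normed_vector) lie_group \<Rightarrow> ('a \<Rightarrow> 'e bivector) \<Rightarrow> 'e covector \<Rightarrow> 'e covector \<Rightarrow> 'e covector"
where
  "dual_bracket G \<pi> \<xi> \<eta> = Blinfun (\<lambda>u. - delta_star G \<pi> u \<xi> \<eta>)"

definition lie_algebra_bracket :: "('v::real_vector \<Rightarrow> 'v \<Rightarrow> 'v) \<Rightarrow> bool" where
  "lie_algebra_bracket b \<longleftrightarrow> bilinear b \<and> (\<forall>x. b x x = 0) \<and>
     (\<forall>x y z. b x (b y z) + b y (b z x) + b z (b x y) = 0)"

text \<open>
  The properties characterizing the bracket \<open>b\<close> of the Drinfeld double Lie algebra; exactly one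
  \<open>b\<close> has them when \<open>(G, \<pi>)\<close> is a Poisson Lie group.
\<close>

definition double_bracket ::
  "('a, 'e::real_normed_vector) lie_group \<Rightarrow> ('a \<Rightarrow> 'e bivector) \<Rightarrow>
   ('e \<times> 'e covector \<Rightarrow> 'e \<times> 'e covector \<Rightarrow> 'e \<times> 'e covector) \<Rightarrow> bool" where
  "double_bracket G \<pi> b \<longleftrightarrow> lie_algebra_bracket b \<and>
     (\<forall>x y z. pairing (b x y) z + pairing y (b x z) = 0) \<and>
     (\<forall>u w. b (u, 0) (w, 0) = (lie_alg_bracket G u w, 0)) \<and>
     (\<forall>\<xi> \<eta>. b (0, \<xi>) (0, \<eta>) = (0, dual_bracket G \<pi> \<xi> \<eta>))"

text \<open>\<open>coAd G g\<close> is the coadjoint action \<open>Ad\<^sup>*\<close> of \<open>g\<^sup>-\<^sup>1\<close>, a left action of \<open>G\<close>.\<close>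

definition coAd :: "('a, 'e::real_normed_vector) lie_group \<Rightarrow> 'a \<Rightarrow> 'e covector \<Rightarrow> 'e covector" where
  "coAd G g \<xi> = cov_pull (Ad G (inv\<^bsub>G\<^esub> g)) \<xi>"

fun double_Ad ::
  "('a, 'e::real_normed_vector) lie_group \<Rightarrow> ('a \<Rightarrow> 'e bivector) \<Rightarrow> 'a \<Rightarrow>
   'e \<times> 'e covector \<Rightarrow> 'e \<times> 'e covector" where
  "double_Ad G \<pi> g (u, \<xi>) =
     (Ad G g u + sharp (push_bivector (dR G (inv\<^bsub>G\<^esub> g) g) (\<pi> g)) (coAd G g \<xi>), coAd G g \<xi>)"

definition drinfeld_double ::
  "('a, 'e::real_normed_vector) lie_group \<Rightarrow> ('a \<Rightarrow> 'e bivector) \<Rightarrow>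
   ('e \<times> 'e covector \<Rightarrow> 'e \<times> 'e covector \<Rightarrow> 'e \<times> 'e covector) \<Rightarrow>
   ('d, 'f::real_normed_vector) lie_group \<Rightarrow> ('f \<Rightarrow> 'e \<times> 'e covector) \<Rightarrow> ('a \<Rightarrow> 'd) \<Rightarrow> bool" where
  "drinfeld_double G \<pi> b D \<iota>\<^sub>D \<phi> \<longleftrightarrow>
     has_lie_algebra D \<iota>\<^sub>D UNIV b \<and>
     (\<forall>d\<in>carrier D. \<forall>v w. pairing (\<iota>\<^sub>D (Ad D d v)) (\<iota>\<^sub>D (Ad D d w)) = pairing (\<iota>\<^sub>D v) (\<iota>\<^sub>D w)) \<and>
     integration G (\<lambda>u. u) D \<iota>\<^sub>D (\<lambda>u. (u, 0)) \<phi> \<and>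
     (\<forall>g\<in>carrier G. \<forall>v. \<iota>\<^sub>D (Ad D (\<phi> g) v) = double_Ad G \<pi> g (\<iota>\<^sub>D v))"

definition lagrangian_subalgebra ::
  "('e::real_normed_vector \<times> 'e covector \<Rightarrow> 'e \<times> 'e covector \<Rightarrow> 'e \<times> 'e covector) \<Rightarrow>
   ('e \<times> 'e covector) set \<Rightarrow> bool" where
  "lagrangian_subalgebra b \<ll> \<longleftrightarrow> subspace \<ll> \<and> (\<forall>x\<in>\<ll>. \<forall>y\<in>\<ll>. b x y \<in> \<ll>) \<and> lagrangian \<ll>"

definition e_dirac ::
  "('a, 'e::real_normed_vector) lie_group \<Rightarrow> ('a \<Rightarrow> 'e bivector) \<Rightarrow> ('e \<times> 'e covector) set \<Rightarrow>
   'a \<Rightarrow> ('e \<times> 'e covector) set" where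
  "e_dirac G \<pi> \<ll> g =
     {- (left_inv_vf G u g + sharp (\<pi> g) (left_inv_form G \<xi> g), left_inv_form G \<xi> g) | u \<xi>. (u, \<xi>) \<in> \<ll>}"


section \<open>Pre-symplectic groupoids\<close>

text \<open>
  The manifold of composable pairs, whose model space \<open>'c\<close> is not determined by those of the
  arrows and the base at the level of types, is a component of the record; \<open>lie_groupoid\<close> requires
  it to be the fibre product with its submanifold structure. \<open>gcomp \<G> a b\<close> is the product \<open>a b\<close>,
  defined when \<open>src \<G> a = tgt \<G> b\<close>.
\<close>

record ('a, 'm, 'b, 'e, 'c) groupoid =
  arrows :: "('a, 'm) manifold"
  base :: "('b, 'e) manifold"
  composables :: "('a \<times> 'a, 'c) manifold"
  src :: "'a \<Rightarrow> 'b"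
  tgt :: "'a \<Rightarrow> 'b"
  unit_arrow :: "'b \<Rightarrow> 'a"
  inv_arrow :: "'a \<Rightarrow> 'a"
  gcomp :: "'a \<Rightarrow> 'a \<Rightarrow> 'a"

definition lie_groupoid ::
  "('a, 'm::real_normed_vector, 'b, 'e::real_normed_vector, 'c::real_normed_vector) groupoid \<Rightarrow> bool" where
  "lie_groupoid \<G> \<longleftrightarrow>
     manifold (arrows \<G>) \<and> manifold (base \<G>) \<and>
     smooth_map (arrows \<G>) (base \<G>) (src \<G>) \<and> smooth_map (arrows \<G>) (base \<G>) (tgt \<G>) \<and>
     (\<forall>a\<in>points (arrows \<G>). surj (tangent_map (arrows \<G>) (base \<G>) (src \<G>) a) \<and>
        surj (tangent_map (arrows \<G>) (base \<G>) (tgt \<G>) a)) \<and>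
     smooth_map (base \<G>) (arrows \<G>) (unit_arrow \<G>) \<and>
     smooth_map (arrows \<G>) (arrows \<G>) (inv_arrow \<G>) \<and>
     points (composables \<G>) =
       {(a, b). a \<in> points (arrows \<G>) \<and> b \<in> points (arrows \<G>) \<and> src \<G> a = tgt \<G> b} \<and>
     embedded_submanifold (composables \<G>) (arrows \<G> \<times>\<^sub>m arrows \<G>) \<and>
     smooth_map (composables \<G>) (arrows \<G>) (\<lambda>(a, b). gcomp \<G> a b) \<and>
     (\<forall>(a, b)\<in>points (composables \<G>).
        src \<G> (gcomp \<G> a b) = src \<G> b \<and> tgt \<G> (gcomp \<G> a b) = tgt \<G> a) \<and>
     (\<forall>a b c. (a, b) \<in> points (composables \<G>) \<longrightarrow> (b, c) \<in> points (composables \<G>) \<longrightarrow>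
        gcomp \<G> (gcomp \<G> a b) c = gcomp \<G> a (gcomp \<G> b c)) \<and>
     (\<forall>x\<in>points (base \<G>). src \<G> (unit_arrow \<G> x) = x \<and> tgt \<G> (unit_arrow \<G> x) = x) \<and>
     (\<forall>a\<in>points (arrows \<G>).
        gcomp \<G> a (unit_arrow \<G> (src \<G> a)) = a \<and> gcomp \<G> (unit_arrow \<G> (tgt \<G> a)) a = a \<and>
        src \<G> (inv_arrow \<G> a) = tgt \<G> a \<and> tgt \<G> (inv_arrow \<G> a) = src \<G> a \<and>
        gcomp \<G> (inv_arrow \<G> a) a = unit_arrow \<G> (src \<G> a) \<and>
        gcomp \<G> a (inv_arrow \<G> a) = unit_arrow \<G> (tgt \<G> a))"

definition pullback2 ::
  "('a, 'e::real_normed_vector) manifold \<Rightarrow> ('b, 'f::real_normed_vector) manifold \<Rightarrow> ('a \<Rightarrow> 'b) \<Rightarrow>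
   ('b \<Rightarrow> 'f \<Rightarrow> 'f \<Rightarrow> real) \<Rightarrow> 'a \<Rightarrow> 'e \<Rightarrow> 'e \<Rightarrow> real" where
  "pullback2 M N f \<omega> p v w = \<omega> (f p) (tangent_map M N f p v) (tangent_map M N f p w)"

definition multiplicative ::
  "('a, 'm::real_normed_vector, 'b, 'e::real_normed_vector, 'c::real_normed_vector) groupoid \<Rightarrow>
   ('a \<Rightarrow> 'm \<Rightarrow> 'm \<Rightarrow> real) \<Rightarrow> bool" where
  "multiplicative \<G> \<omega> \<longleftrightarrow> (\<forall>c\<in>points (composables \<G>). \<forall>v w.
     pullback2 (composables \<G>) (arrows \<G>) (\<lambda>(a, b). gcomp \<G> a b) \<omega> c v w =
     pullback2 (composables \<G>) (arrows \<G>) fst \<omega> c v w +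
     pullback2 (composables \<G>) (arrows \<G>) snd \<omega> c v w)"

definition algebroid_fibre ::
  "('a, 'm::real_normed_vector, 'b, 'e::real_normed_vector, 'c) groupoid \<Rightarrow> 'b \<Rightarrow> 'm set" where
  "algebroid_fibre \<G> x = {a. tangent_map (arrows \<G>) (base \<G>) (src \<G>) (unit_arrow \<G> x) a = 0}"

text \<open>\<open>TM\<close> is included in \<open>T\<G>\<close> along \<open>M\<close> by the differential of the unit map.\<close>

definition delta_form ::
  "('a, 'm::real_normed_vector, 'b, 'e::real_normed_vector, 'c) groupoid \<Rightarrow>
   ('a \<Rightarrow> 'm \<Rightarrow> 'm \<Rightarrow> real) \<Rightarrow> 'b \<Rightarrow> 'm \<Rightarrow> 'e \<times> 'e covector" where
  "delta_form \<G> \<omega> x a =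
     (tangent_map (arrows \<G>) (base \<G>) (tgt \<G>) (unit_arrow \<G> x) a,
      Blinfun (\<lambda>w. \<omega> (unit_arrow \<G> x) a (tangent_map (base \<G>) (arrows \<G>) (unit_arrow \<G>) x w)))"

definition presymplectic_groupoid ::
  "('a, 'm::real_normed_vector, 'b, 'e::real_normed_vector, 'c::real_normed_vector) groupoid \<Rightarrow>
   ('a \<Rightarrow> 'm \<Rightarrow> 'm \<Rightarrow> real) \<Rightarrow> bool" where
  "presymplectic_groupoid \<G> \<omega> \<longleftrightarrow>
     lie_groupoid \<G> \<and> two_form (arrows \<G>) \<omega> \<and> closed_form (arrows \<G>) \<omega> \<and> multiplicative \<G> \<omega> \<and>
     dim (UNIV :: 'm set) = 2 * dim (UNIV :: 'e set) \<and>
     (\<forall>x\<in>points (base \<G>). inj_on (delta_form \<G> \<omega> x) (algebroid_fibre \<G> x))"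

definition integrates_dirac ::
  "('a, 'm::real_normed_vector, 'b, 'e::real_normed_vector, 'c::real_normed_vector) groupoid \<Rightarrow>
   ('a \<Rightarrow> 'm \<Rightarrow> 'm \<Rightarrow> real) \<Rightarrow> ('b \<Rightarrow> ('e \<times> 'e covector) set) \<Rightarrow> bool" where
  "integrates_dirac \<G> \<omega> E \<longleftrightarrow> dirac_structure (base \<G>) E \<and>
     (\<forall>x\<in>points (base \<G>). delta_form \<G> \<omega> x ` algebroid_fibre \<G> x = E x)"


section \<open>The groupoid \<open>\<G>(L)\<close> and the form \<open>\<omega>\<^sub>L\<close>\<close>

definition GL_set ::
  "('k, 'p) lie_group \<Rightarrow> ('g, 'e) lie_group \<Rightarrow> ('l, 'q) lie_group \<Rightarrow> ('d, 'f) lie_group \<Rightarrow>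
   ('k \<Rightarrow> 'd) \<Rightarrow> ('g \<Rightarrow> 'd) \<Rightarrow> ('l \<Rightarrow> 'd) \<Rightarrow> ('k \<times> 'g \<times> 'g \<times> 'l) set" where
  "GL_set Gs G L D \<phi>\<^sub>K \<phi>\<^sub>G \<phi>\<^sub>L =
     {(k, g\<^sub>1, g\<^sub>2, l). k \<in> carrier Gs \<and> g\<^sub>1 \<in> carrier G \<and> g\<^sub>2 \<in> carrier G \<and> l \<in> carrier L \<and>
        \<phi>\<^sub>K k \<otimes>\<^bsub>D\<^esub> \<phi>\<^sub>G g\<^sub>1 = \<phi>\<^sub>G g\<^sub>2 \<otimes>\<^bsub>D\<^esub> inv\<^bsub>D\<^esub> (\<phi>\<^sub>L l)}"

definition GL_groupoid ::
  "('k, 'p) lie_group \<Rightarrow> ('g, 'e) lie_group \<Rightarrow> ('l, 'q) lie_group \<Rightarrow>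
   ('k \<times> 'g \<times> 'g \<times> 'l, 'm) manifold \<Rightarrow>
   (('k \<times> 'g \<times> 'g \<times> 'l) \<times> ('k \<times> 'g \<times> 'g \<times> 'l), 'c) manifold \<Rightarrow>
   ('k \<times> 'g \<times> 'g \<times> 'l, 'm, 'g, 'e, 'c) groupoid" where
  "GL_groupoid Gs G L M C =
     \<lparr>arrows = M, base = mfd G, composables = C,
      src = (\<lambda>(k, g\<^sub>1, g\<^sub>2, l). g\<^sub>2),
      tgt = (\<lambda>(k, g\<^sub>1, g\<^sub>2, l). g\<^sub>1),
      unit_arrow = (\<lambda>g. (\<one>\<^bsub>Gs\<^esub>, g, g, \<one>\<^bsub>L\<^esub>)),
      inv_arrow = (\<lambda>(k, g\<^sub>1, g\<^sub>2, l). (inv\<^bsub>Gs\<^esub> k, g\<^sub>2, g\<^sub>1, inv\<^bsub>L\<^esub> l)),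
      gcomp = (\<lambda>(k\<^sub>1, g\<^sub>1, g, l\<^sub>1) (k\<^sub>2, g', g\<^sub>2, l\<^sub>2). (k\<^sub>2 \<otimes>\<^bsub>Gs\<^esub> k\<^sub>1, g\<^sub>1, g\<^sub>2, l\<^sub>1 \<otimes>\<^bsub>L\<^esub> l\<^sub>2))\<rparr>"

definition wedge_pairing ::
  "('a \<Rightarrow> 'm \<Rightarrow> 'e::real_normed_vector \<times> 'e covector) \<Rightarrow> ('a \<Rightarrow> 'm \<Rightarrow> 'e \<times> 'e covector) \<Rightarrow>
   'a \<Rightarrow> 'm \<Rightarrow> 'm \<Rightarrow> real" where
  "wedge_pairing \<theta>\<^sub>1 \<theta>\<^sub>2 x v\<^sub>1 v\<^sub>2 =
     pairing (\<theta>\<^sub>1 x v\<^sub>1) (\<theta>\<^sub>2 x v\<^sub>2) - pairing (\<theta>\<^sub>2 x v\<^sub>1) (\<theta>\<^sub>1 x v\<^sub>2)"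

text \<open>
  The four Maurer--Cartan forms are pulled back along the projections of \<open>M\<close>, that is, \<open>\<G>(L)\<close>, and
  take values in the double; \<open>\<iota>\<^sub>K\<close> and \<open>\<iota>\<^sub>L\<close> identify the tangent spaces at the unit of \<open>Gs\<close>, the
  group integrating the dual of the Lie algebra of \<open>G\<close>, and of \<open>L\<close> with their Lie algebras.
\<close>

definition omega_L ::
  "('k, 'p::real_normed_vector) lie_group \<Rightarrow> ('p \<Rightarrow> 'e covector) \<Rightarrow>
   ('g, 'e::real_normed_vector) lie_group \<Rightarrow>
   ('l, 'q::real_normed_vector) lie_group \<Rightarrow> ('q \<Rightarrow> 'e \<times> 'e covector) \<Rightarrow>
   ('k \<times> 'g \<times> 'g \<times> 'l, 'm::real_normed_vector) manifold \<Rightarrow>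
   'k \<times> 'g \<times> 'g \<times> 'l \<Rightarrow> 'm \<Rightarrow> 'm \<Rightarrow> real" where
  "omega_L Gs \<iota>\<^sub>K G L \<iota>\<^sub>L M x v w =
    (let pk = (\<lambda>(k, g\<^sub>1, g\<^sub>2, l). k); p1 = (\<lambda>(k, g\<^sub>1, g\<^sub>2, l). g\<^sub>1);
         p2 = (\<lambda>(k, g\<^sub>1, g\<^sub>2, l). g\<^sub>2); pl = (\<lambda>(k, g\<^sub>1, g\<^sub>2, l). l);
         \<theta>r_K = (\<lambda>x v. (0, \<iota>\<^sub>K (mc_right Gs (pk x) (tangent_map M (mfd Gs) pk x v))));
         \<theta>l_1 = (\<lambda>x v. (mc_left G (p1 x) (tangent_map M (mfd G) p1 x v), 0));
         \<theta>r_2 = (\<lambda>x v. (mc_right G (p2 x) (tangent_map M (mfd G) p2 x v), 0));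
         \<theta>r_L = (\<lambda>x v. \<iota>\<^sub>L (mc_right L (pl x) (tangent_map M (mfd L) pl x v)))
     in 1/2 * wedge_pairing \<theta>l_1 \<theta>r_L x v w + 1/2 * wedge_pairing \<theta>r_K \<theta>r_2 x v w)"

end

theory Submission
  imports Defs
begin

text \<open>
  Pulling the Maurer--Cartan form of \<open>D\<close> back along the maps from \<open>\<G>(L)\<close> to \<open>D\<close> given by \<open>k\<close>, \<open>g\<^sub>1\<close>,
  \<open>g\<^sub>2\<close> and \<open>l\<close> yields the forms \<open>\<theta>K\<close>, \<open>\<theta>1\<close>, \<open>\<theta>2\<close> and \<open>\<theta>L\<close> (left-invariant for \<open>g\<^sub>1\<close>, right-invariant for
  the others) with values in \<open>\<gg>\<^sup>*\<close>, \<open>\<gg>\<close>, \<open>\<gg>\<close> and \<open>\<ll>\<close>. Two facts carry the proof. These three subspaces of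
  the double are isotropic subalgebras, so the pairing and the Cartan three-form
  \<open>\<langle>[x, y], z\<rangle>\<close> vanish on each of them. And the equation \<open>k\<^sup>-\<^sup>1 g\<^sub>2 = g\<^sub>1 l\<close> in \<open>D\<close> that defines the
  groupoid has the derivative
  \<open>Ad (k\<^sup>-\<^sup>1) (\<theta>2 - \<theta>K) = Ad g\<^sub>1 (\<theta>1 + \<theta>L)\<close>, the lemma \<open>constraint\<close>.

  Pairing the constraint with itself removes the antisymmetrization from \<open>\<omega>\<close>, which becomes
  \<open>\<langle>\<theta>1, \<theta>L\<rangle> + \<langle>\<theta>K, \<theta>2\<rangle>\<close> (\<open>omega_simple\<close>). Evaluating the Cartan three-form on both sides of the
  constraint gives \<open>d\<omega> = 0\<close>, by the Maurer--Cartan equation (\<open>closed_omega\<close>). For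
  multiplicativity, the product rule for \<open>\<theta>K\<close> and \<open>\<theta>L\<close> produces one cross term each; the
  constraints at the two arrows turn them into the missing terms of the two summands, up to
  errors that cancel (\<open>multiplicative_omega\<close>).

  The map \<open>(k, g) \<mapsto> k\<^sup>-\<^sup>1 g\<close> from \<open>G\<^sup>* \<times> G\<close> to \<open>D\<close> is a local diffeomorphism, because \<open>\<gg>\<close> and
  \<open>\<gg>\<^sup>*\<close> are complementary. Hence \<open>g\<^sub>1\<close> and \<open>l\<close> are local coordinates of \<open>\<G>(L)\<close>
  (\<open>exists_GL_manifold\<close>), and its dimension is \<open>dim \<gg> + dim \<ll> = 2 dim \<gg>\<close>, since a lagrangian
  subspace is isomorphic to \<open>\<gg>\<close> as a vector space (\<open>lagrangian_parametrization\<close>).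

  Right translation identifies \<open>T\<^sub>gG \<oplus> T\<^sup>*\<^sub>gG\<close> with the double and \<open>\<e>(\<ll>\<^sub>G)\<close> at \<open>g\<close> with \<open>Ad g \<ll>\<close>
  (\<open>e_dirac_eq\<close>), which is lagrangian. The Courant bracket of two sections paired with a third
  becomes the Cartan three-form on \<open>Ad g \<ll>\<close> and vanishes (\<open>dirac_e_dirac\<close>). At a unit the
  constraint turns the map from the Lie algebroid to \<open>TG \<oplus> T\<^sup>*G\<close> into \<open>- Ad g \<theta>L\<close>
  (\<open>delta_omega\<close>), which maps the fibre of the algebroid bijectively to this Dirac structure.

  The analytic input is the Maurer--Cartan equation (\<open>maurer_cartan\<close>), from which the derivative
  of the adjoint action also follows, and the inverse function theorem.
\<close>

section \<open>Finite-dimensional normed spaces\<close>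

text \<open>The model spaces are normed spaces without a preferred inner product or basis, so they are not
  Euclidean spaces in the sense of a type class; finite dimension is a predicate on the type.\<close>

definition fin_dim :: "'a::real_vector itself \<Rightarrow> bool" where
  "fin_dim _ \<longleftrightarrow> (\<exists>B::'a set. finite B \<and> span B = UNIV)"

lemma Cauchy_minus:
  fixes f g :: "nat \<Rightarrow> 'a::real_normed_vector"
  assumes "Cauchy f" "Cauchy g"
  shows "Cauchy (\<lambda>n. f n - g n)"
  unfolding Cauchy_def
proof (intro allI impI)
  fix e :: real assume "e > 0"
  then have "e/2 > 0" by simp
  obtain M where M: "\<And>m n. m \<ge> M \<Longrightarrow> n \<ge> M \<Longrightarrow> dist (f m) (f n) < e/2"
    using assms(1) \<open>e/2 > 0\<close> unfolding Cauchy_def by blast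
  obtain N where N: "\<And>m n. m \<ge> N \<Longrightarrow> n \<ge> N \<Longrightarrow> dist (g m) (g n) < e/2"
    using assms(2) \<open>e/2 > 0\<close> unfolding Cauchy_def by blast
  have "dist (f m - g m) (f n - g n) < e" if "m \<ge> max M N" "n \<ge> max M N" for m n
  proof -
    have "dist (f m - g m) (f n - g n) \<le> dist (f m) (f n) + dist (g m) (g n)"
      using norm_triangle_ineq4[of "f m - f n" "g m - g n"] by (simp add: dist_norm algebra_simps)
    also have "\<dots> < e/2 + e/2" using M N that by (intro add_strict_mono) auto
    finally show ?thesis by simp
  qed
  then show "\<exists>M. \<forall>m\<ge>M. \<forall>n\<ge>M. dist (f m - g m) (f n - g n) < e" by blast
qed

text \<open>Induction on \<open>B\<close>. A new vector \<open>b\<close> has a positive distance \<open>d\<close> from the closed span of the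
  others, so \<open>\<bar>c\<bar> d \<le> norm (c b + w)\<close> for \<open>w\<close> in that span, and both parts of a Cauchy sequence
  are Cauchy.\<close>

lemma complete_span:
  fixes B :: "'a::real_normed_vector set"
  assumes "finite B"
  shows "complete (span B)"
  using assms
proof (induction B)
  case empty
  show ?case by (simp only: span_empty) (rule compact_imp_complete, rule finite_imp_compact, simp)
next
  case (insert b B)
  show ?case
  proof (cases "b \<in> span B")
    case True
    then show ?thesis using insert.IH by (simp add: span_redundant)
  next
    case False
    define d where "d = infdist b (span B)"
    have ne: "span B \<noteq> {}" using span_zero by blast
    have "d > 0"
      unfolding d_def using False complete_imp_closed[OF insert.IH] ne
      by (simp add: infdist_pos_not_in_closed)
    have low: "\<bar>c\<bar> * d \<le> norm (c *\<^sub>R b + w)" if "w \<in> span B" for c w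
    proof (cases "c = 0")
      case False
      have "- ((1/c) *\<^sub>R w) \<in> span B" using that by (intro span_neg span_scale)
      then have "d \<le> dist b (- ((1/c) *\<^sub>R w))" unfolding d_def by (rule infdist_le)
      also have "\<dots> = norm ((1/c) *\<^sub>R (c *\<^sub>R b + w))"
        using False by (simp add: dist_norm algebra_simps)
      also have "\<dots> = norm (c *\<^sub>R b + w) / \<bar>c\<bar>" by simp
      finally show ?thesis using False by (simp add: field_simps)
    qed simp
    show ?thesis unfolding complete_def
    proof (intro allI impI)
      fix f assume f: "(\<forall>n. f n \<in> span (insert b B)) \<and> Cauchy f"
      then have "\<forall>n. \<exists>c. f n - c *\<^sub>R b \<in> span B" by (simp add: span_insert)
      then obtain c where c: "\<And>n. f n - c n *\<^sub>R b \<in> span B" by metis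
      have "Cauchy c" unfolding Cauchy_def
      proof (intro allI impI)
        fix e :: real assume "e > 0"
        then have "e * d > 0" using \<open>d > 0\<close> by simp
        then obtain N where N: "\<And>m n. m \<ge> N \<Longrightarrow> n \<ge> N \<Longrightarrow> dist (f m) (f n) < e * d"
          using f unfolding Cauchy_def by blast
        have "dist (c m) (c n) < e" if mn: "m \<ge> N" "n \<ge> N" for m n
        proof -
          have "\<bar>c m - c n\<bar> * d \<le> norm ((c m - c n) *\<^sub>R b + ((f m - c m *\<^sub>R b) - (f n - c n *\<^sub>R b)))"
            by (intro low span_diff c)
          also have "\<dots> = dist (f m) (f n)" by (simp add: dist_norm algebra_simps)
          also have "\<dots> < e * d" using N mn by blast
          finally show ?thesis using \<open>d > 0\<close> by (simp add: dist_real_def)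
        qed
        then show "\<exists>M. \<forall>m\<ge>M. \<forall>n\<ge>M. dist (c m) (c n) < e" by blast
      qed
      then obtain c' where c': "c \<longlonglongrightarrow> c'" using Cauchy_convergent_iff convergent_def by blast
      have cb: "(\<lambda>n. c n *\<^sub>R b) \<longlonglongrightarrow> c' *\<^sub>R b" using c' by (intro tendsto_intros)
      have cau: "Cauchy (\<lambda>n. f n - c n *\<^sub>R b)"
        by (rule Cauchy_minus[OF conjunct2[OF f] LIMSEQ_imp_Cauchy[OF cb]])
      have "\<exists>w\<in>span B. (\<lambda>n. f n - c n *\<^sub>R b) \<longlonglongrightarrow> w"
        by (rule insert.IH[unfolded complete_def, THEN spec, THEN mp]) (intro conjI allI c cau)
      then obtain w where w: "w \<in> span B" "(\<lambda>n. f n - c n *\<^sub>R b) \<longlonglongrightarrow> w" by blast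
      have "f \<longlonglongrightarrow> w + c' *\<^sub>R b" using tendsto_add[OF w(2) cb] by (simp only: diff_add_cancel)
      moreover have "w + c' *\<^sub>R b \<in> span (insert b B)"
        unfolding span_insert mem_Collect_eq by (rule exI[of _ c']) (simp only: add_diff_cancel w(1))
      ultimately show "\<exists>l\<in>span (insert b B). f \<longlonglongrightarrow> l" by blast
    qed
  qed
qed

lemma fin_dim_complete: "fin_dim TYPE('a::real_normed_vector) \<Longrightarrow> complete (UNIV :: 'a set)"
  unfolding fin_dim_def by (metis complete_span)

lemma fin_dim_basis:
  assumes "fin_dim TYPE('a)"
  obtains B :: "'a::real_vector set" where "finite B" "independent B" "span B = UNIV"
proof -
  obtain S :: "'a set" where S: "finite S" "span S = UNIV" using assms unfolding fin_dim_def by blast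
  obtain B where "B \<subseteq> S" "independent B" "S \<subseteq> span B"
    using maximal_independent_subset by blast
  then show thesis using that S
    by (metis finite_subset span_minimal subspace_span top.extremum_uniqueI)
qed

text \<open>Coordinates are bounded: if \<open>d\<close> is the distance of \<open>b\<close> from the span of the other basis vectors,
  which is closed, then \<open>1/d\<close> bounds the coordinate along \<open>b\<close>.\<close>

lemma fin_dim_coords:
  assumes "fin_dim TYPE('a)"
  obtains B :: "'a::real_normed_vector set" and c :: "'a \<Rightarrow> 'a \<Rightarrow> real" where "finite B" "independent B" "span B = UNIV"
    "\<And>b. bounded_linear (c b)" "\<And>x. (\<Sum>b\<in>B. c b x *\<^sub>R b) = x"
    "\<And>b b'. b \<in> B \<Longrightarrow> b' \<in> B \<Longrightarrow> c b b' = (if b = b' then 1 else 0)"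
proof -
  obtain B :: "'a set" where B: "finite B" "independent B" "span B = UNIV" using fin_dim_basis[OF assms] .
  define c where "c b x = representation B x b" for b x
  have sum: "(\<Sum>b\<in>B. c b x *\<^sub>R b) = x" for x
    unfolding c_def using real_vector.sum_representation_eq[of B x B] B by auto
  have "bounded_linear (c b)" for b
  proof (cases "b \<in> B")
    case True
    define d where "d = infdist b (span (B - {b}))"
    have ne: "span (B - {b}) \<noteq> {}" using span_zero by blast
    have "b \<notin> span (B - {b})" using True B(2) dependent_def by blast
    then have "d > 0"
      unfolding d_def using complete_imp_closed[OF complete_span[of "B - {b}"]] B(1) ne
      by (simp add: infdist_pos_not_in_closed)
    have "norm (c b x) \<le> norm x * (1/d)" for x
    proof (cases "c b x = 0")
      case nz: False
      define w where "w = (\<Sum>a\<in>B - {b}. c a x *\<^sub>R a)"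
      have x: "x = c b x *\<^sub>R b + w"
        unfolding w_def using sum[of x] True B(1) by (simp add: sum.remove)
      have "w \<in> span (B - {b})"
        unfolding w_def by (intro span_sum span_scale span_base) auto
      then have "- ((1/c b x) *\<^sub>R w) \<in> span (B - {b})" by (intro span_neg span_scale)
      then have "d \<le> dist b (- ((1/c b x) *\<^sub>R w))" unfolding d_def by (rule infdist_le)
      also have "\<dots> = norm ((1/c b x) *\<^sub>R (c b x *\<^sub>R b + w))"
        using nz by (simp add: dist_norm algebra_simps)
      also have "\<dots> = norm x / \<bar>c b x\<bar>" using x by simp
      finally show ?thesis using nz \<open>d > 0\<close> by (simp add: field_simps)
    qed (use \<open>d > 0\<close> in auto)
    then show ?thesis
      unfolding c_def using B
      by (intro bounded_linear_intro[where K="1/d"])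
         (auto simp: real_vector.representation_add real_vector.representation_scale)
  next
    case False
    then have "c b = (\<lambda>x. 0)"
      unfolding c_def using real_vector.representation_ne_zero[of B _ b] by fastforce
    then show ?thesis by simp
  qed
  moreover have "c b b' = (if b = b' then 1 else 0)" if "b \<in> B" "b' \<in> B" for b b'
    unfolding c_def using real_vector.representation_basis[OF B(2) that(2)] by auto
  ultimately show thesis using that[OF B, of c] sum by blast
qed

lemma fin_dim_bounded_linear:
  fixes f :: "'a::real_normed_vector \<Rightarrow> 'b::real_normed_vector"
  assumes "fin_dim TYPE('a)" "linear f"
  shows "bounded_linear f"
proof -
  obtain B :: "'a set" and c where B: "\<And>b. bounded_linear (c b)" "\<And>x. (\<Sum>b\<in>B. c b x *\<^sub>R b) = x"
    using fin_dim_coords[OF assms(1)] by metis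
  have eq: "f = (\<lambda>x. \<Sum>b\<in>B. c b x *\<^sub>R f b)"
  proof
    fix x show "f x = (\<Sum>b\<in>B. c b x *\<^sub>R f b)"
    using linear_sum[OF assms(2), of "\<lambda>b. c b x *\<^sub>R b" B]
    by (simp add: B(2) linear_scale[OF assms(2)])
  qed
  show ?thesis
    by (subst eq) (intro bounded_linear_sum bounded_linear_scaleR_const B(1))
qed

lemma fin_dim_prod:
  assumes "fin_dim TYPE('a::real_vector)" "fin_dim TYPE('b::real_vector)"
  shows "fin_dim TYPE('a \<times> 'b)"
proof -
  obtain S :: "'a set" and T :: "'b set" where S: "finite S" "span S = UNIV" "finite T" "span T = UNIV"
    using assms unfolding fin_dim_def by blast
  let ?X = "(\<lambda>x. (x, 0::'b)) ` S \<union> (\<lambda>y. (0::'a, y)) ` T"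
  have l: "linear (\<lambda>x::'a. (x, 0::'b))" "linear (\<lambda>y::'b. (0::'a, y))" by (auto intro!: linearI)
  have "(x, 0) \<in> span ?X" for x
  proof -
    have "(x, 0) \<in> (\<lambda>x. (x, 0)) ` span S" using S(2) by blast
    then have "(x, 0) \<in> span ((\<lambda>x. (x, 0::'b)) ` S)" by (simp add: linear_span_image[OF l(1)])
    then show ?thesis by (meson span_mono subsetD sup.cobounded1)
  qed
  moreover have "(0, y) \<in> span ?X" for y
  proof -
    have "(0, y) \<in> (\<lambda>x. (0, x)) ` span T" using S(4) by blast
    then have "(0, y) \<in> span ((\<lambda>x. (0::'a, x)) ` T)" by (simp add: linear_span_image[OF l(2)])
    then show ?thesis by (meson span_mono subsetD sup.cobounded2)
  qed
  ultimately have "(x, 0) + (0, y) \<in> span ?X" for x y by (rule span_add)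
  then have "span ?X = UNIV" by auto
  then show ?thesis unfolding fin_dim_def using S(1,3) by (metis (no_types) finite_UnI finite_imageI)
qed

lemma fin_dim_inj_imp_surj:
  fixes f :: "'a::real_vector \<Rightarrow> 'a"
  assumes "fin_dim TYPE('a)" "linear f" "inj f"
  shows "surj f"
proof -
  obtain B :: "'a set" where B: "finite B" "independent B" "span B = UNIV" using fin_dim_basis[OF assms(1)] .
  interpret fd: finite_dimensional_vector_space "scaleR :: real \<Rightarrow> 'a \<Rightarrow> 'a" B
    using B by unfold_locales (auto simp: dependent_raw_def span_raw_def)
  show ?thesis
    using assms fd.linear_inj_imp_surj[of f] by (simp add: linear_def)
qed

lemma dim_UNIV_prod:
  assumes "fin_dim TYPE('a::real_vector)" "fin_dim TYPE('b::real_vector)"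
  shows "dim (UNIV :: ('a \<times> 'b) set) = dim (UNIV :: 'a set) + dim (UNIV :: 'b set)"
proof -
  obtain A :: "'a set" where A: "finite A" "independent A" "span A = UNIV" using fin_dim_basis[OF assms(1)] .
  obtain B :: "'b set" where B: "finite B" "independent B" "span B = UNIV" using fin_dim_basis[OF assms(2)] .
  interpret fa: finite_dimensional_vector_space "scaleR :: real \<Rightarrow> 'a \<Rightarrow> 'a" A
    using A by unfold_locales (auto simp: dependent_raw_def span_raw_def)
  interpret fb: finite_dimensional_vector_space "scaleR :: real \<Rightarrow> 'b \<Rightarrow> 'b" B
    using B by unfold_locales (auto simp: dependent_raw_def span_raw_def)
  interpret fp: finite_dimensional_vector_space_prod "scaleR :: real \<Rightarrow> 'a \<Rightarrow> 'a" "scaleR :: real \<Rightarrow> 'b \<Rightarrow> 'b" A B ..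
  show ?thesis
    using fp.dim_Times[of UNIV UNIV]
    by (simp add: dim_raw_def[symmetric] subspace_raw_def[symmetric] module_prod_scale_eq_scaleR)
qed

lemma fin_dim_covector:
  assumes "fin_dim TYPE('e::real_normed_vector)"
  shows "fin_dim TYPE('e covector)"
proof -
  obtain B :: "'e set" and c where B: "finite B" "\<And>b. bounded_linear (c b)" "\<And>x. (\<Sum>b\<in>B. c b x *\<^sub>R b) = x"
    using fin_dim_coords[OF assms(1)] by metis
  have "\<alpha> \<in> span ((\<lambda>b. Blinfun (c b)) ` B)" for \<alpha> :: "'e covector"
  proof -
    have "\<alpha> x = (\<Sum>b\<in>B. \<alpha> b *\<^sub>R Blinfun (c b)) x" for x
    proof -
      have "blinfun_apply \<alpha> x = \<alpha> (\<Sum>b\<in>B. c b x *\<^sub>R b)" by (simp add: B(3))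
      also have "\<dots> = (\<Sum>b\<in>B. c b x * \<alpha> b)"
        by (simp add: blinfun.sum_right blinfun.scaleR_right)
      also have "\<dots> = (\<Sum>b\<in>B. \<alpha> b *\<^sub>R Blinfun (c b)) x"
        by (simp add: blinfun.sum_left blinfun.scaleR_left bounded_linear_Blinfun_apply B(2) mult.commute)
      finally show ?thesis .
    qed
    then have "\<alpha> = (\<Sum>b\<in>B. \<alpha> b *\<^sub>R Blinfun (c b))" by (intro blinfun_eqI)
    also have "\<dots> \<in> span ((\<lambda>b. Blinfun (c b)) ` B)" by (intro span_sum span_scale span_base) auto
    finally show ?thesis .
  qed
  then show ?thesis unfolding fin_dim_def using B(1) by (metis UNIV_eq_I finite_imageI)
qed

section \<open>Smooth functions between normed spaces\<close>

lemma frechet_derivative_eqI: "(f has_derivative f') (at x) \<Longrightarrow> frechet_derivative f (at x) = f'"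
  using frechet_derivative_at by metis

lemma frechet_derivative_cong_eventually:
  assumes "\<forall>\<^sub>F y in nhds x. f y = g y"
  shows "frechet_derivative f (at x) = frechet_derivative g (at x)"
proof -
  have *: "\<forall>\<^sub>F y in at x. f y = g y" "f x = g x"
    using assms eventually_nhds_x_imp_x by (auto simp: eventually_nhds_conv_at)
  have **: "\<forall>\<^sub>F y in at x. g y = f y" using *(1) by (simp add: eq_commute)
  have "(f has_derivative f') (at x) = (g has_derivative f') (at x)" for f'
    using has_derivative_transform_eventually[OF _ *(1) *(2)]
      has_derivative_transform_eventually[OF _ ** *(2)[symmetric]] by blast
  then show ?thesis unfolding frechet_derivative_def by simp
qed

lemma Ck_on_subset: "Ck_on k U f \<Longrightarrow> V \<subseteq> U \<Longrightarrow> Ck_on k V f"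
  by (induction k arbitrary: f) (auto intro: continuous_on_subset)

lemma Ck_on_SucD: "Ck_on (Suc k) U f \<Longrightarrow> Ck_on k U f"
proof (induction k arbitrary: f)
  case 0
  then show ?case
    by (simp add: continuous_at_imp_continuous_on differentiable_imp_continuous_within)
next
  case (Suc k)
  then show ?case using Ck_on.simps(2) by blast
qed

lemma Ck_on_cong:
  assumes "open U" "\<And>x. x \<in> U \<Longrightarrow> f x = g x" "Ck_on k U f"
  shows "Ck_on k U g"
  using assms(2,3)
proof (induction k arbitrary: f g)
  case 0
  then show ?case by simp
next
  case (Suc k)
  have ev: "\<forall>\<^sub>F y in nhds x. f y = g y" if "x \<in> U" for x
    using assms(1) that Suc.prems(1) eventually_nhds by blast
  have eq: "frechet_derivative f (at x) = frechet_derivative g (at x)" if "x \<in> U" for x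
    by (rule frechet_derivative_cong_eventually[OF ev[OF that]])
  have "g differentiable (at x)" if "x \<in> U" for x
  proof -
    have "(f has_derivative frechet_derivative f (at x)) (at x)"
      using Suc.prems(2) that frechet_derivative_works by auto
    then show ?thesis
      by (intro differentiableI has_derivative_transform_within_open[OF _ assms(1) that Suc.prems(1)])
  qed
  moreover have "Ck_on k U (\<lambda>x. frechet_derivative g (at x) v)" for v
    by (rule Suc.IH[of "\<lambda>x. frechet_derivative f (at x) v"]) (use Suc.prems(2) eq in auto)
  ultimately show ?case by simp
qed

lemma Ck_on_SucI:
  assumes "open U" "\<And>x. x \<in> U \<Longrightarrow> (f has_derivative f' x) (at x)" "\<And>v. Ck_on k U (\<lambda>x. f' x v)"
  shows "Ck_on (Suc k) U f"
proof -
  have "Ck_on k U (\<lambda>x. frechet_derivative f (at x) v)" for v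
    by (rule Ck_on_cong[OF assms(1) _ assms(3)[of v]]) (simp add: frechet_derivative_eqI[OF assms(2)])
  then show ?thesis by (auto intro: differentiableI assms(2))
qed

lemma Ck_on_has_derivative:
  "Ck_on (Suc k) U f \<Longrightarrow> x \<in> U \<Longrightarrow> (f has_derivative frechet_derivative f (at x)) (at x)"
  using frechet_derivative_works by auto

lemma Ck_on_frechet: "Ck_on (Suc k) U f \<Longrightarrow> Ck_on k U (\<lambda>x. frechet_derivative f (at x) v)"
  by simp

lemma Ck_on_const: "open U \<Longrightarrow> Ck_on k U (\<lambda>x. c)"
proof (induction k arbitrary: c)
  case (Suc k)
  show ?case by (rule Ck_on_SucI[OF Suc.prems, of _ "\<lambda>_ _. 0"]) (auto intro: Suc)
qed simp

lemma Ck_on_bounded_linear: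
  assumes "bounded_linear L" "open U" "Ck_on k U f"
  shows "Ck_on k U (\<lambda>x. L (f x))"
  using assms(3)
proof (induction k arbitrary: f)
  case 0
  then show ?case using assms(1) by (simp add: bounded_linear.continuous_on)
next
  case (Suc k)
  show ?case
    by (rule Ck_on_SucI[OF assms(2), of _ "\<lambda>x v. L (frechet_derivative f (at x) v)"])
      (use Suc assms(1) Ck_on_has_derivative[OF Suc.prems] in \<open>auto intro: bounded_linear.has_derivative\<close>)
qed

lemma Ck_on_ident: "open U \<Longrightarrow> Ck_on k U (\<lambda>x. x)"
  by (cases k) (auto intro!: Ck_on_SucI[of U _ "\<lambda>_ v. v"] Ck_on_const)

lemma Ck_on_Pair:
  assumes "open U" "Ck_on k U f" "Ck_on k U g"
  shows "Ck_on k U (\<lambda>x. (f x, g x))"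
  using assms(2,3)
proof (induction k arbitrary: f g)
  case 0
  then show ?case by (simp add: continuous_on_Pair)
next
  case (Suc k)
  show ?case
    by (rule Ck_on_SucI[OF assms(1), of _ "\<lambda>x v. (frechet_derivative f (at x) v, frechet_derivative g (at x) v)"])
      (use Suc Ck_on_has_derivative[OF Suc.prems(1)] Ck_on_has_derivative[OF Suc.prems(2)]
        in \<open>auto intro: has_derivative_Pair\<close>)
qed

lemma Ck_on_add:
  assumes "open U" "Ck_on k U f" "Ck_on k U g"
  shows "Ck_on k U (\<lambda>x. f x + g x)"
proof -
  have "bounded_linear (\<lambda>p :: 'b \<times> 'b. fst p + snd p)"
    by (intro bounded_linear_add bounded_linear_fst bounded_linear_snd)
  from Ck_on_bounded_linear[OF this assms(1) Ck_on_Pair[OF assms]] show ?thesis by simp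
qed

lemma Ck_on_sum:
  assumes "open U" "\<And>i. i \<in> I \<Longrightarrow> Ck_on k U (f i)"
  shows "Ck_on k U (\<lambda>x. \<Sum>i\<in>I. f i x)"
  using assms(2)
  by (induction I rule: infinite_finite_induct) (auto intro!: Ck_on_const Ck_on_add assms(1))

lemma Ck_on_bounded_bilinear:
  assumes "bounded_bilinear p" "open U" "Ck_on k U f" "Ck_on k U g"
  shows "Ck_on k U (\<lambda>x. p (f x) (g x))"
  using assms(3,4)
proof (induction k arbitrary: f g)
  case 0
  then show ?case using assms(1) by (simp add: bounded_bilinear.continuous_on)
next
  case (Suc k)
  show ?case
  proof (rule Ck_on_SucI[OF assms(2), of _ "\<lambda>x v. p (f x) (frechet_derivative g (at x) v)
        + p (frechet_derivative f (at x) v) (g x)"])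
    fix x assume "x \<in> U"
    then show "((\<lambda>x. p (f x) (g x)) has_derivative (\<lambda>v. p (f x) (frechet_derivative g (at x) v)
        + p (frechet_derivative f (at x) v) (g x))) (at x)"
      by (intro bounded_bilinear.FDERIV[OF assms(1)] Ck_on_has_derivative[OF Suc.prems(1)]
          Ck_on_has_derivative[OF Suc.prems(2)])
  next
    fix v
    show "Ck_on k U (\<lambda>x. p (f x) (frechet_derivative g (at x) v) + p (frechet_derivative f (at x) v) (g x))"
      by (rule Ck_on_add[OF assms(2) Suc.IH[OF Ck_on_SucD[OF Suc.prems(1)] Ck_on_frechet[OF Suc.prems(2)]]
            Suc.IH[OF Ck_on_frechet[OF Suc.prems(1)] Ck_on_SucD[OF Suc.prems(2)]]])
  qed
qed

text \<open>The definition of \<open>C\<^sup>k\<close> sees derivatives only in constant directions, whereas the chain rule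
  evaluates \<open>g'\<close> in the moving direction \<open>f' v\<close>. Expanding this direction in a basis of the middle
  space reduces the one to the other.\<close>

lemma Ck_on_compose:
  fixes f :: "'a::real_normed_vector \<Rightarrow> 'b::real_normed_vector"
    and g :: "'b \<Rightarrow> 'c::real_normed_vector"
  assumes "fin_dim TYPE('b)" "open U" "open V" "f ` U \<subseteq> V" "Ck_on k U f" "Ck_on k V g"
  shows "Ck_on k U (\<lambda>x. g (f x))"
proof -
  obtain B :: "'b set" and c where B: "\<And>b. bounded_linear (c b)" "\<And>x. (\<Sum>b\<in>B. c b x *\<^sub>R b) = x"
    using fin_dim_coords[OF assms(1)] by metis
  show ?thesis using assms(5,6)
  proof (induction k arbitrary: g)
    case 0
    then show ?case using assms(4) by (auto intro: continuous_on_compose2)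
  next
    case (Suc k)
    let ?f' = "\<lambda>x. frechet_derivative f (at x)" and ?g' = "\<lambda>x. frechet_derivative g (at x)"
    show ?case
    proof (rule Ck_on_SucI[OF assms(2), of _ "\<lambda>x v. \<Sum>b\<in>B. c b (?f' x v) *\<^sub>R ?g' (f x) b"])
      fix x assume x: "x \<in> U"
      have g: "(g has_derivative ?g' (f x)) (at (f x))"
        using Suc.prems(2) assms(4) x by (intro Ck_on_has_derivative) auto
      interpret g: linear "?g' (f x)" using g has_derivative_linear by blast
      have "?g' (f x) (?f' x v) = (\<Sum>b\<in>B. c b (?f' x v) *\<^sub>R ?g' (f x) b)" for v
        using g.sum[of "\<lambda>b. c b (?f' x v) *\<^sub>R b" B] by (simp add: B(2) g.scale)
      moreover have "((\<lambda>x. g (f x)) has_derivative (\<lambda>v. ?g' (f x) (?f' x v))) (at x)"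
        using Ck_on_has_derivative[OF Suc.prems(1) x] g by (rule has_derivative_compose)
      ultimately show "((\<lambda>x. g (f x)) has_derivative (\<lambda>v. \<Sum>b\<in>B. c b (?f' x v) *\<^sub>R ?g' (f x) b)) (at x)"
        by simp
    next
      fix v
      show "Ck_on k U (\<lambda>x. \<Sum>b\<in>B. c b (?f' x v) *\<^sub>R ?g' (f x) b)"
        by (rule Ck_on_sum[OF assms(2)], rule Ck_on_bounded_bilinear[OF bounded_bilinear_scaleR assms(2)
              Ck_on_bounded_linear[OF B(1) assms(2) Ck_on_frechet[OF Suc.prems(1)]]
              Suc.IH[OF Ck_on_SucD[OF Suc.prems(1)] Ck_on_frechet[OF Suc.prems(2)]]])
    qed
  qed
qed

text \<open>Smoothness of a germ. Statements at a point combine with neighbourhood filters, without open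
  sets having to be named and shrunk.\<close>

definition smooth_pt :: "('a::real_normed_vector \<Rightarrow> 'b::real_normed_vector) \<Rightarrow> 'a \<Rightarrow> bool" where
  "smooth_pt f x \<longleftrightarrow> (\<exists>U. open U \<and> x \<in> U \<and> smooth_on U f)"

lemma smooth_on_iff:
  assumes "open U"
  shows "smooth_on U f \<longleftrightarrow> (\<forall>x\<in>U. smooth_pt f x)"
proof
  show "\<forall>x\<in>U. smooth_pt f x" if "smooth_on U f" using that assms smooth_pt_def by blast
next
  have "Ck_on k U f" if "\<forall>x\<in>U. \<exists>V. open V \<and> x \<in> V \<and> Ck_on k V f" for k and f :: "'a \<Rightarrow> 'b"
    using that
  proof (induction k arbitrary: f)
    case 0
    then show ?case
      by simp (metis assms continuous_on_eq_continuous_at)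
  next
    case (Suc k)
    have "Ck_on k U (\<lambda>x. frechet_derivative f (at x) v)" for v
      by (rule Suc.IH) (use Suc.prems in fastforce)
    then show ?case using Suc.prems by fastforce
  qed
  then show "smooth_on U f" if "\<forall>x\<in>U. smooth_pt f x"
    using that unfolding smooth_on_def smooth_pt_def by meson
qed

lemma smooth_pt_eventually: "smooth_pt f x \<Longrightarrow> \<forall>\<^sub>F y in nhds x. smooth_pt f y"
  unfolding smooth_pt_def eventually_nhds by blast

lemma smooth_pt_cong:
  assumes "smooth_pt f x" "\<forall>\<^sub>F y in nhds x. f y = g y"
  shows "smooth_pt g x"
proof -
  obtain U where U: "open U" "x \<in> U" "smooth_on U f" using assms(1) smooth_pt_def by blast
  obtain V where V: "open V" "x \<in> V" "\<And>y. y \<in> V \<Longrightarrow> f y = g y" using assms(2)[unfolded eventually_nhds] by blast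
  have "smooth_on (U \<inter> V) g"
    unfolding smooth_on_def
  proof
    fix k
    have "Ck_on k (U \<inter> V) f" using U(3) Ck_on_subset unfolding smooth_on_def by blast
    then show "Ck_on k (U \<inter> V) g" using U V by (intro Ck_on_cong[of "U \<inter> V" f g k]) auto
  qed
  then show ?thesis unfolding smooth_pt_def using U V by (metis IntI open_Int)
qed

lemma smooth_pt_has_derivative:
  "smooth_pt f x \<Longrightarrow> (f has_derivative frechet_derivative f (at x)) (at x)"
  unfolding smooth_pt_def smooth_on_def using Ck_on_has_derivative by blast

lemma smooth_pt_linear: "smooth_pt f x \<Longrightarrow> linear (frechet_derivative f (at x))"
  using smooth_pt_has_derivative has_derivative_linear by blast

lemma smooth_pt_isCont: "smooth_pt f x \<Longrightarrow> isCont f x"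
  using smooth_pt_has_derivative has_derivative_continuous by blast

lemma smooth_pt_eventually_compose:
  assumes "smooth_pt f x" "\<forall>\<^sub>F y in nhds (f x). P y"
  shows "\<forall>\<^sub>F y in nhds x. P (f y)"
  using assms(2) smooth_pt_isCont[OF assms(1)]
  by (metis continuous_within tendsto_at_iff_tendsto_nhds filterlim_iff)

lemma smooth_pt_frechet: "smooth_pt f x \<Longrightarrow> smooth_pt (\<lambda>y. frechet_derivative f (at y) v) x"
  unfolding smooth_pt_def smooth_on_def using Ck_on_frechet by blast

lemma smooth_pt_const: "smooth_pt (\<lambda>x. c) x"
  unfolding smooth_pt_def smooth_on_def using Ck_on_const by blast

lemma smooth_pt_ident: "smooth_pt (\<lambda>x. x) x"
  unfolding smooth_pt_def smooth_on_def using Ck_on_ident by blast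

lemma smooth_ptI: "open U \<Longrightarrow> x \<in> U \<Longrightarrow> (\<And>k. Ck_on k U f) \<Longrightarrow> smooth_pt f x"
  unfolding smooth_pt_def smooth_on_def by blast

lemma smooth_ptE:
  assumes "smooth_pt f x"
  obtains U where "open U" "x \<in> U" "\<And>k. Ck_on k U f"
  using assms unfolding smooth_pt_def smooth_on_def by blast

lemma smooth_pt2E:
  assumes "smooth_pt f x" "smooth_pt g x"
  obtains U where "open U" "x \<in> U" "\<And>k. Ck_on k U f" "\<And>k. Ck_on k U g"
proof -
  obtain U where U: "open U" "x \<in> U" "\<And>k. Ck_on k U f" using smooth_ptE[OF assms(1)] by metis
  obtain V where V: "open V" "x \<in> V" "\<And>k. Ck_on k V g" using smooth_ptE[OF assms(2)] by metis
  show thesis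
    using that[of "U \<inter> V"] U V Ck_on_subset[OF U(3) inf_le1] Ck_on_subset[OF V(3) inf_le2] by blast
qed

lemma smooth_pt_bounded_linear:
  assumes "bounded_linear L" "smooth_pt f x"
  shows "smooth_pt (\<lambda>x. L (f x)) x"
proof -
  obtain U where U: "open U" "x \<in> U" "\<And>k. Ck_on k U f" using smooth_ptE[OF assms(2)] by metis
  show ?thesis by (rule smooth_ptI[OF U(1,2) Ck_on_bounded_linear[OF assms(1) U(1,3)]])
qed

lemma smooth_pt_linear_comp:
  fixes f :: "'a::real_normed_vector \<Rightarrow> 'b::real_normed_vector"
  assumes "fin_dim TYPE('b)" "linear L" "smooth_pt f x"
  shows "smooth_pt (\<lambda>x. L (f x)) x"
  by (rule smooth_pt_bounded_linear[OF fin_dim_bounded_linear[OF assms(1,2)] assms(3)])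

lemma smooth_pt_bounded_bilinear:
  assumes "bounded_bilinear p" "smooth_pt f x" "smooth_pt g x"
  shows "smooth_pt (\<lambda>x. p (f x) (g x)) x"
proof -
  obtain U where U: "open U" "x \<in> U" "\<And>k. Ck_on k U f" "\<And>k. Ck_on k U g"
    using smooth_pt2E[OF assms(2,3)] by metis
  show ?thesis by (rule smooth_ptI[OF U(1,2) Ck_on_bounded_bilinear[OF assms(1) U(1,3,4)]])
qed

lemma smooth_pt_Pair:
  assumes "smooth_pt f x" "smooth_pt g x"
  shows "smooth_pt (\<lambda>x. (f x, g x)) x"
proof -
  obtain U where U: "open U" "x \<in> U" "\<And>k. Ck_on k U f" "\<And>k. Ck_on k U g"
    using smooth_pt2E[OF assms] by metis
  show ?thesis by (rule smooth_ptI[OF U(1,2) Ck_on_Pair[OF U(1,3,4)]])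
qed

lemma smooth_pt_fst: "smooth_pt f x \<Longrightarrow> smooth_pt (\<lambda>x. fst (f x)) x"
  by (rule smooth_pt_bounded_linear[OF bounded_linear_fst])

lemma smooth_pt_snd: "smooth_pt f x \<Longrightarrow> smooth_pt (\<lambda>x. snd (f x)) x"
  by (rule smooth_pt_bounded_linear[OF bounded_linear_snd])

lemma smooth_pt_add: "smooth_pt f x \<Longrightarrow> smooth_pt g x \<Longrightarrow> smooth_pt (\<lambda>x. f x + g x) x"
proof -
  assume "smooth_pt f x" "smooth_pt g x"
  from smooth_pt_bounded_linear[OF _ smooth_pt_Pair[OF this], of "\<lambda>p. fst p + snd p"]
  show ?thesis by (simp add: bounded_linear_add bounded_linear_fst bounded_linear_snd)
qed

lemma smooth_pt_minus: "smooth_pt f x \<Longrightarrow> smooth_pt (\<lambda>x. - f x) x"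
  by (rule smooth_pt_bounded_linear[OF bounded_linear_minus[OF bounded_linear_ident]])

lemma smooth_pt_diff: "smooth_pt f x \<Longrightarrow> smooth_pt g x \<Longrightarrow> smooth_pt (\<lambda>x. f x - g x) x"
  using smooth_pt_add[OF _ smooth_pt_minus, of f x g] by simp

lemma smooth_pt_scaleR: "smooth_pt f x \<Longrightarrow> smooth_pt g x \<Longrightarrow> smooth_pt (\<lambda>x. f x *\<^sub>R g x) x"
  by (rule smooth_pt_bounded_bilinear[OF bounded_bilinear_scaleR])

lemma smooth_pt_sum: "(\<And>i. i \<in> I \<Longrightarrow> smooth_pt (f i) x) \<Longrightarrow> smooth_pt (\<lambda>x. \<Sum>i\<in>I. f i x) x"
  by (induction I rule: infinite_finite_induct) (auto intro!: smooth_pt_const smooth_pt_add)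

lemma smooth_pt_compose:
  fixes f :: "'a::real_normed_vector \<Rightarrow> 'b::real_normed_vector"
  assumes "fin_dim TYPE('b)" "smooth_pt f x" "smooth_pt g (f x)"
  shows "smooth_pt (\<lambda>x. g (f x)) x"
proof -
  obtain V where V: "open V" "f x \<in> V" "smooth_on V g" using assms(3) smooth_pt_def by blast
  have "\<forall>\<^sub>F y in nhds x. f y \<in> V"
    by (rule smooth_pt_eventually_compose[OF assms(2)]) (use V in \<open>auto simp: eventually_nhds\<close>)
  then have "\<forall>\<^sub>F y in nhds x. smooth_pt f y \<and> f y \<in> V"
    using smooth_pt_eventually[OF assms(2)] eventually_conj by blast
  then obtain U where U: "open U" "x \<in> U" "\<And>y. y \<in> U \<Longrightarrow> smooth_pt f y \<and> f y \<in> V"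
    unfolding eventually_nhds by blast
  have "smooth_on U f" using U(3) by (simp add: smooth_on_iff[OF U(1)])
  then have kf: "Ck_on k U f" for k by (simp add: smooth_on_def)
  have kg: "Ck_on k V g" for k using V(3) by (simp add: smooth_on_def)
  have "f ` U \<subseteq> V" using U(3) by blast
  then show ?thesis by (rule smooth_ptI[OF U(1,2) Ck_on_compose[OF assms(1) U(1) V(1) _ kf kg]])
qed

lemma frechet_derivative_compose:
  assumes "smooth_pt f x" "smooth_pt g (f x)"
  shows "frechet_derivative (\<lambda>x. g (f x)) (at x) =
    (\<lambda>v. frechet_derivative g (at (f x)) (frechet_derivative f (at x) v))"
  by (rule frechet_derivative_eqI[OF has_derivative_compose[OF smooth_pt_has_derivative[OF assms(1)]
        smooth_pt_has_derivative[OF assms(2)]]])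

text \<open>Joint smoothness of \<open>(y, w) \<mapsto> Df(y) w\<close>, although only constant \<open>w\<close> occur in the
  definition of smoothness.\<close>

lemma smooth_pt_frechet_apply:
  fixes f :: "'b::real_normed_vector \<Rightarrow> 'c::real_normed_vector"
  assumes "fin_dim TYPE('b)" "smooth_pt h x" "smooth_pt f (h x)" "smooth_pt w x"
  shows "smooth_pt (\<lambda>y. frechet_derivative f (at (h y)) (w y)) x"
proof -
  obtain B :: "'b set" and c where B: "\<And>b. bounded_linear (c b)" "\<And>x. (\<Sum>b\<in>B. c b x *\<^sub>R b) = x"
    using fin_dim_coords[OF assms(1)] by metis
  have "smooth_pt (\<lambda>y. \<Sum>b\<in>B. c b (w y) *\<^sub>R frechet_derivative f (at (h y)) b) x"
    by (rule smooth_pt_sum, rule smooth_pt_scaleR[OF smooth_pt_bounded_linear[OF B(1) assms(4)]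
        smooth_pt_compose[OF assms(1,2) smooth_pt_frechet[OF assms(3)]]])
  moreover have "\<forall>\<^sub>F y in nhds x. (\<Sum>b\<in>B. c b (w y) *\<^sub>R frechet_derivative f (at (h y)) b)
      = frechet_derivative f (at (h y)) (w y)"
    using smooth_pt_eventually_compose[OF assms(2) smooth_pt_eventually[OF assms(3)]]
  proof (rule eventually_mono)
    fix y assume "smooth_pt f (h y)"
    then interpret linear "frechet_derivative f (at (h y))" by (rule smooth_pt_linear)
    show "(\<Sum>b\<in>B. c b (w y) *\<^sub>R frechet_derivative f (at (h y)) b) = frechet_derivative f (at (h y)) (w y)"
      using sum[of "\<lambda>b. c b (w y) *\<^sub>R b" B] by (simp add: B(2) scale)
  qed
  ultimately show ?thesis by (rule smooth_pt_cong)
qed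

lemma smooth_pt_blinfun:
  fixes f :: "'a::real_normed_vector \<Rightarrow> 'e::real_normed_vector covector"
  assumes "fin_dim TYPE('e)" "\<And>v. smooth_pt (\<lambda>x. blinfun_apply (f x) v) x"
  shows "smooth_pt f x"
proof -
  obtain B :: "'e set" and c where B: "\<And>b. bounded_linear (c b)" "\<And>x. (\<Sum>b\<in>B. c b x *\<^sub>R b) = x"
    using fin_dim_coords[OF assms(1)] by metis
  have eq: "(\<Sum>b\<in>B. f y b *\<^sub>R Blinfun (c b)) = f y" for y
  proof (rule blinfun_eqI)
    fix v
    have "f y (\<Sum>b\<in>B. c b v *\<^sub>R b) = (\<Sum>b\<in>B. f y b *\<^sub>R Blinfun (c b)) v"
      by (simp add: blinfun.sum_right blinfun.scaleR_right blinfun.sum_left blinfun.scaleR_left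
          bounded_linear_Blinfun_apply B(1) mult.commute)
    then show "(\<Sum>b\<in>B. f y b *\<^sub>R Blinfun (c b)) v = f y v" by (simp add: B(2))
  qed
  have "smooth_pt (\<lambda>y. \<Sum>b\<in>B. f y b *\<^sub>R Blinfun (c b)) x"
    by (rule smooth_pt_sum, rule smooth_pt_scaleR[OF assms(2) smooth_pt_const])
  then show ?thesis by (simp add: eq)
qed

lemma linear_inv_of_bij:
  assumes "linear f" "bij f"
  shows "linear (inv_into UNIV f)"
proof (rule linearI)
  have s: "f (inv_into UNIV f y) = y" for y using assms(2) by (simp add: bij_is_surj surj_f_inv_f)
  have i: "inv_into UNIV f (f x) = x" for x using assms(2) by (simp add: bij_is_inj)
  show "inv_into UNIV f (x + y) = inv_into UNIV f x + inv_into UNIV f y" for x y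
    using i[of "inv_into UNIV f x + inv_into UNIV f y"] by (simp add: linear_add[OF assms(1)] s)
  show "inv_into UNIV f (r *\<^sub>R x) = r *\<^sub>R inv_into UNIV f x" for r x
    using i[of "r *\<^sub>R inv_into UNIV f x"] by (simp add: linear_scale[OF assms(1)] s)
qed

lemma fin_dim_expansion:
  assumes "fin_dim TYPE('a::real_normed_vector)"
  shows "\<exists>(B :: 'a set) c. (\<forall>b. bounded_linear (c b)) \<and> (\<forall>x. (\<Sum>b\<in>B. c b x *\<^sub>R b) = x)"
  using fin_dim_coords[OF assms] by metis

text \<open>In a basis, a family of linear maps is determined by its values on constant vectors; the product
  rule follows from the one for scalar multiplication.\<close>

lemma
  fixes F :: "'x::real_normed_vector \<Rightarrow> 'w::real_normed_vector \<Rightarrow> 'v::real_normed_vector"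
  assumes fd: "fin_dim TYPE('w)" and lin: "\<forall>\<^sub>F x in nhds x0. linear (F x)"
    and F: "\<And>w. smooth_pt (\<lambda>x. F x w) x0" and w: "smooth_pt w x0"
  shows smooth_pt_operator_apply: "smooth_pt (\<lambda>x. F x (w x)) x0"
    and operator_apply_derivative: "frechet_derivative (\<lambda>x. F x (w x)) (at x0) u =
      frechet_derivative (\<lambda>x. F x (w x0)) (at x0) u + F x0 (frechet_derivative w (at x0) u)"
proof -
  obtain B :: "'w set" and c where B: "\<forall>a. bounded_linear (c a)" "\<forall>x. (\<Sum>a\<in>B. c a x *\<^sub>R a) = x"
    using fin_dim_expansion[OF fd] by (elim exE conjE)
  have exp: "(\<Sum>a\<in>B. c a y *\<^sub>R L a) = L y" if "linear L" for L :: "'w \<Rightarrow> 'v" and y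
    using linear_sum[OF that, of "\<lambda>a. c a y *\<^sub>R a" B] by (simp add: linear_scale[OF that] B(2))
  have ev: "\<forall>\<^sub>F x in nhds x0. (\<Sum>a\<in>B. c a (w x) *\<^sub>R F x a) = F x (w x)"
    using lin by eventually_elim (rule exp)
  have "smooth_pt (\<lambda>x. \<Sum>a\<in>B. c a (w x) *\<^sub>R F x a) x0"
    by (rule smooth_pt_sum, rule smooth_pt_scaleR[OF smooth_pt_bounded_linear[OF B(1)[rule_format] w] F])
  then show "smooth_pt (\<lambda>x. F x (w x)) x0" using ev by (rule smooth_pt_cong)
  have ev0: "\<forall>\<^sub>F x in nhds x0. (\<Sum>a\<in>B. c a (w x0) *\<^sub>R F x a) = F x (w x0)"
    using lin by eventually_elim (rule exp)
  have l0: "linear (F x0)" by (rule eventually_nhds_x_imp_x[OF lin])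
  let ?F' = "\<lambda>a. frechet_derivative (\<lambda>x. F x a) (at x0)" and ?w' = "frechet_derivative w (at x0)"
  have "((\<lambda>x. \<Sum>a\<in>B. c a (w x) *\<^sub>R F x a) has_derivative
      (\<lambda>u. \<Sum>a\<in>B. c a (w x0) *\<^sub>R ?F' a u + c a (?w' u) *\<^sub>R F x0 a)) (at x0)"
    by (rule has_derivative_sum, rule has_derivative_scaleR[OF bounded_linear.has_derivative[OF B(1)[rule_format]
            smooth_pt_has_derivative[OF w]] smooth_pt_has_derivative[OF F]])
  then have 1: "frechet_derivative (\<lambda>x. F x (w x)) (at x0) u = (\<Sum>a\<in>B. c a (w x0) *\<^sub>R ?F' a u + c a (?w' u) *\<^sub>R F x0 a)"
    unfolding frechet_derivative_cong_eventually[OF ev, symmetric] by (simp add: frechet_derivative_eqI)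
  have "((\<lambda>x. \<Sum>a\<in>B. c a (w x0) *\<^sub>R F x a) has_derivative (\<lambda>u. \<Sum>a\<in>B. c a (w x0) *\<^sub>R ?F' a u)) (at x0)"
    by (rule has_derivative_sum, rule has_derivative_scaleR_right[OF smooth_pt_has_derivative[OF F]])
  then have 2: "frechet_derivative (\<lambda>x. F x (w x0)) (at x0) u = (\<Sum>a\<in>B. c a (w x0) *\<^sub>R ?F' a u)"
    unfolding frechet_derivative_cong_eventually[OF ev0, symmetric] by (simp add: frechet_derivative_eqI)
  show "frechet_derivative (\<lambda>x. F x (w x)) (at x0) u = ?F' (w x0) u + F x0 (?w' u)"
    unfolding 1 2 by (simp add: sum.distrib exp[OF l0])
qed

subsection \<open>Symmetry of second derivatives\<close>

text \<open>With \<open>G\<close> the derivative of \<open>y \<mapsto> f'(y) u\<close> at \<open>x\<close>, this is the mean value inequality for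
  \<open>s \<mapsto> f (x + s u + t v) - f (x + s u) - s t G v\<close> on \<open>[0, t]\<close>.\<close>

lemma second_difference:
  fixes f :: "'a::real_normed_vector \<Rightarrow> 'b::real_normed_vector"
  assumes f: "smooth_pt f x" and e: "e > 0"
  shows "\<forall>\<^sub>F t in at_right 0. norm ((f (x + t *\<^sub>R u + t *\<^sub>R v) - f (x + t *\<^sub>R u) - (f (x + t *\<^sub>R v) - f x))
     - t\<^sup>2 *\<^sub>R frechet_derivative (\<lambda>y. frechet_derivative f (at y) u) (at x) v) \<le> e * t\<^sup>2"
proof -
  let ?f' = "\<lambda>y. frechet_derivative f (at y)"
  define G where "G = frechet_derivative (\<lambda>y. ?f' y u) (at x)"
  define N where "N = norm u + norm v + 1"
  have N: "N > 0" unfolding N_def by (simp add: add_nonneg_pos)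
  have G: "((\<lambda>y. ?f' y u) has_derivative G) (at x)"
    unfolding G_def by (rule smooth_pt_has_derivative[OF smooth_pt_frechet[OF f]])
  interpret G: linear G using G has_derivative_linear by blast
  define e' where "e' = e / (2 * N)"
  have e': "e' > 0" unfolding e'_def using e N by simp
  obtain d1 where d1: "d1 > 0" "\<And>y. norm (y - x) < d1 \<Longrightarrow> norm (?f' y u - ?f' x u - G (y - x)) \<le> e' * norm (y - x)"
    using G e' unfolding has_derivative_at_alt by blast
  obtain d2 where d2: "d2 > 0" "\<And>y. dist y x < d2 \<Longrightarrow> smooth_pt f y"
    using smooth_pt_eventually[OF f] unfolding eventually_nhds_metric by blast
  define d where "d = min d1 d2 / N"
  have d: "d > 0" unfolding d_def using d1 d2 N by simp
  have "norm ((f (x + t *\<^sub>R u + t *\<^sub>R v) - f (x + t *\<^sub>R u) - (f (x + t *\<^sub>R v) - f x)) - t\<^sup>2 *\<^sub>R G v) \<le> e * t\<^sup>2"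
    if t: "0 < t" "t < d" for t
  proof -
    have tN: "t * N < min d1 d2" using t(2) N unfolding d_def by (simp add: field_simps)
    have small: "norm (s *\<^sub>R u + r *\<^sub>R v) \<le> t * N" if "0 \<le> s" "s \<le> t" "0 \<le> r" "r \<le> t" for s r
    proof -
      have "norm (s *\<^sub>R u + r *\<^sub>R v) \<le> s * norm u + r * norm v"
        using norm_triangle_ineq[of "s *\<^sub>R u" "r *\<^sub>R v"] that by simp
      also have "\<dots> \<le> t * norm u + t * norm v" using that by (intro add_mono mult_right_mono) auto
      also have "\<dots> \<le> t * N" unfolding N_def using t by (simp add: algebra_simps)
      finally show ?thesis .
    qed
    define \<phi> where "\<phi> s = f (x + s *\<^sub>R u + t *\<^sub>R v) - f (x + s *\<^sub>R u) - s *\<^sub>R (t *\<^sub>R G v)" for s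
    define \<phi>' where "\<phi>' s h = h *\<^sub>R (?f' (x + s *\<^sub>R u + t *\<^sub>R v) u - ?f' (x + s *\<^sub>R u) u - t *\<^sub>R G v)" for s h :: real
    have der: "(\<phi> has_derivative \<phi>' s) (at s within {0..t})" if s: "s \<in> {0..t}" for s
    proof -
      have sm: "smooth_pt f (x + s *\<^sub>R u + t *\<^sub>R v)" "smooth_pt f (x + s *\<^sub>R u)"
        using small[of s t] small[of s 0] s tN t by (auto intro!: d2(2) simp: dist_norm add.assoc)
      have a: "((\<lambda>s. x + s *\<^sub>R u + t *\<^sub>R v) has_derivative (\<lambda>h. h *\<^sub>R u)) (at s)"
        and b: "((\<lambda>s. x + s *\<^sub>R u) has_derivative (\<lambda>h. h *\<^sub>R u)) (at s)"
        by (auto intro!: derivative_eq_intros)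
      have "((\<lambda>s. f (x + s *\<^sub>R u + t *\<^sub>R v)) has_derivative (\<lambda>h. ?f' (x + s *\<^sub>R u + t *\<^sub>R v) (h *\<^sub>R u))) (at s)"
        by (rule has_derivative_compose[OF a smooth_pt_has_derivative[OF sm(1)]])
      moreover have "((\<lambda>s. f (x + s *\<^sub>R u)) has_derivative (\<lambda>h. ?f' (x + s *\<^sub>R u) (h *\<^sub>R u))) (at s)"
        by (rule has_derivative_compose[OF b smooth_pt_has_derivative[OF sm(2)]])
      moreover have "((\<lambda>s. s *\<^sub>R (t *\<^sub>R G v)) has_derivative (\<lambda>h. h *\<^sub>R (t *\<^sub>R G v))) (at s)"
        by (auto intro!: derivative_eq_intros)
      ultimately have "(\<phi> has_derivative (\<lambda>h. ?f' (x + s *\<^sub>R u + t *\<^sub>R v) (h *\<^sub>R u) - ?f' (x + s *\<^sub>R u) (h *\<^sub>R u)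
           - h *\<^sub>R (t *\<^sub>R G v))) (at s)"
        unfolding \<phi>_def by (intro has_derivative_diff)
      moreover have "(\<lambda>h. ?f' (x + s *\<^sub>R u + t *\<^sub>R v) (h *\<^sub>R u) - ?f' (x + s *\<^sub>R u) (h *\<^sub>R u)
           - h *\<^sub>R (t *\<^sub>R G v)) = \<phi>' s"
        unfolding \<phi>'_def by (simp add: fun_eq_iff linear_scale[OF smooth_pt_linear] sm scaleR_diff_right)
      ultimately show ?thesis by (simp add: has_derivative_at_withinI)
    qed
    have bd: "onorm (\<phi>' s) \<le> e * t" if s: "s \<in> {0..t}" for s
    proof (rule onorm_bound)
      fix h
      have n1: "norm (s *\<^sub>R u + t *\<^sub>R v) \<le> t * N" "norm (s *\<^sub>R u) \<le> t * N"
        using small[of s t] small[of s 0] s t by auto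
      have "norm (?f' (x + s *\<^sub>R u + t *\<^sub>R v) u - ?f' x u - G (s *\<^sub>R u + t *\<^sub>R v)) \<le> e' * norm (s *\<^sub>R u + t *\<^sub>R v)"
        using d1(2)[of "x + s *\<^sub>R u + t *\<^sub>R v"] n1 tN by (simp add: algebra_simps)
      also have "\<dots> \<le> e' * (t * N)" using e' n1 by (intro mult_left_mono) auto
      finally have 1: "norm (?f' (x + s *\<^sub>R u + t *\<^sub>R v) u - ?f' x u - G (s *\<^sub>R u + t *\<^sub>R v)) \<le> e' * (t * N)" .
      have "norm (?f' (x + s *\<^sub>R u) u - ?f' x u - G (s *\<^sub>R u)) \<le> e' * norm (s *\<^sub>R u)"
        using d1(2)[of "x + s *\<^sub>R u"] n1 tN by simp
      also have "\<dots> \<le> e' * (t * N)" using e' n1 by (intro mult_left_mono) auto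
      finally have 2: "norm (?f' (x + s *\<^sub>R u) u - ?f' x u - G (s *\<^sub>R u)) \<le> e' * (t * N)" .
      have "?f' (x + s *\<^sub>R u + t *\<^sub>R v) u - ?f' (x + s *\<^sub>R u) u - t *\<^sub>R G v =
         (?f' (x + s *\<^sub>R u + t *\<^sub>R v) u - ?f' x u - G (s *\<^sub>R u + t *\<^sub>R v)) - (?f' (x + s *\<^sub>R u) u - ?f' x u - G (s *\<^sub>R u))"
        by (simp add: G.add G.scale)
      then have "norm (?f' (x + s *\<^sub>R u + t *\<^sub>R v) u - ?f' (x + s *\<^sub>R u) u - t *\<^sub>R G v) \<le> e' * (t * N) + e' * (t * N)"
        using norm_triangle_ineq4 1 2 by (smt (verit))
      also have "\<dots> = e * t" unfolding e'_def using N by (simp add: field_simps)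
      finally have "norm (?f' (x + s *\<^sub>R u + t *\<^sub>R v) u - ?f' (x + s *\<^sub>R u) u - t *\<^sub>R G v) \<le> e * t" .
      then have "\<bar>h\<bar> * norm (?f' (x + s *\<^sub>R u + t *\<^sub>R v) u - ?f' (x + s *\<^sub>R u) u - t *\<^sub>R G v) \<le> \<bar>h\<bar> * (e * t)"
        by (intro mult_left_mono) auto
      then show "norm (\<phi>' s h) \<le> e * t * norm h" unfolding \<phi>'_def by (simp add: mult.commute mult.left_commute)
    qed (use e t in auto)
    have "norm (\<phi> t - \<phi> 0) \<le> e * t * norm (t - 0)"
      by (rule differentiable_bound[where f = \<phi>, OF _ der bd]) (use t in auto)
    also have "\<dots> = e * t\<^sup>2" using t by (simp add: power2_eq_square)
    finally show ?thesis
      unfolding \<phi>_def by (simp add: power2_eq_square algebra_simps)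
  qed
  then show ?thesis unfolding G_def[symmetric] eventually_at_right_field using d by blast
qed

text \<open>The second difference is symmetric in \<open>u\<close> and \<open>v\<close>, and after division by \<open>t\<^sup>2\<close> it tends to
  either side.\<close>

lemma symmetric_second_derivative:
  fixes f :: "'a::real_normed_vector \<Rightarrow> 'b::real_normed_vector"
  assumes "smooth_pt f x"
  shows "frechet_derivative (\<lambda>y. frechet_derivative f (at y) u) (at x) v =
    frechet_derivative (\<lambda>y. frechet_derivative f (at y) v) (at x) u" (is "?A = ?B")
proof -
  have "norm (?A - ?B) \<le> e" if "e > 0" for e
  proof -
    have e: "e/2 > 0" using that by simp
    have "\<forall>\<^sub>F t::real in at_right 0. norm (?A - ?B) \<le> e"
      using second_difference[OF assms e, of u v] second_difference[OF assms e, of v u]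
        eventually_at_right_less[of 0]
    proof eventually_elim
      case (elim t)
      let ?D = "f (x + t *\<^sub>R u + t *\<^sub>R v) - f (x + t *\<^sub>R u) - (f (x + t *\<^sub>R v) - f x)"
      have "?D = f (x + t *\<^sub>R v + t *\<^sub>R u) - f (x + t *\<^sub>R v) - (f (x + t *\<^sub>R u) - f x)"
        by (simp add: algebra_simps)
      then have 2: "norm (?D - t\<^sup>2 *\<^sub>R ?B) \<le> e/2 * t\<^sup>2" using elim(2) by presburger
      have "t\<^sup>2 * norm (?A - ?B) = norm ((?D - t\<^sup>2 *\<^sub>R ?B) - (?D - t\<^sup>2 *\<^sub>R ?A))"
        by (simp add: scaleR_diff_right[symmetric])
      also have "\<dots> \<le> e/2 * t\<^sup>2 + e/2 * t\<^sup>2"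
        by (rule order_trans[OF norm_triangle_ineq4 add_mono[OF 2 elim(1)]])
      also have "\<dots> = t\<^sup>2 * e" by simp
      finally show ?case using elim(3) by simp
    qed
    then show ?thesis using eventually_happens'[OF trivial_limit_at_right_real] by blast
  qed
  from this[of "norm (?A - ?B) / 2"] have "\<not> 0 < norm (?A - ?B)" by linarith
  then show ?thesis by simp
qed

subsection \<open>The inverse function theorem\<close>

text \<open>Continuity on each vector is continuity in the operator norm, since it can be tested on the
  finitely many vectors of a basis.\<close>

lemma uniform_operator_continuity:
  fixes A :: "'x::t2_space \<Rightarrow> 'b::real_normed_vector \<Rightarrow> 'c::real_normed_vector"
  assumes "fin_dim TYPE('b)" "\<forall>\<^sub>F x in nhds x0. linear (A x)" "\<And>v. isCont (\<lambda>x. A x v) x0" "e > 0"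
  shows "\<forall>\<^sub>F x in nhds x0. \<forall>v. norm (A x v - A x0 v) \<le> e * norm v"
proof -
  obtain B :: "'b set" and c where B: "\<And>b. bounded_linear (c b)" "\<And>x. (\<Sum>b\<in>B. c b x *\<^sub>R b) = x"
    using fin_dim_coords[OF assms(1)] by metis
  define S where "S x = (\<Sum>b\<in>B. onorm (c b) * norm (A x b - A x0 b))" for x
  have "isCont S x0" unfolding S_def using assms(3) by (intro continuous_intros)
  then have ev: "\<forall>\<^sub>F x in nhds x0. S x < e"
    unfolding continuous_within tendsto_at_iff_tendsto_nhds
    by (rule order_tendstoD(2)) (simp add: S_def assms(4))
  have l0: "linear (A x0)" using eventually_nhds_x_imp_x[OF assms(2)] .
  show ?thesis using ev assms(2)
  proof eventually_elim
    case (elim x)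
    show ?case
    proof
      fix v
      have exp: "L v = (\<Sum>b\<in>B. c b v *\<^sub>R L b)" if "linear L" for L :: "'b \<Rightarrow> 'c"
        using linear_sum[OF that, of "\<lambda>b. c b v *\<^sub>R b" B] by (simp add: B(2) linear_scale[OF that])
      have "norm (A x v - A x0 v) = norm (\<Sum>b\<in>B. c b v *\<^sub>R (A x b - A x0 b))"
        by (simp add: exp[OF elim(2)] exp[OF l0] scaleR_diff_right sum_subtractf)
      also have "\<dots> \<le> (\<Sum>b\<in>B. norm (c b v *\<^sub>R (A x b - A x0 b)))" by (rule norm_sum)
      also have "\<dots> \<le> (\<Sum>b\<in>B. (onorm (c b) * norm v) * norm (A x b - A x0 b))"
        using onorm[OF B(1)] by (intro sum_mono) (simp add: mult_right_mono)
      also have "\<dots> = S x * norm v" unfolding S_def sum_distrib_right by (simp add: ac_simps)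
      also have "\<dots> \<le> e * norm v" using elim(1) by (intro mult_right_mono) auto
      finally show "norm (A x v - A x0 v) \<le> e * norm v" .
    qed
  qed
qed

text \<open>The inverse \<open>B\<close> of \<open>A\<close> has the derivative \<open>- B A' B\<close>, which is built from \<open>B\<close> itself, so the
  order of differentiability climbs by induction.\<close>

lemma Ck_on_inverse_operator:
  fixes A :: "'x::real_normed_vector \<Rightarrow> 'b::real_normed_vector \<Rightarrow> 'c::real_normed_vector"
  assumes fd: "fin_dim TYPE('b)" "fin_dim TYPE('c)" and U: "open U"
    and A: "\<And>x. x \<in> U \<Longrightarrow> linear (A x)" "\<And>k v. Ck_on k U (\<lambda>x. A x v)"
    and BA: "\<And>x v. x \<in> U \<Longrightarrow> B x (A x v) = v" and AB: "\<And>x w. x \<in> U \<Longrightarrow> A x (B x w) = w"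
  shows "Ck_on k U (\<lambda>x. B x w)"
proof -
  obtain Bb :: "'b set" and cb where Bb: "\<And>b. bounded_linear (cb b)" "\<And>x. (\<Sum>b\<in>Bb. cb b x *\<^sub>R b) = x"
    using fin_dim_coords[OF fd(1)] by metis
  obtain Bc :: "'c set" and cc where Bc: "\<And>b. bounded_linear (cc b)" "\<And>x. (\<Sum>b\<in>Bc. cc b x *\<^sub>R b) = x"
    using fin_dim_coords[OF fd(2)] by metis
  have Bl: "linear (B x)" if x: "x \<in> U" for x
  proof (rule linearI)
    fix v w r
    show "B x (v + w) = B x v + B x w"
      using BA[OF x, of "B x v + B x w"] by (simp add: linear_add[OF A(1)[OF x]] AB[OF x])
    show "B x (r *\<^sub>R v) = r *\<^sub>R B x v"
      using BA[OF x, of "r *\<^sub>R B x v"] by (simp add: linear_scale[OF A(1)[OF x]] AB[OF x])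
  qed
  define A' where "A' x z u = (\<Sum>b\<in>Bb. cb b z *\<^sub>R frechet_derivative (\<lambda>x. A x b) (at x) u)" for x z u
  have A': "((\<lambda>x. A x z) has_derivative A' x z) (at x)" if x: "x \<in> U" for x z
  proof -
    have "((\<lambda>x. \<Sum>b\<in>Bb. cb b z *\<^sub>R A x b) has_derivative A' x z) (at x)"
      unfolding A'_def using Ck_on_has_derivative[OF A(2) x] by (intro has_derivative_sum has_derivative_scaleR_right)
    moreover have "(\<Sum>b\<in>Bb. cb b z *\<^sub>R A y b) = A y z" if "y \<in> U" for y
      using linear_sum[OF A(1)[OF that], of "\<lambda>b. cb b z *\<^sub>R b" Bb] by (simp add: Bb(2) linear_scale[OF A(1)[OF that]])
    ultimately show ?thesis by (rule has_derivative_transform_within_open[OF _ U x])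
  qed
  have evU: "\<forall>\<^sub>F y in nhds x. y \<in> U" if "x \<in> U" for x using U that eventually_nhds by blast
  have opc: "\<forall>\<^sub>F y in nhds x. \<forall>v. norm (A y v - A x v) \<le> e * norm v" if "x \<in> U" "e > 0" for x e
  proof (rule uniform_operator_continuity[OF fd(1) _ _ that(2)])
    show "\<forall>\<^sub>F y in nhds x. linear (A y)" using evU[OF that(1)] A(1) by (rule eventually_mono)
    show "isCont (\<lambda>x. A x v) x" for v using A'[OF that(1)] has_derivative_continuous by blast
  qed
  have der: "((\<lambda>x. B x w) has_derivative (\<lambda>u. - B x0 (A' x0 (B x0 w) u))) (at x0)" if x0: "x0 \<in> U" for x0 w
  proof -
    have bl: "bounded_linear (B x0)" by (rule fin_dim_bounded_linear[OF fd(2) Bl[OF x0]])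
    obtain K where K: "K > 0" "\<And>v. norm (B x0 v) \<le> norm v * K" using bounded_linear.pos_bounded[OF bl] by blast
    define z where "z = B x0 w"
    have bl': "bounded_linear (A' x0 z)" using A'[OF x0] has_derivative_bounded_linear by blast
    obtain C where C: "C > 0" "\<And>v. norm (A' x0 z v) \<le> norm v * C" using bounded_linear.pos_bounded[OF bl'] by blast
    have K2: "1 / (2 * K) > 0" using K(1) by simp
    (* If A y is within 1/(2K) of A x0, its inverse is at most twice as large. *)
    have bd: "\<forall>\<^sub>F y in nhds x0. \<forall>v. norm (B y v) \<le> 2 * K * norm v"
      using opc[OF x0 K2] evU[OF x0]
    proof eventually_elim
      case (elim y)
      show ?case
      proof
        fix v
        let ?p = "B y v"
        have "norm ?p = norm (B x0 (A x0 ?p))" by (simp add: BA[OF x0])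
        also have "\<dots> \<le> norm (A x0 ?p) * K" by (rule K(2))
        also have "norm (A x0 ?p) \<le> norm v + norm (A y ?p - A x0 ?p)"
          using norm_triangle_ineq4[of v "A y ?p - A x0 ?p"] by (simp add: AB[OF elim(2)])
        also have "\<dots> \<le> norm v + norm ?p / (2*K)" using elim(1)[rule_format, of ?p] by simp
        finally have "norm ?p \<le> (norm v + norm ?p / (2*K)) * K" using K(1) by simp
        also have "\<dots> = norm v * K + norm ?p / 2" using K(1) by (simp add: field_simps)
        finally show "norm ?p \<le> 2 * K * norm v" by (simp add: field_simps)
      qed
    qed
    show ?thesis
      unfolding has_derivative_at_alt
    proof (intro conjI allI impI)
      show "bounded_linear (\<lambda>u. - B x0 (A' x0 (B x0 w) u))"
        using bounded_linear_minus[OF bounded_linear_compose[OF bl bl']] by (simp add: z_def)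
    next
      fix e :: real assume e: "e > 0"
      define e1 where "e1 = e / (4 * K)"
      define e2 where "e2 = e / (4 * K * K * C)"
      have e12: "e1 > 0" "e2 > 0" unfolding e1_def e2_def using e K C by auto
      have "\<exists>d>0. \<forall>y. norm (y - x0) < d \<longrightarrow> norm (A y z - A x0 z - A' x0 z (y - x0)) \<le> e1 * norm (y - x0)"
        using A'[OF x0, of z] e12(1) unfolding has_derivative_at_alt by blast
      then have ev1: "\<forall>\<^sub>F y in nhds x0. norm (A y z - A x0 z - A' x0 z (y - x0)) \<le> e1 * norm (y - x0)"
        unfolding eventually_nhds_metric dist_norm .
      have "\<forall>\<^sub>F y in nhds x0. norm (B y w - B x0 w - - B x0 (A' x0 (B x0 w) (y - x0))) \<le> e * norm (y - x0)"
        using bd ev1 opc[OF x0 e12(2)] evU[OF x0]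
      proof eventually_elim
        case (elim y)
        let ?h = "y - x0"
        let ?q = "A' x0 z ?h"
        let ?r = "A y z - A x0 z - ?q"
        let ?s = "A y (B x0 ?q) - A x0 (B x0 ?q)"
        (* The error term is B y applied to s - r: r is the error in the expansion of A, and s the
           change of A on the vector B x0 q. *)
        have "B y ?s = B x0 ?q - B y ?q"
          by (simp add: linear_diff[OF Bl[OF elim(4)]] BA[OF elim(4)] AB[OF x0])
        moreover have "B y ?r = z - B y w - B y ?q"
          by (simp add: linear_diff[OF Bl[OF elim(4)]] BA[OF elim(4)]) (simp add: z_def AB[OF x0])
        ultimately have eq: "B y w - B x0 w - - B x0 (A' x0 (B x0 w) ?h) = B y (?s - ?r)"
          by (simp add: linear_diff[OF Bl[OF elim(4)]] z_def)
        have "norm ?s \<le> e2 * norm (B x0 ?q)" using elim(3) by blast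
        also have "\<dots> \<le> e2 * ((norm ?h * C) * K)"
          using e12(2) K C(2)[of ?h] by (intro mult_left_mono order_trans[OF K(2)] mult_right_mono) auto
        also have "\<dots> = e / (4*K) * norm ?h" unfolding e2_def using K C by (simp add: field_simps)
        finally have "norm (?s - ?r) \<le> e / (4*K) * norm ?h + e / (4*K) * norm ?h"
          using elim(2) norm_triangle_ineq4[of ?s ?r] unfolding e1_def by linarith
        then have "2 * K * norm (?s - ?r) \<le> 2 * K * (e / (4*K) * norm ?h + e / (4*K) * norm ?h)"
          using K(1) by (intro mult_left_mono) auto
        also have "\<dots> = e * norm ?h" using K(1) by (simp add: field_simps)
        finally show ?case unfolding eq using elim(1)[rule_format, of "?s - ?r"] by linarith
      qed
      then show "\<exists>d>0. \<forall>y. norm (y - x0) < d \<longrightarrow>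
          norm (B y w - B x0 w - - B x0 (A' x0 (B x0 w) (y - x0))) \<le> e * norm (y - x0)"
        unfolding eventually_nhds_metric dist_norm .
    qed
  qed
  have Bexp: "(\<Sum>c\<in>Bc. cc c q *\<^sub>R B x c) = B x q" if "x \<in> U" for x q
    using linear_sum[OF Bl[OF that], of "\<lambda>b. cc b q *\<^sub>R b" Bc] by (simp add: Bc(2) linear_scale[OF Bl[OF that]])
  show ?thesis
  proof (induction k arbitrary: w)
    case 0
    show ?case
      using has_derivative_continuous[OF der]
      by (simp add: continuous_at_imp_continuous_on)
  next
    case (Suc k)
    show ?case
    proof (rule Ck_on_SucI[OF U der])
      fix u
      have "Ck_on k U (\<lambda>x. A' x (B x w) u)"
        unfolding A'_def
        by (rule Ck_on_sum[OF U], rule Ck_on_bounded_bilinear[OF bounded_bilinear_scaleR U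
              Ck_on_bounded_linear[OF Bb(1) U Suc.IH] Ck_on_frechet[OF A(2)]])
      then have "Ck_on k U (\<lambda>x. \<Sum>c\<in>Bc. cc c (A' x (B x w) u) *\<^sub>R B x c)"
        by (intro Ck_on_sum[OF U] Ck_on_bounded_bilinear[OF bounded_bilinear_scaleR U
              Ck_on_bounded_linear[OF Bc(1) U] Suc.IH])
      from Ck_on_cong[OF U _ this, of "\<lambda>x. B x (A' x (B x w) u)"]
      have "Ck_on k U (\<lambda>x. B x (A' x (B x w) u))" by (simp add: Bexp)
      then show "Ck_on k U (\<lambda>x. - B x (A' x (B x w) u))"
        by (rule Ck_on_bounded_linear[OF bounded_linear_minus[OF bounded_linear_ident] U])
    qed
  qed
qed

text \<open>Near \<open>x0\<close> the map \<open>f - id\<close> has Lipschitz constant \<open>1/2\<close>, so \<open>x \<mapsto> w - (f x - x)\<close> is a contraction,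
  and its fixed point solves \<open>f x = w\<close>. The derivative of the inverse is the inverse operator, which
  is smooth as a function of the inverse; this lifts the order of differentiability step by step.\<close>

lemma inverse_function_near_identity:
  fixes f :: "'a::real_normed_vector \<Rightarrow> 'a"
  assumes fd: "fin_dim TYPE('a)" and W: "open W" "x0 \<in> W" "\<And>x. x \<in> W \<Longrightarrow> smooth_pt f x"
    and id: "frechet_derivative f (at x0) = (\<lambda>v. v)"
  shows "\<exists>U g. open U \<and> x0 \<in> U \<and> U \<subseteq> W \<and> open (f ` U) \<and> (\<forall>x\<in>U. g (f x) = x) \<and> (\<forall>y\<in>f ` U. smooth_pt g y)"
proof -
  let ?f' = "\<lambda>x. frechet_derivative f (at x)"
  have sm0: "smooth_pt f x0" using W by blast
  have "\<forall>\<^sub>F x in nhds x0. \<forall>v. norm (?f' x v - ?f' x0 v) \<le> 1/2 * norm v"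
  proof (rule uniform_operator_continuity[OF fd])
    show "\<forall>\<^sub>F x in nhds x0. linear (?f' x)"
      by (rule eventually_mono[OF smooth_pt_eventually[OF sm0]]) (rule smooth_pt_linear)
    show "isCont (\<lambda>x. ?f' x v) x0" for v by (rule smooth_pt_isCont[OF smooth_pt_frechet[OF sm0]])
  qed simp
  then have "\<forall>\<^sub>F x in nhds x0. x \<in> W \<and> (\<forall>v. norm (?f' x v - v) \<le> 1/2 * norm v)"
    using W id by (auto intro!: eventually_conj simp: eventually_nhds)
  then obtain d where d: "d > 0" "\<And>x. dist x x0 < d \<Longrightarrow> x \<in> W \<and> (\<forall>v. norm (?f' x v - v) \<le> 1/2 * norm v)"
    unfolding eventually_nhds_metric by blast
  define U where "U = ball x0 d"
  have U: "open U" "x0 \<in> U" "U \<subseteq> W" "convex U"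
    using d by (auto simp: U_def dist_commute)
  have near: "norm (?f' x v - v) \<le> 1/2 * norm v" if "x \<in> U" for x v
    using d(2)[of x] that by (auto simp: U_def dist_commute)
  have lip: "norm ((f x - x) - (f y - y)) \<le> 1/2 * norm (x - y)" if "x \<in> U" "y \<in> U" for x y
  proof (rule differentiable_bound[where f = "\<lambda>x. f x - x" and f' = "\<lambda>x v. ?f' x v - v", OF U(4) _ _ that])
    fix x assume x: "x \<in> U"
    show "((\<lambda>x. f x - x) has_derivative (\<lambda>v. ?f' x v - v)) (at x within U)"
      by (rule has_derivative_diff[OF has_derivative_at_withinI[OF smooth_pt_has_derivative[OF W(3)[OF subsetD[OF U(3) x]]]]
            has_derivative_ident])
    show "onorm (\<lambda>v. ?f' x v - v) \<le> 1/2" by (rule onorm_bound[OF _ near[OF x]]) simp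
  qed
  have exp: "norm (x - y) \<le> 2 * norm (f x - f y)" if "x \<in> U" "y \<in> U" for x y
  proof -
    have "x - y = (f x - f y) - ((f x - x) - (f y - y))" by simp
    then have "norm (x - y) \<le> norm (f x - f y) + norm ((f x - x) - (f y - y))"
      using norm_triangle_ineq4[of "f x - f y" "(f x - x) - (f y - y)"] by metis
    then show ?thesis using lip[OF that] by simp
  qed
  then have inj: "inj_on f U" by (intro inj_onI) (metis eq_iff_diff_eq_0 mult_zero_right norm_le_zero_iff norm_zero)
  have op: "open (f ` U)"
    unfolding open_contains_ball
  proof
    fix y assume "y \<in> f ` U"
    then obtain x1 where x1: "x1 \<in> U" "y = f x1" by blast
    obtain r where r: "r > 0" "cball x1 r \<subseteq> U" using U(1) x1(1) open_contains_cball by blast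
    have "w \<in> f ` U" if w: "w \<in> ball y (r/2)" for w
    proof -
      let ?T = "\<lambda>x. w - (f x - x)"
      have cU: "x \<in> U" if "x \<in> cball x1 r" for x using that r by blast
      have x1': "x1 \<in> cball x1 r" using r by simp
      have "\<exists>!x. x \<in> cball x1 r \<and> ?T x = x"
      proof (rule Banach_fix[where c = "1/2"])
        show "complete (cball x1 r)"
          by (rule complete_closed_subset[OF closed_cball subset_UNIV fin_dim_complete[OF fd]])
        show "?T ` cball x1 r \<subseteq> cball x1 r"
        proof
          fix p assume "p \<in> ?T ` cball x1 r"
          then obtain x where x: "x \<in> cball x1 r" "p = ?T x" by blast
          have "norm (p - x1) = norm ((w - y) - ((f x - x) - (f x1 - x1)))" unfolding x(2) x1(2) by (simp add: algebra_simps)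
          also have "\<dots> \<le> norm (w - y) + norm ((f x - x) - (f x1 - x1))" by (rule norm_triangle_ineq4)
          also have "\<dots> \<le> r/2 + 1/2 * norm (x - x1)"
            using w lip[OF cU[OF x(1)] x1(1)] by (intro add_mono) (auto simp: dist_norm norm_minus_commute)
          also have "\<dots> \<le> r" using x by (simp add: dist_norm norm_minus_commute)
          finally show "p \<in> cball x1 r" by (simp add: dist_norm norm_minus_commute)
        qed
        fix x z assume "x \<in> cball x1 r" "z \<in> cball x1 r"
        then show "dist (?T x) (?T z) \<le> 1/2 * dist x z"
          using lip[of x z] cU by (simp add: dist_norm norm_minus_commute algebra_simps)
      qed (use r in auto)
      then obtain x where "x \<in> cball x1 r" "?T x = x" by blast
      then show ?thesis using cU by (metis diff_eq_eq add_diff_cancel_left' diff_add_cancel imageI)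
    qed
    then show "\<exists>e>0. ball y e \<subseteq> f ` U" using r(1) by (intro exI[of _ "r/2"]) auto
  qed
  define g where "g = inv_into U f"
  have gf: "g (f x) = x" if "x \<in> U" for x unfolding g_def using inj that by simp
  have gU: "g y \<in> U" "f (g y) = y" if "y \<in> f ` U" for y
    using that gf by auto
  have bijf': "bij (?f' x)" if x: "x \<in> U" for x
  proof -
    have l: "linear (?f' x)" using W(3) U(3) x smooth_pt_linear by blast
    have "v = 0" if "?f' x v = 0" for v using near[OF x, of v] that by simp
    then have "inj (?f' x)" using linear_injective_0[OF l] by blast
    then show ?thesis using fin_dim_inj_imp_surj[OF fd l] bij_def by blast
  qed
  define B where "B x = inv_into UNIV (?f' x)" for x
  have B: "B x (?f' x v) = v" "?f' x (B x v) = v" if "x \<in> U" for x v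
    unfolding B_def using bijf'[OF that] by (simp_all add: bij_is_inj bij_is_surj surj_f_inv_f)
  have fCk: "Ck_on k U f" for k
    using smooth_on_iff[OF U(1), of f] W(3) U(3) by (auto simp: smooth_on_def)
  have BCk: "Ck_on k U (\<lambda>x. B x w)" for k w
    by (rule Ck_on_inverse_operator[OF fd fd U(1), of ?f'])
       (use fCk[of "Suc _"] B smooth_pt_linear[OF W(3)[OF subsetD[OF U(3)]]] in auto)
  have gcont: "continuous_on (f ` U) g"
  proof (rule continuous_onI)
    fix y e assume y: "y \<in> f ` U" and e: "(e::real) > 0"
    have "dist (g y') (g y) \<le> e" if "y' \<in> f ` U" "dist y' y < e/2" for y'
      using exp[OF gU(1)[OF that(1)] gU(1)[OF y]] gU(2)[OF that(1)] gU(2)[OF y] that(2) by (simp add: dist_norm)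
    then show "\<exists>d>0. \<forall>y'\<in>f ` U. dist y' y < d \<longrightarrow> dist (g y') (g y) \<le> e"
      using e by (intro exI[of _ "e/2"]) auto
  qed
  have gder: "(g has_derivative B (g y)) (at y)" if y: "y \<in> f ` U" for y
  proof (rule has_derivative_inverse_basic[where f = f and g = g, OF _ _ _ _ op y gU(2)])
    show "(f has_derivative ?f' (g y)) (at (g y))"
      using W(3) U(3) gU(1)[OF y] by (intro smooth_pt_has_derivative) blast
    have "linear (B (g y))"
      unfolding B_def using bijf'[OF gU(1)[OF y]] W(3) U(3) gU(1)[OF y] smooth_pt_linear
      by (intro linear_inv_of_bij) blast+
    then show "bounded_linear (B (g y))" by (rule fin_dim_bounded_linear[OF fd])
    show "B (g y) \<circ> ?f' (g y) = id" using B(1)[OF gU(1)[OF y]] by auto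
    show "isCont g y" using gcont continuous_on_eq_continuous_at[OF op] y by blast
  qed
  have gCk: "Ck_on k (f ` U) g" for k
  proof (induction k)
    case (Suc k)
    have "Ck_on k (f ` U) (\<lambda>y. B (g y) w)" for w
      using Ck_on_compose[OF fd op U(1) _ Suc BCk] gU(1) by blast
    from Ck_on_SucI[OF op gder this] show ?case by simp
  qed (simp add: gcont)
  have "smooth_pt g y" if "y \<in> f ` U" for y by (rule smooth_ptI[OF op that gCk])
  then show ?thesis using U(1-3) op gf by blast
qed

text \<open>Composing \<open>f\<close> with the inverse \<open>T\<close> of its derivative at \<open>x0\<close> makes this derivative the identity.\<close>

theorem inverse_function:
  fixes f :: "'a::real_normed_vector \<Rightarrow> 'b::real_normed_vector"
  assumes fd: "fin_dim TYPE('a)" "fin_dim TYPE('b)"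
    and W: "open W" "x0 \<in> W" "\<And>x. x \<in> W \<Longrightarrow> smooth_pt f x"
    and bij: "bij (frechet_derivative f (at x0))"
  shows "\<exists>U g. open U \<and> x0 \<in> U \<and> U \<subseteq> W \<and> open (f ` U) \<and> (\<forall>x\<in>U. g (f x) = x) \<and> (\<forall>y\<in>f ` U. smooth_pt g y)"
proof -
  define T where "T = inv_into UNIV (frechet_derivative f (at x0))"
  have "linear T"
    unfolding T_def by (rule linear_inv_of_bij[OF smooth_pt_linear[OF W(3)[OF W(2)]] bij])
  then have T: "bounded_linear T" by (rule fin_dim_bounded_linear[OF fd(2)])
  have injT: "inj T" unfolding T_def using bij by (simp add: bij_imp_bij_inv bij_is_inj)
  have sm: "smooth_pt (\<lambda>x. T (f x)) x" if "x \<in> W" for x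
    by (rule smooth_pt_bounded_linear[OF T W(3)[OF that]])
  have "((\<lambda>x. T (f x)) has_derivative (\<lambda>v. T (frechet_derivative f (at x0) v))) (at x0)"
    by (rule bounded_linear.has_derivative[OF T smooth_pt_has_derivative[OF W(3)[OF W(2)]]])
  then have "frechet_derivative (\<lambda>x. T (f x)) (at x0) = (\<lambda>v. v)"
    using bij by (subst frechet_derivative_eqI) (auto simp: T_def bij_is_inj)
  then have "\<exists>U g. open U \<and> x0 \<in> U \<and> U \<subseteq> W \<and> open ((\<lambda>x. T (f x)) ` U) \<and> (\<forall>x\<in>U. g (T (f x)) = x) \<and>
      (\<forall>y\<in>(\<lambda>x. T (f x)) ` U. smooth_pt g y)"
    by (intro inverse_function_near_identity[OF fd(1) W(1,2)] sm)
  then obtain U g where U: "open U" "x0 \<in> U" "U \<subseteq> W" "open ((\<lambda>x. T (f x)) ` U)"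
    "\<And>x. x \<in> U \<Longrightarrow> g (T (f x)) = x" "\<And>y. y \<in> (\<lambda>x. T (f x)) ` U \<Longrightarrow> smooth_pt g y" by blast
  have "f ` U = T -` ((\<lambda>x. T (f x)) ` U)" using injT by (auto dest: injD)
  then have op: "open (f ` U)"
    using open_vimage[OF U(4)] linear_continuous_on[OF T] by metis
  have "smooth_pt (\<lambda>y. g (T y)) y" if "y \<in> f ` U" for y
    by (rule smooth_pt_compose[OF fd(1) smooth_pt_bounded_linear[OF T smooth_pt_ident] U(6)]) (use that in blast)
  then show ?thesis using U(1-3,5) op by (intro exI[of _ U] exI[of _ "\<lambda>y. g (T y)"]) simp
qed

section \<open>Manifolds\<close>

text \<open>The conditions on the charts alone, on which the local calculus rests.\<close>

definition atlas :: "('a, 'e::real_normed_vector) manifold \<Rightarrow> bool" where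
  "atlas M \<longleftrightarrow> fin_dim TYPE('e) \<and>
     (\<forall>p\<in>points M. p \<in> chart_dom M p \<and> chart_dom M p \<subseteq> points M \<and>
        inj_on (chart M p) (chart_dom M p) \<and> open (chart M p ` chart_dom M p)) \<and>
     (\<forall>p\<in>points M. \<forall>q\<in>points M.
        open (chart M p ` (chart_dom M p \<inter> chart_dom M q)) \<and>
        smooth_on (chart M p ` (chart_dom M p \<inter> chart_dom M q)) (chart M q \<circ> chart_inv M p))"

lemma manifold_iff:
  "manifold M \<longleftrightarrow> atlas M \<and> Hausdorff_space (mtopology M) \<and> second_countable (mtopology M)"
  unfolding manifold_def atlas_def fin_dim_def by blast

lemma manifold_atlas: "manifold M \<Longrightarrow> atlas M"
  by (simp add: manifold_iff)

lemma atlas_fin_dim: "atlas (M :: ('a, 'e::real_normed_vector) manifold) \<Longrightarrow> fin_dim TYPE('e)"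
  by (simp add: atlas_def)

lemma atlas_chart:
  assumes "atlas M" "p \<in> points M"
  shows "p \<in> chart_dom M p" "chart_dom M p \<subseteq> points M" "inj_on (chart M p) (chart_dom M p)"
    "open (chart M p ` chart_dom M p)"
  using assms unfolding atlas_def by blast+

lemma chart_inv_chart: "atlas M \<Longrightarrow> p \<in> points M \<Longrightarrow> q \<in> chart_dom M p \<Longrightarrow> chart_inv M p (chart M p q) = q"
  unfolding chart_inv_def using atlas_chart(3) inv_into_f_f by metis

lemma chart_inv_image:
  assumes "atlas M" "p \<in> points M" "x \<in> chart M p ` chart_dom M p"
  shows "chart M p (chart_inv M p x) = x" "chart_inv M p x \<in> chart_dom M p"
proof -
  obtain q where "q \<in> chart_dom M p" "x = chart M p q" using assms(3) by blast
  then show "chart M p (chart_inv M p x) = x" "chart_inv M p x \<in> chart_dom M p"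
    using chart_inv_chart[OF assms(1,2)] by auto
qed

lemma openin_mtopology:
  assumes "atlas M"
  shows "openin (mtopology M) U \<longleftrightarrow>
    U \<subseteq> points M \<and> (\<forall>p\<in>points M. open (chart M p ` (U \<inter> chart_dom M p)))"
proof -
  let ?P = "\<lambda>U. U \<subseteq> points M \<and> (\<forall>p\<in>points M. open (chart M p ` (U \<inter> chart_dom M p)))"
  have "istopology ?P"
    unfolding istopology_def
  proof (intro conjI allI impI)
    fix S T assume S: "?P S" and T: "?P T"
    show "S \<inter> T \<subseteq> points M" using S by blast
    show "\<forall>p\<in>points M. open (chart M p ` ((S \<inter> T) \<inter> chart_dom M p))"
    proof
      fix p assume p: "p \<in> points M"
      have "chart M p ` ((S \<inter> T) \<inter> chart_dom M p) =
          chart M p ` (S \<inter> chart_dom M p) \<inter> chart M p ` (T \<inter> chart_dom M p)"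
        using inj_on_image_Int[OF atlas_chart(3)[OF assms p], of "S \<inter> chart_dom M p" "T \<inter> chart_dom M p"]
        by (simp add: Int_ac inf_assoc inf_left_commute)
      then show "open (chart M p ` ((S \<inter> T) \<inter> chart_dom M p))" using S T p by (simp add: open_Int)
    qed
  next
    fix K assume K: "\<forall>S\<in>K. ?P S"
    show "\<Union> K \<subseteq> points M" using K by blast
    show "\<forall>p\<in>points M. open (chart M p ` (\<Union> K \<inter> chart_dom M p))"
    proof
      fix p assume p: "p \<in> points M"
      have "chart M p ` (\<Union> K \<inter> chart_dom M p) = (\<Union>S\<in>K. chart M p ` (S \<inter> chart_dom M p))" by blast
      then show "open (chart M p ` (\<Union> K \<inter> chart_dom M p))" using K p by auto
    qed
  qed
  then show ?thesis unfolding mtopology_def using topology_inverse'[of ?P] by simp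
qed

lemma openin_chart_dom: "atlas M \<Longrightarrow> p \<in> points M \<Longrightarrow> openin (mtopology M) (chart_dom M p)"
  by (simp add: openin_mtopology atlas_chart(2)) (metis Int_commute atlas_def)

lemma openin_points: "atlas M \<Longrightarrow> openin (mtopology M) (points M)"
  by (simp add: openin_mtopology) (metis atlas_chart(2,4) inf.absorb2)

lemma topspace_mtopology: "atlas M \<Longrightarrow> topspace (mtopology M) = points M"
  by (meson openin_mtopology openin_points openin_subset openin_topspace subset_antisym)

lemma openin_chart_inv_image:
  assumes M: "atlas M" and p: "p \<in> points M" and W: "open W" "W \<subseteq> chart M p ` chart_dom M p"
  shows "openin (mtopology M) (chart_inv M p ` W)"
  unfolding openin_mtopology[OF M]
proof (intro conjI ballI)
  have dom: "chart_inv M p ` W \<subseteq> chart_dom M p" using chart_inv_image(2)[OF M p] W(2) by blast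
  then show "chart_inv M p ` W \<subseteq> points M" using atlas_chart(2)[OF M p] by blast
  fix q assume q: "q \<in> points M"
  define S where "S = chart M q ` (chart_dom M q \<inter> chart_dom M p)"
  have S: "open S" "smooth_on S (chart M p \<circ> chart_inv M q)"
    using M p q unfolding atlas_def S_def by blast+
  have "Ck_on 0 S (chart M p \<circ> chart_inv M q)" using S(2) unfolding smooth_on_def by blast
  then have cont: "continuous_on S (chart M p \<circ> chart_inv M q)" by simp
  have "chart M q ` (chart_inv M p ` W \<inter> chart_dom M q) = S \<inter> (chart M p \<circ> chart_inv M q) -` W"
  proof (rule Set.set_eqI, rule iffI)
    fix y assume "y \<in> chart M q ` (chart_inv M p ` W \<inter> chart_dom M q)"
    then obtain x where x: "x \<in> W" "chart_inv M p x \<in> chart_dom M q" "y = chart M q (chart_inv M p x)" by blast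
    moreover have "chart_inv M p x \<in> chart_dom M p" using dom x(1) by blast
    ultimately show "y \<in> S \<inter> (chart M p \<circ> chart_inv M q) -` W"
      unfolding S_def using chart_inv_chart[OF M q] chart_inv_image(1)[OF M p] W(2) by auto
  next
    fix y assume "y \<in> S \<inter> (chart M p \<circ> chart_inv M q) -` W"
    then obtain r where r: "r \<in> chart_dom M q" "r \<in> chart_dom M p" "y = chart M q r" "chart M p r \<in> W"
      unfolding S_def using chart_inv_chart[OF M q] by auto
    then have "r = chart_inv M p (chart M p r)" using chart_inv_chart[OF M p] by simp
    then show "y \<in> chart M q ` (chart_inv M p ` W \<inter> chart_dom M q)" using r by blast
  qed
  then show "open (chart M q ` (chart_inv M p ` W \<inter> chart_dom M q))"
    using continuous_open_preimage[OF cont S(1) W(1)] by simp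
qed

text \<open>Neighbourhood filters turn ``on a neighbourhood'' side conditions into statements that can be
  combined; they can be computed in any chart.\<close>

definition mnhds :: "('a, 'e::real_normed_vector) manifold \<Rightarrow> 'a \<Rightarrow> 'a filter" where
  "mnhds M p = nhdsin (mtopology M) p"

lemma eventually_mnhds:
  "atlas M \<Longrightarrow> p \<in> points M \<Longrightarrow>
    eventually P (mnhds M p) \<longleftrightarrow> (\<exists>U. openin (mtopology M) U \<and> p \<in> U \<and> (\<forall>q\<in>U. P q))"
  unfolding mnhds_def eventually_nhdsin by (simp add: topspace_mtopology)

lemma eventually_mnhds_chart:
  assumes M: "atlas M" and p: "p \<in> points M" and q: "q \<in> chart_dom M p"
  shows "eventually P (mnhds M q) \<longleftrightarrow> (\<forall>\<^sub>F x in nhds (chart M p q). P (chart_inv M p x))"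
proof -
  have q': "q \<in> points M" using atlas_chart(2)[OF M p] q by blast
  show ?thesis unfolding eventually_mnhds[OF M q'] eventually_nhds
  proof
    assume "\<exists>U. openin (mtopology M) U \<and> q \<in> U \<and> (\<forall>q\<in>U. P q)"
    then obtain U where U: "openin (mtopology M) U" "q \<in> U" "\<forall>q\<in>U. P q" by blast
    have "open (chart M p ` (U \<inter> chart_dom M p))" using U(1) p openin_mtopology[OF M] by blast
    then show "\<exists>S. open S \<and> chart M p q \<in> S \<and> (\<forall>x\<in>S. P (chart_inv M p x))"
      using U q chart_inv_chart[OF M p] by (intro exI[of _ "chart M p ` (U \<inter> chart_dom M p)"]) auto
  next
    assume "\<exists>S. open S \<and> chart M p q \<in> S \<and> (\<forall>x\<in>S. P (chart_inv M p x))"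
    then obtain S where S: "open S" "chart M p q \<in> S" "\<forall>x\<in>S. P (chart_inv M p x)" by blast
    let ?W = "S \<inter> chart M p ` chart_dom M p"
    have "openin (mtopology M) (chart_inv M p ` ?W)"
      using S(1) atlas_chart(4)[OF M p] by (intro openin_chart_inv_image[OF M p]) auto
    moreover have "q \<in> chart_inv M p ` ?W"
      using S(2) q chart_inv_chart[OF M p q] by (intro image_eqI[of _ _ "chart M p q"]) auto
    ultimately show "\<exists>U. openin (mtopology M) U \<and> q \<in> U \<and> (\<forall>q\<in>U. P q)" using S(3) by blast
  qed
qed

lemma eventually_mnhds_at: "eventually P (mnhds M p) \<Longrightarrow> atlas M \<Longrightarrow> p \<in> points M \<Longrightarrow> P p"
  by (auto simp: eventually_mnhds)

lemma eventually_openin: "openin (mtopology M) U \<Longrightarrow> p \<in> U \<Longrightarrow> atlas M \<Longrightarrow> eventually (\<lambda>q. q \<in> U) (mnhds M p)"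
  using openin_mtopology by (subst eventually_mnhds) auto

lemma eventually_mnhds_chart_dom:
  "atlas M \<Longrightarrow> p \<in> points M \<Longrightarrow> q \<in> chart_dom M p \<Longrightarrow> eventually (\<lambda>r. r \<in> chart_dom M p) (mnhds M q)"
  using eventually_openin openin_chart_dom by metis

lemma eventually_mnhds_points:
  "atlas M \<Longrightarrow> p \<in> points M \<Longrightarrow> eventually (\<lambda>q. q \<in> points M) (mnhds M p)"
  using eventually_openin openin_points by metis

lemma openin_iff_eventually:
  assumes "atlas M" "U \<subseteq> points M"
  shows "openin (mtopology M) U \<longleftrightarrow> (\<forall>p\<in>U. \<forall>\<^sub>F q in mnhds M p. q \<in> U)"
proof
  assume "\<forall>p\<in>U. \<forall>\<^sub>F q in mnhds M p. q \<in> U"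
  then have "\<forall>p\<in>U. \<exists>V. openin (mtopology M) V \<and> p \<in> V \<and> V \<subseteq> U"
    using eventually_mnhds[OF assms(1)] assms(2) by (meson subset_iff)
  then show "openin (mtopology M) U" by (subst openin_subopen) blast
qed (use eventually_openin assms(1) in metis)

lemma eventually_chart_image:
  assumes "atlas M" "p \<in> points M" "x \<in> chart M p ` chart_dom M p"
  shows "\<forall>\<^sub>F y in nhds x. y \<in> chart M p ` chart_dom M p"
  by (rule eventually_nhds_in_open[OF atlas_chart(4)[OF assms(1,2)] assms(3)])

lemma eventually_eventually_mnhds:
  assumes "atlas M" "p \<in> points M" "eventually P (mnhds M p)"
  shows "\<forall>\<^sub>F q in mnhds M p. eventually P (mnhds M q)"
proof -
  obtain U where U: "openin (mtopology M) U" "p \<in> U" "\<forall>q\<in>U. P q"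
    using assms(3) eventually_mnhds[OF assms(1,2)] by blast
  have "eventually P (mnhds M q)" if "q \<in> U" for q
    by (rule eventually_mono[OF eventually_openin[OF U(1) that assms(1)]]) (use U(3) in blast)
  then show ?thesis by (intro eventually_mono[OF eventually_openin[OF U(1,2) assms(1)]]) blast
qed

subsection \<open>Maps that are smooth near a point\<close>

text \<open>Smoothness of a germ of a map, together with the well-formedness of its source and target, so that
  this single hypothesis serves all rules of the calculus.\<close>

definition smooth_at ::
  "('a, 'e::real_normed_vector) manifold \<Rightarrow> ('b, 'f::real_normed_vector) manifold \<Rightarrow> ('a \<Rightarrow> 'b) \<Rightarrow> 'a \<Rightarrow> bool"
where
  "smooth_at M N f p \<longleftrightarrow> atlas M \<and> atlas N \<and> p \<in> points M \<and> f p \<in> points N \<and>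
     (\<forall>\<^sub>F q in mnhds M p. f q \<in> chart_dom N (f p)) \<and>
     smooth_pt (\<lambda>x. chart N (f p) (f (chart_inv M p x))) (chart M p p)"

lemma smooth_atD:
  assumes "smooth_at M N f p"
  shows "atlas M" "atlas N" "p \<in> points M" "f p \<in> points N"
    "\<forall>\<^sub>F q in mnhds M p. f q \<in> chart_dom N (f p)"
    "smooth_pt (\<lambda>x. chart N (f p) (f (chart_inv M p x))) (chart M p p)"
  using assms unfolding smooth_at_def by blast+

lemma tangent_map_eq:
  "tangent_map M N f p = frechet_derivative (\<lambda>x. chart N (f p) (f (chart_inv M p x))) (at (chart M p p))"
  unfolding tangent_map_def comp_def by simp

lemma tangent_map_linear: "smooth_at M N f p \<Longrightarrow> linear (tangent_map M N f p)"
  unfolding tangent_map_eq by (intro smooth_pt_linear) (simp add: smooth_at_def)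

lemma tangent_map_bounded_linear: "smooth_at M N f p \<Longrightarrow> bounded_linear (tangent_map M N f p)"
  by (rule fin_dim_bounded_linear[OF atlas_fin_dim[OF smooth_atD(1)] tangent_map_linear])

lemma mnhds_cong:
  assumes "\<forall>\<^sub>F q in mnhds M p. f q = g q" "atlas M" "p \<in> points M"
  shows "f p = g p" "\<forall>\<^sub>F x in nhds (chart M p p). f (chart_inv M p x) = g (chart_inv M p x)"
  using eventually_mnhds_at[OF assms] assms(1)
    eventually_mnhds_chart[OF assms(2,3) atlas_chart(1)[OF assms(2,3)]] by auto

lemma smooth_at_cong:
  assumes "smooth_at M N f p" "\<forall>\<^sub>F q in mnhds M p. f q = g q"
  shows "smooth_at M N g p"
proof -
  note f = smooth_atD[OF assms(1)]
  note eq = mnhds_cong[OF assms(2) f(1,3)]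
  have "\<forall>\<^sub>F q in mnhds M p. g q \<in> chart_dom N (f p)"
    using f(5) assms(2) by eventually_elim simp
  moreover have "smooth_pt (\<lambda>x. chart N (f p) (g (chart_inv M p x))) (chart M p p)"
    by (rule smooth_pt_cong[OF f(6)]) (use eq(2) in \<open>rule eventually_mono, simp\<close>)
  ultimately show ?thesis using f(1-4) eq(1) unfolding smooth_at_def by simp
qed

lemma tangent_map_cong:
  assumes "\<forall>\<^sub>F q in mnhds M p. f q = g q" "atlas M" "p \<in> points M"
  shows "tangent_map M N f p = tangent_map M N g p"
  unfolding tangent_map_eq mnhds_cong(1)[OF assms]
  by (rule frechet_derivative_cong_eventually) (use mnhds_cong(2)[OF assms] in \<open>rule eventually_mono, simp\<close>)

lemma smooth_at_eventually_into:
  assumes "smooth_at M N f p" "eventually P (mnhds N (f p))"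
  shows "\<forall>\<^sub>F q in mnhds M p. P (f q)"
proof -
  note f = smooth_atD[OF assms(1)]
  note pd = atlas_chart(1)[OF f(1,3)]
  have "\<forall>\<^sub>F y in nhds (chart N (f p) (f (chart_inv M p (chart M p p)))). P (chart_inv N (f p) y)"
    using assms(2) unfolding eventually_mnhds_chart[OF f(2,4) atlas_chart(1)[OF f(2,4)]]
      chart_inv_chart[OF f(1,3) pd] .
  from smooth_pt_eventually_compose[OF f(6) this]
  have 1: "\<forall>\<^sub>F x in nhds (chart M p p). P (chart_inv N (f p) (chart N (f p) (f (chart_inv M p x))))" .
  have 2: "\<forall>\<^sub>F x in nhds (chart M p p). f (chart_inv M p x) \<in> chart_dom N (f p)"
    using f(5)[unfolded eventually_mnhds_chart[OF f(1,3) pd]] .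
  show ?thesis unfolding eventually_mnhds_chart[OF f(1,3) pd]
    using 1 2 by eventually_elim (simp add: chart_inv_chart[OF f(2,4)])
qed

lemma smooth_at_compose:
  assumes "smooth_at M N f p" "smooth_at N Q g (f p)"
  shows "smooth_at M Q (\<lambda>x. g (f x)) p"
    and "tangent_map M Q (\<lambda>x. g (f x)) p v = tangent_map N Q g (f p) (tangent_map M N f p v)"
proof -
  note f = smooth_atD[OF assms(1)]
  note g = smooth_atD[OF assms(2)]
  note pd = atlas_chart(1)[OF f(1,3)]
  let ?F = "\<lambda>x. chart N (f p) (f (chart_inv M p x))"
  let ?G = "\<lambda>y. chart Q (g (f p)) (g (chart_inv N (f p) y))"
  have Fp: "?F (chart M p p) = chart N (f p) (f p)" by (simp add: chart_inv_chart[OF f(1,3) pd])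
  have ev: "\<forall>\<^sub>F q in mnhds M p. g (f q) \<in> chart_dom Q (g (f p))"
    by (rule smooth_at_eventually_into[OF assms(1) g(5)])
  have "\<forall>\<^sub>F x in nhds (chart M p p). f (chart_inv M p x) \<in> chart_dom N (f p)"
    using f(5)[unfolded eventually_mnhds_chart[OF f(1,3) pd]] .
  then have eq: "\<forall>\<^sub>F x in nhds (chart M p p). ?G (?F x) = chart Q (g (f p)) (g (f (chart_inv M p x)))"
    by eventually_elim (simp add: chart_inv_chart[OF f(2,4)])
  have G: "smooth_pt ?G (?F (chart M p p))" unfolding Fp by (rule g(6))
  show "smooth_at M Q (\<lambda>x. g (f x)) p"
    unfolding smooth_at_def
    using f(1,3) g(2,4) ev smooth_pt_cong[OF smooth_pt_compose[OF atlas_fin_dim[OF f(2)] f(6) G] eq]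
    by blast
  show "tangent_map M Q (\<lambda>x. g (f x)) p v = tangent_map N Q g (f p) (tangent_map M N f p v)"
    unfolding tangent_map_eq frechet_derivative_cong_eventually[OF eq, symmetric]
      frechet_derivative_compose[OF f(6) G] Fp ..
qed

lemma atlas_vspace: "fin_dim TYPE('e::real_normed_vector) \<Longrightarrow> atlas (vspace :: ('e, 'e) manifold)"
proof -
  assume fd: "fin_dim TYPE('e)"
  have "chart_inv vspace p = (\<lambda>x. x)" for p :: 'e
    unfolding chart_inv_def vspace_def by (auto simp: inv_into_def)
  then show ?thesis
    using fd Ck_on_ident[OF open_UNIV, where 'a = 'e] by (simp add: atlas_def vspace_def smooth_on_def comp_def)
qed

lemma vspace_simps [simp]:
  "points vspace = UNIV" "chart_dom vspace p = UNIV" "chart vspace p x = x" "chart_inv vspace p = (\<lambda>x. x)"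
  by (auto simp: vspace_def chart_inv_def inv_into_def)

lemma mnhds_vspace:
  assumes "fin_dim TYPE('e::real_normed_vector)"
  shows "mnhds (vspace :: ('e, 'e) manifold) x = nhds x"
  by (rule filter_eqI) (simp add: eventually_mnhds_chart[OF atlas_vspace[OF assms], of x])

lemma smooth_at_vspace:
  fixes f :: "'e::real_normed_vector \<Rightarrow> 'f::real_normed_vector"
  assumes "fin_dim TYPE('e)" "fin_dim TYPE('f)"
  shows "smooth_at vspace vspace f x \<longleftrightarrow> smooth_pt f x"
  unfolding smooth_at_def by (simp add: atlas_vspace assms)

lemma tangent_map_vspace: "tangent_map vspace vspace f x = frechet_derivative f (at x)"
  unfolding tangent_map_eq by simp

lemma smooth_at_into_vspace:
  fixes f :: "'a \<Rightarrow> 'f::real_normed_vector"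
  assumes "fin_dim TYPE('f)" "atlas M" "p \<in> points M"
  shows "smooth_at M vspace f p \<longleftrightarrow> smooth_pt (\<lambda>x. f (chart_inv M p x)) (chart M p p)"
  unfolding smooth_at_def by (simp add: atlas_vspace assms)

lemma smooth_at_chart:
  fixes M :: "('a, 'e::real_normed_vector) manifold"
  assumes M: "atlas M" and p: "p \<in> points M" and q: "q \<in> chart_dom M p"
  shows "smooth_at M vspace (chart M p) q"
proof -
  have q': "q \<in> points M" using atlas_chart(2)[OF M p] q by blast
  let ?S = "chart M q ` (chart_dom M q \<inter> chart_dom M p)"
  have "open ?S" "smooth_on ?S (chart M p \<circ> chart_inv M q)" using M p q' unfolding atlas_def by blast+
  moreover have "chart M q q \<in> ?S" using q atlas_chart(1)[OF M q'] by blast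
  ultimately have "smooth_pt (\<lambda>x. chart M p (chart_inv M q x)) (chart M q q)"
    unfolding smooth_pt_def comp_def by blast
  then show ?thesis by (simp add: smooth_at_into_vspace[OF atlas_fin_dim[OF M] M q'])
qed

lemma smooth_at_chart_inv:
  fixes M :: "('a, 'e::real_normed_vector) manifold"
  assumes M: "atlas M" and p: "p \<in> points M" and x: "x \<in> chart M p ` chart_dom M p"
  shows "smooth_at vspace M (chart_inv M p) x"
proof -
  define q where "q = chart_inv M p x"
  have q: "q \<in> chart_dom M p" "chart M p q = x" unfolding q_def using chart_inv_image[OF M p x] by auto
  have q': "q \<in> points M" using atlas_chart(2)[OF M p] q by blast
  let ?S = "chart M p ` (chart_dom M p \<inter> chart_dom M q)"
  have S: "open ?S" "smooth_on ?S (chart M q \<circ> chart_inv M p)" using M p q' unfolding atlas_def by blast+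
  have xS: "x \<in> ?S" using q atlas_chart(1)[OF M q'] by blast
  have "smooth_pt (\<lambda>x. chart M q (chart_inv M p x)) x"
    using S xS unfolding smooth_pt_def comp_def by blast
  moreover have "\<forall>\<^sub>F y in nhds x. chart_inv M p y \<in> chart_dom M q"
    unfolding eventually_nhds using S(1) xS chart_inv_chart[OF M p] by (intro exI[of _ ?S]) auto
  ultimately show ?thesis
    unfolding smooth_at_def using M q' atlas_vspace[OF atlas_fin_dim[OF M]]
    by (simp add: mnhds_vspace[OF atlas_fin_dim[OF M]] q_def)
qed

lemma smooth_at_eventually:
  assumes "smooth_at M N f p"
  shows "\<forall>\<^sub>F q in mnhds M p. smooth_at M N f q"
proof -
  note f = smooth_atD[OF assms]
  note pd = atlas_chart(1)[OF f(1,3)]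
  let ?F = "\<lambda>x. chart N (f p) (f (chart_inv M p x))"
  have "\<forall>\<^sub>F q in mnhds M p. smooth_pt ?F (chart M p q)"
    by (rule eventually_mnhds_chart[OF f(1,3) pd, THEN iffD2])
      (use smooth_pt_eventually[OF f(6)] eventually_chart_image[OF f(1,3) imageI[OF pd]] in
        \<open>eventually_elim, simp add: chart_inv_image[OF f(1,3)]\<close>)
  moreover have "\<forall>\<^sub>F q in mnhds M p. \<forall>\<^sub>F r in mnhds M q. r \<in> chart_dom M p \<and> f r \<in> chart_dom N (f p)"
    by (intro eventually_eventually_mnhds f eventually_conj eventually_mnhds_chart_dom pd)
  ultimately show ?thesis using eventually_mnhds_points[OF f(1,3)]
  proof eventually_elim
    case (elim q)
    have q: "q \<in> chart_dom M p" "f q \<in> chart_dom N (f p)"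
      using eventually_mnhds_at[OF elim(2) f(1) elim(3)] by auto
    have "smooth_at vspace vspace ?F (chart M p q)"
      using elim(1) by (simp add: smooth_at_vspace atlas_fin_dim[OF f(1)] atlas_fin_dim[OF f(2)])
    from smooth_at_compose(1)[OF smooth_at_chart[OF f(1,3) q(1)] this]
    have 1: "smooth_at M vspace (\<lambda>r. chart N (f p) (f (chart_inv M p (chart M p r)))) q" .
    have "smooth_at M N (\<lambda>r. chart_inv N (f p) (chart N (f p) (f (chart_inv M p (chart M p r))))) q"
      by (rule smooth_at_compose(1)[OF 1 smooth_at_chart_inv[OF f(2,4)]])
        (use q chart_inv_chart[OF f(1,3) q(1)] in auto)
    then show ?case
    proof (rule smooth_at_cong)
      show "\<forall>\<^sub>F r in mnhds M q. chart_inv N (f p) (chart N (f p) (f (chart_inv M p (chart M p r)))) = f r"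
        using elim(2) by eventually_elim (simp add: chart_inv_chart[OF f(1,3)] chart_inv_chart[OF f(2,4)])
    qed
  qed
qed

lemma smooth_map_iff:
  assumes M: "atlas M" and N: "atlas N"
  shows "smooth_map M N f \<longleftrightarrow> (\<forall>p\<in>points M. smooth_at M N f p)"
proof
  assume f: "smooth_map M N f"
  show "\<forall>p\<in>points M. smooth_at M N f p"
  proof
    fix p assume p: "p \<in> points M"
    obtain U where U: "openin (mtopology M) U" "p \<in> U" "U \<subseteq> chart_dom M p" "f ` U \<subseteq> chart_dom N (f p)"
      "smooth_on (chart M p ` U) (chart N (f p) \<circ> f \<circ> chart_inv M p)"
      using f p unfolding smooth_map_def by blast
    have "open (chart M p ` U)"
      using U(1,3) p openin_mtopology[OF M, of U] by (metis inf.absorb1)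
    then have "smooth_pt (\<lambda>x. chart N (f p) (f (chart_inv M p x))) (chart M p p)"
      unfolding smooth_pt_def using U(2,5) by (auto simp: comp_def)
    moreover have "\<forall>\<^sub>F q in mnhds M p. f q \<in> chart_dom N (f p)"
      using eventually_openin[OF U(1,2) M] by eventually_elim (use U(4) in blast)
    moreover have "f p \<in> points N" using f p unfolding smooth_map_def by blast
    ultimately show "smooth_at M N f p" unfolding smooth_at_def using M N p by blast
  qed
next
  assume f: "\<forall>p\<in>points M. smooth_at M N f p"
  have "\<exists>U. openin (mtopology M) U \<and> p \<in> U \<and> U \<subseteq> chart_dom M p \<and> f ` U \<subseteq> chart_dom N (f p) \<and>
        smooth_on (chart M p ` U) (chart N (f p) \<circ> f \<circ> chart_inv M p)" if p: "p \<in> points M" for p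
  proof -
    note fp = smooth_atD[OF f[rule_format, OF p]]
    note pd = atlas_chart(1)[OF M p]
    let ?F = "\<lambda>x. chart N (f p) (f (chart_inv M p x))"
    have "\<forall>\<^sub>F x in nhds (chart M p p). smooth_pt ?F x \<and> f (chart_inv M p x) \<in> chart_dom N (f p) \<and>
        x \<in> chart M p ` chart_dom M p"
      using fp(5) by (intro eventually_conj smooth_pt_eventually[OF fp(6)]
          eventually_chart_image[OF M p imageI[OF pd]]) (simp add: eventually_mnhds_chart[OF M p pd])
    then obtain W where W: "open W" "chart M p p \<in> W"
      "\<And>x. x \<in> W \<Longrightarrow> smooth_pt ?F x \<and> f (chart_inv M p x) \<in> chart_dom N (f p) \<and> x \<in> chart M p ` chart_dom M p"
      unfolding eventually_nhds by blast
    have Wd: "W \<subseteq> chart M p ` chart_dom M p" using W(3) by blast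
    have img: "chart M p ` chart_inv M p ` W = W"
      using chart_inv_image(1)[OF M p] Wd by (force simp: image_image)
    have "p \<in> chart_inv M p ` W" using W(2) chart_inv_chart[OF M p pd] by (metis imageI)
    moreover have "chart_inv M p ` W \<subseteq> chart_dom M p" using chart_inv_image(2)[OF M p] Wd by blast
    moreover have "f ` chart_inv M p ` W \<subseteq> chart_dom N (f p)" using W(3) by blast
    moreover have "smooth_on (chart M p ` chart_inv M p ` W) (chart N (f p) \<circ> f \<circ> chart_inv M p)"
      unfolding img smooth_on_iff[OF W(1)] using W(3) by (simp add: comp_def)
    ultimately show ?thesis using openin_chart_inv_image[OF M p W(1) Wd] by blast
  qed
  then show "smooth_map M N f" unfolding smooth_map_def using f smooth_atD(4) by (metis image_subsetI)
qed

lemma smooth_at_ident: "atlas M \<Longrightarrow> p \<in> points M \<Longrightarrow> smooth_at M M (\<lambda>x. x) p"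
  and tangent_map_ident: "atlas M \<Longrightarrow> p \<in> points M \<Longrightarrow> tangent_map M M (\<lambda>x. x) p v = v"
proof -
  assume M: "atlas M" and p: "p \<in> points M"
  have ev: "\<forall>\<^sub>F x in nhds (chart M p p). x = chart M p (chart_inv M p x)"
    using eventually_chart_image[OF M p imageI[OF atlas_chart(1)[OF M p]]]
    by eventually_elim (simp add: chart_inv_image(1)[OF M p])
  show "smooth_at M M (\<lambda>x. x) p"
    unfolding smooth_at_def
    using M p smooth_pt_cong[OF smooth_pt_ident ev] eventually_mnhds_chart_dom[OF M p atlas_chart(1)[OF M p]] by blast
  show "tangent_map M M (\<lambda>x. x) p v = v"
    unfolding tangent_map_eq frechet_derivative_cong_eventually[OF ev, symmetric] by simp
qed

lemma smooth_at_const: "atlas M \<Longrightarrow> atlas N \<Longrightarrow> p \<in> points M \<Longrightarrow> c \<in> points N \<Longrightarrow> smooth_at M N (\<lambda>x. c) p"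
  unfolding smooth_at_def by (simp add: atlas_chart smooth_pt_const)

lemma tangent_map_const: "tangent_map M N (\<lambda>x. c) p v = 0"
  unfolding tangent_map_eq by simp

lemma to_chart_eq: "to_chart M p q = tangent_map M vspace (chart M p) q"
  unfolding to_chart_def tangent_map_eq by (simp add: comp_def)

lemma from_chart_eq:
  "atlas M \<Longrightarrow> p \<in> points M \<Longrightarrow> q \<in> chart_dom M p \<Longrightarrow>
    from_chart M p q = tangent_map vspace M (chart_inv M p) (chart M p q)"
  unfolding from_chart_def tangent_map_eq by (simp add: comp_def chart_inv_chart)

subsection \<open>Products\<close>

lemma prod_simps [simp]:
  "points (M \<times>\<^sub>m N) = points M \<times> points N"
  "chart_dom (M \<times>\<^sub>m N) (p, q) = chart_dom M p \<times> chart_dom N q"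
  "chart (M \<times>\<^sub>m N) (p, q) z = (chart M p (fst z), chart N q (snd z))"
  by (auto simp: prod_manifold_def split_beta)

lemma prod_chart_image:
  "chart (M \<times>\<^sub>m N) (p, q) ` (A \<times> B) = (chart M p ` A) \<times> (chart N q ` B)"
  by (auto simp: image_iff)

lemma prod_chart_inv:
  assumes "atlas M" "atlas N" "p \<in> points M" "q \<in> points N"
    "x \<in> chart M p ` chart_dom M p" "y \<in> chart N q ` chart_dom N q"
  shows "chart_inv (M \<times>\<^sub>m N) (p, q) (x, y) = (chart_inv M p x, chart_inv N q y)"
proof -
  have "inj_on (chart (M \<times>\<^sub>m N) (p, q)) (chart_dom (M \<times>\<^sub>m N) (p, q))"
    using atlas_chart(3)[OF assms(1,3)] atlas_chart(3)[OF assms(2,4)] by (auto simp: inj_on_def)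
  moreover have "chart (M \<times>\<^sub>m N) (p, q) (chart_inv M p x, chart_inv N q y) = (x, y)"
    "(chart_inv M p x, chart_inv N q y) \<in> chart_dom (M \<times>\<^sub>m N) (p, q)"
    using chart_inv_image[OF assms(1,3,5)] chart_inv_image[OF assms(2,4,6)] by auto
  ultimately show ?thesis unfolding chart_inv_def using inv_into_f_f by metis
qed

lemma atlas_prod:
  assumes M: "atlas M" and N: "atlas N"
  shows "atlas (M \<times>\<^sub>m N)"
  unfolding atlas_def
proof (intro conjI ballI)
  show "fin_dim TYPE('b \<times> 'd)" by (intro fin_dim_prod atlas_fin_dim[OF M] atlas_fin_dim[OF N])
next
  fix z assume z: "z \<in> points (M \<times>\<^sub>m N)"
  obtain p q where pq: "z = (p, q)" "p \<in> points M" "q \<in> points N" using z by auto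
  note a = atlas_chart[OF M pq(2)] and b = atlas_chart[OF N pq(3)]
  show "z \<in> chart_dom (M \<times>\<^sub>m N) z" "chart_dom (M \<times>\<^sub>m N) z \<subseteq> points (M \<times>\<^sub>m N)"
    "inj_on (chart (M \<times>\<^sub>m N) z) (chart_dom (M \<times>\<^sub>m N) z)"
    using a b unfolding pq(1) by (auto simp: inj_on_def)
  show "open (chart (M \<times>\<^sub>m N) z ` chart_dom (M \<times>\<^sub>m N) z)"
    unfolding pq(1) prod_simps prod_chart_image using a(4) b(4) by (rule open_Times)
  fix z' assume z': "z' \<in> points (M \<times>\<^sub>m N)"
  obtain p' q' where pq': "z' = (p', q')" "p' \<in> points M" "q' \<in> points N" using z' by auto
  let ?A = "chart M p ` (chart_dom M p \<inter> chart_dom M p')" and ?B = "chart N q ` (chart_dom N q \<inter> chart_dom N q')"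
  have A: "open ?A" "smooth_on ?A (chart M p' \<circ> chart_inv M p)"
    using M pq pq' unfolding atlas_def by blast+
  have B: "open ?B" "smooth_on ?B (chart N q' \<circ> chart_inv N q)"
    using N pq pq' unfolding atlas_def by blast+
  have img: "chart (M \<times>\<^sub>m N) z ` (chart_dom (M \<times>\<^sub>m N) z \<inter> chart_dom (M \<times>\<^sub>m N) z') = ?A \<times> ?B"
    unfolding pq(1) pq'(1) prod_simps Times_Int_Times prod_chart_image ..
  show op: "open (chart (M \<times>\<^sub>m N) z ` (chart_dom (M \<times>\<^sub>m N) z \<inter> chart_dom (M \<times>\<^sub>m N) z'))"
    unfolding img using A(1) B(1) by (rule open_Times)
  have "smooth_pt (chart (M \<times>\<^sub>m N) z' \<circ> chart_inv (M \<times>\<^sub>m N) z) w" if w: "w \<in> ?A \<times> ?B" for w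
  proof -
    have fA: "smooth_pt (chart M p' \<circ> chart_inv M p) (fst w)" and fB: "smooth_pt (chart N q' \<circ> chart_inv N q) (snd w)"
      using A(2)[unfolded smooth_on_iff[OF A(1)]] B(2)[unfolded smooth_on_iff[OF B(1)]] w by auto
    have "smooth_pt (\<lambda>w. ((chart M p' \<circ> chart_inv M p) (fst w), (chart N q' \<circ> chart_inv N q) (snd w))) w"
      by (rule smooth_pt_Pair[OF
            smooth_pt_compose[where g = "chart M p' \<circ> chart_inv M p", OF atlas_fin_dim[OF M] smooth_pt_fst[OF smooth_pt_ident] fA]
            smooth_pt_compose[where g = "chart N q' \<circ> chart_inv N q", OF atlas_fin_dim[OF N] smooth_pt_snd[OF smooth_pt_ident] fB]])
    moreover have "\<forall>\<^sub>F v in nhds w. v \<in> ?A \<times> ?B"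
      by (rule eventually_nhds_in_open[OF open_Times[OF A(1) B(1)] w])
    then have "\<forall>\<^sub>F v in nhds w. ((chart M p' \<circ> chart_inv M p) (fst v), (chart N q' \<circ> chart_inv N q) (snd v)) =
        (chart (M \<times>\<^sub>m N) z' \<circ> chart_inv (M \<times>\<^sub>m N) z) v"
    proof eventually_elim
      case (elim v)
      then have "chart_inv (M \<times>\<^sub>m N) (p, q) (fst v, snd v) = (chart_inv M p (fst v), chart_inv N q (snd v))"
        by (intro prod_chart_inv M N pq) auto
      then show ?case by (simp add: pq(1) pq'(1))
    qed
    ultimately show ?thesis by (rule smooth_pt_cong)
  qed
  then show "smooth_on (chart (M \<times>\<^sub>m N) z ` (chart_dom (M \<times>\<^sub>m N) z \<inter> chart_dom (M \<times>\<^sub>m N) z'))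
      (chart (M \<times>\<^sub>m N) z' \<circ> chart_inv (M \<times>\<^sub>m N) z)"
    using smooth_on_iff[OF op] unfolding img by blast
qed

lemma eventually_prod_chart_inv:
  assumes M: "atlas M" and N: "atlas N" and p: "p \<in> points M" and q: "q \<in> points N"
  shows "\<forall>\<^sub>F z in nhds (chart (M \<times>\<^sub>m N) (p, q) (p, q)).
    chart_inv (M \<times>\<^sub>m N) (p, q) z = (chart_inv M p (fst z), chart_inv N q (snd z)) \<and>
    fst z \<in> chart M p ` chart_dom M p \<and> snd z \<in> chart N q ` chart_dom N q"
proof -
  let ?W = "(chart M p ` chart_dom M p) \<times> (chart N q ` chart_dom N q)"
  have W: "open ?W" by (intro open_Times atlas_chart M N p q)
  moreover have "chart (M \<times>\<^sub>m N) (p, q) (p, q) \<in> ?W" using atlas_chart(1)[OF M p] atlas_chart(1)[OF N q] by simp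
  ultimately have "\<forall>\<^sub>F z in nhds (chart (M \<times>\<^sub>m N) (p, q) (p, q)). z \<in> ?W" by (rule eventually_nhds_in_open)
  then show ?thesis
  proof eventually_elim
    case (elim z)
    then show ?case using prod_chart_inv[OF M N p q, of "fst z" "snd z"] by auto
  qed
qed

lemma
  assumes M: "atlas M" and N: "atlas N" and pq: "p \<in> points M" "q \<in> points N"
  shows smooth_at_fst: "smooth_at (M \<times>\<^sub>m N) M fst (p, q)"
    and smooth_at_snd: "smooth_at (M \<times>\<^sub>m N) N snd (p, q)"
    and tangent_map_fst: "tangent_map (M \<times>\<^sub>m N) M fst (p, q) v = fst v"
    and tangent_map_snd: "tangent_map (M \<times>\<^sub>m N) N snd (p, q) v = snd v"
proof -
  note MN = atlas_prod[OF M N]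
  have pq': "(p, q) \<in> points (M \<times>\<^sub>m N)" using pq by simp
  have e1: "\<forall>\<^sub>F z in nhds (chart (M \<times>\<^sub>m N) (p, q) (p, q)). fst z = chart M p (fst (chart_inv (M \<times>\<^sub>m N) (p, q) z))"
    using eventually_prod_chart_inv[OF M N pq] by eventually_elim (simp add: chart_inv_image(1)[OF M pq(1)])
  have e2: "\<forall>\<^sub>F z in nhds (chart (M \<times>\<^sub>m N) (p, q) (p, q)). snd z = chart N q (snd (chart_inv (M \<times>\<^sub>m N) (p, q) z))"
    using eventually_prod_chart_inv[OF M N pq] by eventually_elim (simp add: chart_inv_image(1)[OF N pq(2)])
  have dom: "\<forall>\<^sub>F z in mnhds (M \<times>\<^sub>m N) (p, q). z \<in> chart_dom (M \<times>\<^sub>m N) (p, q)"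
    by (rule eventually_mnhds_chart_dom[OF MN pq' atlas_chart(1)[OF MN pq']])
  have d1: "\<forall>\<^sub>F z in mnhds (M \<times>\<^sub>m N) (p, q). fst z \<in> chart_dom M (fst (p, q))"
    using dom by eventually_elim auto
  have d2: "\<forall>\<^sub>F z in mnhds (M \<times>\<^sub>m N) (p, q). snd z \<in> chart_dom N (snd (p, q))"
    using dom by eventually_elim auto
  show "smooth_at (M \<times>\<^sub>m N) M fst (p, q)"
    unfolding smooth_at_def
    using MN M N pq d1 smooth_pt_cong[OF smooth_pt_fst[OF smooth_pt_ident] e1] by simp
  show "smooth_at (M \<times>\<^sub>m N) N snd (p, q)"
    unfolding smooth_at_def
    using MN M N pq d2 smooth_pt_cong[OF smooth_pt_snd[OF smooth_pt_ident] e2] by simp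
  show "tangent_map (M \<times>\<^sub>m N) M fst (p, q) v = fst v"
    unfolding tangent_map_eq fst_conv frechet_derivative_cong_eventually[OF e1, symmetric]
    by (simp add: frechet_derivative_eqI[OF bounded_linear_imp_has_derivative[OF bounded_linear_fst]])
  show "tangent_map (M \<times>\<^sub>m N) N snd (p, q) v = snd v"
    unfolding tangent_map_eq snd_conv frechet_derivative_cong_eventually[OF e2, symmetric]
    by (simp add: frechet_derivative_eqI[OF bounded_linear_imp_has_derivative[OF bounded_linear_snd]])
qed

lemma
  assumes f: "smooth_at Q M f r" and g: "smooth_at Q N g r"
  shows smooth_at_Pair: "smooth_at Q (M \<times>\<^sub>m N) (\<lambda>x. (f x, g x)) r"
    and tangent_map_Pair: "tangent_map Q (M \<times>\<^sub>m N) (\<lambda>x. (f x, g x)) r v =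
      (tangent_map Q M f r v, tangent_map Q N g r v)"
proof -
  note f' = smooth_atD[OF f] and g' = smooth_atD[OF g]
  have "\<forall>\<^sub>F q in mnhds Q r. (f q, g q) \<in> chart_dom (M \<times>\<^sub>m N) (f r, g r)"
    using f'(5) g'(5) by eventually_elim simp
  then show "smooth_at Q (M \<times>\<^sub>m N) (\<lambda>x. (f x, g x)) r"
    unfolding smooth_at_def using atlas_prod[OF f'(2) g'(2)] f' g' smooth_pt_Pair[OF f'(6) g'(6)] by simp
  show "tangent_map Q (M \<times>\<^sub>m N) (\<lambda>x. (f x, g x)) r v = (tangent_map Q M f r v, tangent_map Q N g r v)"
    unfolding tangent_map_eq
    using frechet_derivative_eqI[OF has_derivative_Pair[OF smooth_pt_has_derivative[OF f'(6)]
          smooth_pt_has_derivative[OF g'(6)]]] by simp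
qed

lemma tangent_map_partial:
  assumes M: "atlas M" and N: "atlas N" and f: "smooth_at (M \<times>\<^sub>m N) Q f (p, q)"
  shows "tangent_map (M \<times>\<^sub>m N) Q f (p, q) (v, w) =
      tangent_map M Q (\<lambda>x. f (x, q)) p v + tangent_map N Q (\<lambda>y. f (p, y)) q w"
proof -
  have pq: "p \<in> points M" "q \<in> points N" using smooth_atD(3)[OF f] by auto
  note i1 = smooth_at_ident[OF M pq(1)] and c1 = smooth_at_const[OF M N pq]
  note i2 = smooth_at_ident[OF N pq(2)] and c2 = smooth_at_const[OF N M pq(2,1)]
  note s1 = smooth_at_Pair[OF i1 c1] and s2 = smooth_at_Pair[OF c2 i2]
  have "tangent_map M Q (\<lambda>x. f (x, q)) p v = tangent_map (M \<times>\<^sub>m N) Q f (p, q) (v, 0)"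
    by (simp add: smooth_at_compose(2)[OF s1 f] tangent_map_Pair[OF i1 c1] tangent_map_ident[OF M pq(1)] tangent_map_const)
  moreover have "tangent_map N Q (\<lambda>y. f (p, y)) q w = tangent_map (M \<times>\<^sub>m N) Q f (p, q) (0, w)"
    by (simp add: smooth_at_compose(2)[OF s2 f] tangent_map_Pair[OF c2 i2] tangent_map_ident[OF N pq(2)] tangent_map_const)
  ultimately show "tangent_map (M \<times>\<^sub>m N) Q f (p, q) (v, w) =
      tangent_map M Q (\<lambda>x. f (x, q)) p v + tangent_map N Q (\<lambda>y. f (p, y)) q w"
    using linear_add[OF tangent_map_linear[OF f], of "(v, 0)" "(0, w)"] by simp
qed

lemma mtopology_prod:
  assumes M: "atlas M" and N: "atlas N"
  shows "mtopology (M \<times>\<^sub>m N) = prod_topology (mtopology M) (mtopology N)"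
  unfolding topology_eq
proof (intro allI iffI)
  note MN = atlas_prod[OF M N]
  fix S
  assume S: "openin (mtopology (M \<times>\<^sub>m N)) S"
  show "openin (prod_topology (mtopology M) (mtopology N)) S"
    unfolding openin_prod_topology_alt
  proof (intro allI impI)
    fix p q assume pqS: "(p, q) \<in> S"
    then have pq: "p \<in> points M" "q \<in> points N" using S unfolding openin_mtopology[OF MN] by auto
    note a = atlas_chart[OF M pq(1)] and b = atlas_chart[OF N pq(2)]
    let ?I = "chart (M \<times>\<^sub>m N) (p, q) ` (S \<inter> chart_dom (M \<times>\<^sub>m N) (p, q))"
    have "open ?I" using S pq unfolding openin_mtopology[OF MN] by simp
    moreover have "(chart M p p, chart N q q) \<in> ?I" using pqS a(1) b(1) by force
    ultimately obtain A B where AB: "open A" "open B" "(chart M p p, chart N q q) \<in> A \<times> B" "A \<times> B \<subseteq> ?I"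
      by (rule open_prod_elim)
    let ?U = "chart_inv M p ` (A \<inter> chart M p ` chart_dom M p)"
    let ?V = "chart_inv N q ` (B \<inter> chart N q ` chart_dom N q)"
    have "openin (mtopology M) ?U" "openin (mtopology N) ?V"
      using AB a(4) b(4) by (auto intro!: openin_chart_inv_image M N pq)
    moreover have "p \<in> ?U" "q \<in> ?V"
      using AB(3) a(1) b(1) chart_inv_chart[OF M pq(1) a(1)] chart_inv_chart[OF N pq(2) b(1)]
      by (auto intro!: image_eqI[of p _ "chart M p p"] image_eqI[of q _ "chart N q q"])
    moreover have "(chart_inv M p x, chart_inv N q y) \<in> S" if "x \<in> A" "y \<in> B" for x y
    proof -
      obtain r1 r2 where r: "(r1, r2) \<in> S" "r1 \<in> chart_dom M p" "r2 \<in> chart_dom N q"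
        "x = chart M p r1" "y = chart N q r2" using AB(4) \<open>x \<in> A\<close> \<open>y \<in> B\<close> by auto
      then show ?thesis using chart_inv_chart[OF M pq(1)] chart_inv_chart[OF N pq(2)] by simp
    qed
    then have "?U \<times> ?V \<subseteq> S" by auto
    ultimately show "\<exists>U V. openin (mtopology M) U \<and> openin (mtopology N) V \<and> p \<in> U \<and> q \<in> V \<and> U \<times> V \<subseteq> S"
      by blast
  qed
next
  note MN = atlas_prod[OF M N]
  fix S
  assume S: "openin (prod_topology (mtopology M) (mtopology N)) S"
  have sub: "S \<subseteq> points (M \<times>\<^sub>m N)" using openin_subset[OF S] by (simp add: topspace_mtopology M N)
  show "openin (mtopology (M \<times>\<^sub>m N)) S"
    unfolding openin_iff_eventually[OF MN sub]
  proof
    fix z assume z: "z \<in> S"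
    obtain p q where pq: "z = (p, q)" by (cases z)
    then have pts: "p \<in> points M" "q \<in> points N" using z sub by auto
    obtain U V where UV: "openin (mtopology M) U" "openin (mtopology N) V" "p \<in> U" "q \<in> V" "U \<times> V \<subseteq> S"
      using S[unfolded openin_prod_topology_alt, rule_format, OF z[unfolded pq]] by blast
    have "\<forall>\<^sub>F r in mnhds (M \<times>\<^sub>m N) (p, q). fst r \<in> U"
      using smooth_at_eventually_into[OF smooth_at_fst[OF M N pts]] eventually_openin[OF UV(1,3) M] by simp
    moreover have "\<forall>\<^sub>F r in mnhds (M \<times>\<^sub>m N) (p, q). snd r \<in> V"
      using smooth_at_eventually_into[OF smooth_at_snd[OF M N pts]] eventually_openin[OF UV(2,4) N] by simp
    ultimately show "\<forall>\<^sub>F r in mnhds (M \<times>\<^sub>m N) z. r \<in> S"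
      unfolding pq by eventually_elim (use UV(5) in \<open>auto simp: mem_Times_iff\<close>)
  qed
qed

lemma second_countable_prod_topology:
  assumes "second_countable X" "second_countable Y"
  shows "second_countable (prod_topology X Y)"
proof -
  obtain A where A: "countable A" "\<And>V. V \<in> A \<Longrightarrow> openin X V"
    "\<And>U x. openin X U \<and> x \<in> U \<Longrightarrow> \<exists>V\<in>A. x \<in> V \<and> V \<subseteq> U"
    using assms(1) unfolding second_countable_def by metis
  obtain B where B: "countable B" "\<And>V. V \<in> B \<Longrightarrow> openin Y V"
    "\<And>U x. openin Y U \<and> x \<in> U \<Longrightarrow> \<exists>V\<in>B. x \<in> V \<and> V \<subseteq> U"
    using assms(2) unfolding second_countable_def by metis
  let ?C = "(\<lambda>(U, V). U \<times> V) ` (A \<times> B)"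
  have "countable ?C" using A(1) B(1) by blast
  moreover have "openin (prod_topology X Y) W" if "W \<in> ?C" for W
    using that A(2) B(2) by (auto simp: openin_prod_Times_iff)
  moreover have "\<exists>W\<in>?C. z \<in> W \<and> W \<subseteq> S" if S: "openin (prod_topology X Y) S" "z \<in> S" for S z
  proof -
    obtain x y where z: "z = (x, y)" by (cases z)
    obtain U V where UV: "openin X U" "openin Y V" "x \<in> U" "y \<in> V" "U \<times> V \<subseteq> S"
      using S(1)[unfolded openin_prod_topology_alt, rule_format, OF S(2)[unfolded z]] by blast
    obtain U' where U': "U' \<in> A" "x \<in> U'" "U' \<subseteq> U" using A(3)[OF conjI[OF UV(1,3)]] by blast
    obtain V' where V': "V' \<in> B" "y \<in> V'" "V' \<subseteq> V" using B(3)[OF conjI[OF UV(2,4)]] by blast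
    have "U' \<times> V' \<in> ?C" by (rule image_eqI[of _ _ "(U', V')"]) (simp_all add: U' V')
    moreover have "z \<in> U' \<times> V' \<and> U' \<times> V' \<subseteq> S" using U' V' UV(5) z by blast
    ultimately show ?thesis by blast
  qed
  ultimately show ?thesis unfolding second_countable_def by (intro exI[of _ ?C] conjI ballI allI impI) auto
qed

lemma manifold_prod: "manifold M \<Longrightarrow> manifold N \<Longrightarrow> manifold (M \<times>\<^sub>m N)"
  by (auto simp: manifold_iff atlas_prod mtopology_prod Hausdorff_space_prod_topology second_countable_prod_topology)

lemma smooth_at_Pair_vspace:
  fixes f :: "'a \<Rightarrow> 'b::real_normed_vector" and g :: "'a \<Rightarrow> 'c::real_normed_vector"
  assumes fd: "fin_dim TYPE('b)" "fin_dim TYPE('c)" and f: "smooth_at M vspace f p" and g: "smooth_at M vspace g p"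
  shows "smooth_at M vspace (\<lambda>x. (f x, g x)) p"
proof -
  note p = smooth_atD(1,3)[OF f]
  show ?thesis
    using f g smooth_pt_Pair
    unfolding smooth_at_into_vspace[OF fd(1) p] smooth_at_into_vspace[OF fd(2) p] smooth_at_into_vspace[OF fin_dim_prod[OF fd] p]
    by blast
qed

lemma smooth_at_linear:
  fixes L :: "'a::real_normed_vector \<Rightarrow> 'b::real_normed_vector"
  assumes "fin_dim TYPE('a)" "fin_dim TYPE('b)" "linear L"
  shows "smooth_at vspace vspace L x"
  using smooth_pt_linear_comp[OF assms(1,3) smooth_pt_ident] by (simp add: smooth_at_vspace[OF assms(1,2)])

section \<open>Lie groups and Maurer--Cartan forms\<close>

lemma lie_groupD:
  assumes "lie_group G"
  shows "group G" "manifold (mfd G)" "atlas (mfd G)" "points (mfd G) = carrier G"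
  using assms unfolding lie_group_def manifold_iff by blast+

lemma smooth_at_mult:
  assumes G: "lie_group G" and f: "smooth_at M (mfd G) f p" and g: "smooth_at M (mfd G) g p"
  shows "smooth_at M (mfd G) (\<lambda>x. f x \<otimes>\<^bsub>G\<^esub> g x) p"
proof -
  have "smooth_map (mfd G \<times>\<^sub>m mfd G) (mfd G) (\<lambda>(g, h). g \<otimes>\<^bsub>G\<^esub> h)"
    using G unfolding lie_group_def by blast
  then have "smooth_at (mfd G \<times>\<^sub>m mfd G) (mfd G) (\<lambda>(g, h). g \<otimes>\<^bsub>G\<^esub> h) (f p, g p)"
    using smooth_map_iff[OF atlas_prod[OF lie_groupD(3)[OF G] lie_groupD(3)[OF G]] lie_groupD(3)[OF G]]
      smooth_atD(4)[OF f] smooth_atD(4)[OF g] by simp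
  from smooth_at_compose(1)[OF smooth_at_Pair[OF f g] this] show ?thesis by simp
qed

lemma smooth_at_inv:
  assumes G: "lie_group G" and f: "smooth_at M (mfd G) f p"
  shows "smooth_at M (mfd G) (\<lambda>x. inv\<^bsub>G\<^esub> f x) p"
proof -
  have "smooth_map (mfd G) (mfd G) (\<lambda>g. inv\<^bsub>G\<^esub> g)" using G unfolding lie_group_def by blast
  then have "smooth_at (mfd G) (mfd G) (\<lambda>g. inv\<^bsub>G\<^esub> g) (f p)"
    using smooth_map_iff[OF lie_groupD(3)[OF G] lie_groupD(3)[OF G]] smooth_atD(4)[OF f] by blast
  from smooth_at_compose(1)[OF f this] show ?thesis .
qed

lemma smooth_at_const_group:
  assumes "lie_group G" "atlas M" "p \<in> points M" "c \<in> carrier G"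
  shows "smooth_at M (mfd G) (\<lambda>x. c) p"
  using assms lie_groupD[OF assms(1)] by (intro smooth_at_const) auto

lemma smooth_at_ident_group:
  assumes "lie_group G" "g \<in> carrier G"
  shows "smooth_at (mfd G) (mfd G) (\<lambda>x. x) g"
  using assms lie_groupD[OF assms(1)] by (intro smooth_at_ident) auto

lemma smooth_at_carrier: "lie_group G \<Longrightarrow> smooth_at M (mfd G) f p \<Longrightarrow> f p \<in> carrier G"
  using smooth_atD(4) lie_groupD(4) by metis

lemma smooth_at_eventually_carrier:
  assumes "lie_group G" "smooth_at M (mfd G) f p"
  shows "\<forall>\<^sub>F x in mnhds M p. f x \<in> carrier G"
  using smooth_at_eventually[OF assms(2)] by eventually_elim (rule smooth_at_carrier[OF assms(1)])

lemma
  assumes G: "lie_group G" and g: "g \<in> carrier G" and h: "h \<in> carrier G"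
  shows smooth_at_right_translation: "smooth_at (mfd G) (mfd G) (\<lambda>x. x \<otimes>\<^bsub>G\<^esub> g) h"
    and smooth_at_left_translation: "smooth_at (mfd G) (mfd G) (\<lambda>x. g \<otimes>\<^bsub>G\<^esub> x) h"
proof -
  have h': "h \<in> points (mfd G)" using h lie_groupD(4)[OF G] by simp
  note a = smooth_at_ident_group[OF G h] smooth_at_const_group[OF G lie_groupD(3)[OF G] h' g]
  show "smooth_at (mfd G) (mfd G) (\<lambda>x. x \<otimes>\<^bsub>G\<^esub> g) h" by (rule smooth_at_mult[OF G a])
  show "smooth_at (mfd G) (mfd G) (\<lambda>x. g \<otimes>\<^bsub>G\<^esub> x) h" by (rule smooth_at_mult[OF G a(2,1)])
qed

lemma smooth_at_conjugation:
  assumes G: "lie_group G" and g: "g \<in> carrier G" and h: "h \<in> carrier G"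
  shows "smooth_at (mfd G) (mfd G) (\<lambda>x. g \<otimes>\<^bsub>G\<^esub> x \<otimes>\<^bsub>G\<^esub> inv\<^bsub>G\<^esub> g) h"
proof -
  interpret group G by (rule lie_groupD(1)[OF G])
  show ?thesis
    using smooth_at_compose(1)[OF smooth_at_left_translation[OF G g h]
        smooth_at_right_translation[OF G inv_closed[OF g]]] g h by simp
qed

lemma linear_dR: "lie_group G \<Longrightarrow> g \<in> carrier G \<Longrightarrow> h \<in> carrier G \<Longrightarrow> linear (dR G g h)"
  unfolding dR_def by (rule tangent_map_linear[OF smooth_at_right_translation])

lemma linear_dL: "lie_group G \<Longrightarrow> g \<in> carrier G \<Longrightarrow> h \<in> carrier G \<Longrightarrow> linear (dL G g h)"
  unfolding dL_def by (rule tangent_map_linear[OF smooth_at_left_translation])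

lemma linear_Ad: "lie_group G \<Longrightarrow> g \<in> carrier G \<Longrightarrow> linear (Ad G g)"
  unfolding Ad_def
  by (rule tangent_map_linear[OF smooth_at_conjugation]) (auto simp: lie_groupD(1) group.is_monoid monoid.one_closed)

lemma tangent_map_mult:
  assumes G: "lie_group G" and f: "smooth_at M (mfd G) f p" and g: "smooth_at M (mfd G) g p"
  shows "tangent_map M (mfd G) (\<lambda>x. f x \<otimes>\<^bsub>G\<^esub> g x) p v =
    dR G (g p) (f p) (tangent_map M (mfd G) f p v) + dL G (f p) (g p) (tangent_map M (mfd G) g p v)"
proof -
  note A = lie_groupD(3)[OF G]
  have m: "smooth_at (mfd G \<times>\<^sub>m mfd G) (mfd G) (\<lambda>z. fst z \<otimes>\<^bsub>G\<^esub> snd z) (f p, g p)"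
    by (rule smooth_at_mult[OF G smooth_at_fst[OF A A] smooth_at_snd[OF A A]])
      (use smooth_atD(4)[OF f] smooth_atD(4)[OF g] in auto)
  show ?thesis
    using smooth_at_compose(2)[OF smooth_at_Pair[OF f g] m, of v]
      tangent_map_partial[OF A A m, of "tangent_map M (mfd G) f p v" "tangent_map M (mfd G) g p v"]
    by (simp add: tangent_map_Pair[OF f g] dR_def dL_def)
qed

text \<open>The pullbacks \<open>f\<^sup>*\<theta>\<^sup>r\<close> and \<open>f\<^sup>*\<theta>\<^sup>l\<close> of the Maurer--Cartan forms at a point of the source of \<open>f\<close>.\<close>

definition mcR :: "('a, 'e::real_normed_vector) manifold \<Rightarrow> ('b, 'f::real_normed_vector) lie_group \<Rightarrow> ('a \<Rightarrow> 'b) \<Rightarrow>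
    'a \<Rightarrow> 'e \<Rightarrow> 'f" where
  "mcR M G f p v = mc_right G (f p) (tangent_map M (mfd G) f p v)"

definition mcL :: "('a, 'e::real_normed_vector) manifold \<Rightarrow> ('b, 'f::real_normed_vector) lie_group \<Rightarrow> ('a \<Rightarrow> 'b) \<Rightarrow>
    'a \<Rightarrow> 'e \<Rightarrow> 'f" where
  "mcL M G f p v = mc_left G (f p) (tangent_map M (mfd G) f p v)"

lemma mcR_alt:
  assumes G: "lie_group G" and f: "smooth_at M (mfd G) f p"
  shows "mcR M G f p v = tangent_map M (mfd G) (\<lambda>x. f x \<otimes>\<^bsub>G\<^esub> inv\<^bsub>G\<^esub> f p) p v"
  using smooth_at_compose(2)[OF f smooth_at_right_translation[OF G]] smooth_at_carrier[OF G f] lie_groupD(1)[OF G]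
  by (simp add: mcR_def mc_right_def dR_def group.inv_closed)

lemma mcL_alt:
  assumes G: "lie_group G" and f: "smooth_at M (mfd G) f p"
  shows "mcL M G f p v = tangent_map M (mfd G) (\<lambda>x. inv\<^bsub>G\<^esub> f p \<otimes>\<^bsub>G\<^esub> f x) p v"
  using smooth_at_compose(2)[OF f smooth_at_left_translation[OF G]] smooth_at_carrier[OF G f] lie_groupD(1)[OF G]
  by (simp add: mcL_def mc_left_def dL_def group.inv_closed)

lemma linear_mcR:
  assumes "lie_group G" "smooth_at M (mfd G) f p"
  shows "linear (mcR M G f p)"
proof -
  have "linear (tangent_map M (mfd G) (\<lambda>x. f x \<otimes>\<^bsub>G\<^esub> inv\<^bsub>G\<^esub> f p) p)"
    using smooth_at_carrier[OF assms] assms lie_groupD(1)[OF assms(1)] smooth_atD(1,3)[OF assms(2)]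
    by (intro tangent_map_linear smooth_at_mult smooth_at_const_group) (auto simp: group.inv_closed)
  then show ?thesis using mcR_alt[OF assms] by (simp add: linear_iff)
qed

lemma mcR_compose:
  assumes "smooth_at M N h p" "smooth_at N (mfd G) f (h p)"
  shows "mcR M G (\<lambda>x. f (h x)) p v = mcR N G f (h p) (tangent_map M N h p v)"
  by (simp add: mcR_def smooth_at_compose(2)[OF assms])

lemma mcR_const: "lie_group G \<Longrightarrow> c \<in> carrier G \<Longrightarrow> mcR M G (\<lambda>x. c) p v = 0"
  by (simp add: mcR_def tangent_map_const mc_right_def linear_0[OF linear_dR] lie_groupD(1) group.inv_closed)

lemma mcR_cong:
  assumes "\<forall>\<^sub>F x in mnhds M p. f x = g x" "atlas M" "p \<in> points M"
  shows "mcR M G f p = mcR M G g p"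
  unfolding mcR_def tangent_map_cong[OF assms] mnhds_cong(1)[OF assms] ..

lemma mcR_right_translate:
  assumes G: "lie_group G" and f: "smooth_at M (mfd G) f p" and c: "c \<in> carrier G"
  shows "mcR M G (\<lambda>x. f x \<otimes>\<^bsub>G\<^esub> c) p v = mcR M G f p v"
proof -
  interpret group G by (rule lie_groupD(1)[OF G])
  note p = smooth_atD(1,3)[OF f]
  have fc: "smooth_at M (mfd G) (\<lambda>x. f x \<otimes>\<^bsub>G\<^esub> c) p"
    by (rule smooth_at_mult[OF G f smooth_at_const_group[OF G p c]])
  have fp: "f p \<in> carrier G" by (rule smooth_at_carrier[OF G f])
  have "\<forall>\<^sub>F x in mnhds M p. f x \<otimes>\<^bsub>G\<^esub> c \<otimes>\<^bsub>G\<^esub> inv\<^bsub>G\<^esub> (f p \<otimes>\<^bsub>G\<^esub> c) = f x \<otimes>\<^bsub>G\<^esub> inv\<^bsub>G\<^esub> f p"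
    using smooth_at_eventually_carrier[OF G f]
  proof eventually_elim
    case (elim x)
    have "c \<otimes>\<^bsub>G\<^esub> (inv\<^bsub>G\<^esub> c \<otimes>\<^bsub>G\<^esub> z) = z" if "z \<in> carrier G" for z
      using c that by (simp flip: m_assoc)
    then show ?case using elim fp c by (simp add: inv_mult_group m_assoc)
  qed
  from tangent_map_cong[OF this p, where N = "mfd G"] show ?thesis by (simp add: mcR_alt[OF G fc] mcR_alt[OF G f])
qed

lemma
  assumes G: "lie_group G" and h: "h \<in> carrier G"
  shows dR_one: "dR G \<one>\<^bsub>G\<^esub> h v = v" and dL_one: "dL G \<one>\<^bsub>G\<^esub> h v = v"
proof -
  interpret group G by (rule lie_groupD(1)[OF G])
  note A = lie_groupD(3,4)[OF G]
  have h': "h \<in> points (mfd G)" using h A by simp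
  have ev: "\<forall>\<^sub>F x in mnhds (mfd G) h. x \<in> carrier G" using eventually_mnhds_points[OF A(1) h'] A(2) by simp
  have e1: "\<forall>\<^sub>F x in mnhds (mfd G) h. x \<otimes>\<^bsub>G\<^esub> \<one>\<^bsub>G\<^esub> = x" using ev by eventually_elim simp
  have e2: "\<forall>\<^sub>F x in mnhds (mfd G) h. \<one>\<^bsub>G\<^esub> \<otimes>\<^bsub>G\<^esub> x = x" using ev by eventually_elim simp
  show "dR G \<one>\<^bsub>G\<^esub> h v = v" "dL G \<one>\<^bsub>G\<^esub> h v = v"
    unfolding dR_def dL_def tangent_map_cong[OF e1 A(1) h'] tangent_map_cong[OF e2 A(1) h']
    by (simp_all add: tangent_map_ident[OF A(1) h'])
qed

lemma tangent_map_conjugate: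
  assumes G: "lie_group G" and f: "smooth_at M (mfd G) f p" and fp: "f p = \<one>\<^bsub>G\<^esub>" and g: "g \<in> carrier G"
  shows "smooth_at M (mfd G) (\<lambda>x. g \<otimes>\<^bsub>G\<^esub> f x \<otimes>\<^bsub>G\<^esub> inv\<^bsub>G\<^esub> g) p"
    and "tangent_map M (mfd G) (\<lambda>x. g \<otimes>\<^bsub>G\<^esub> f x \<otimes>\<^bsub>G\<^esub> inv\<^bsub>G\<^esub> g) p v = Ad G g (tangent_map M (mfd G) f p v)"
proof -
  interpret group G by (rule lie_groupD(1)[OF G])
  have c: "smooth_at (mfd G) (mfd G) (\<lambda>x. g \<otimes>\<^bsub>G\<^esub> x \<otimes>\<^bsub>G\<^esub> inv\<^bsub>G\<^esub> g) (f p)"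
    using smooth_at_conjugation[OF G g] fp by simp
  show "smooth_at M (mfd G) (\<lambda>x. g \<otimes>\<^bsub>G\<^esub> f x \<otimes>\<^bsub>G\<^esub> inv\<^bsub>G\<^esub> g) p" by (rule smooth_at_compose(1)[OF f c])
  show "tangent_map M (mfd G) (\<lambda>x. g \<otimes>\<^bsub>G\<^esub> f x \<otimes>\<^bsub>G\<^esub> inv\<^bsub>G\<^esub> g) p v = Ad G g (tangent_map M (mfd G) f p v)"
    by (simp add: smooth_at_compose(2)[OF f c] Ad_def fp)
qed

text \<open>Translating to the unit on the right, the product \<open>f g\<close> becomes the product of two maps through the
  unit, the second of them conjugated by \<open>f p\<close>; there the differential of the multiplication is
  the addition.\<close>

lemma mcR_mult:
  assumes G: "lie_group G" and f: "smooth_at M (mfd G) f p" and g: "smooth_at M (mfd G) g p"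
  shows "mcR M G (\<lambda>x. f x \<otimes>\<^bsub>G\<^esub> g x) p v = mcR M G f p v + Ad G (f p) (mcR M G g p v)"
proof -
  interpret group G by (rule lie_groupD(1)[OF G])
  note p = smooth_atD(1,3)[OF f]
  have fp: "f p \<in> carrier G" and gp: "g p \<in> carrier G" by (rule smooth_at_carrier[OF G f], rule smooth_at_carrier[OF G g])
  let ?f = "\<lambda>x. f x \<otimes>\<^bsub>G\<^esub> inv\<^bsub>G\<^esub> f p" and ?g = "\<lambda>x. g x \<otimes>\<^bsub>G\<^esub> inv\<^bsub>G\<^esub> g p"
  let ?h = "\<lambda>x. f p \<otimes>\<^bsub>G\<^esub> ?g x \<otimes>\<^bsub>G\<^esub> inv\<^bsub>G\<^esub> f p"
  have sf: "smooth_at M (mfd G) ?f p" and sg: "smooth_at M (mfd G) ?g p"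
    using fp gp by (auto intro!: smooth_at_mult G f g smooth_at_const_group p)
  have g1: "?g p = \<one>\<^bsub>G\<^esub>" using gp by simp
  note sh = tangent_map_conjugate[OF G sg g1 fp]
  have "\<forall>\<^sub>F x in mnhds M p. f x \<otimes>\<^bsub>G\<^esub> g x \<otimes>\<^bsub>G\<^esub> inv\<^bsub>G\<^esub> (f p \<otimes>\<^bsub>G\<^esub> g p) = ?f x \<otimes>\<^bsub>G\<^esub> ?h x"
    using smooth_at_eventually_carrier[OF G f] smooth_at_eventually_carrier[OF G g]
  proof eventually_elim
    case (elim x)
    have "inv\<^bsub>G\<^esub> f p \<otimes>\<^bsub>G\<^esub> (f p \<otimes>\<^bsub>G\<^esub> z) = z" if "z \<in> carrier G" for z
      using fp that by (simp flip: m_assoc)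
    then show ?case using elim fp gp by (simp add: inv_mult_group m_assoc)
  qed
  then have "tangent_map M (mfd G) (\<lambda>x. f x \<otimes>\<^bsub>G\<^esub> g x \<otimes>\<^bsub>G\<^esub> inv\<^bsub>G\<^esub> (f p \<otimes>\<^bsub>G\<^esub> g p)) p v =
      tangent_map M (mfd G) (\<lambda>x. ?f x \<otimes>\<^bsub>G\<^esub> ?h x) p v"
    by (simp add: tangent_map_cong[OF _ p])
  also have "\<dots> = tangent_map M (mfd G) ?f p v + tangent_map M (mfd G) ?h p v"
    unfolding tangent_map_mult[OF G sf sh(1)] using fp gp by (simp add: dR_one[OF G] dL_one[OF G])
  finally show ?thesis
    by (simp add: mcR_alt[OF G smooth_at_mult[OF G f g]] mcR_alt[OF G f] mcR_alt[OF G g] sh(2))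
qed

lemma Ad_mult:
  assumes G: "lie_group G" and g: "g \<in> carrier G" and h: "h \<in> carrier G"
  shows "Ad G (g \<otimes>\<^bsub>G\<^esub> h) v = Ad G g (Ad G h v)"
proof -
  interpret group G by (rule lie_groupD(1)[OF G])
  note A = lie_groupD(3,4)[OF G]
  have e: "\<one>\<^bsub>G\<^esub> \<in> points (mfd G)" using A by simp
  have sh: "smooth_at (mfd G) (mfd G) (\<lambda>x. h \<otimes>\<^bsub>G\<^esub> x \<otimes>\<^bsub>G\<^esub> inv\<^bsub>G\<^esub> h) \<one>\<^bsub>G\<^esub>"
    by (rule smooth_at_conjugation[OF G h]) simp
  have h1: "h \<otimes>\<^bsub>G\<^esub> \<one>\<^bsub>G\<^esub> \<otimes>\<^bsub>G\<^esub> inv\<^bsub>G\<^esub> h = \<one>\<^bsub>G\<^esub>" using h by simp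
  have "\<forall>\<^sub>F x in mnhds (mfd G) \<one>\<^bsub>G\<^esub>. x \<in> carrier G" using eventually_mnhds_points[OF A(1) e] A(2) by simp
  then have "\<forall>\<^sub>F x in mnhds (mfd G) \<one>\<^bsub>G\<^esub>. (g \<otimes>\<^bsub>G\<^esub> h) \<otimes>\<^bsub>G\<^esub> x \<otimes>\<^bsub>G\<^esub> inv\<^bsub>G\<^esub> (g \<otimes>\<^bsub>G\<^esub> h) =
      g \<otimes>\<^bsub>G\<^esub> (h \<otimes>\<^bsub>G\<^esub> x \<otimes>\<^bsub>G\<^esub> inv\<^bsub>G\<^esub> h) \<otimes>\<^bsub>G\<^esub> inv\<^bsub>G\<^esub> g"
    by eventually_elim (simp add: inv_mult_group m_assoc g h)
  from tangent_map_cong[OF this A(1) e, where N = "mfd G"] show ?thesis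
    unfolding Ad_def[of G "g \<otimes>\<^bsub>G\<^esub> h"] Ad_def[of G h] by (simp add: tangent_map_conjugate(2)[OF G sh h1 g])
qed

lemma Ad_one:
  assumes G: "lie_group G"
  shows "Ad G \<one>\<^bsub>G\<^esub> v = v"
proof -
  interpret group G by (rule lie_groupD(1)[OF G])
  note A = lie_groupD(3,4)[OF G]
  have e: "\<one>\<^bsub>G\<^esub> \<in> points (mfd G)" using A by simp
  have "\<forall>\<^sub>F x in mnhds (mfd G) \<one>\<^bsub>G\<^esub>. x \<in> carrier G" using eventually_mnhds_points[OF A(1) e] A(2) by simp
  then have "\<forall>\<^sub>F x in mnhds (mfd G) \<one>\<^bsub>G\<^esub>. \<one>\<^bsub>G\<^esub> \<otimes>\<^bsub>G\<^esub> x \<otimes>\<^bsub>G\<^esub> inv\<^bsub>G\<^esub> \<one>\<^bsub>G\<^esub> = x" by eventually_elim simp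
  from tangent_map_cong[OF this A(1) e, where N = "mfd G"] show ?thesis
    unfolding Ad_def by (simp add: tangent_map_ident[OF A(1) e])
qed

lemma Ad_inv_cancel:
  assumes G: "lie_group G" and g: "g \<in> carrier G"
  shows "Ad G (inv\<^bsub>G\<^esub> g) (Ad G g v) = v" "Ad G g (Ad G (inv\<^bsub>G\<^esub> g) v) = v"
proof -
  interpret group G by (rule lie_groupD(1)[OF G])
  show "Ad G (inv\<^bsub>G\<^esub> g) (Ad G g v) = v" "Ad G g (Ad G (inv\<^bsub>G\<^esub> g) v) = v"
    using Ad_mult[OF G inv_closed[OF g] g] Ad_mult[OF G g inv_closed[OF g]] g by (simp_all add: Ad_one[OF G])
qed

lemma mcR_inv:
  assumes G: "lie_group G" and f: "smooth_at M (mfd G) f p"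
  shows "mcR M G (\<lambda>x. inv\<^bsub>G\<^esub> f x) p v = - Ad G (inv\<^bsub>G\<^esub> f p) (mcR M G f p v)"
proof -
  interpret group G by (rule lie_groupD(1)[OF G])
  note p = smooth_atD(1,3)[OF f]
  have fp: "f p \<in> carrier G" by (rule smooth_at_carrier[OF G f])
  have i: "smooth_at M (mfd G) (\<lambda>x. inv\<^bsub>G\<^esub> f x) p" by (rule smooth_at_inv[OF G f])
  have "\<forall>\<^sub>F x in mnhds M p. inv\<^bsub>G\<^esub> f x \<otimes>\<^bsub>G\<^esub> f x = \<one>\<^bsub>G\<^esub>"
    using smooth_at_eventually_carrier[OF G f] by eventually_elim simp
  from fun_cong[OF mcR_cong[OF this p, where G = G], of v] have "mcR M G (\<lambda>x. inv\<^bsub>G\<^esub> f x \<otimes>\<^bsub>G\<^esub> f x) p v = 0"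
    by (simp add: mcR_const[OF G])
  then show ?thesis unfolding mcR_mult[OF G i f] by (simp add: eq_neg_iff_add_eq_0)
qed

lemma mcL_eq:
  assumes G: "lie_group G" and f: "smooth_at M (mfd G) f p"
  shows "mcL M G f p v = Ad G (inv\<^bsub>G\<^esub> f p) (mcR M G f p v)"
proof -
  interpret group G by (rule lie_groupD(1)[OF G])
  note p = smooth_atD(1,3)[OF f]
  have fp: "f p \<in> carrier G" by (rule smooth_at_carrier[OF G f])
  have sf: "smooth_at M (mfd G) (\<lambda>x. f x \<otimes>\<^bsub>G\<^esub> inv\<^bsub>G\<^esub> f p) p"
    using fp by (auto intro!: smooth_at_mult G f smooth_at_const_group p)
  have f1: "f p \<otimes>\<^bsub>G\<^esub> inv\<^bsub>G\<^esub> f p = \<one>\<^bsub>G\<^esub>" using fp by simp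
  have "\<forall>\<^sub>F x in mnhds M p. inv\<^bsub>G\<^esub> f p \<otimes>\<^bsub>G\<^esub> f x =
      inv\<^bsub>G\<^esub> f p \<otimes>\<^bsub>G\<^esub> (f x \<otimes>\<^bsub>G\<^esub> inv\<^bsub>G\<^esub> f p) \<otimes>\<^bsub>G\<^esub> inv\<^bsub>G\<^esub> (inv\<^bsub>G\<^esub> f p)"
    using smooth_at_eventually_carrier[OF G f] by eventually_elim (simp add: fp m_assoc)
  from tangent_map_cong[OF this p, where N = "mfd G"] show ?thesis
    by (simp add: mcL_alt[OF G f] mcR_alt[OF G f] tangent_map_conjugate(2)[OF G sf f1 inv_closed[OF fp]])
qed

lemma lie_hom_smooth_at:
  assumes "lie_hom S T \<phi>" "lie_group S" "lie_group T" "g \<in> carrier S"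
  shows "smooth_at (mfd S) (mfd T) \<phi> g"
  using assms(1,4) smooth_map_iff[OF lie_groupD(3)[OF assms(2)] lie_groupD(3)[OF assms(3)], of \<phi>]
    lie_groupD(4)[OF assms(2)] unfolding lie_hom_def by simp

lemma lie_hom_group_hom:
  assumes "lie_hom S T \<phi>" "lie_group S" "lie_group T"
  shows "group_hom S T \<phi>"
  using assms(1) lie_groupD(1)[OF assms(2)] lie_groupD(1)[OF assms(3)]
  unfolding lie_hom_def group_hom_def group_hom_axioms_def by simp

text \<open>A homomorphism intertwines right translations.\<close>

lemma mcR_hom:
  assumes S: "lie_group S" and T: "lie_group T" and \<phi>: "lie_hom S T \<phi>" and f: "smooth_at M (mfd S) f p"
  shows "mcR M T (\<lambda>x. \<phi> (f x)) p v = tangent_map (mfd S) (mfd T) \<phi> \<one>\<^bsub>S\<^esub> (mcR M S f p v)"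
proof -
  interpret group_hom S T \<phi> by (rule lie_hom_group_hom[OF \<phi> S T])
  note p = smooth_atD(1,3)[OF f]
  have fp: "f p \<in> carrier S" by (rule smooth_at_carrier[OF S f])
  have \<phi>f: "smooth_at M (mfd T) (\<lambda>x. \<phi> (f x)) p"
    by (rule smooth_at_compose(1)[OF f lie_hom_smooth_at[OF \<phi> S T fp]])
  have sf: "smooth_at M (mfd S) (\<lambda>x. f x \<otimes>\<^bsub>S\<^esub> inv\<^bsub>S\<^esub> f p) p"
    using fp by (auto intro!: smooth_at_mult S f smooth_at_const_group p)
  have f1: "f p \<otimes>\<^bsub>S\<^esub> inv\<^bsub>S\<^esub> f p = \<one>\<^bsub>S\<^esub>" using fp by simp
  have \<phi>1: "smooth_at (mfd S) (mfd T) \<phi> (f p \<otimes>\<^bsub>S\<^esub> inv\<^bsub>S\<^esub> f p)"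
    unfolding f1 by (rule lie_hom_smooth_at[OF \<phi> S T]) simp
  have "\<forall>\<^sub>F x in mnhds M p. \<phi> (f x) \<otimes>\<^bsub>T\<^esub> inv\<^bsub>T\<^esub> \<phi> (f p) = \<phi> (f x \<otimes>\<^bsub>S\<^esub> inv\<^bsub>S\<^esub> f p)"
    using smooth_at_eventually_carrier[OF S f] by eventually_elim (simp add: fp)
  from tangent_map_cong[OF this p, where N = "mfd T"] show ?thesis
    by (simp add: mcR_alt[OF T \<phi>f] mcR_alt[OF S f] smooth_at_compose(2)[OF sf \<phi>1] f1)
qed

lemma tangent_map_hom_Ad:
  assumes S: "lie_group S" and T: "lie_group T" and \<phi>: "lie_hom S T \<phi>" and g: "g \<in> carrier S"
  shows "tangent_map (mfd S) (mfd T) \<phi> \<one>\<^bsub>S\<^esub> (Ad S g u) = Ad T (\<phi> g) (tangent_map (mfd S) (mfd T) \<phi> \<one>\<^bsub>S\<^esub> u)"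
proof -
  interpret group_hom S T \<phi> by (rule lie_hom_group_hom[OF \<phi> S T])
  note A = lie_groupD(3,4)[OF S]
  have e: "\<one>\<^bsub>S\<^esub> \<in> points (mfd S)" using A by simp
  have c: "smooth_at (mfd S) (mfd S) (\<lambda>x. g \<otimes>\<^bsub>S\<^esub> x \<otimes>\<^bsub>S\<^esub> inv\<^bsub>S\<^esub> g) \<one>\<^bsub>S\<^esub>"
    by (rule smooth_at_conjugation[OF S g]) simp
  have c1: "g \<otimes>\<^bsub>S\<^esub> \<one>\<^bsub>S\<^esub> \<otimes>\<^bsub>S\<^esub> inv\<^bsub>S\<^esub> g = \<one>\<^bsub>S\<^esub>" using g by simp
  have \<phi>1: "smooth_at (mfd S) (mfd T) \<phi> (g \<otimes>\<^bsub>S\<^esub> \<one>\<^bsub>S\<^esub> \<otimes>\<^bsub>S\<^esub> inv\<^bsub>S\<^esub> g)" and \<phi>2: "smooth_at (mfd S) (mfd T) \<phi> \<one>\<^bsub>S\<^esub>"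
    unfolding c1 by (rule lie_hom_smooth_at[OF \<phi> S T], simp)+
  have "\<forall>\<^sub>F x in mnhds (mfd S) \<one>\<^bsub>S\<^esub>. x \<in> carrier S" using eventually_mnhds_points[OF A(1) e] A(2) by simp
  then have "\<forall>\<^sub>F x in mnhds (mfd S) \<one>\<^bsub>S\<^esub>. \<phi> (g \<otimes>\<^bsub>S\<^esub> x \<otimes>\<^bsub>S\<^esub> inv\<^bsub>S\<^esub> g) = \<phi> g \<otimes>\<^bsub>T\<^esub> \<phi> x \<otimes>\<^bsub>T\<^esub> inv\<^bsub>T\<^esub> \<phi> g"
    by eventually_elim (simp add: g)
  from tangent_map_cong[OF this A(1) e, where N = "mfd T"]
  show ?thesis
    using smooth_at_compose(2)[OF c \<phi>1, of u] tangent_map_conjugate(2)[OF T \<phi>2 hom_one hom_closed[OF g], of u]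
    by (simp add: Ad_def[of S] c1)
qed

lemma
  assumes G: "lie_group G" and g: "g \<in> carrier G"
  shows mc_right_right_inv_vf: "mc_right G g (right_inv_vf G u g) = u"
    and right_inv_vf_mc_right: "right_inv_vf G (mc_right G g v) g = v"
    and left_inv_vf_eq: "left_inv_vf G u g = right_inv_vf G (Ad G g u) g"
    and mc_left_eq: "mc_left G g v = Ad G (inv\<^bsub>G\<^esub> g) (mc_right G g v)"
proof -
  interpret group G by (rule lie_groupD(1)[OF G])
  note A = lie_groupD(3,4)[OF G]
  have e: "\<one>\<^bsub>G\<^esub> \<in> points (mfd G)" and g': "g \<in> points (mfd G)" using A g by simp_all
  have r1: "smooth_at (mfd G) (mfd G) (\<lambda>x. x \<otimes>\<^bsub>G\<^esub> g) \<one>\<^bsub>G\<^esub>"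
    by (rule smooth_at_right_translation[OF G g]) simp
  have r2: "smooth_at (mfd G) (mfd G) (\<lambda>x. x \<otimes>\<^bsub>G\<^esub> inv\<^bsub>G\<^esub> g) (\<one>\<^bsub>G\<^esub> \<otimes>\<^bsub>G\<^esub> g)"
    by (rule smooth_at_right_translation[OF G]) (simp_all add: g)
  have r3: "smooth_at (mfd G) (mfd G) (\<lambda>x. x \<otimes>\<^bsub>G\<^esub> inv\<^bsub>G\<^esub> g) g"
    by (rule smooth_at_right_translation[OF G]) (simp_all add: g)
  have r4: "smooth_at (mfd G) (mfd G) (\<lambda>x. x \<otimes>\<^bsub>G\<^esub> g) (g \<otimes>\<^bsub>G\<^esub> inv\<^bsub>G\<^esub> g)"
    by (rule smooth_at_right_translation[OF G]) (simp_all add: g)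
  have ev: "\<forall>\<^sub>F x in mnhds (mfd G) h. x \<in> carrier G" if "h \<in> carrier G" for h
    using eventually_mnhds_points[OF A(1)] A(2) that by simp
  have e1: "\<forall>\<^sub>F x in mnhds (mfd G) \<one>\<^bsub>G\<^esub>. x \<otimes>\<^bsub>G\<^esub> g \<otimes>\<^bsub>G\<^esub> inv\<^bsub>G\<^esub> g = x"
    using ev[OF one_closed] by eventually_elim (simp add: g m_assoc)
  have e2: "\<forall>\<^sub>F x in mnhds (mfd G) g. x \<otimes>\<^bsub>G\<^esub> inv\<^bsub>G\<^esub> g \<otimes>\<^bsub>G\<^esub> g = x"
    using ev[OF g] by eventually_elim (simp add: g m_assoc)
  show "mc_right G g (right_inv_vf G u g) = u"
    using smooth_at_compose(2)[OF r1 r2, of u] tangent_map_cong[OF e1 A(1) e, where N = "mfd G"]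
    by (simp add: mc_right_def right_inv_vf_def dR_def g tangent_map_ident[OF A(1) e])
  show "right_inv_vf G (mc_right G g v) g = v"
    using smooth_at_compose(2)[OF r3 r4, of v] tangent_map_cong[OF e2 A(1) g', where N = "mfd G"]
    by (simp add: mc_right_def right_inv_vf_def dR_def g tangent_map_ident[OF A(1) g'])
  have c: "smooth_at (mfd G) (mfd G) (\<lambda>x. g \<otimes>\<^bsub>G\<^esub> x \<otimes>\<^bsub>G\<^esub> inv\<^bsub>G\<^esub> g) \<one>\<^bsub>G\<^esub>"
    by (rule smooth_at_conjugation[OF G g]) simp
  have c1: "g \<otimes>\<^bsub>G\<^esub> \<one>\<^bsub>G\<^esub> \<otimes>\<^bsub>G\<^esub> inv\<^bsub>G\<^esub> g = \<one>\<^bsub>G\<^esub>" using g by simp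
  have r5: "smooth_at (mfd G) (mfd G) (\<lambda>x. x \<otimes>\<^bsub>G\<^esub> g) (g \<otimes>\<^bsub>G\<^esub> \<one>\<^bsub>G\<^esub> \<otimes>\<^bsub>G\<^esub> inv\<^bsub>G\<^esub> g)"
    unfolding c1 by (rule r1)
  have e3: "\<forall>\<^sub>F x in mnhds (mfd G) \<one>\<^bsub>G\<^esub>. g \<otimes>\<^bsub>G\<^esub> x = g \<otimes>\<^bsub>G\<^esub> x \<otimes>\<^bsub>G\<^esub> inv\<^bsub>G\<^esub> g \<otimes>\<^bsub>G\<^esub> g"
    using ev[OF one_closed] by eventually_elim (simp add: g m_assoc)
  show "left_inv_vf G u g = right_inv_vf G (Ad G g u) g"
    using smooth_at_compose(2)[OF c r5, of u] tangent_map_cong[OF e3 A(1) e, where N = "mfd G"]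
    by (simp add: left_inv_vf_def right_inv_vf_def dR_def dL_def Ad_def c1)
  show "mc_left G g v = Ad G (inv\<^bsub>G\<^esub> g) (mc_right G g v)"
    using mcL_eq[OF G smooth_at_ident_group[OF G g], of v]
    by (simp add: mcL_def mcR_def tangent_map_ident[OF A(1) g'])
qed

subsection \<open>The Maurer--Cartan equation\<close>

definition unit_chart_inv :: "('a, 'e::real_normed_vector) lie_group \<Rightarrow> 'e \<Rightarrow> 'a" where
  "unit_chart_inv G = chart_inv (mfd G) \<one>\<^bsub>G\<^esub>"

definition unit_coord :: "('a, 'e::real_normed_vector) lie_group \<Rightarrow> 'e" where
  "unit_coord G = chart (mfd G) \<one>\<^bsub>G\<^esub> \<one>\<^bsub>G\<^esub>"

lemma
  assumes G: "lie_group (G :: ('a, 'e::real_normed_vector) lie_group)"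
  shows one_points: "\<one>\<^bsub>G\<^esub> \<in> points (mfd G)"
    and unit_chart_inv_coord: "unit_chart_inv G (unit_coord G) = \<one>\<^bsub>G\<^esub>"
    and smooth_at_unit_chart_inv: "smooth_at vspace (mfd G) (unit_chart_inv G) (unit_coord G)"
    and lie_group_fin_dim: "fin_dim TYPE('e)"
    and tangent_map_unit_chart_inv: "tangent_map vspace (mfd G) (unit_chart_inv G) (unit_coord G) v = v"
proof -
  interpret group G by (rule lie_groupD(1)[OF G])
  note A = lie_groupD(3,4)[OF G]
  show e: "\<one>\<^bsub>G\<^esub> \<in> points (mfd G)" using A by simp
  note ed = atlas_chart(1)[OF A(1) e]
  show u: "unit_chart_inv G (unit_coord G) = \<one>\<^bsub>G\<^esub>"
    unfolding unit_chart_inv_def unit_coord_def by (rule chart_inv_chart[OF A(1) e ed])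
  show "smooth_at vspace (mfd G) (unit_chart_inv G) (unit_coord G)"
    unfolding unit_chart_inv_def unit_coord_def by (rule smooth_at_chart_inv[OF A(1) e imageI[OF ed]])
  show "fin_dim TYPE('e)" by (rule atlas_fin_dim[OF A(1)])
  have "\<forall>\<^sub>F x in nhds (unit_coord G). chart (mfd G) \<one>\<^bsub>G\<^esub> (unit_chart_inv G x) = x"
    using eventually_chart_image[OF A(1) e imageI[OF ed]]
    unfolding unit_chart_inv_def unit_coord_def by eventually_elim (simp add: chart_inv_image(1)[OF A(1) e])
  from frechet_derivative_cong_eventually[OF this]
  show "tangent_map vspace (mfd G) (unit_chart_inv G) (unit_coord G) v = v"
    unfolding tangent_map_eq by (simp add: u)
qed

text \<open>With the chart at the unit moved to \<open>\<gamma> x0\<close> by a right translation, the form \<open>\<theta>\<^sup>r\<close> is a partial derivative of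
  \<open>(a, b) \<mapsto> a b\<^sup>-\<^sup>1\<close> along the diagonal.\<close>

lemma smooth_pt_mcR:
  fixes \<gamma> :: "'x::real_normed_vector \<Rightarrow> 'a" and G :: "('a, 'e::real_normed_vector) lie_group"
  assumes G: "lie_group G" and \<gamma>: "smooth_at vspace (mfd G) \<gamma> x0" and w: "smooth_pt w x0"
  shows "smooth_pt (\<lambda>x. mcR vspace G \<gamma> x (w x)) x0"
proof -
  interpret group G by (rule lie_groupD(1)[OF G])
  note A = lie_groupD(3,4)[OF G]
  note e = one_points[OF G] and fe = lie_group_fin_dim[OF G] and Ec = unit_chart_inv_coord[OF G]
  note fx = atlas_fin_dim[OF smooth_atD(1)[OF \<gamma>]]
  note ed = atlas_chart(1)[OF A(1) e]
  let ?e0 = "unit_coord G" and ?E = "unit_chart_inv G" and ?c = "chart (mfd G) \<one>\<^bsub>G\<^esub>"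
  define c where "c = \<gamma> x0"
  have c: "c \<in> carrier G" unfolding c_def by (rule smooth_at_carrier[OF G \<gamma>])
  have av: "atlas (vspace :: ('x, 'x) manifold)" by (rule atlas_vspace[OF fx])
  define \<delta> where "\<delta> x = \<gamma> x \<otimes>\<^bsub>G\<^esub> inv\<^bsub>G\<^esub> c" for x
  define \<eta> where "\<eta> x = ?c (\<delta> x)" for x
  define \<mu> where "\<mu> ab = ?c (?E (fst ab) \<otimes>\<^bsub>G\<^esub> inv\<^bsub>G\<^esub> ?E (snd ab))" for ab
  have \<delta>: "smooth_at vspace (mfd G) \<delta> x0"
    unfolding \<delta>_def using c by (intro smooth_at_mult G \<gamma> smooth_at_const_group av) auto
  have \<delta>0: "\<delta> x0 = \<one>\<^bsub>G\<^esub>" unfolding \<delta>_def using c by (simp add: c_def[symmetric])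
  have \<delta>dom: "\<forall>\<^sub>F x in nhds x0. \<delta> x \<in> chart_dom (mfd G) \<one>\<^bsub>G\<^esub>"
    using smooth_at_eventually_into[OF \<delta>, unfolded \<delta>0, OF eventually_mnhds_chart_dom[OF A(1) e ed]]
    by (simp add: mnhds_vspace[OF fx])
  have c1: "smooth_at (mfd G) vspace ?c (\<delta> x0)" unfolding \<delta>0 by (rule smooth_at_chart[OF A(1) e ed])
  have \<eta>: "smooth_pt \<eta> x0"
    using smooth_at_compose(1)[OF \<delta> c1] smooth_at_vspace[OF fx fe] unfolding \<eta>_def by blast
  have \<eta>0: "\<eta> x0 = ?e0" unfolding \<eta>_def \<delta>0 unit_coord_def ..
  have fee: "fin_dim TYPE('e \<times> 'e)" by (rule fin_dim_prod[OF fe fe])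
  have f: "smooth_at vspace vspace fst (?e0, ?e0)" and s: "smooth_at vspace vspace snd (?e0, ?e0)"
    by (simp_all add: smooth_at_vspace[OF fee fe] smooth_pt_fst[OF smooth_pt_ident] smooth_pt_snd[OF smooth_pt_ident])
  have Ef: "smooth_at vspace (mfd G) ?E (fst (?e0, ?e0))" and Es: "smooth_at vspace (mfd G) ?E (snd (?e0, ?e0))"
    using smooth_at_unit_chart_inv[OF G] by simp_all
  have m: "smooth_at vspace (mfd G) (\<lambda>ab. ?E (fst ab) \<otimes>\<^bsub>G\<^esub> inv\<^bsub>G\<^esub> ?E (snd ab)) (?e0, ?e0)"
    by (rule smooth_at_mult[OF G smooth_at_compose(1)[OF f Ef] smooth_at_inv[OF G smooth_at_compose(1)[OF s Es]]])
  have c2: "smooth_at (mfd G) vspace ?c (?E (fst (?e0, ?e0)) \<otimes>\<^bsub>G\<^esub> inv\<^bsub>G\<^esub> ?E (snd (?e0, ?e0)))"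
    using smooth_at_chart[OF A(1) e ed] by (simp add: Ec)
  have \<mu>: "smooth_pt \<mu> (\<eta> x0, \<eta> x0)"
    using smooth_at_compose(1)[OF m c2] smooth_at_vspace[OF fee fe] unfolding \<mu>_def \<eta>0 by blast
  have \<eta>\<eta>: "smooth_pt (\<lambda>x. (\<eta> x, \<eta> x)) x0" by (rule smooth_pt_Pair[OF \<eta> \<eta>])
  have D\<eta>: "smooth_pt (\<lambda>x. frechet_derivative \<eta> (at x) (w x)) x0"
    by (rule smooth_pt_frechet_apply[OF fx smooth_pt_ident \<eta> w])
  have main: "smooth_pt (\<lambda>x. frechet_derivative \<mu> (at (\<eta> x, \<eta> x)) (frechet_derivative \<eta> (at x) (w x), 0)) x0"
    by (rule smooth_pt_frechet_apply[OF fee \<eta>\<eta> \<mu> smooth_pt_Pair[OF D\<eta> smooth_pt_const]])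
  have near: "\<forall>\<^sub>F x in nhds x0. smooth_at vspace (mfd G) \<gamma> x \<and> \<delta> x \<in> chart_dom (mfd G) \<one>\<^bsub>G\<^esub> \<and>
      smooth_pt \<eta> x \<and> smooth_pt \<mu> (\<eta> x, \<eta> x)"
    using smooth_at_eventually[OF \<gamma>, unfolded mnhds_vspace[OF fx]] \<delta>dom smooth_pt_eventually[OF \<eta>]
      smooth_pt_eventually_compose[OF \<eta>\<eta> smooth_pt_eventually[OF \<mu>]]
    by eventually_elim blast
  have "\<forall>\<^sub>F x in nhds x0. frechet_derivative \<mu> (at (\<eta> x, \<eta> x)) (frechet_derivative \<eta> (at x) (w x), 0) =
      mcR vspace G \<gamma> x (w x)"
    using near eventually_eventually[THEN iffD2, OF near]
  proof eventually_elim
    case (elim x)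
    note gx = conjunct1[OF elim(1)]
    have cx: "\<gamma> x \<in> carrier G" by (rule smooth_at_carrier[OF G gx])
    have "\<forall>\<^sub>F y in nhds x. \<mu> (\<eta> y, \<eta> x) = ?c (\<gamma> y \<otimes>\<^bsub>G\<^esub> inv\<^bsub>G\<^esub> \<gamma> x)"
      using elim(2)
    proof eventually_elim
      case (elim y)
      have cy: "\<gamma> y \<in> carrier G" by (rule smooth_at_carrier[OF G conjunct1[OF elim]])
      have "?E (\<eta> y) = \<delta> y" "?E (\<eta> x) = \<delta> x"
        using elim \<open>smooth_at vspace (mfd G) \<gamma> x \<and> _\<close> chart_inv_chart[OF A(1) e]
        unfolding unit_chart_inv_def \<eta>_def by auto
      moreover have "inv\<^bsub>G\<^esub> c \<otimes>\<^bsub>G\<^esub> (c \<otimes>\<^bsub>G\<^esub> z) = z" if "z \<in> carrier G" for z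
        using c that by (simp flip: m_assoc)
      then have "\<delta> y \<otimes>\<^bsub>G\<^esub> inv\<^bsub>G\<^esub> \<delta> x = \<gamma> y \<otimes>\<^bsub>G\<^esub> inv\<^bsub>G\<^esub> \<gamma> x"
        unfolding \<delta>_def using c cx cy by (simp add: inv_mult_group m_assoc)
      ultimately show ?case unfolding \<mu>_def by simp
    qed
    then have eq: "frechet_derivative (\<lambda>y. \<mu> (\<eta> y, \<eta> x)) (at x) =
        frechet_derivative (\<lambda>y. ?c (\<gamma> y \<otimes>\<^bsub>G\<^esub> inv\<^bsub>G\<^esub> \<gamma> x)) (at x)"
      by (rule frechet_derivative_cong_eventually)
    have h: "((\<lambda>y. (\<eta> y, \<eta> x)) has_derivative (\<lambda>v. (frechet_derivative \<eta> (at x) v, 0))) (at x)"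
      by (rule has_derivative_Pair[OF smooth_pt_has_derivative has_derivative_const]) (use elim(1) in blast)
    have "frechet_derivative (\<lambda>y. \<mu> (\<eta> y, \<eta> x)) (at x) =
        (\<lambda>v. frechet_derivative \<mu> (at (\<eta> x, \<eta> x)) (frechet_derivative \<eta> (at x) v, 0))"
      by (rule frechet_derivative_eqI[OF has_derivative_compose[OF h smooth_pt_has_derivative]]) (use elim(1) in blast)
    then show ?case
      unfolding mcR_alt[OF G gx] tangent_map_eq using eq cx by simp
  qed
  with main show ?thesis by (rule smooth_pt_cong)
qed

text \<open>The component functions are partial derivatives of \<open>(a, x) \<mapsto> a x\<close> at \<open>a = e\<close>. The parameter \<open>w\<close> may
  vary with the point, so that sections expanded in the right-invariant frame are covered.\<close>

lemma right_inv_vf_rep: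
  fixes G :: "('a, 'e::real_normed_vector) lie_group"
  assumes G: "lie_group G" and p: "p \<in> carrier G"
    and w: "smooth_pt w x0" and x0: "x0 \<in> chart (mfd G) p ` chart_dom (mfd G) p"
  shows "smooth_pt (vf_rep (mfd G) p (\<lambda>q. right_inv_vf G (w (chart (mfd G) p q)) q)) x0"
proof -
  interpret group G by (rule lie_groupD(1)[OF G])
  note A = lie_groupD(3,4)[OF G]
  have p': "p \<in> points (mfd G)" using p A by simp
  note e = one_points[OF G] and fe = lie_group_fin_dim[OF G] and Ec = unit_chart_inv_coord[OF G]
  have fee: "fin_dim TYPE('e \<times> 'e)" by (rule fin_dim_prod[OF fe fe])
  let ?e0 = "unit_coord G" and ?E = "unit_chart_inv G" and ?c = "chart (mfd G) p" and ?P = "chart_inv (mfd G) p"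
  define m where "m ab = ?c (?E (fst ab) \<otimes>\<^bsub>G\<^esub> ?P (snd ab))" for ab
  have near: "\<forall>\<^sub>F x in nhds x0. x \<in> ?c ` chart_dom (mfd G) p"
    by (rule eventually_chart_image[OF A(1) p' x0])
  have Px: "?P x \<in> carrier G" "?P x \<in> chart_dom (mfd G) p" "?c (?P x) = x" if "x \<in> ?c ` chart_dom (mfd G) p" for x
    using chart_inv_image[OF A(1) p' that] atlas_chart(2)[OF A(1) p'] A(2) by auto
  have sm: "smooth_at vspace (mfd G) (\<lambda>ab. ?E (fst ab) \<otimes>\<^bsub>G\<^esub> ?P (snd ab)) (?e0, x)" if x: "x \<in> ?c ` chart_dom (mfd G) p" for x
  proof -
    have f: "smooth_at vspace vspace fst (?e0, x)" and s: "smooth_at vspace vspace snd (?e0, x)"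
      by (simp_all add: smooth_at_vspace[OF fee fe] smooth_pt_fst[OF smooth_pt_ident] smooth_pt_snd[OF smooth_pt_ident])
    have Ef: "smooth_at vspace (mfd G) ?E (fst (?e0, x))" and Es: "smooth_at vspace (mfd G) ?P (snd (?e0, x))"
      using smooth_at_unit_chart_inv[OF G] smooth_at_chart_inv[OF A(1) p' x] by simp_all
    show ?thesis by (rule smooth_at_mult[OF G smooth_at_compose(1)[OF f Ef] smooth_at_compose(1)[OF s Es]])
  qed
  have m: "smooth_pt m (?e0, x)" if x: "x \<in> ?c ` chart_dom (mfd G) p" for x
  proof -
    have "smooth_at (mfd G) vspace ?c (?E (fst (?e0, x)) \<otimes>\<^bsub>G\<^esub> ?P (snd (?e0, x)))"
      using smooth_at_chart[OF A(1) p' Px(2)[OF x]] Px(1)[OF x] by (simp add: Ec)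
    from smooth_at_compose(1)[OF sm[OF x] this] show ?thesis
      using smooth_at_vspace[OF fee fe] unfolding m_def by blast
  qed
  have "smooth_pt (\<lambda>x. frechet_derivative m (at (?e0, x)) (w x, 0)) x0"
    by (rule smooth_pt_frechet_apply[OF fee smooth_pt_Pair[OF smooth_pt_const smooth_pt_ident] m[OF x0]
          smooth_pt_Pair[OF w smooth_pt_const]])
  moreover have "\<forall>\<^sub>F x in nhds x0. frechet_derivative m (at (?e0, x)) (w x, 0) =
      vf_rep (mfd G) p (\<lambda>q. right_inv_vf G (w (?c q)) q) x"
    using near
  proof eventually_elim
    case (elim x)
    note P = Px[OF elim]
    have r: "smooth_at (mfd G) (mfd G) (\<lambda>a. a \<otimes>\<^bsub>G\<^esub> ?P x) \<one>\<^bsub>G\<^esub>"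
      by (rule smooth_at_right_translation[OF G P(1)]) simp
    have cc: "smooth_at (mfd G) vspace ?c (\<one>\<^bsub>G\<^esub> \<otimes>\<^bsub>G\<^esub> ?P x)"
      using smooth_at_chart[OF A(1) p' P(2)] P(1) by simp
    have rc: "smooth_at (mfd G) vspace (\<lambda>a. ?c (a \<otimes>\<^bsub>G\<^esub> ?P x)) (?E ?e0)"
      unfolding Ec by (rule smooth_at_compose(1)[OF r cc])
    have h: "((\<lambda>a. (a, x)) has_derivative (\<lambda>v. (v, 0))) (at ?e0)"
      by (rule has_derivative_Pair[OF has_derivative_ident has_derivative_const])
    have "frechet_derivative m (at (?e0, x)) (w x, 0) = frechet_derivative (\<lambda>a. m (a, x)) (at ?e0) (w x)"
      by (subst frechet_derivative_eqI[OF has_derivative_compose[OF h smooth_pt_has_derivative[OF m[OF elim]]]]) simp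
    also have "\<dots> = tangent_map vspace vspace (\<lambda>a. ?c (?E a \<otimes>\<^bsub>G\<^esub> ?P x)) ?e0 (w x)"
      by (simp add: tangent_map_vspace m_def)
    also have "\<dots> = tangent_map (mfd G) vspace (\<lambda>a. ?c (a \<otimes>\<^bsub>G\<^esub> ?P x)) \<one>\<^bsub>G\<^esub> (w x)"
      using smooth_at_compose(2)[OF smooth_at_unit_chart_inv[OF G] rc, of "w x"]
      by (simp add: tangent_map_unit_chart_inv[OF G] Ec)
    also have "\<dots> = vf_rep (mfd G) p (\<lambda>q. right_inv_vf G (w (?c q)) q) x"
      using smooth_at_compose(2)[OF r cc, of "w x"] P
      by (simp add: vf_rep_def Let_def to_chart_eq right_inv_vf_def dR_def)
    finally show ?case .
  qed
  ultimately show ?thesis by (rule smooth_pt_cong)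
qed

lemma mcR_chart_vf_rep:
  assumes G: "lie_group G" and p: "p \<in> carrier G" and x: "x \<in> chart (mfd G) p ` chart_dom (mfd G) p"
  shows "mcR vspace G (chart_inv (mfd G) p) x (vf_rep (mfd G) p X x) =
    mc_right G (chart_inv (mfd G) p x) (X (chart_inv (mfd G) p x))"
proof -
  note A = lie_groupD(3,4)[OF G]
  have p': "p \<in> points (mfd G)" using p A by simp
  let ?P = "chart_inv (mfd G) p" and ?c = "chart (mfd G) p"
  note P = chart_inv_image[OF A(1) p' x]
  have q: "?P x \<in> points (mfd G)" using P(2) atlas_chart(2)[OF A(1) p'] by blast
  have s2: "smooth_at vspace (mfd G) ?P (?c (?P x))" unfolding P(1) by (rule smooth_at_chart_inv[OF A(1) p' x])
  have "\<forall>\<^sub>F r in mnhds (mfd G) (?P x). ?P (?c r) = r"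
    using eventually_mnhds_chart_dom[OF A(1) p' P(2)] by eventually_elim (rule chart_inv_chart[OF A(1) p'])
  from tangent_map_cong[OF this A(1) q, where N = "mfd G"]
  have "tangent_map vspace (mfd G) ?P x (vf_rep (mfd G) p X x) = X (?P x)"
    using smooth_at_compose(2)[OF smooth_at_chart[OF A(1) p' P(2)] s2, of "X (?P x)"]
    by (simp add: vf_rep_def Let_def to_chart_eq P(1) tangent_map_ident[OF A(1) q])
  then show ?thesis by (simp add: mcR_def)
qed

text \<open>\<open>\<theta>\<^sup>r\<close> in the chart at the unit inverts the frame of right-invariant vector fields, whose
  derivatives at the unit give the bracket. A general curve \<open>\<gamma>\<close> is moved to the unit by a right
  translation; the second derivatives of its coordinates are symmetric and cancel.\<close>

theorem maurer_cartan:
  fixes \<gamma> :: "'x::real_normed_vector \<Rightarrow> 'a" and G :: "('a, 'e::real_normed_vector) lie_group"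
  assumes G: "lie_group G" and \<gamma>: "smooth_at vspace (mfd G) \<gamma> x0"
  shows "frechet_derivative (\<lambda>x. mcR vspace G \<gamma> x v) (at x0) u -
    frechet_derivative (\<lambda>x. mcR vspace G \<gamma> x u) (at x0) v =
    - lie_alg_bracket G (mcR vspace G \<gamma> x0 u) (mcR vspace G \<gamma> x0 v)"
proof -
  interpret group G by (rule lie_groupD(1)[OF G])
  note A = lie_groupD(3,4)[OF G]
  note e = one_points[OF G] and fe = lie_group_fin_dim[OF G] and Ec = unit_chart_inv_coord[OF G]
  note fx = atlas_fin_dim[OF smooth_atD(1)[OF \<gamma>]]
  note ed = atlas_chart(1)[OF A(1) e]
  have fee: "fin_dim TYPE('e \<times> 'e)" by (rule fin_dim_prod[OF fe fe])
  let ?e0 = "unit_coord G" and ?E = "unit_chart_inv G" and ?c = "chart (mfd G) \<one>\<^bsub>G\<^esub>"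
  have ei: "?e0 \<in> ?c ` chart_dom (mfd G) \<one>\<^bsub>G\<^esub>" unfolding unit_coord_def using ed by (rule imageI)
  have nearE: "\<forall>\<^sub>F z in nhds ?e0. smooth_at vspace (mfd G) ?E z \<and> z \<in> ?c ` chart_dom (mfd G) \<one>\<^bsub>G\<^esub>"
    using smooth_at_eventually[OF smooth_at_unit_chart_inv[OF G]] eventually_chart_image[OF A(1) e ei]
    unfolding mnhds_vspace[OF fe] by eventually_elim simp
  (* Q is the form in the chart at the unit, as a function of the point and the vector. It is the
     identity at the unit, and its derivative in the point there is the bilinear map \<beta>. *)
  define Q where "Q zw = mcR vspace G ?E (fst zw) (snd zw)" for zw :: "'e \<times> 'e"
  have Q: "smooth_pt Q (?e0, w)" for w
  proof -
    have f: "smooth_at vspace vspace fst (?e0, w)"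
      by (simp add: smooth_at_vspace[OF fee fe] smooth_pt_fst[OF smooth_pt_ident])
    have Ef: "smooth_at vspace (mfd G) ?E (fst (?e0, w))"
      using smooth_at_unit_chart_inv[OF G] by simp
    note Ef' = smooth_at_compose(1)[OF f Ef]
    have 1: "smooth_pt (\<lambda>zw. mcR vspace G (\<lambda>zw. ?E (fst zw)) zw (snd zw, 0)) (?e0, w)"
      by (rule smooth_pt_mcR[OF G Ef' smooth_pt_Pair[OF smooth_pt_snd[OF smooth_pt_ident] smooth_pt_const]])
    have "\<forall>\<^sub>F zw in nhds (?e0, w). smooth_at vspace (mfd G) ?E (fst zw)"
      by (rule smooth_pt_eventually_compose[OF smooth_pt_fst[OF smooth_pt_ident]])
        (use nearE in \<open>simp add: eventually_conj_iff\<close>)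
    then have "\<forall>\<^sub>F zw in nhds (?e0, w). mcR vspace G (\<lambda>zw. ?E (fst zw)) zw (snd zw, 0) = Q zw"
    proof eventually_elim
      case (elim zw)
      have f: "smooth_at vspace vspace fst zw"
        by (simp add: smooth_at_vspace[OF fee fe] smooth_pt_fst[OF smooth_pt_ident])
      show ?case
        by (simp add: mcR_compose[OF f elim] Q_def tangent_map_vspace
            frechet_derivative_eqI[OF bounded_linear_imp_has_derivative[OF bounded_linear_fst]])
    qed
    with 1 show ?thesis by (rule smooth_pt_cong)
  qed
  have Q0: "Q (?e0, w) = w" for w
  proof -
    have "mc_right G \<one>\<^bsub>G\<^esub> w = w" by (simp add: mc_right_def dR_one[OF G])
    then show ?thesis by (simp add: Q_def mcR_def tangent_map_unit_chart_inv[OF G] Ec)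
  qed
  let ?V = "\<lambda>u. vf_rep (mfd G) \<one>\<^bsub>G\<^esub> (right_inv_vf G u)"
  have V: "smooth_pt (?V u) ?e0" for u
    using right_inv_vf_rep[OF G one_closed smooth_pt_const ei, of u] by simp
  have QV: "\<forall>\<^sub>F z in nhds ?e0. Q (z, ?V u z) = u" for u
    using nearE
  proof eventually_elim
    case (elim z)
    have z: "z \<in> ?c ` chart_dom (mfd G) \<one>\<^bsub>G\<^esub>" using elim by blast
    have Ez: "?E z \<in> carrier G" by (rule smooth_at_carrier[OF G conjunct1[OF elim]])
    show ?case
      using mcR_chart_vf_rep[OF G one_closed z, of "right_inv_vf G u"] Ez
      by (simp add: Q_def unit_chart_inv_def[symmetric] mc_right_right_inv_vf[OF G])
  qed
  have V0: "?V u ?e0 = u" for u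
    using eventually_nhds_x_imp_x[OF QV[of u]] Q0 by simp
  define \<beta> where "\<beta> a w = frechet_derivative Q (at (?e0, w)) (a, 0)" for a w
  have DQ: "frechet_derivative Q (at (?e0, w)) (a, w') = \<beta> a w + w'" for a w w'
  proof -
    have h: "((\<lambda>w. (?e0, w)) has_derivative (\<lambda>v. (0, v))) (at w)"
      by (rule has_derivative_Pair[OF has_derivative_const has_derivative_ident])
    have "frechet_derivative (\<lambda>w. Q (?e0, w)) (at w) = (\<lambda>v. frechet_derivative Q (at (?e0, w)) (0, v))"
      by (rule frechet_derivative_eqI[OF has_derivative_compose[OF h smooth_pt_has_derivative[OF Q]]])
    then have "frechet_derivative Q (at (?e0, w)) (0, w') = w'" by (simp add: Q0 fun_eq_iff)
    then show ?thesis
      using linear_add[OF smooth_pt_linear[OF Q], of w "(a, 0)" "(0, w')"] by (simp add: \<beta>_def)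
  qed
  have DV: "frechet_derivative (?V u) (at ?e0) a = - \<beta> a u" for a u
  proof -
    have h: "((\<lambda>z. (z, ?V u z)) has_derivative (\<lambda>a. (a, frechet_derivative (?V u) (at ?e0) a))) (at ?e0)"
      by (rule has_derivative_Pair[OF has_derivative_ident smooth_pt_has_derivative[OF V]])
    have Qh: "(Q has_derivative frechet_derivative Q (at (?e0, u))) (at (?e0, ?V u ?e0))"
      unfolding V0 by (rule smooth_pt_has_derivative[OF Q])
    have "frechet_derivative (\<lambda>z. Q (z, ?V u z)) (at ?e0) =
        (\<lambda>a. frechet_derivative Q (at (?e0, u)) (a, frechet_derivative (?V u) (at ?e0) a))"
      by (rule frechet_derivative_eqI[OF has_derivative_compose[OF h Qh]])
    moreover have "frechet_derivative (\<lambda>z. Q (z, ?V u z)) (at ?e0) = frechet_derivative (\<lambda>z. u) (at ?e0)"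
      by (rule frechet_derivative_cong_eventually[OF QV])
    ultimately have "\<beta> a u + frechet_derivative (?V u) (at ?e0) a = 0" by (simp add: DQ fun_eq_iff)
    then show ?thesis by (simp add: eq_neg_iff_add_eq_0 add.commute)
  qed
  have bracket: "lie_alg_bracket G a w = \<beta> w a - \<beta> a w" for a w
  proof -
    have "right_inv_vf G u \<one>\<^bsub>G\<^esub> = u" for u by (simp add: right_inv_vf_def dR_one[OF G])
    then show ?thesis
      by (simp add: lie_alg_bracket_def lie_bracket_def unit_coord_def[symmetric] DV)
  qed
  (* \<eta> is the coordinate expression of \<gamma> after the right translation of \<gamma> x0 to the unit, which does
     not change the pullback of the right-invariant form. *)
  define \<delta> where "\<delta> x = \<gamma> x \<otimes>\<^bsub>G\<^esub> inv\<^bsub>G\<^esub> \<gamma> x0" for x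
  define \<eta> where "\<eta> x = ?c (\<delta> x)" for x
  have c: "\<gamma> x0 \<in> carrier G" by (rule smooth_at_carrier[OF G \<gamma>])
  have \<delta>: "smooth_at vspace (mfd G) \<delta> x0"
    unfolding \<delta>_def using c by (intro smooth_at_mult G \<gamma> smooth_at_const_group smooth_atD[OF \<gamma>]) auto
  have \<delta>0: "\<delta> x0 = \<one>\<^bsub>G\<^esub>" unfolding \<delta>_def using c by simp
  have \<delta>dom: "\<forall>\<^sub>F x in nhds x0. \<delta> x \<in> chart_dom (mfd G) \<one>\<^bsub>G\<^esub>"
    using smooth_at_eventually_into[OF \<delta>, unfolded \<delta>0, OF eventually_mnhds_chart_dom[OF A(1) e ed]]
    by (simp add: mnhds_vspace[OF fx])
  have c1: "smooth_at (mfd G) vspace ?c (\<delta> x0)" unfolding \<delta>0 by (rule smooth_at_chart[OF A(1) e ed])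
  have \<eta>: "smooth_pt \<eta> x0"
    using smooth_at_compose(1)[OF \<delta> c1] smooth_at_vspace[OF fx fe] unfolding \<eta>_def by blast
  have \<eta>0: "\<eta> x0 = ?e0" unfolding \<eta>_def \<delta>0 unit_coord_def ..
  have near: "\<forall>\<^sub>F x in nhds x0. smooth_at vspace (mfd G) \<gamma> x \<and> \<delta> x \<in> chart_dom (mfd G) \<one>\<^bsub>G\<^esub> \<and>
      smooth_pt \<eta> x \<and> smooth_at vspace (mfd G) ?E (\<eta> x)"
    using smooth_at_eventually[OF \<gamma>, unfolded mnhds_vspace[OF fx]] \<delta>dom smooth_pt_eventually[OF \<eta>]
      smooth_pt_eventually_compose[OF \<eta> nearE[folded \<eta>0]]
    by eventually_elim blast
  have R: "\<forall>\<^sub>F x in nhds x0. Q (\<eta> x, frechet_derivative \<eta> (at x) v) = mcR vspace G \<gamma> x v" for v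
    using near eventually_eventually[THEN iffD2, OF near]
  proof eventually_elim
    case (elim x)
    have gx: "smooth_at vspace (mfd G) \<gamma> x" using elim by blast
    have hx: "smooth_at vspace vspace \<eta> x" using elim smooth_at_vspace[OF fx fe] by blast
    have Ex: "smooth_at vspace (mfd G) ?E (\<eta> x)" using elim by blast
    have "\<forall>\<^sub>F y in mnhds vspace x. ?E (\<eta> y) = \<gamma> y \<otimes>\<^bsub>G\<^esub> inv\<^bsub>G\<^esub> \<gamma> x0"
      unfolding mnhds_vspace[OF fx] using elim(2)
      by eventually_elim (simp add: \<delta>_def[symmetric] \<eta>_def unit_chart_inv_def chart_inv_chart[OF A(1) e])
    from mcR_cong[OF this smooth_atD(1,3)[OF gx], where G = G]
    have "mcR vspace G (\<lambda>y. ?E (\<eta> y)) x v = mcR vspace G \<gamma> x v"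
      using mcR_right_translate[OF G gx inv_closed[OF c]] by simp
    then show ?case by (simp add: mcR_compose[OF hx Ex] Q_def tangent_map_vspace)
  qed
  let ?D = "\<lambda>x. frechet_derivative \<eta> (at x)"
  have DR: "frechet_derivative (\<lambda>x. mcR vspace G \<gamma> x v) (at x0) u =
      \<beta> (?D x0 u) (?D x0 v) + frechet_derivative (\<lambda>x. ?D x v) (at x0) u" for u v
  proof -
    have h: "((\<lambda>x. (\<eta> x, ?D x v)) has_derivative (\<lambda>u. (?D x0 u, frechet_derivative (\<lambda>x. ?D x v) (at x0) u))) (at x0)"
      by (rule has_derivative_Pair[OF smooth_pt_has_derivative[OF \<eta>] smooth_pt_has_derivative[OF smooth_pt_frechet[OF \<eta>]]])
    have Qh: "(Q has_derivative frechet_derivative Q (at (?e0, ?D x0 v))) (at (\<eta> x0, ?D x0 v))"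
      unfolding \<eta>0 by (rule smooth_pt_has_derivative[OF Q])
    show ?thesis
      unfolding frechet_derivative_cong_eventually[OF R, symmetric]
        frechet_derivative_eqI[OF has_derivative_compose[OF h Qh]] by (simp add: DQ)
  qed
  have R0: "mcR vspace G \<gamma> x0 v = ?D x0 v" for v
    using eventually_nhds_x_imp_x[OF R[of v]] by (simp add: \<eta>0 Q0)
  show ?thesis
    unfolding DR R0 bracket symmetric_second_derivative[OF \<eta>, of u v] by simp
qed

lemma lie_alg_bracket_hom:
  assumes S: "lie_group S" and T: "lie_group T" and \<phi>: "lie_hom S T \<phi>"
  shows "tangent_map (mfd S) (mfd T) \<phi> \<one>\<^bsub>S\<^esub> (lie_alg_bracket S u w) =
    lie_alg_bracket T (tangent_map (mfd S) (mfd T) \<phi> \<one>\<^bsub>S\<^esub> u) (tangent_map (mfd S) (mfd T) \<phi> \<one>\<^bsub>S\<^esub> w)"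
proof -
  interpret group_hom S T \<phi> by (rule lie_hom_group_hom[OF \<phi> S T])
  let ?T = "tangent_map (mfd S) (mfd T) \<phi> \<one>\<^bsub>S\<^esub>" and ?E = "unit_chart_inv S" and ?e0 = "unit_coord S"
  note E = smooth_at_unit_chart_inv[OF S]
  note Ec = unit_chart_inv_coord[OF S] and fe = lie_group_fin_dim[OF S]
  have T1: "smooth_at (mfd S) (mfd T) \<phi> (?E ?e0)" unfolding Ec by (rule lie_hom_smooth_at[OF \<phi> S T]) simp
  note \<phi>E = smooth_at_compose(1)[OF E T1]
  have bl: "bounded_linear ?T" using tangent_map_bounded_linear[OF T1] by (simp add: Ec)
  have R: "\<forall>\<^sub>F x in nhds ?e0. mcR vspace T (\<lambda>x. \<phi> (?E x)) x v = ?T (mcR vspace S ?E x v)" for v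
    using smooth_at_eventually[OF E] unfolding mnhds_vspace[OF fe] by eventually_elim (rule mcR_hom[OF S T \<phi>])
  have D: "frechet_derivative (\<lambda>x. mcR vspace T (\<lambda>x. \<phi> (?E x)) x v) (at ?e0) u =
      ?T (frechet_derivative (\<lambda>x. mcR vspace S ?E x v) (at ?e0) u)" for u v
    unfolding frechet_derivative_cong_eventually[OF R]
    by (simp add: frechet_derivative_eqI[OF bounded_linear.has_derivative[OF bl
          smooth_pt_has_derivative[OF smooth_pt_mcR[OF S E smooth_pt_const]]]])
  have R0: "mcR vspace S ?E ?e0 v = v" for v
    by (simp add: mcR_def tangent_map_unit_chart_inv[OF S] Ec mc_right_def dR_one[OF S])
  have "?T (- lie_alg_bracket S u w) = - lie_alg_bracket T (?T u) (?T w)"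
    using maurer_cartan[OF T \<phi>E, of w u] arg_cong[where f = ?T, OF maurer_cartan[OF S E, of w u]]
      eventually_nhds_x_imp_x[OF R]
    by (simp add: D R0 linear_diff[OF tangent_map_linear[OF T1[unfolded Ec]]])
  then show ?thesis by (simp add: linear_neg[OF tangent_map_linear[OF T1[unfolded Ec]]])
qed

text \<open>Conjugation by \<open>g\<close> is a homomorphism with differential \<open>Ad g\<close>.\<close>

lemma Ad_lie_alg_bracket:
  assumes G: "lie_group G" and g: "g \<in> carrier G"
  shows "Ad G g (lie_alg_bracket G u w) = lie_alg_bracket G (Ad G g u) (Ad G g w)"
proof -
  interpret group G by (rule lie_groupD(1)[OF G])
  have i: "inv\<^bsub>G\<^esub> g \<otimes>\<^bsub>G\<^esub> (g \<otimes>\<^bsub>G\<^esub> z) = z" if "z \<in> carrier G" for z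
    using g that by (simp flip: m_assoc)
  have "(\<lambda>x. g \<otimes>\<^bsub>G\<^esub> x \<otimes>\<^bsub>G\<^esub> inv\<^bsub>G\<^esub> g) \<in> hom G G"
    using g by (auto intro!: homI simp: m_assoc i)
  moreover have "smooth_map (mfd G) (mfd G) (\<lambda>x. g \<otimes>\<^bsub>G\<^esub> x \<otimes>\<^bsub>G\<^esub> inv\<^bsub>G\<^esub> g)"
    using smooth_at_conjugation[OF G g] smooth_map_iff[OF lie_groupD(3)[OF G] lie_groupD(3)[OF G]]
    by (simp add: lie_groupD(4)[OF G])
  ultimately have "lie_hom G G (\<lambda>x. g \<otimes>\<^bsub>G\<^esub> x \<otimes>\<^bsub>G\<^esub> inv\<^bsub>G\<^esub> g)" unfolding lie_hom_def by blast
  from lie_alg_bracket_hom[OF G G this, of u w] show ?thesis unfolding Ad_def by simp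
qed

text \<open>Both statements come from the form \<open>\<theta>\<^sup>r\<close> of the product \<open>\<gamma>(x) h\<close> at \<open>h = e\<close>, where it is
  \<open>\<gamma>\<^sup>*\<theta>\<^sup>r + Ad\<^bsub>\<gamma>\<^esub> \<theta>\<^sup>r\<close>.\<close>

lemma
  fixes \<gamma> :: "'x::real_normed_vector \<Rightarrow> 'a" and G :: "('a, 'e::real_normed_vector) lie_group"
  assumes G: "lie_group G" and \<gamma>: "smooth_at vspace (mfd G) \<gamma> x0"
  shows smooth_pt_Ad: "smooth_pt (\<lambda>x. Ad G (\<gamma> x) w) x0"
    and Ad_derivative: "frechet_derivative (\<lambda>x. Ad G (\<gamma> x) w) (at x0) u =
      - lie_alg_bracket G (mcR vspace G \<gamma> x0 u) (Ad G (\<gamma> x0) w)"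
proof -
  interpret group G by (rule lie_groupD(1)[OF G])
  note Ec = unit_chart_inv_coord[OF G] and fe = lie_group_fin_dim[OF G] and E = smooth_at_unit_chart_inv[OF G]
  note fx = atlas_fin_dim[OF smooth_atD(1)[OF \<gamma>]]
  have fxe: "fin_dim TYPE('x \<times> 'e)" by (rule fin_dim_prod[OF fx fe])
  let ?E = "unit_chart_inv G" and ?e0 = "unit_coord G"
  have f: "smooth_at vspace vspace fst (x, y)" and s: "smooth_at vspace vspace snd (x, y)" for x :: 'x and y :: 'e
    by (simp_all add: smooth_at_vspace[OF fxe fe] smooth_at_vspace[OF fxe fx] smooth_pt_fst[OF smooth_pt_ident] smooth_pt_snd[OF smooth_pt_ident])
  have gf: "smooth_at vspace (mfd G) (\<lambda>z. \<gamma> (fst z)) (x, y)" if "smooth_at vspace (mfd G) \<gamma> x" for x :: 'x and y :: 'e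
    by (rule smooth_at_compose(1)[OF f]) (simp add: that)
  have Es: "smooth_at vspace (mfd G) (\<lambda>z. ?E (snd z)) (x, y)" if "smooth_at vspace (mfd G) ?E y" for x :: 'x and y :: 'e
    by (rule smooth_at_compose(1)[OF s]) (simp add: that)
  let ?\<Gamma> = "\<lambda>z :: 'x \<times> 'e. \<gamma> (fst z) \<otimes>\<^bsub>G\<^esub> ?E (snd z)"
  have \<Gamma>: "smooth_at vspace (mfd G) ?\<Gamma> (x0, ?e0)" by (rule smooth_at_mult[OF G gf[OF \<gamma>] Es[OF E]])
  have R: "mcR vspace G ?\<Gamma> (x, y) (u, v) = mcR vspace G \<gamma> x u + Ad G (\<gamma> x) (mcR vspace G ?E y v)"
    if "smooth_at vspace (mfd G) \<gamma> x" "smooth_at vspace (mfd G) ?E y" for x y u v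
  proof -
    have g': "smooth_at vspace (mfd G) \<gamma> (fst (x, y))" and E': "smooth_at vspace (mfd G) ?E (snd (x, y))"
      using that by simp_all
    show ?thesis
      unfolding mcR_mult[OF G gf[OF that(1)] Es[OF that(2)]] mcR_compose[OF f g'] mcR_compose[OF s E'] tangent_map_vspace
      by (simp add: frechet_derivative_eqI[OF bounded_linear_imp_has_derivative[OF bounded_linear_fst]]
          frechet_derivative_eqI[OF bounded_linear_imp_has_derivative[OF bounded_linear_snd]])
  qed
  have R0: "mcR vspace G ?E ?e0 v = v" for v
    by (simp add: mcR_def tangent_map_unit_chart_inv[OF G] Ec mc_right_def dR_one[OF G])
  have l0: "mcR vspace G \<gamma> x 0 = 0" if "smooth_at vspace (mfd G) \<gamma> x" for x
    by (rule linear_0[OF linear_mcR[OF G that]])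
  have lA: "Ad G (\<gamma> x) 0 = 0" if "smooth_at vspace (mfd G) \<gamma> x" for x
    by (rule linear_0[OF linear_Ad[OF G smooth_at_carrier[OF G that]]])
  have lE: "mcR vspace G ?E y 0 = 0" if "smooth_at vspace (mfd G) ?E y" for y
    by (rule linear_0[OF linear_mcR[OF G that]])
  have ev\<gamma>: "\<forall>\<^sub>F x in nhds x0. smooth_at vspace (mfd G) \<gamma> x"
    using smooth_at_eventually[OF \<gamma>] by (simp add: mnhds_vspace[OF fx])
  have evE: "\<forall>\<^sub>F y in nhds ?e0. smooth_at vspace (mfd G) ?E y"
    using smooth_at_eventually[OF E] by (simp add: mnhds_vspace[OF fe])
  have Sw: "smooth_pt (\<lambda>z. mcR vspace G ?\<Gamma> z (u, w)) (x0, ?e0)" for u w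
    by (rule smooth_pt_mcR[OF G \<Gamma> smooth_pt_const])
  have px: "smooth_pt (\<lambda>x. (x, ?e0)) x0" by (rule smooth_pt_Pair[OF smooth_pt_ident smooth_pt_const])
  have eqx: "\<forall>\<^sub>F x in nhds x0. mcR vspace G ?\<Gamma> (x, ?e0) (0, w) = Ad G (\<gamma> x) w" for w
    using ev\<gamma> by eventually_elim (simp add: R E R0 l0)
  show "smooth_pt (\<lambda>x. Ad G (\<gamma> x) w) x0"
    by (rule smooth_pt_cong[OF smooth_pt_compose[OF fxe px Sw] eqx])
  have hx: "((\<lambda>x. (x, ?e0)) has_derivative (\<lambda>u. (u, 0))) (at x0)"
    by (rule has_derivative_Pair[OF has_derivative_ident has_derivative_const])
  have hy: "((\<lambda>y. (x0, y)) has_derivative (\<lambda>v. (0, v))) (at ?e0)"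
    by (rule has_derivative_Pair[OF has_derivative_const has_derivative_ident])
  have 1: "frechet_derivative (\<lambda>z. mcR vspace G ?\<Gamma> z (0, w)) (at (x0, ?e0)) (u, 0) =
      frechet_derivative (\<lambda>x. Ad G (\<gamma> x) w) (at x0) u"
    using frechet_derivative_cong_eventually[OF eqx[of w]]
      frechet_derivative_eqI[OF has_derivative_compose[OF hx smooth_pt_has_derivative[OF Sw[of 0 w]]]]
    by (simp add: fun_eq_iff)
  have "\<forall>\<^sub>F y in nhds ?e0. mcR vspace G ?\<Gamma> (x0, y) (u, 0) = mcR vspace G \<gamma> x0 u"
    using evE by eventually_elim (simp add: R \<gamma> lE lA)
  from frechet_derivative_cong_eventually[OF this]
  have 2: "frechet_derivative (\<lambda>z. mcR vspace G ?\<Gamma> z (u, 0)) (at (x0, ?e0)) (0, w) = 0"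
    using frechet_derivative_eqI[OF has_derivative_compose[OF hy smooth_pt_has_derivative[OF Sw[of u 0]]]]
    by (simp add: fun_eq_iff)
  show "frechet_derivative (\<lambda>x. Ad G (\<gamma> x) w) (at x0) u =
      - lie_alg_bracket G (mcR vspace G \<gamma> x0 u) (Ad G (\<gamma> x0) w)"
    using maurer_cartan[OF G \<Gamma>, of "(0, w)" "(u, 0)"] by (simp add: 1 2 R \<gamma> E R0 l0 lE lA)
qed

section \<open>Submanifolds from local parametrizations\<close>

text \<open>What makes an embedded submanifold usable: its charts extend to functions that are smooth on the
  ambient manifold, and its neighbourhoods are the traces of ambient ones. Maps into and out of the
  submanifold can then be treated as ambient maps.\<close>

definition ambient_smooth ::
  "('a, 'm::real_normed_vector) manifold \<Rightarrow> ('a, 'n::real_normed_vector) manifold \<Rightarrow> bool" where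
  "ambient_smooth M N \<longleftrightarrow> manifold M \<and> manifold N \<and> points M \<subseteq> points N \<and>
     (\<forall>p\<in>points M. smooth_at M N (\<lambda>x. x) p \<and> smooth_at N vspace (chart M p) p \<and>
        (\<forall>P. eventually P (mnhds M p) \<longleftrightarrow> (\<forall>\<^sub>F q in mnhds N p. q \<in> points M \<longrightarrow> P q)))"

text \<open>The maps \<open>\<psi> p\<close> are the charts and \<open>\<sigma>\<close> their inverses. The transition maps are compositions of
  smooth maps through \<open>N\<close>, the continuity of \<open>\<psi> p\<close> and \<open>\<sigma>\<close> gives the subspace topology, and
  \<open>\<psi> p\<close>, defined near \<open>p\<close> in \<open>N\<close>, provides a left inverse to the differential of the inclusion.\<close>

theorem submanifold_of_parametrizations:
  fixes N :: "('a, 'n::real_normed_vector) manifold" and \<psi> :: "'a \<Rightarrow> 'a \<Rightarrow> 'm::real_normed_vector"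
  assumes N: "manifold N" and S: "S \<subseteq> points N" and fd: "fin_dim TYPE('m)"
    and loc: "\<And>p. p \<in> S \<Longrightarrow> \<exists>U W \<sigma>. openin (mtopology N) U \<and> p \<in> U \<and> open W \<and> \<sigma> ` W = S \<inter> U \<and>
      (\<forall>x\<in>W. smooth_at vspace N \<sigma> x \<and> \<psi> p (\<sigma> x) = x) \<and> (\<forall>q\<in>S \<inter> U. smooth_at N vspace (\<psi> p) q)"
  shows "\<exists>M :: ('a, 'm) manifold. points M = S \<and> chart M = \<psi> \<and> embedded_submanifold M N \<and> ambient_smooth M N"
proof -
  note NA = manifold_atlas[OF N]
  have "\<forall>p. \<exists>U W \<sigma>. p \<in> S \<longrightarrow> openin (mtopology N) U \<and> p \<in> U \<and> open W \<and> \<sigma> ` W = S \<inter> U \<and>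
      (\<forall>x\<in>W. smooth_at vspace N \<sigma> x \<and> \<psi> p (\<sigma> x) = x) \<and> (\<forall>q\<in>S \<inter> U. smooth_at N vspace (\<psi> p) q)"
    using loc by meson
  then obtain U W \<sigma> where UW: "\<forall>p. p \<in> S \<longrightarrow> openin (mtopology N) (U p) \<and> p \<in> U p \<and> open (W p) \<and> \<sigma> p ` W p = S \<inter> U p \<and>
      (\<forall>x\<in>W p. smooth_at vspace N (\<sigma> p) x \<and> \<psi> p (\<sigma> p x) = x) \<and> (\<forall>q\<in>S \<inter> U p. smooth_at N vspace (\<psi> p) q)"
    by (metis (no_types, lifting))
  have U: "openin (mtopology N) (U p)" "p \<in> U p" "open (W p)" "\<sigma> p ` W p = S \<inter> U p" if "p \<in> S" for p
    using UW that by auto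
  have \<sigma>: "smooth_at vspace N (\<sigma> p) x" "\<psi> p (\<sigma> p x) = x" if "p \<in> S" "x \<in> W p" for p x
    using UW that by auto
  have \<psi>: "smooth_at N vspace (\<psi> p) q" if "p \<in> S" "q \<in> S" "q \<in> U p" for p q
    using UW that by auto
  have \<sigma>S: "\<sigma> p x \<in> S" "\<sigma> p x \<in> U p" if "p \<in> S" "x \<in> W p" for p x
    using U(4)[OF that(1)] that(2) by auto
  have \<psi>W: "\<psi> p q \<in> W p" "\<sigma> p (\<psi> p q) = q" if pq: "p \<in> S" "q \<in> S" "q \<in> U p" for p q
  proof -
    obtain x where "x \<in> W p" "q = \<sigma> p x" using U(4)[OF pq(1)] pq(2,3) by blast
    then show "\<psi> p q \<in> W p" "\<sigma> p (\<psi> p q) = q" using \<sigma>(2)[OF pq(1)] by auto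
  qed
  define M :: "('a, 'm) manifold" where "M = \<lparr>points = S, chart_dom = (\<lambda>p. S \<inter> U p), chart = \<psi>\<rparr>"
  have M [simp]: "points M = S" "chart_dom M p = S \<inter> U p" "chart M = \<psi>" for p
    unfolding M_def by auto
  have inj: "inj_on (\<psi> p) (S \<inter> U p)" if "p \<in> S" for p
    using \<psi>W(2)[OF that] by (auto intro!: inj_on_inverseI[of _ "\<sigma> p"])
  have img: "\<psi> p ` (S \<inter> U p) = W p" if "p \<in> S" for p
  proof
    show "\<psi> p ` (S \<inter> U p) \<subseteq> W p" using \<psi>W(1)[OF that] by auto
    show "W p \<subseteq> \<psi> p ` (S \<inter> U p)" using \<sigma>(2)[OF that] \<sigma>S[OF that] by (metis IntI image_eqI subsetI)
  qed
  have ci: "chart_inv M p x = \<sigma> p x" if "p \<in> S" "x \<in> W p" for p x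
    unfolding chart_inv_def using inv_into_f_f[OF inj[OF that(1)], of "\<sigma> p x"] \<sigma>[OF that] \<sigma>S[OF that] by simp
  have evW: "\<forall>\<^sub>F y in nhds x. y \<in> W p" if "p \<in> S" "x \<in> W p" for p x
    by (rule eventually_nhds_in_open[OF U(3)[OF that(1)] that(2)])
  have mv: "mnhds vspace x = nhds x" for x :: 'm by (rule mnhds_vspace[OF fd])
  have evU: "\<forall>\<^sub>F y in nhds x. \<sigma> p y \<in> U q" if "p \<in> S" "q \<in> S" "x \<in> W p" "\<sigma> p x \<in> U q" for p q x
    using smooth_at_eventually_into[OF \<sigma>(1)[OF that(1,3)] eventually_openin[OF U(1)[OF that(2)] that(4) NA]]
    by (simp add: mv)
  have trimg: "\<psi> p ` (S \<inter> U p \<inter> (S \<inter> U q)) = {x \<in> W p. \<sigma> p x \<in> U q}" if pq: "p \<in> S" "q \<in> S" for p q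
  proof (rule Set.set_eqI, rule iffI)
    fix x assume "x \<in> \<psi> p ` (S \<inter> U p \<inter> (S \<inter> U q))"
    then show "x \<in> {x \<in> W p. \<sigma> p x \<in> U q}" using \<psi>W[OF pq(1)] by auto
  next
    fix x assume x: "x \<in> {x \<in> W p. \<sigma> p x \<in> U q}"
    then have "\<sigma> p x \<in> S \<inter> U p \<inter> (S \<inter> U q)" using \<sigma>S[OF pq(1)] by auto
    then show "x \<in> \<psi> p ` (S \<inter> U p \<inter> (S \<inter> U q))" using \<sigma>(2)[OF pq(1)] x by (metis (mono_tags, lifting) image_eqI mem_Collect_eq)
  qed
  have tropen: "open {x \<in> W p. \<sigma> p x \<in> U q}" if pq: "p \<in> S" "q \<in> S" for p q
    unfolding open_subopen[of "{x \<in> W p. \<sigma> p x \<in> U q}"]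
  proof
    fix x assume "x \<in> {x \<in> W p. \<sigma> p x \<in> U q}"
    then have "\<forall>\<^sub>F y in nhds x. y \<in> {x \<in> W p. \<sigma> p x \<in> U q}"
      using eventually_conj[OF evW[OF pq(1), of x] evU[OF pq, of x]] by simp
    then show "\<exists>T. open T \<and> x \<in> T \<and> T \<subseteq> {x \<in> W p. \<sigma> p x \<in> U q}"
      unfolding eventually_nhds by (meson subsetI)
  qed
  have trsmooth: "smooth_pt (\<psi> q \<circ> chart_inv M p) x" if pq: "p \<in> S" "q \<in> S" and x: "x \<in> W p" "\<sigma> p x \<in> U q" for p q x
  proof -
    have "smooth_at vspace vspace (\<lambda>x. \<psi> q (\<sigma> p x)) x"
      by (rule smooth_at_compose(1)[OF \<sigma>(1)[OF pq(1) x(1)] \<psi>[OF pq(2) \<sigma>S(1)[OF pq(1) x(1)] x(2)]])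
    then have "smooth_pt (\<lambda>x. \<psi> q (\<sigma> p x)) x" by (simp add: smooth_at_vspace[OF fd fd])
    then show ?thesis
      by (rule smooth_pt_cong) (use evW[OF pq(1) x(1)] in \<open>eventually_elim, simp add: ci[OF pq(1)]\<close>)
  qed
  have MA: "atlas M"
    unfolding atlas_def M img
  proof (intro conjI ballI)
    show "fin_dim TYPE('m)" by (rule fd)
  next
    fix p assume p: "p \<in> S"
    show "p \<in> S \<inter> U p" "S \<inter> U p \<subseteq> S" "inj_on (\<psi> p) (S \<inter> U p)" using p U(2)[OF p] inj[OF p] by auto
    show "open (\<psi> p ` (S \<inter> U p))" unfolding img[OF p] by (rule U(3)[OF p])
    fix q assume q: "q \<in> S"
    show "open (\<psi> p ` (S \<inter> U p \<inter> (S \<inter> U q)))" unfolding trimg[OF p q] by (rule tropen[OF p q])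
    show "smooth_on (\<psi> p ` (S \<inter> U p \<inter> (S \<inter> U q))) (\<psi> q \<circ> chart_inv M p)"
      unfolding trimg[OF p q] smooth_on_iff[OF tropen[OF p q]] using trsmooth[OF p q] by simp
  qed
  have nb: "eventually P (mnhds M p) \<longleftrightarrow> (\<forall>\<^sub>F q in mnhds N p. q \<in> S \<longrightarrow> P q)" if p: "p \<in> S" for p P
  proof -
    have pU: "p \<in> U p" by (rule U(2)[OF p])
    note x0 = \<psi>W[OF p p pU]
    have "eventually P (mnhds M p) \<longleftrightarrow> (\<forall>\<^sub>F x in nhds (\<psi> p p). P (chart_inv M p x))"
      using eventually_mnhds_chart[OF MA, of p p] p pU by simp
    also have "\<dots> \<longleftrightarrow> (\<forall>\<^sub>F x in nhds (\<psi> p p). P (\<sigma> p x))"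
      by (rule eventually_cong[OF evW[OF p x0(1)]]) (simp add: ci[OF p])
    also have "\<dots> \<longleftrightarrow> (\<forall>\<^sub>F q in mnhds N p. q \<in> S \<longrightarrow> P q)"
    proof
      assume "\<forall>\<^sub>F x in nhds (\<psi> p p). P (\<sigma> p x)"
      then have "\<forall>\<^sub>F q in mnhds N p. P (\<sigma> p (\<psi> p q))"
        using smooth_at_eventually_into[OF \<psi>[OF p p pU]] by (simp add: mv)
      with eventually_openin[OF U(1)[OF p] pU NA]
      show "\<forall>\<^sub>F q in mnhds N p. q \<in> S \<longrightarrow> P q" by eventually_elim (use \<psi>W(2)[OF p] in auto)
    next
      assume "\<forall>\<^sub>F q in mnhds N p. q \<in> S \<longrightarrow> P q"
      then have "\<forall>\<^sub>F x in nhds (\<psi> p p). \<sigma> p x \<in> S \<longrightarrow> P (\<sigma> p x)"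
        using smooth_at_eventually_into[OF \<sigma>(1)[OF p x0(1)]] by (simp add: mv x0(2))
      with evW[OF p x0(1)] show "\<forall>\<^sub>F x in nhds (\<psi> p p). P (\<sigma> p x)"
        by eventually_elim (use \<sigma>S(1)[OF p] in auto)
    qed
    finally show ?thesis .
  qed
  have top: "mtopology M = subtopology (mtopology N) S"
    unfolding topology_eq
  proof
    fix T
    show "openin (mtopology M) T \<longleftrightarrow> openin (subtopology (mtopology N) S) T"
    proof
      assume T: "openin (mtopology M) T"
      then have TS: "T \<subseteq> S" using openin_mtopology[OF MA] by simp
      have "\<forall>p\<in>T. \<exists>V. openin (mtopology N) V \<and> p \<in> V \<and> (\<forall>q\<in>V. q \<in> S \<longrightarrow> q \<in> T)"
      proof
        fix p assume p: "p \<in> T"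
        then have "\<forall>\<^sub>F q in mnhds M p. q \<in> T" using T eventually_openin[OF _ _ MA] by blast
        then have "\<forall>\<^sub>F q in mnhds N p. q \<in> S \<longrightarrow> q \<in> T" using nb p TS by auto
        moreover have "p \<in> points N" using p TS S by blast
        ultimately show "\<exists>V. openin (mtopology N) V \<and> p \<in> V \<and> (\<forall>q\<in>V. q \<in> S \<longrightarrow> q \<in> T)"
          using eventually_mnhds[OF NA] by blast
      qed
      then obtain V where V: "\<And>p. p \<in> T \<Longrightarrow> openin (mtopology N) (V p) \<and> p \<in> V p \<and> (\<forall>q\<in>V p. q \<in> S \<longrightarrow> q \<in> T)"
        by metis
      have "openin (mtopology N) (\<Union>p\<in>T. V p)" using V by (intro openin_Union) auto
      moreover have "T = (\<Union>p\<in>T. V p) \<inter> S" using V TS by blast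
      ultimately show "openin (subtopology (mtopology N) S) T" unfolding openin_subtopology by blast
    next
      assume "openin (subtopology (mtopology N) S) T"
      then obtain V where V: "openin (mtopology N) V" "T = V \<inter> S" unfolding openin_subtopology by blast
      have "\<forall>p\<in>T. \<forall>\<^sub>F q in mnhds M p. q \<in> T"
      proof
        fix p assume p: "p \<in> T"
        then have "\<forall>\<^sub>F q in mnhds N p. q \<in> V" using V eventually_openin[OF V(1) _ NA] by blast
        then have "\<forall>\<^sub>F q in mnhds N p. q \<in> S \<longrightarrow> q \<in> T" by eventually_elim (use V(2) in blast)
        then show "\<forall>\<^sub>F q in mnhds M p. q \<in> T" using nb p V(2) by blast
      qed
      then show "openin (mtopology M) T" using openin_iff_eventually[OF MA, of T] V(2) by simp
    qed
  qed
  have MM: "manifold M"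
    using N unfolding manifold_iff top
    by (simp add: MA Hausdorff_space_subtopology second_countable_subtopology)
  have incl: "smooth_at M N (\<lambda>x. x) p" if p: "p \<in> S" for p
  proof -
    have pU: "p \<in> U p" and pN: "p \<in> points N" using U(2)[OF p] p S by auto
    note x0 = \<psi>W[OF p p pU]
    have "\<forall>\<^sub>F q in mnhds N p. q \<in> chart_dom N p"
      by (rule eventually_mnhds_chart_dom[OF NA pN atlas_chart(1)[OF NA pN]])
    then have "\<forall>\<^sub>F q in mnhds N p. q \<in> S \<longrightarrow> q \<in> chart_dom N p" by eventually_elim simp
    then have 1: "\<forall>\<^sub>F q in mnhds M p. q \<in> chart_dom N p" by (simp add: nb[OF p])
    have c: "smooth_at N vspace (chart N p) (\<sigma> p (\<psi> p p))"
      unfolding x0(2) by (rule smooth_at_chart[OF NA pN atlas_chart(1)[OF NA pN]])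
    have "smooth_pt (\<lambda>x. chart N p (\<sigma> p x)) (\<psi> p p)"
      using smooth_at_compose(1)[OF \<sigma>(1)[OF p x0(1)] c] smooth_at_vspace[OF fd atlas_fin_dim[OF NA]] by blast
    then have "smooth_pt (\<lambda>x. chart N p (chart_inv M p x)) (\<psi> p p)"
      by (rule smooth_pt_cong) (use evW[OF p x0(1)] in \<open>eventually_elim, simp add: ci[OF p]\<close>)
    then show ?thesis unfolding smooth_at_def using MA NA p pN 1 by simp
  qed
  have "embedded_submanifold M N"
    unfolding embedded_submanifold_def
  proof (intro conjI ballI)
    show "manifold M" "manifold N" "points M \<subseteq> points N" using MM N S by auto
    show "mtopology M = subtopology (mtopology N) (points M)" using top by simp
    show "smooth_map M N (\<lambda>x. x)" using incl by (simp add: smooth_map_iff[OF MA NA])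
    fix p assume "p \<in> points M"
    then have p: "p \<in> S" by simp
    have pU: "p \<in> U p" by (rule U(2)[OF p])
    have id: "tangent_map N vspace (\<psi> p) p (tangent_map M N (\<lambda>x. x) p v) = v" for v
    proof -
      have "\<forall>\<^sub>F x in nhds (\<psi> p p). \<psi> p (chart_inv M p x) = x"
        using evW[OF p \<psi>W(1)[OF p p pU]] by eventually_elim (simp add: ci[OF p] \<sigma>(2)[OF p])
      from frechet_derivative_cong_eventually[OF this]
      have "tangent_map M vspace (\<psi> p) p v = v" unfolding tangent_map_eq by simp
      then show ?thesis using smooth_at_compose(2)[OF incl[OF p] \<psi>[OF p p pU], of v] by simp
    qed
    show "inj (tangent_map M N (\<lambda>x. x) p)" by (rule inj_on_inverseI) (rule id)
  qed
  moreover have "ambient_smooth M N"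
    unfolding ambient_smooth_def using MM N S incl nb \<psi> U(2) by simp
  ultimately show ?thesis by (intro exI[of _ M]) simp
qed

lemma ambient_smoothD:
  assumes "ambient_smooth M N"
  shows "manifold M" "manifold N" "points M \<subseteq> points N"
    "p \<in> points M \<Longrightarrow> smooth_at M N (\<lambda>x. x) p"
    "p \<in> points M \<Longrightarrow> smooth_at N vspace (chart M p) p"
    "p \<in> points M \<Longrightarrow> eventually P (mnhds M p) \<longleftrightarrow> (\<forall>\<^sub>F q in mnhds N p. q \<in> points M \<longrightarrow> P q)"
  using assms unfolding ambient_smooth_def by auto

lemma smooth_at_into_submanifold:
  assumes MN: "ambient_smooth M N" and f: "smooth_at Q N f x" and ev: "\<forall>\<^sub>F y in mnhds Q x. f y \<in> points M"
  shows "smooth_at Q M f x"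
proof -
  note D = ambient_smoothD[OF MN]
  note fx = smooth_atD[OF f] and MA = manifold_atlas[OF D(1)]
  have fM: "f x \<in> points M" by (rule eventually_mnhds_at[OF ev fx(1,3)])
  have "\<forall>\<^sub>F q in mnhds M (f x). q \<in> chart_dom M (f x)"
    by (rule eventually_mnhds_chart_dom[OF MA fM atlas_chart(1)[OF MA fM]])
  then have "\<forall>\<^sub>F y in mnhds Q x. f y \<in> points M \<longrightarrow> f y \<in> chart_dom M (f x)"
    using smooth_at_eventually_into[OF f] D(6)[OF fM] by blast
  with ev have 1: "\<forall>\<^sub>F y in mnhds Q x. f y \<in> chart_dom M (f x)" by eventually_elim simp
  have "smooth_pt (\<lambda>z. chart M (f x) (f (chart_inv Q x z))) (chart Q x x)"
    by (rule smooth_at_into_vspace[OF atlas_fin_dim[OF MA] fx(1,3), THEN iffD1, OF smooth_at_compose(1)[OF f D(5)[OF fM]]])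
  then show ?thesis unfolding smooth_at_def using fx MA fM 1 by blast
qed

lemma smooth_at_restrict_submanifold:
  assumes "ambient_smooth M N" "p \<in> points M" "smooth_at N Q f p"
  shows "smooth_at M Q f p"
  using smooth_at_compose(1)[OF ambient_smoothD(4)[OF assms(1,2)], of Q f] assms(3) by simp

lemma tangent_map_chart_self:
  assumes "atlas M" "p \<in> points M"
  shows "tangent_map M vspace (chart M p) p v = v"
proof -
  have "\<forall>\<^sub>F x in nhds (chart M p p). chart M p (chart_inv M p x) = x"
    using eventually_chart_image[OF assms imageI[OF atlas_chart(1)[OF assms]]]
    by eventually_elim (rule chart_inv_image(1)[OF assms])
  from frechet_derivative_cong_eventually[OF this] show ?thesis unfolding tangent_map_eq by simp
qed

subsection \<open>The inverse function theorem on manifolds\<close>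

theorem manifold_inverse_function:
  fixes M :: "('a, 'e::real_normed_vector) manifold" and N :: "('b, 'f::real_normed_vector) manifold"
  assumes f: "\<And>q. q \<in> points M \<Longrightarrow> smooth_at M N f q" and p: "p \<in> points M"
    and bij: "bij (tangent_map M N f p)"
  shows "\<exists>U h. openin (mtopology M) U \<and> p \<in> U \<and> openin (mtopology N) (f ` U) \<and>
    (\<forall>q\<in>U. h (f q) = q) \<and> (\<forall>r\<in>f ` U. smooth_at N M h r)"
proof -
  note fp = smooth_atD[OF f[OF p]]
  note MA = fp(1) and NA = fp(2)
  note pd = atlas_chart(1)[OF MA p] and fpd = atlas_chart(1)[OF NA fp(4)]
  let ?c = "chart M p" and ?ci = "chart_inv M p" and ?d = "chart N (f p)" and ?di = "chart_inv N (f p)"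
  define F where "F x = ?d (f (?ci x))" for x
  have ev: "\<forall>\<^sub>F x in nhds (?c p). x \<in> ?c ` chart_dom M p \<and> f (?ci x) \<in> chart_dom N (f p)"
    using eventually_chart_image[OF MA p imageI[OF pd]] fp(5)[unfolded eventually_mnhds_chart[OF MA p pd]]
    by eventually_elim simp
  then obtain W where W: "open W" "?c p \<in> W" "\<And>x. x \<in> W \<Longrightarrow> x \<in> ?c ` chart_dom M p \<and> f (?ci x) \<in> chart_dom N (f p)"
    unfolding eventually_nhds by blast
  have ciW: "?ci x \<in> points M" "?ci x \<in> chart_dom M p" "?c (?ci x) = x" if "x \<in> W" for x
    using chart_inv_image[OF MA p] W(3)[OF that] atlas_chart(2)[OF MA p] by auto
  have F: "smooth_pt F x" if x: "x \<in> W" for x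
  proof -
    have "smooth_at vspace M ?ci x" using smooth_at_chart_inv[OF MA p] W(3)[OF x] by blast
    from smooth_at_compose(1)[OF smooth_at_compose(1)[OF this f[OF ciW(1)[OF x]]]
        smooth_at_chart[OF NA fp(4)]] W(3)[OF x]
    have "smooth_at vspace vspace F x" unfolding F_def by blast
    then show ?thesis by (simp add: smooth_at_vspace[OF atlas_fin_dim[OF MA] atlas_fin_dim[OF NA]])
  qed
  have "bij (frechet_derivative F (at (?c p)))"
    using bij unfolding tangent_map_eq F_def .
  from inverse_function[OF atlas_fin_dim[OF MA] atlas_fin_dim[OF NA] W(1,2) F this]
  obtain V g where V: "open V" "?c p \<in> V" "V \<subseteq> W" "open (F ` V)" "\<And>x. x \<in> V \<Longrightarrow> g (F x) = x"
    "\<And>y. y \<in> F ` V \<Longrightarrow> smooth_pt g y" by blast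
  define U where "U = ?ci ` V"
  define h where "h r = ?ci (g (?d r))" for r
  have VW: "x \<in> W" if "x \<in> V" for x using V(3) that by blast
  have "V \<subseteq> ?c ` chart_dom M p" using W(3) VW by blast
  then have U: "openin (mtopology M) U" unfolding U_def by (rule openin_chart_inv_image[OF MA p V(1)])
  have pU: "p \<in> U" unfolding U_def using V(2) chart_inv_chart[OF MA p pd] by (metis imageI)
  have di: "?di (F x) = f (?ci x)" if "x \<in> V" for x
    unfolding F_def using chart_inv_chart[OF NA fp(4)] W(3)[OF VW[OF that]] by blast
  have "f ` U = ?di ` F ` V" unfolding U_def image_image using di by (intro image_cong) auto
  moreover have "F ` V \<subseteq> ?d ` chart_dom N (f p)" unfolding F_def using W(3) VW by blast
  ultimately have fU: "openin (mtopology N) (f ` U)" using openin_chart_inv_image[OF NA fp(4) V(4)] by simp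
  have hf: "h (f q) = q" if q: "q \<in> U" for q
  proof -
    obtain x where x: "x \<in> V" "q = ?ci x" using q unfolding U_def by blast
    then have "g (?d (f q)) = x" using V(5)[OF x(1)] unfolding F_def by simp
    then show ?thesis unfolding h_def x(2) by simp
  qed
  have "smooth_at N M h r" if rU: "r \<in> f ` U" for r
  proof -
    obtain x where x: "x \<in> V" "r = f (?ci x)" using rU unfolding U_def by blast
    have dr: "?d r = F x" unfolding F_def x(2) ..
    have r: "r \<in> chart_dom N (f p)" using W(3)[OF VW[OF x(1)]] x(2) by blast
    have g: "smooth_at vspace vspace g (?d r)"
      using V(6)[of "F x"] x(1) dr by (simp add: smooth_at_vspace[OF atlas_fin_dim[OF NA] atlas_fin_dim[OF MA]])
    have "smooth_at vspace M ?ci (g (?d r))"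
      unfolding dr V(5)[OF x(1)] using smooth_at_chart_inv[OF MA p] W(3)[OF VW[OF x(1)]] by blast
    from smooth_at_compose(1)[OF smooth_at_compose(1)[OF smooth_at_chart[OF NA fp(4) r] g] this]
    show ?thesis unfolding h_def .
  qed
  then show ?thesis using U pU fU hf by blast
qed

section \<open>The pairing\<close>

lemma pairing_eq: "pairing x y = blinfun_apply (snd y) (fst x) + blinfun_apply (snd x) (fst y)"
  by (cases x; cases y) simp

lemma pairing_commute: "pairing x y = pairing y x"
  by (simp add: pairing_eq)

lemma bounded_bilinear_pairing:
  "bounded_bilinear (pairing :: 'e::real_normed_vector \<times> 'e covector \<Rightarrow> _)"
proof
  fix a a' b b' :: "'e \<times> 'e covector" and r :: real
  show "pairing (a + a') b = pairing a b + pairing a' b" "pairing a (b + b') = pairing a b + pairing a b'"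
    by (simp_all add: pairing_eq blinfun.add_left blinfun.add_right)
  show "pairing (r *\<^sub>R a) b = r *\<^sub>R pairing a b" "pairing a (r *\<^sub>R b) = r *\<^sub>R pairing a b"
    by (simp_all add: pairing_eq blinfun.scaleR_left blinfun.scaleR_right distrib_left)
  have "norm (pairing a b) \<le> norm a * norm b * 2" for a b :: "'e \<times> 'e covector"
  proof -
    have le: "norm (fst x) \<le> norm x" "norm (snd x) \<le> norm x" for x :: "'e \<times> 'e covector"
      using norm_fst_le[of "fst x" "snd x"] norm_snd_le[of "snd x" "fst x"] by simp_all
    have 1: "norm (blinfun_apply (snd b) (fst a)) \<le> norm b * norm a"
      by (rule order_trans[OF norm_blinfun mult_mono[OF le(2) le(1)]]) auto
    have 2: "norm (blinfun_apply (snd a) (fst b)) \<le> norm a * norm b"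
      by (rule order_trans[OF norm_blinfun mult_mono[OF le(2) le(1)]]) auto
    show ?thesis
      unfolding pairing_eq using norm_triangle_ineq[of "blinfun_apply (snd b) (fst a)" "blinfun_apply (snd a) (fst b)"] 1 2
      by (simp add: mult.commute)
  qed
  then show "\<exists>K. \<forall>a b :: 'e \<times> 'e covector. norm (pairing a b) \<le> norm a * norm b * K" by blast
qed

lemmas pairing_add_left = bounded_bilinear.add_left[OF bounded_bilinear_pairing]
  and pairing_add_right = bounded_bilinear.add_right[OF bounded_bilinear_pairing]
  and pairing_diff_left = bounded_bilinear.diff_left[OF bounded_bilinear_pairing]
  and pairing_diff_right = bounded_bilinear.diff_right[OF bounded_bilinear_pairing]
  and pairing_minus_left = bounded_bilinear.minus_left[OF bounded_bilinear_pairing]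
  and pairing_minus_right = bounded_bilinear.minus_right[OF bounded_bilinear_pairing]
  and pairing_zero_left = bounded_bilinear.zero_left[OF bounded_bilinear_pairing]
  and pairing_zero_right = bounded_bilinear.zero_right[OF bounded_bilinear_pairing]
  and pairing_scaleR_left = bounded_bilinear.scaleR_left[OF bounded_bilinear_pairing]
  and pairing_scaleR_right = bounded_bilinear.scaleR_right[OF bounded_bilinear_pairing]

lemma covector_separates:
  assumes "fin_dim TYPE('e::real_normed_vector)" "\<And>\<xi> :: 'e covector. blinfun_apply \<xi> u = 0"
  shows "u = 0"
proof -
  obtain B :: "'e set" and c where B: "\<And>b. bounded_linear (c b)" "\<And>x. (\<Sum>b\<in>B. c b x *\<^sub>R b) = x"
    using fin_dim_coords[OF assms(1)] by metis
  have "c b u = 0" for b using assms(2)[of "Blinfun (c b)"] by (simp add: bounded_linear_Blinfun_apply B(1))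
  then show ?thesis using B(2)[of u] by simp
qed

lemma pairing_nondegenerate:
  fixes x :: "'e::real_normed_vector \<times> 'e covector"
  assumes "fin_dim TYPE('e)" "\<And>y. pairing x y = 0"
  shows "x = 0"
proof -
  have "blinfun_apply \<xi> (fst x) = 0" for \<xi> :: "'e covector" using assms(2)[of "(0, \<xi>)"] by (simp add: pairing_eq)
  then have "fst x = 0" by (rule covector_separates[OF assms(1)])
  moreover have "snd x = 0" using assms(2)[of "(_, 0)"] by (intro blinfun_eqI) (simp add: pairing_eq)
  ultimately show ?thesis by (simp add: prod_eq_iff)
qed

lemma lagrangian_iff: "lagrangian W \<Longrightarrow> x \<in> W \<longleftrightarrow> (\<forall>y\<in>W. pairing x y = 0)"
  unfolding lagrangian_def by blast

lemma lagrangian_pairing: "lagrangian W \<Longrightarrow> x \<in> W \<Longrightarrow> y \<in> W \<Longrightarrow> pairing x y = 0"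
  using lagrangian_iff by blast

text \<open>A basis of the projection \<open>I\<close> of \<open>W\<close> to the vectors lifts to \<open>W\<close>. When it is
  completed to a basis of the whole space, the coordinates along the new members vanish on \<open>I\<close> and
  are therefore orthogonal to \<open>W\<close>, that is, in \<open>W\<close>. The lifts and these covectors are a basis of \<open>W\<close>.\<close>

lemma lagrangian_parametrization:
  fixes W :: "('e::real_normed_vector \<times> 'e covector) set"
  assumes fd: "fin_dim TYPE('e)" and W: "subspace W" "lagrangian W"
  shows "\<exists>h :: 'e \<Rightarrow> 'e \<times> 'e covector. linear h \<and> inj h \<and> range h = W"
proof -
  obtain B0 where B0: "B0 \<subseteq> fst ` W" "independent B0" "fst ` W \<subseteq> span B0"
    using maximal_independent_subset[of "fst ` W"] by blast
  define B where "B = extend_basis B0"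
  have B: "B0 \<subseteq> B" "independent B" "span B = UNIV"
    unfolding B_def using extend_basis_superset[OF B0(2)] independent_extend_basis[OF B0(2)] span_extend_basis[OF B0(2)]
    by auto
  obtain S :: "'e set" where S: "finite S" "span S = UNIV" using fd unfolding fin_dim_def by blast
  have finB: "finite B" using independent_span_bound[OF S(1) B(2)] S(2) by simp
  define c where "c b x = representation B x b" for b x
  have c_lin: "linear (c b)" for b
    unfolding c_def using B by (intro linearI) (auto simp: representation_add representation_scale)
  then have c: "bounded_linear (c b)" for b by (rule fin_dim_bounded_linear[OF fd])
  have sum: "(\<Sum>b\<in>B. c b x *\<^sub>R b) = x" for x
    unfolding c_def using sum_representation_eq[of B x B] B finB by auto
  have cb: "c b b' = (if b = b' then 1 else 0)" if "b' \<in> B" for b b'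
    unfolding c_def using representation_basis[OF B(2) that] by auto
  have cI: "c b x = 0" if "b \<in> B - B0" "x \<in> span B0" for b x
  proof -
    have "c b x = representation B0 x b" unfolding c_def using representation_extend[OF B(2) that(2) B(1)] by simp
    then show ?thesis using representation_ne_zero[of B0 x b] that(1) by auto
  qed
  have "\<forall>b\<in>B0. \<exists>x\<in>W. fst x = b" using B0(1) by blast
  then obtain xw where xw: "\<And>b. b \<in> B0 \<Longrightarrow> xw b \<in> W \<and> fst (xw b) = b" by metis
  define e where "e b = (if b \<in> B0 then xw b else (0, Blinfun (c b)))" for b
  have eW: "e b \<in> W" if "b \<in> B" for b
  proof (cases "b \<in> B0")
    case False
    have "pairing (0, Blinfun (c b)) y = 0" if y: "y \<in> W" for y
    proof -
      have "fst y \<in> span B0" using B0(3) y by blast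
      then show ?thesis using cI[of b "fst y"] False \<open>b \<in> B\<close> by (simp add: pairing_eq bounded_linear_Blinfun_apply c)
    qed
    then have "(0, Blinfun (c b)) \<in> W" by (subst lagrangian_iff[OF W(2)]) blast
    then show ?thesis using False by (simp add: e_def)
  qed (simp add: e_def xw)
  define h where "h x = (\<Sum>b\<in>B. c b x *\<^sub>R e b)" for x
  have h_lin: "linear h"
    unfolding h_def
    by (intro linearI) (simp_all add: linear_add[OF c_lin] linear_scale[OF c_lin] scaleR_add_left sum.distrib scaleR_sum_right)
  have split: "(\<Sum>b\<in>B. c b x *\<^sub>R e b) = (\<Sum>b\<in>B0. c b x *\<^sub>R xw b) + (\<Sum>b\<in>B - B0. c b x *\<^sub>R (0, Blinfun (c b)))" for x
    using sum.subset_diff[OF B(1) finB, of "\<lambda>b. c b x *\<^sub>R e b"] by (simp add: e_def add.commute)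
  have fsth: "fst (h x) = (\<Sum>b\<in>B0. c b x *\<^sub>R b)" for x
    unfolding h_def split by (simp add: fst_sum xw)
  have hW: "h x \<in> W" for x
    unfolding h_def by (intro subspace_sum[OF W(1)] subspace_scale[OF W(1)] eW)
  have inj: "x = 0" if hx: "h x = 0" for x
  proof -
    have z: "(\<Sum>b\<in>B0. c b x *\<^sub>R b) = 0" using fsth[of x] hx by simp
    have "independent B0" by (rule B0(2))
    then have c0: "c b x = 0" if "b \<in> B0" for b
      using z that finite_subset[OF B(1) finB] independentD[of B0 B0 "\<lambda>b. c b x" b] by blast
    then have "(\<Sum>b\<in>B - B0. c b x *\<^sub>R (0 :: 'e, Blinfun (c b))) = 0"
      using hx unfolding h_def split by simp
    then have "(\<Sum>b\<in>B - B0. c b x *\<^sub>R Blinfun (c b)) = 0"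
      by (metis (no_types, lifting) scaleR_Pair snd_conv snd_sum sum.cong snd_zero)
    then have *: "(\<Sum>b\<in>B - B0. c b x *\<^sub>R Blinfun (c b)) b' = 0" for b' by simp
    have "c b' x = 0" if b': "b' \<in> B - B0" for b'
    proof -
      have "(\<Sum>b\<in>B - B0. c b x *\<^sub>R Blinfun (c b)) b' = (\<Sum>b\<in>B - B0. if b = b' then c b' x else 0)"
        unfolding blinfun.sum_left using b'
        by (intro sum.cong) (auto simp: blinfun.scaleR_left bounded_linear_Blinfun_apply c cb)
      also have "\<dots> = c b' x" using b' finB by simp
      finally show ?thesis using * by simp
    qed
    then have "c b x = 0" if "b \<in> B" for b using c0 that by blast
    then show ?thesis using sum[of x] by simp
  qed
  have surj: "x \<in> range h" if x: "x \<in> W" for x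
  proof -
    have span0: "fst x \<in> span B0" using B0(3) x by blast
    define y where "y = x - h (fst x)"
    have yW: "y \<in> W" unfolding y_def using x hW by (intro subspace_diff[OF W(1)])
    have "(\<Sum>b\<in>B - B0. c b (fst x) *\<^sub>R b) = 0" using cI[OF _ span0] by simp
    then have "fst (h (fst x)) = fst x"
      using sum.subset_diff[OF B(1) finB, of "\<lambda>b. c b (fst x) *\<^sub>R b"] sum[of "fst x"] fsth[of "fst x"] by simp
    then have fy: "fst y = 0" unfolding y_def by simp
    define z where "z = (\<Sum>b\<in>B - B0. snd y b *\<^sub>R b)"
    have yb: "snd y b = 0" if "b \<in> B0" for b
      using lagrangian_pairing[OF W(2) yW, of "xw b"] xw[OF that] fy by (simp add: pairing_eq)
    have cz: "c b z = (if b \<in> B0 then 0 else snd y b)" if b: "b \<in> B" for b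
    proof -
      have "c b z = (\<Sum>a\<in>B - B0. snd y a * c b a)"
        unfolding z_def using linear_sum[OF c_lin[of b], of "\<lambda>a. snd y a *\<^sub>R a" "B - B0"] by (simp add: linear_scale[OF c_lin])
      also have "\<dots> = (\<Sum>a\<in>B - B0. if a = b then snd y b else 0)"
        by (intro sum.cong) (auto simp: cb)
      also have "\<dots> = (if b \<in> B0 then 0 else snd y b)" using b finB by auto
      finally show ?thesis .
    qed
    have "h z = (\<Sum>b\<in>B - B0. c b z *\<^sub>R (0, Blinfun (c b)))"
      unfolding h_def split using cz B(1) by (simp add: subset_iff)
    also have "\<dots> = y"
    proof -
      have "snd y = (\<Sum>b\<in>B - B0. c b z *\<^sub>R Blinfun (c b))"
      proof (rule blinfun_eqI)
        fix v
        have "snd y v = snd y (\<Sum>b\<in>B. c b v *\<^sub>R b)" by (simp add: sum)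
        also have "\<dots> = (\<Sum>b\<in>B. c b v * snd y b)" by (simp add: blinfun.sum_right blinfun.scaleR_right)
        also have "\<dots> = (\<Sum>b\<in>B - B0. c b v * snd y b)"
          using sum.subset_diff[OF B(1) finB, of "\<lambda>b. c b v * snd y b"] yb by simp
        also have "\<dots> = (\<Sum>b\<in>B - B0. c b z *\<^sub>R Blinfun (c b)) v"
          unfolding blinfun.sum_left using cz
          by (intro sum.cong) (auto simp: blinfun.scaleR_left bounded_linear_Blinfun_apply c)
        finally show "snd y v = (\<Sum>b\<in>B - B0. c b z *\<^sub>R Blinfun (c b)) v" .
      qed
      then show ?thesis by (intro prod_eqI) (simp_all add: fst_sum snd_sum fy)
    qed
    finally have "x = h (fst x + z)" by (simp add: linear_add[OF h_lin] y_def)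
    then show ?thesis by blast
  qed
  have "inj h" using inj by (simp add: linear_injective_0[OF h_lin])
  then show ?thesis using h_lin hW surj by blast
qed

lemma sharp_eqI:
  fixes P :: "'e::real_normed_vector bivector"
  assumes fd: "fin_dim TYPE('e)" and w: "\<And>\<beta>. blinfun_apply \<beta> w = P \<alpha> \<beta>"
  shows "sharp P \<alpha> = w"
  unfolding sharp_def
proof (rule the_equality)
  fix w' assume w': "\<forall>\<beta>. blinfun_apply \<beta> w' = P \<alpha> \<beta>"
  have "w' - w = 0" by (rule covector_separates[OF fd]) (simp add: blinfun.diff_right w w')
  then show "w' = w" by simp
qed (use w in blast)

lemma sharp_apply:
  fixes P :: "'e::real_normed_vector bivector"
  assumes fd: "fin_dim TYPE('e)" and P: "linear (P \<alpha>)"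
  shows "blinfun_apply \<beta> (sharp P \<alpha>) = P \<alpha> \<beta>"
proof -
  obtain B :: "'e set" and c where B: "\<And>b. bounded_linear (c b)" "\<And>x. (\<Sum>b\<in>B. c b x *\<^sub>R b) = x"
    using fin_dim_coords[OF fd] by metis
  define w where "w = (\<Sum>b\<in>B. P \<alpha> (Blinfun (c b)) *\<^sub>R b)"
  have w: "blinfun_apply \<beta> w = P \<alpha> \<beta>" for \<beta>
  proof -
    have "blinfun_apply \<beta> w = (\<Sum>b\<in>B. \<beta> b * P \<alpha> (Blinfun (c b)))"
      unfolding w_def by (simp add: blinfun.sum_right blinfun.scaleR_right mult.commute)
    also have "\<dots> = P \<alpha> (\<Sum>b\<in>B. \<beta> b *\<^sub>R Blinfun (c b))"
      using linear_sum[OF P, of "\<lambda>b. \<beta> b *\<^sub>R Blinfun (c b)" B] by (simp add: linear_scale[OF P])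
    also have "(\<Sum>b\<in>B. \<beta> b *\<^sub>R Blinfun (c b)) = \<beta>"
    proof (rule blinfun_eqI)
      fix v
      have "\<beta> (\<Sum>b\<in>B. c b v *\<^sub>R b) = (\<Sum>b\<in>B. \<beta> b *\<^sub>R Blinfun (c b)) v"
        by (simp add: blinfun.sum_right blinfun.scaleR_right blinfun.sum_left blinfun.scaleR_left
            bounded_linear_Blinfun_apply B(1) mult.commute)
      then show "(\<Sum>b\<in>B. \<beta> b *\<^sub>R Blinfun (c b)) v = \<beta> v" by (simp add: B(2))
    qed
    finally show ?thesis .
  qed
  show ?thesis unfolding sharp_eqI[of w P \<alpha>, OF fd w] by (rule w)
qed

lemma cov_pull_apply: "bounded_linear A \<Longrightarrow> blinfun_apply (cov_pull A \<alpha>) v = blinfun_apply \<alpha> (A v)"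
  unfolding cov_pull_def
  by (rule bounded_linear_Blinfun_apply[OF bounded_linear_compose[OF blinfun.bounded_linear_right], THEN fun_cong])

text \<open>\<open>A\<close> intertwines the contractions with \<open>P\<close> and with the pushforward \<open>A\<^sub>* P\<close>.\<close>

lemma sharp_push_bivector:
  fixes A :: "'e::real_normed_vector \<Rightarrow> 'f::real_normed_vector"
  assumes fd: "fin_dim TYPE('e)" "fin_dim TYPE('f)" and A: "bounded_linear A" and P: "linear (P (cov_pull A \<alpha>))"
  shows "sharp (push_bivector A P) \<alpha> = A (sharp P (cov_pull A \<alpha>))"
proof (rule sharp_eqI[OF fd(2)])
  fix \<beta> :: "'f covector"
  have "blinfun_apply \<beta> (A (sharp P (cov_pull A \<alpha>))) = blinfun_apply (cov_pull A \<beta>) (sharp P (cov_pull A \<alpha>))"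
    by (simp add: cov_pull_apply[OF A])
  also have "\<dots> = push_bivector A P \<alpha> \<beta>"
    unfolding push_bivector_def by (rule sharp_apply[OF fd(1), of P, OF P])
  finally show "blinfun_apply \<beta> (A (sharp P (cov_pull A \<alpha>))) = push_bivector A P \<alpha> \<beta>" .
qed

lemma lagrangian_image:
  assumes iso: "\<And>x y. pairing (\<Phi> x) (\<Phi> y) = pairing x y" and surj: "surj \<Phi>" and W: "lagrangian W"
  shows "lagrangian (\<Phi> ` W)"
  unfolding lagrangian_def
proof (rule Set.set_eqI, rule iffI)
  fix x assume "x \<in> \<Phi> ` W"
  then show "x \<in> {x. \<forall>y\<in>\<Phi> ` W. pairing x y = 0}" using iso lagrangian_pairing[OF W] by auto
next
  fix x assume x: "x \<in> {x. \<forall>y\<in>\<Phi> ` W. pairing x y = 0}"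
  obtain z where z: "x = \<Phi> z" using surj by (metis surjD)
  have "z \<in> W" unfolding lagrangian_iff[OF W] using x iso unfolding z by auto
  then show "x \<in> \<Phi> ` W" unfolding z by (rule imageI)
qed

section \<open>The double as the ambient group\<close>

locale drinfeld_setup =
  fixes G :: "('g, 'e::real_normed_vector) lie_group" and \<pi> :: "'g \<Rightarrow> 'e bivector"
    and b :: "'e \<times> 'e covector \<Rightarrow> 'e \<times> 'e covector \<Rightarrow> 'e \<times> 'e covector"
    and D :: "('d, 'f::real_normed_vector) lie_group" and \<iota>\<^sub>D :: "'f \<Rightarrow> 'e \<times> 'e covector"
    and \<phi>\<^sub>G :: "'g \<Rightarrow> 'd"
    and \<ll> :: "('e \<times> 'e covector) set"
    and Gs :: "('k, 'p::real_normed_vector) lie_group" and \<iota>\<^sub>K :: "'p \<Rightarrow> 'e covector"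
    and \<phi>\<^sub>K :: "'k \<Rightarrow> 'd"
    and L :: "('l, 'q::real_normed_vector) lie_group" and \<iota>\<^sub>L :: "'q \<Rightarrow> 'e \<times> 'e covector"
    and \<phi>\<^sub>L :: "'l \<Rightarrow> 'd"
  assumes poisson_lie: "poisson_lie_group G \<pi>"
    and double: "double_bracket G \<pi> b"
    and drinfeld: "drinfeld_double G \<pi> b D \<iota>\<^sub>D \<phi>\<^sub>G"
    and lagr: "lagrangian_subalgebra b \<ll>"
    and dual_group: "has_lie_algebra Gs \<iota>\<^sub>K UNIV (dual_bracket G \<pi>)"
    and dual_hom: "integration Gs \<iota>\<^sub>K D \<iota>\<^sub>D (\<lambda>\<xi>. (0, \<xi>)) \<phi>\<^sub>K"
    and lagr_group: "has_lie_algebra L \<iota>\<^sub>L \<ll> b"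
    and lagr_hom: "integration L \<iota>\<^sub>L D \<iota>\<^sub>D (\<lambda>x. x) \<phi>\<^sub>L"
begin

lemma LG: "lie_group G" and LD: "lie_group D" and LK: "lie_group Gs" and LL: "lie_group L"
  using poisson_lie drinfeld dual_group lagr_group
  unfolding poisson_lie_group_def drinfeld_double_def has_lie_algebra_def by auto

lemma hom_G: "lie_hom G D \<phi>\<^sub>G" and hom_K: "lie_hom Gs D \<phi>\<^sub>K" and hom_L: "lie_hom L D \<phi>\<^sub>L"
  using drinfeld dual_hom lagr_hom unfolding drinfeld_double_def integration_def by auto

lemma T\<phi>_G: "\<iota>\<^sub>D (tangent_map (mfd G) (mfd D) \<phi>\<^sub>G \<one>\<^bsub>G\<^esub> u) = (u, 0)"
  and T\<phi>_K: "\<iota>\<^sub>D (tangent_map (mfd Gs) (mfd D) \<phi>\<^sub>K \<one>\<^bsub>Gs\<^esub> w) = (0, \<iota>\<^sub>K w)"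
  and T\<phi>_L: "\<iota>\<^sub>D (tangent_map (mfd L) (mfd D) \<phi>\<^sub>L \<one>\<^bsub>L\<^esub> z) = \<iota>\<^sub>L z"
  using drinfeld dual_hom lagr_hom unfolding drinfeld_double_def integration_def by auto

lemma \<iota>\<^sub>D: "linear \<iota>\<^sub>D" "inj \<iota>\<^sub>D" "range \<iota>\<^sub>D = UNIV" "\<iota>\<^sub>D (lie_alg_bracket D v w) = b (\<iota>\<^sub>D v) (\<iota>\<^sub>D w)"
  using drinfeld unfolding drinfeld_double_def has_lie_algebra_def by auto

lemma \<iota>\<^sub>K: "linear \<iota>\<^sub>K" "inj \<iota>\<^sub>K" "range \<iota>\<^sub>K = UNIV"
  using dual_group unfolding has_lie_algebra_def by auto

lemma \<iota>\<^sub>L: "linear \<iota>\<^sub>L" "inj \<iota>\<^sub>L" "range \<iota>\<^sub>L = \<ll>"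
  using lagr_group unfolding has_lie_algebra_def by auto

lemma l_subspace: "subspace \<ll>" and l_closed: "x \<in> \<ll> \<Longrightarrow> y \<in> \<ll> \<Longrightarrow> b x y \<in> \<ll>" and l_lagr: "lagrangian \<ll>"
  using lagr unfolding lagrangian_subalgebra_def by auto

lemma fdE: "fin_dim TYPE('e)" and fdQ: "fin_dim TYPE('q)" and fdF: "fin_dim TYPE('f)"
  by (rule lie_group_fin_dim[OF LG], rule lie_group_fin_dim[OF LL], rule lie_group_fin_dim[OF LD])

lemma fd_double: "fin_dim TYPE('e \<times> 'e covector)"
  by (rule fin_dim_prod[OF fdE fin_dim_covector[OF fdE]])

lemma b_bilinear: "bilinear b" and b_self: "b x x = 0"
  and b_inv: "pairing (b x y) z + pairing y (b x z) = 0"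
  and b_g: "b (u, 0) (w, 0) = (lie_alg_bracket G u w, 0)"
  and b_dual: "b (0, \<xi>) (0, \<eta>) = (0, dual_bracket G \<pi> \<xi> \<eta>)"
proof -
  note d = double[unfolded double_bracket_def lie_algebra_bracket_def]
  show "bilinear b" "b x x = 0" "pairing (b x y) z + pairing y (b x z) = 0"
    "b (u, 0) (w, 0) = (lie_alg_bracket G u w, 0)" "b (0, \<xi>) (0, \<eta>) = (0, dual_bracket G \<pi> \<xi> \<eta>)"
    using d by blast+
qed

lemma b_add_left: "b (x + y) z = b x z + b y z" and b_add_right: "b x (y + z) = b x y + b x z"
  and b_diff_left: "b (x - y) z = b x z - b y z" and b_diff_right: "b x (y - z) = b x y - b x z"
  and b_minus_left: "b (- x) z = - b x z" and b_minus_right: "b x (- z) = - b x z"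
  by (rule bilinear_ladd[OF b_bilinear], rule bilinear_radd[OF b_bilinear], rule bilinear_lsub[OF b_bilinear],
      rule bilinear_rsub[OF b_bilinear], rule bilinear_lneg[OF b_bilinear], rule bilinear_rneg[OF b_bilinear])

lemma b_swap: "b y x = - b x y"
proof -
  have "b (x + y) (x + y) = 0" by (rule b_self)
  then have "b y x + b x y = 0" unfolding b_add_left b_add_right by (simp add: b_self add.commute)
  then show ?thesis by (simp add: eq_neg_iff_add_eq_0)
qed

text \<open>The Cartan three-form of the double, alternating because the pairing is invariant.\<close>

definition cartan :: "'e \<times> 'e covector \<Rightarrow> 'e \<times> 'e covector \<Rightarrow> 'e \<times> 'e covector \<Rightarrow> real" where
  "cartan x y z = pairing (b x y) z"

lemma cartan_swap12: "cartan y x z = - cartan x y z"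
  unfolding cartan_def by (subst b_swap) (rule pairing_minus_left)

lemma cartan_swap23: "cartan x z y = - cartan x y z"
  using b_inv[of x y z] unfolding cartan_def by (simp add: pairing_commute[of y])

lemma cartan_cyclic: "cartan y z x = cartan x y z"
  by (metis cartan_swap12 cartan_swap23 minus_minus)

lemma cartan_add: "cartan (x + x') y z = cartan x y z + cartan x' y z" "cartan x (y + y') z = cartan x y z + cartan x y' z"
    "cartan x y (z + z') = cartan x y z + cartan x y z'"
  and cartan_diff: "cartan (x - x') y z = cartan x y z - cartan x' y z" "cartan x (y - y') z = cartan x y z - cartan x y' z"
    "cartan x y (z - z') = cartan x y z - cartan x y z'"
  and cartan_minus: "cartan (- x) y z = - cartan x y z" "cartan x (- y) z = - cartan x y z" "cartan x y (- z) = - cartan x y z"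
  unfolding cartan_def
  by (simp_all add: b_add_left b_add_right b_diff_left b_diff_right b_minus_left b_minus_right
      pairing_add_left pairing_add_right pairing_diff_left pairing_diff_right pairing_minus_left pairing_minus_right)

text \<open>The three-form vanishes on each isotropic subalgebra.\<close>

lemma cartan_g: "cartan (u, 0) (v, 0) (w, 0) = 0"
  unfolding cartan_def b_g by simp

lemma cartan_dual: "cartan (0, \<xi>) (0, \<eta>) (0, \<zeta>) = 0"
  unfolding cartan_def b_dual by simp

lemma cartan_l: "x \<in> \<ll> \<Longrightarrow> y \<in> \<ll> \<Longrightarrow> z \<in> \<ll> \<Longrightarrow> cartan x y z = 0"
  unfolding cartan_def by (intro lagrangian_pairing[OF l_lagr] l_closed)

definition jD :: "'e \<times> 'e covector \<Rightarrow> 'f" where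
  "jD = inv_into UNIV \<iota>\<^sub>D"

lemma jD: "\<iota>\<^sub>D (jD x) = x" "jD (\<iota>\<^sub>D v) = v" "linear jD"
proof -
  have bij: "bij \<iota>\<^sub>D" using \<iota>\<^sub>D(2,3) by (simp add: bij_def)
  show "\<iota>\<^sub>D (jD x) = x" "jD (\<iota>\<^sub>D v) = v" "linear jD"
    unfolding jD_def using bij linear_inv_of_bij[OF \<iota>\<^sub>D(1) bij]
    by (auto simp: bij_is_surj surj_f_inv_f bij_is_inj)
qed

text \<open>The adjoint action and, below, the Maurer--Cartan form of \<open>D\<close> are moved to \<open>\<gg> \<oplus> \<gg>\<^sup>*\<close> along
  \<open>\<iota>\<^sub>D\<close>, where the values of the four forms of the groupoid can be compared.\<close>

definition AdD :: "'d \<Rightarrow> 'e \<times> 'e covector \<Rightarrow> 'e \<times> 'e covector" where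
  "AdD d x = \<iota>\<^sub>D (Ad D d (jD x))"

lemma linear_AdD:
  assumes d: "d \<in> carrier D"
  shows "linear (AdD d)"
proof -
  have "linear (\<lambda>x. \<iota>\<^sub>D (Ad D d (jD x)))"
    using linear_compose[OF linear_compose[OF jD(3) linear_Ad[OF LD d]] \<iota>\<^sub>D(1)] by (simp add: comp_def)
  then show ?thesis unfolding AdD_def[abs_def] .
qed

lemma AdD_add: "d \<in> carrier D \<Longrightarrow> AdD d (x + y) = AdD d x + AdD d y"
  and AdD_diff: "d \<in> carrier D \<Longrightarrow> AdD d (x - y) = AdD d x - AdD d y"
  and AdD_zero: "d \<in> carrier D \<Longrightarrow> AdD d 0 = 0"
  using linear_AdD linear_add linear_diff linear_0 by blast+

lemma AdD_mult: "d \<in> carrier D \<Longrightarrow> d' \<in> carrier D \<Longrightarrow> AdD (d \<otimes>\<^bsub>D\<^esub> d') x = AdD d (AdD d' x)"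
  by (simp add: AdD_def jD Ad_mult[OF LD])

lemma AdD_inv: "d \<in> carrier D \<Longrightarrow> AdD (inv\<^bsub>D\<^esub> d) (AdD d x) = x" "d \<in> carrier D \<Longrightarrow> AdD d (AdD (inv\<^bsub>D\<^esub> d) x) = x"
  by (simp_all add: AdD_def jD Ad_inv_cancel[OF LD])

lemma AdD_pairing: "d \<in> carrier D \<Longrightarrow> pairing (AdD d x) (AdD d y) = pairing x y"
  using drinfeld unfolding drinfeld_double_def AdD_def by (metis jD(1))

lemma AdD_b: "d \<in> carrier D \<Longrightarrow> AdD d (b x y) = b (AdD d x) (AdD d y)"
proof -
  assume d: "d \<in> carrier D"
  have "jD (b x y) = lie_alg_bracket D (jD x) (jD y)"
    using \<iota>\<^sub>D(4)[of "jD x" "jD y"] by (metis jD(1,2))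
  then show ?thesis by (simp add: AdD_def Ad_lie_alg_bracket[OF LD d] \<iota>\<^sub>D(4))
qed

lemma AdD_cartan: "d \<in> carrier D \<Longrightarrow> cartan (AdD d x) (AdD d y) (AdD d z) = cartan x y z"
  by (simp add: cartan_def AdD_b[symmetric] AdD_pairing)

lemma AdD_pairing_inv: "d \<in> carrier D \<Longrightarrow> pairing (AdD d x) y = pairing x (AdD (inv\<^bsub>D\<^esub> d) y)"
  using AdD_pairing[of d x "AdD (inv\<^bsub>D\<^esub> d) y"] by (simp add: AdD_inv)

lemma \<phi>_closed:
  "g \<in> carrier G \<Longrightarrow> \<phi>\<^sub>G g \<in> carrier D" "k \<in> carrier Gs \<Longrightarrow> \<phi>\<^sub>K k \<in> carrier D" "l \<in> carrier L \<Longrightarrow> \<phi>\<^sub>L l \<in> carrier D"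
  using hom_G hom_K hom_L unfolding lie_hom_def hom_def by auto

lemma AdD_G: "g \<in> carrier G \<Longrightarrow> AdD (\<phi>\<^sub>G g) (u, \<xi>) = double_Ad G \<pi> g (u, \<xi>)"
  using drinfeld unfolding drinfeld_double_def AdD_def by (metis jD(1))

lemma AdD_G_g: "g \<in> carrier G \<Longrightarrow> AdD (\<phi>\<^sub>G g) (u, 0) = (Ad G g u, 0)"
  using tangent_map_hom_Ad[OF LG LD hom_G, of g u] by (metis AdD_def T\<phi>_G jD(2))

text \<open>A homomorphism into \<open>D\<close> intertwines the adjoint actions; therefore \<open>G\<^sup>*\<close>
  preserves \<open>\<gg>\<^sup>*\<close> and \<open>L\<close> preserves \<open>\<ll>\<close>.\<close>

lemma AdD_K: "k \<in> carrier Gs \<Longrightarrow> \<exists>\<eta>. AdD (\<phi>\<^sub>K k) (0, \<xi>) = (0, \<eta>)"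
proof -
  assume k: "k \<in> carrier Gs"
  obtain p where p: "\<xi> = \<iota>\<^sub>K p" using \<iota>\<^sub>K(3) by blast
  show ?thesis
    using tangent_map_hom_Ad[OF LK LD hom_K k, of p] unfolding p by (metis AdD_def T\<phi>_K jD(2))
qed

lemma AdD_L: "l \<in> carrier L \<Longrightarrow> x \<in> \<ll> \<Longrightarrow> AdD (\<phi>\<^sub>L l) x \<in> \<ll>"
proof -
  assume l: "l \<in> carrier L" and "x \<in> \<ll>"
  then obtain q where q: "x = \<iota>\<^sub>L q" using \<iota>\<^sub>L(3) by blast
  have "AdD (\<phi>\<^sub>L l) x = \<iota>\<^sub>L (Ad L l q)"
    using tangent_map_hom_Ad[OF LL LD hom_L l, of q] unfolding q by (metis AdD_def T\<phi>_L jD(2))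
  then show ?thesis using \<iota>\<^sub>L(3) by auto
qed

definition RD :: "('a, 'm::real_normed_vector) manifold \<Rightarrow> ('a \<Rightarrow> 'd) \<Rightarrow> 'a \<Rightarrow> 'm \<Rightarrow> 'e \<times> 'e covector" where
  "RD M f p v = \<iota>\<^sub>D (mcR M D f p v)"

lemma RD_mult:
  assumes "smooth_at M (mfd D) f p" "smooth_at M (mfd D) g p"
  shows "RD M (\<lambda>x. f x \<otimes>\<^bsub>D\<^esub> g x) p v = RD M f p v + AdD (f p) (RD M g p v)"
  by (simp add: RD_def AdD_def jD mcR_mult[OF LD assms] linear_add[OF \<iota>\<^sub>D(1)])

lemma RD_inv:
  assumes "smooth_at M (mfd D) f p"
  shows "RD M (\<lambda>x. inv\<^bsub>D\<^esub> f x) p v = - AdD (inv\<^bsub>D\<^esub> f p) (RD M f p v)"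
  by (simp add: RD_def AdD_def jD mcR_inv[OF LD assms] linear_neg[OF \<iota>\<^sub>D(1)])

lemma RD_G: "smooth_at M (mfd G) g p \<Longrightarrow> RD M (\<lambda>x. \<phi>\<^sub>G (g x)) p v = (mcR M G g p v, 0)"
  by (simp add: RD_def mcR_hom[OF LG LD hom_G] T\<phi>_G)

lemma RD_K: "smooth_at M (mfd Gs) k p \<Longrightarrow> RD M (\<lambda>x. \<phi>\<^sub>K (k x)) p v = (0, \<iota>\<^sub>K (mcR M Gs k p v))"
  by (simp add: RD_def mcR_hom[OF LK LD hom_K] T\<phi>_K)

lemma RD_L: "smooth_at M (mfd L) l p \<Longrightarrow> RD M (\<lambda>x. \<phi>\<^sub>L (l x)) p v = \<iota>\<^sub>L (mcR M L l p v)"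
  by (simp add: RD_def mcR_hom[OF LL LD hom_L] T\<phi>_L)

lemma
  shows smooth_\<phi>_G: "smooth_at M (mfd G) g p \<Longrightarrow> smooth_at M (mfd D) (\<lambda>x. \<phi>\<^sub>G (g x)) p"
    and smooth_\<phi>_K: "smooth_at M (mfd Gs) k p \<Longrightarrow> smooth_at M (mfd D) (\<lambda>x. \<phi>\<^sub>K (k x)) p"
    and smooth_\<phi>_L: "smooth_at M (mfd L) l p \<Longrightarrow> smooth_at M (mfd D) (\<lambda>x. \<phi>\<^sub>L (l x)) p"
  by (rule smooth_at_compose(1), assumption, rule lie_hom_smooth_at[OF hom_G LG LD smooth_at_carrier[OF LG]], assumption,
      rule smooth_at_compose(1), assumption, rule lie_hom_smooth_at[OF hom_K LK LD smooth_at_carrier[OF LK]], assumption,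
      rule smooth_at_compose(1), assumption, rule lie_hom_smooth_at[OF hom_L LL LD smooth_at_carrier[OF LL]], assumption)

lemma linear_RD:
  assumes "smooth_at M (mfd D) f p"
  shows "linear (RD M f p)"
proof -
  have "linear (\<lambda>v. \<iota>\<^sub>D (mcR M D f p v))"
    using linear_compose[OF linear_mcR[OF LD assms] \<iota>\<^sub>D(1)] by (simp add: comp_def)
  then show ?thesis unfolding RD_def[abs_def] .
qed

lemma smooth_pt_RD:
  fixes \<gamma> :: "'x::real_normed_vector \<Rightarrow> 'd"
  assumes "smooth_at vspace (mfd D) \<gamma> x0" "smooth_pt w x0"
  shows "smooth_pt (\<lambda>x. RD vspace \<gamma> x (w x)) x0"
  unfolding RD_def by (rule smooth_pt_linear_comp[OF fdF \<iota>\<^sub>D(1) smooth_pt_mcR[OF LD assms]])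

lemma RD_maurer_cartan:
  fixes \<gamma> :: "'x::real_normed_vector \<Rightarrow> 'd"
  assumes \<gamma>: "smooth_at vspace (mfd D) \<gamma> x0"
  shows "frechet_derivative (\<lambda>x. RD vspace \<gamma> x v) (at x0) u - frechet_derivative (\<lambda>x. RD vspace \<gamma> x u) (at x0) v =
    - b (RD vspace \<gamma> x0 u) (RD vspace \<gamma> x0 v)"
proof -
  have "frechet_derivative (\<lambda>x. RD vspace \<gamma> x v) (at x0) u =
      \<iota>\<^sub>D (frechet_derivative (\<lambda>x. mcR vspace D \<gamma> x v) (at x0) u)" for u v
    unfolding RD_def
    by (simp add: frechet_derivative_eqI[OF bounded_linear.has_derivative[OF fin_dim_bounded_linear[OF fdF \<iota>\<^sub>D(1)]
            smooth_pt_has_derivative[OF smooth_pt_mcR[OF LD \<gamma> smooth_pt_const]]]])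
  then show ?thesis
    by (simp add: linear_diff[OF \<iota>\<^sub>D(1), symmetric] maurer_cartan[OF LD \<gamma>] linear_neg[OF \<iota>\<^sub>D(1)] \<iota>\<^sub>D(4) RD_def)
qed

lemma
  fixes \<gamma> :: "'x::real_normed_vector \<Rightarrow> 'd"
  assumes \<gamma>: "smooth_at vspace (mfd D) \<gamma> x0"
  shows smooth_pt_AdD: "smooth_pt (\<lambda>x. AdD (\<gamma> x) w) x0"
    and AdD_derivative: "frechet_derivative (\<lambda>x. AdD (\<gamma> x) w) (at x0) u = - b (RD vspace \<gamma> x0 u) (AdD (\<gamma> x0) w)"
proof -
  note s = smooth_pt_Ad[OF LD \<gamma>, of "jD w"]
  show "smooth_pt (\<lambda>x. AdD (\<gamma> x) w) x0"
    unfolding AdD_def by (rule smooth_pt_linear_comp[OF fdF \<iota>\<^sub>D(1) s])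
  show "frechet_derivative (\<lambda>x. AdD (\<gamma> x) w) (at x0) u = - b (RD vspace \<gamma> x0 u) (AdD (\<gamma> x0) w)"
    unfolding AdD_def RD_def
    by (simp add: frechet_derivative_eqI[OF bounded_linear.has_derivative[OF fin_dim_bounded_linear[OF fdF \<iota>\<^sub>D(1)]
            smooth_pt_has_derivative[OF s]]] Ad_derivative[OF LD \<gamma>] linear_neg[OF \<iota>\<^sub>D(1)] \<iota>\<^sub>D(4))
qed

lemma smooth_pt_AdD_apply:
  fixes \<gamma> :: "'x::real_normed_vector \<Rightarrow> 'd"
  assumes \<gamma>: "smooth_at vspace (mfd D) \<gamma> x0" and w: "smooth_pt w x0"
  shows "smooth_pt (\<lambda>x. AdD (\<gamma> x) (w x)) x0"
proof (rule smooth_pt_operator_apply[OF fd_double _ smooth_pt_AdD[OF \<gamma>] w])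
  show "\<forall>\<^sub>F x in nhds x0. linear (AdD (\<gamma> x))"
    using smooth_at_eventually[OF \<gamma>, unfolded mnhds_vspace[OF atlas_fin_dim[OF smooth_atD(1)[OF \<gamma>]]]]
    by eventually_elim (rule linear_AdD[OF smooth_at_carrier[OF LD]])
qed

end

section \<open>The groupoid\<close>

definition pk :: "'k \<times> 'g \<times> 'g \<times> 'l \<Rightarrow> 'k" where "pk = (\<lambda>(k, g\<^sub>1, g\<^sub>2, l). k)"
definition p1 :: "'k \<times> 'g \<times> 'g \<times> 'l \<Rightarrow> 'g" where "p1 = (\<lambda>(k, g\<^sub>1, g\<^sub>2, l). g\<^sub>1)"
definition p2 :: "'k \<times> 'g \<times> 'g \<times> 'l \<Rightarrow> 'g" where "p2 = (\<lambda>(k, g\<^sub>1, g\<^sub>2, l). g\<^sub>2)"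
definition pl :: "'k \<times> 'g \<times> 'g \<times> 'l \<Rightarrow> 'l" where "pl = (\<lambda>(k, g\<^sub>1, g\<^sub>2, l). l)"

lemma proj_simps [simp]: "pk (k, g, g', l) = k" "p1 (k, g, g', l) = g" "p2 (k, g, g', l) = g'" "pl (k, g, g', l) = l"
  by (simp_all add: pk_def p1_def p2_def pl_def)

lemma proj_eq: "pk q = fst q" "p1 q = fst (snd q)" "p2 q = fst (snd (snd q))" "pl q = snd (snd (snd q))"
  by (cases q; simp)+

context drinfeld_setup
begin

abbreviation ambient :: "('k \<times> 'g \<times> 'g \<times> 'l, 'p \<times> 'e \<times> 'e \<times> 'q) manifold" where
  "ambient \<equiv> mfd Gs \<times>\<^sub>m mfd G \<times>\<^sub>m mfd G \<times>\<^sub>m mfd L"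

abbreviation GL :: "('k \<times> 'g \<times> 'g \<times> 'l) set" where
  "GL \<equiv> GL_set Gs G L D \<phi>\<^sub>K \<phi>\<^sub>G \<phi>\<^sub>L"

lemma manifold_ambient: "manifold ambient"
  by (intro manifold_prod lie_groupD(2) LG LK LL)

lemma points_ambient: "q \<in> points ambient \<longleftrightarrow> pk q \<in> carrier Gs \<and> p1 q \<in> carrier G \<and> p2 q \<in> carrier G \<and> pl q \<in> carrier L"
  by (cases q) (simp add: lie_groupD(4) LG LK LL)

definition \<Psi> :: "'k \<times> 'g \<Rightarrow> 'd" where
  "\<Psi> u = inv\<^bsub>D\<^esub> \<phi>\<^sub>K (fst u) \<otimes>\<^bsub>D\<^esub> \<phi>\<^sub>G (snd u)"

lemma GL_iff: "q \<in> GL \<longleftrightarrow> q \<in> points ambient \<and> \<Psi> (pk q, p2 q) = \<phi>\<^sub>G (p1 q) \<otimes>\<^bsub>D\<^esub> \<phi>\<^sub>L (pl q)"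
proof -
  interpret group D by (rule lie_groupD(1)[OF LD])
  obtain k g1 g2 l where q: "q = (k, g1, g2, l)" by (cases q)
  have "\<phi>\<^sub>K k \<otimes>\<^bsub>D\<^esub> \<phi>\<^sub>G g1 = \<phi>\<^sub>G g2 \<otimes>\<^bsub>D\<^esub> inv\<^bsub>D\<^esub> (\<phi>\<^sub>L l) \<longleftrightarrow>
      inv\<^bsub>D\<^esub> \<phi>\<^sub>K k \<otimes>\<^bsub>D\<^esub> \<phi>\<^sub>G g2 = \<phi>\<^sub>G g1 \<otimes>\<^bsub>D\<^esub> \<phi>\<^sub>L l"
    if "k \<in> carrier Gs" "g1 \<in> carrier G" "g2 \<in> carrier G" "l \<in> carrier L"
  proof -
    note c = \<phi>_closed(2)[OF that(1)] \<phi>_closed(1)[OF that(2)] \<phi>_closed(1)[OF that(3)] \<phi>_closed(3)[OF that(4)]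
    have "\<phi>\<^sub>K k \<otimes>\<^bsub>D\<^esub> \<phi>\<^sub>G g1 = \<phi>\<^sub>G g2 \<otimes>\<^bsub>D\<^esub> inv\<^bsub>D\<^esub> (\<phi>\<^sub>L l) \<longleftrightarrow> \<phi>\<^sub>K k \<otimes>\<^bsub>D\<^esub> \<phi>\<^sub>G g1 \<otimes>\<^bsub>D\<^esub> \<phi>\<^sub>L l = \<phi>\<^sub>G g2"
      unfolding inv_solve_right[OF m_closed[OF c(1,2)] c(3,4)] by (rule eq_commute)
    also have "\<dots> \<longleftrightarrow> inv\<^bsub>D\<^esub> \<phi>\<^sub>K k \<otimes>\<^bsub>D\<^esub> \<phi>\<^sub>G g2 = \<phi>\<^sub>G g1 \<otimes>\<^bsub>D\<^esub> \<phi>\<^sub>L l"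
      unfolding inv_solve_left'[OF m_closed[OF c(2,4)] c(1,3)] m_assoc[OF c(1,2,4)] by (rule eq_commute)
    finally show ?thesis .
  qed
  then show ?thesis unfolding GL_set_def points_ambient q \<Psi>_def by auto
qed

lemma
  assumes q: "q \<in> points ambient"
  shows smooth_pk: "smooth_at ambient (mfd Gs) pk q" and smooth_p1: "smooth_at ambient (mfd G) p1 q"
    and smooth_p2: "smooth_at ambient (mfd G) p2 q" and smooth_pl: "smooth_at ambient (mfd L) pl q"
proof -
  obtain k g1 g2 l where e: "q = (k, g1, g2, l)" by (cases q)
  have c: "k \<in> points (mfd Gs)" "g1 \<in> points (mfd G)" "g2 \<in> points (mfd G)" "l \<in> points (mfd L)"
    using q unfolding e by auto
  note A = lie_groupD(3)[OF LG] and B = lie_groupD(3)[OF LK] and C = lie_groupD(3)[OF LL]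
  note AC = atlas_prod[OF A C]
  note AAC = atlas_prod[OF A AC]
  have c2: "(g2, l) \<in> points (mfd G \<times>\<^sub>m mfd L)" and c3: "(g1, g2, l) \<in> points (mfd G \<times>\<^sub>m mfd G \<times>\<^sub>m mfd L)"
    using c by auto
  have s1: "smooth_at ambient (mfd G \<times>\<^sub>m mfd G \<times>\<^sub>m mfd L) snd (k, g1, g2, l)" by (rule smooth_at_snd[OF B AAC c(1) c3])
  have s2: "smooth_at ambient (mfd G \<times>\<^sub>m mfd L) (\<lambda>q. snd (snd q)) (k, g1, g2, l)"
    by (rule smooth_at_compose(1)[OF s1]) (simp add: smooth_at_snd[OF A AC c(2) c2])
  have pe: "pk = fst" "p1 = (\<lambda>q. fst (snd q))" "p2 = (\<lambda>q. fst (snd (snd q)))" "pl = (\<lambda>q. snd (snd (snd q)))"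
    by (auto simp: fun_eq_iff proj_eq)
  show "smooth_at ambient (mfd Gs) pk q" unfolding pe e by (rule smooth_at_fst[OF B AAC c(1) c3])
  show "smooth_at ambient (mfd G) p1 q" unfolding pe e
    by (rule smooth_at_compose(1)[OF s1]) (simp add: smooth_at_fst[OF A AC c(2) c2])
  show "smooth_at ambient (mfd G) p2 q" unfolding pe e
    by (rule smooth_at_compose(1)[OF s2]) (simp add: smooth_at_fst[OF A C c(3,4)])
  show "smooth_at ambient (mfd L) pl q" unfolding pe e
    by (rule smooth_at_compose(1)[OF s2]) (simp add: smooth_at_snd[OF A C c(3,4)])
qed

lemma smooth_into_ambient:
  assumes "smooth_at Q (mfd Gs) k x" "smooth_at Q (mfd G) g1 x" "smooth_at Q (mfd G) g2 x" "smooth_at Q (mfd L) l x"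
  shows "smooth_at Q ambient (\<lambda>x. (k x, g1 x, g2 x, l x)) x"
  by (rule smooth_at_Pair[OF assms(1) smooth_at_Pair[OF assms(2) smooth_at_Pair[OF assms(3,4)]]])

lemma smooth_\<Psi>:
  assumes u: "u \<in> points (mfd Gs \<times>\<^sub>m mfd G)"
  shows "smooth_at (mfd Gs \<times>\<^sub>m mfd G) (mfd D) \<Psi> u"
proof -
  obtain k g where e: "u = (k, g)" by (cases u)
  have c: "k \<in> points (mfd Gs)" "g \<in> points (mfd G)" using u unfolding e by auto
  note A = lie_groupD(3)[OF LG] and B = lie_groupD(3)[OF LK]
  show ?thesis
    unfolding \<Psi>_def[abs_def] e
    by (rule smooth_at_mult[OF LD smooth_at_inv[OF LD smooth_\<phi>_K[OF smooth_at_fst[OF B A c]]] smooth_\<phi>_G[OF smooth_at_snd[OF B A c]]])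
qed

text \<open>In the trivialization by right translations the differential is
  \<open>(v, w) \<mapsto> Ad (k\<^sup>-\<^sup>1) (w - v)\<close> on \<open>\<gg>\<^sup>* \<times> \<gg>\<close>, and \<open>\<gg> \<oplus> \<gg>\<^sup>*\<close> is the whole double.\<close>

lemma bij_tangent_\<Psi>:
  assumes u: "u \<in> points (mfd Gs \<times>\<^sub>m mfd G)"
  shows "bij (tangent_map (mfd Gs \<times>\<^sub>m mfd G) (mfd D) \<Psi> u)"
proof -
  interpret D: group D by (rule lie_groupD(1)[OF LD])
  obtain k g where e: "u = (k, g)" by (cases u)
  have c: "k \<in> points (mfd Gs)" "g \<in> points (mfd G)" using u unfolding e by auto
  then have k: "k \<in> carrier Gs" and g: "g \<in> carrier G" by (simp_all add: lie_groupD(4) LK LG)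
  note A = lie_groupD(3)[OF LG] and B = lie_groupD(3)[OF LK]
  let ?P = "mfd Gs \<times>\<^sub>m mfd G" and ?T = "tangent_map (mfd Gs \<times>\<^sub>m mfd G) (mfd D) \<Psi> (k, g)"
  have kD: "\<phi>\<^sub>K k \<in> carrier D" and dD: "inv\<^bsub>D\<^esub> \<phi>\<^sub>K k \<in> carrier D" using \<phi>_closed(2)[OF k] by auto
  note sf = smooth_at_fst[OF B A c] and ss = smooth_at_snd[OF B A c]
  have sT: "smooth_at ?P (mfd D) \<Psi> (k, g)" using smooth_\<Psi>[OF u] e by simp
  have \<Psi>D: "\<Psi> (k, g) \<in> carrier D" by (rule smooth_at_carrier[OF LD sT])
  have R: "RD ?P \<Psi> (k, g) (v, w) = AdD (inv\<^bsub>D\<^esub> \<phi>\<^sub>K k) (mc_right G g w, - \<iota>\<^sub>K (mc_right Gs k v))" for v w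
  proof -
    have "RD ?P \<Psi> (k, g) (v, w) = - AdD (inv\<^bsub>D\<^esub> \<phi>\<^sub>K k) (RD ?P (\<lambda>x. \<phi>\<^sub>K (fst x)) (k, g) (v, w))
        + AdD (inv\<^bsub>D\<^esub> \<phi>\<^sub>K k) (RD ?P (\<lambda>x. \<phi>\<^sub>G (snd x)) (k, g) (v, w))"
      unfolding \<Psi>_def[abs_def] RD_mult[OF smooth_at_inv[OF LD smooth_\<phi>_K[OF sf]] smooth_\<phi>_G[OF ss]] RD_inv[OF smooth_\<phi>_K[OF sf]]
      by simp
    also have "\<dots> = AdD (inv\<^bsub>D\<^esub> \<phi>\<^sub>K k) ((mc_right G g w, 0) - (0, \<iota>\<^sub>K (mc_right Gs k v)))"
      unfolding RD_K[OF sf] RD_G[OF ss] AdD_diff[OF dD]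
      by (simp add: mcR_def tangent_map_fst[OF B A c] tangent_map_snd[OF B A c])
    finally show ?thesis by simp
  qed
  have Req: "RD ?P \<Psi> (k, g) z = \<iota>\<^sub>D (mc_right D (\<Psi> (k, g)) (?T z))" for z by (simp add: RD_def mcR_def)
  have "?T z = 0 \<Longrightarrow> z = 0" for z
  proof -
    assume z: "?T z = 0"
    obtain v w where vw: "z = (v, w)" by (cases z)
    have "mc_right D (\<Psi> (k, g)) 0 = 0"
      unfolding mc_right_def by (rule linear_0[OF linear_dR[OF LD _ \<Psi>D]]) (use \<Psi>D in auto)
    then have "AdD (inv\<^bsub>D\<^esub> \<phi>\<^sub>K k) (mc_right G g w, - \<iota>\<^sub>K (mc_right Gs k v)) = 0"
      using Req[of z] z R[of v w] linear_0[OF \<iota>\<^sub>D(1)] vw by simp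
    then have "(mc_right G g w, - \<iota>\<^sub>K (mc_right Gs k v)) = 0"
      using AdD_inv(2)[OF kD] AdD_zero[OF kD] by metis
    then have 0: "mc_right G g w = 0" "\<iota>\<^sub>K (mc_right Gs k v) = 0" by (auto simp: zero_prod_def)
    have "mc_right Gs k v = 0" using 0(2) \<iota>\<^sub>K(1,2) linear_0[OF \<iota>\<^sub>K(1)] by (metis injD)
    then have "v = right_inv_vf Gs 0 k" "w = right_inv_vf G 0 g"
      using right_inv_vf_mc_right[OF LK k, of v] right_inv_vf_mc_right[OF LG g, of w] 0(1) by auto
    moreover have "right_inv_vf Gs 0 k = 0" "right_inv_vf G 0 g = 0"
      using linear_0[OF linear_dR[OF LK k]] linear_0[OF linear_dR[OF LG g]] lie_groupD(1)[OF LK] lie_groupD(1)[OF LG]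
      by (auto simp: right_inv_vf_def group.is_monoid)
    ultimately show "z = 0" using vw by (simp add: zero_prod_def)
  qed
  then have "inj ?T" using linear_injective_0[OF tangent_map_linear[OF sT]] by blast
  moreover have "y \<in> range ?T" for y
  proof -
    define x where "x = AdD (\<phi>\<^sub>K k) (\<iota>\<^sub>D (mc_right D (\<Psi> (k, g)) y))"
    obtain \<kappa> where \<kappa>: "\<iota>\<^sub>K \<kappa> = - snd x" using \<iota>\<^sub>K(3) by (metis rangeE UNIV_I)
    let ?z = "(right_inv_vf Gs \<kappa> k, right_inv_vf G (fst x) g)"
    have "RD ?P \<Psi> (k, g) ?z = AdD (inv\<^bsub>D\<^esub> \<phi>\<^sub>K k) x"
      unfolding R mc_right_right_inv_vf[OF LK k] mc_right_right_inv_vf[OF LG g] \<kappa> by simp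
    also have "\<dots> = \<iota>\<^sub>D (mc_right D (\<Psi> (k, g)) y)" unfolding x_def by (rule AdD_inv(1)[OF kD])
    finally have "mc_right D (\<Psi> (k, g)) (?T ?z) = mc_right D (\<Psi> (k, g)) y"
      unfolding Req using \<iota>\<^sub>D(2) by (rule injD[rotated])
    then have "?T ?z = y" using right_inv_vf_mc_right[OF LD \<Psi>D] by metis
    then show ?thesis by blast
  qed
  ultimately show ?thesis unfolding bij_def e by blast
qed

text \<open>The Lie algebra \<open>\<ll>\<close> of \<open>L\<close> has the dimension of \<open>\<gg>\<close>, so the groupoid can be modelled on \<open>\<gg> \<times> \<gg>\<close>.\<close>

lemma exists_model_iso: "\<exists>A :: 'e \<Rightarrow> 'q. linear A \<and> bij A"
proof -
  obtain h :: "'e \<Rightarrow> 'e \<times> 'e covector" where h: "linear h" "inj h" "range h = \<ll>"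
    using lagrangian_parametrization[OF fdE l_subspace l_lagr] by blast
  define A where "A x = inv_into UNIV \<iota>\<^sub>L (h x)" for x
  have A: "\<iota>\<^sub>L (A x) = h x" for x
    unfolding A_def by (rule f_inv_into_f) (use h(3) \<iota>\<^sub>L(3) in auto)
  have "linear A"
  proof (rule linearI)
    show "A (x + y) = A x + A y" for x y
      by (rule injD[OF \<iota>\<^sub>L(2)]) (simp add: linear_add[OF \<iota>\<^sub>L(1)] A linear_add[OF h(1)])
    show "A (r *\<^sub>R x) = r *\<^sub>R A x" for r x
      by (rule injD[OF \<iota>\<^sub>L(2)]) (simp add: linear_scale[OF \<iota>\<^sub>L(1)] A linear_scale[OF h(1)])
  qed
  moreover have "inj A" using A h(2) by (metis injD injI)
  moreover have "q \<in> range A" for q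
  proof -
    obtain x where "h x = \<iota>\<^sub>L q" using h(3) \<iota>\<^sub>L(3) by (metis rangeE rangeI)
    then have "A x = q" using A[of x] \<iota>\<^sub>L(2) by (metis injD)
    then show ?thesis by blast
  qed
  ultimately show ?thesis by (intro exI[of _ A]) (auto simp: bij_def)
qed

definition iso :: "'e \<Rightarrow> 'q" where "iso = (SOME A. linear A \<and> bij A)"
definition iso_inv :: "'q \<Rightarrow> 'e" where "iso_inv = inv_into UNIV iso"

lemma iso: "linear iso" "linear iso_inv" "iso (iso_inv y) = y" "iso_inv (iso x) = x"
proof -
  have i: "linear iso" "bij iso" using someI_ex[OF exists_model_iso] unfolding iso_def by auto
  show "linear iso" "linear iso_inv" "iso (iso_inv y) = y" "iso_inv (iso x) = x"
    unfolding iso_inv_def using i linear_inv_of_bij[OF i] by (auto simp: bij_is_surj surj_f_inv_f bij_is_inj)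
qed

text \<open>Near \<open>p\<close> the groupoid is a graph over the variables \<open>g\<^sub>1\<close> and \<open>l\<close>, because they determine
  \<open>k\<^sup>-\<^sup>1 g\<^sub>2 = g\<^sub>1 l\<close>, and \<open>\<Psi>\<close> is a local diffeomorphism.\<close>

definition GL_chart :: "'k \<times> 'g \<times> 'g \<times> 'l \<Rightarrow> 'k \<times> 'g \<times> 'g \<times> 'l \<Rightarrow> 'e \<times> 'e" where
  "GL_chart p q = (chart (mfd G) (p1 p) (p1 q), iso_inv (chart (mfd L) (pl p) (pl q)))"

lemma exists_GL_manifold:
  "\<exists>M :: ('k \<times> 'g \<times> 'g \<times> 'l, 'e \<times> 'e) manifold. points M = GL \<and> chart M = GL_chart \<and>
    embedded_submanifold M ambient \<and> ambient_smooth M ambient"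
proof (rule submanifold_of_parametrizations[OF manifold_ambient])
  show "GL \<subseteq> points ambient" using GL_iff by blast
  show "fin_dim TYPE('e \<times> 'e)" by (rule fin_dim_prod[OF fdE fdE])
  fix p assume p: "p \<in> GL"
  note A = lie_groupD(3)[OF LG] and B = lie_groupD(3)[OF LK] and C = lie_groupD(3)[OF LL] and E = lie_groupD(3)[OF LD]
  note NA = manifold_atlas[OF manifold_ambient]
  note BA = atlas_prod[OF B A]
  have pN: "p \<in> points ambient" using p GL_iff by blast
  then have c: "pk p \<in> points (mfd Gs)" "p1 p \<in> points (mfd G)" "p2 p \<in> points (mfd G)" "pl p \<in> points (mfd L)"
    unfolding points_ambient by (simp_all add: lie_groupD(4) LG LK LL)
  have u0: "(pk p, p2 p) \<in> points (mfd Gs \<times>\<^sub>m mfd G)" using c by simp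
  obtain U0 h where U0: "openin (mtopology (mfd Gs \<times>\<^sub>m mfd G)) U0" "(pk p, p2 p) \<in> U0"
    "openin (mtopology (mfd D)) (\<Psi> ` U0)" "\<forall>q\<in>U0. h (\<Psi> q) = q" "\<forall>r\<in>\<Psi> ` U0. smooth_at (mfd D) (mfd Gs \<times>\<^sub>m mfd G) h r"
    using manifold_inverse_function[OF smooth_\<Psi> u0 bij_tangent_\<Psi>[OF u0]] by blast
  let ?cG = "chart (mfd G) (p1 p)" and ?dG = "chart_dom (mfd G) (p1 p)" and ?iG = "chart_inv (mfd G) (p1 p)"
  let ?cL = "chart (mfd L) (pl p)" and ?dL = "chart_dom (mfd L) (pl p)" and ?iL = "chart_inv (mfd L) (pl p)"
  note ciG = chart_inv_chart[OF A c(2)] and iG = chart_inv_image[OF A c(2)]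
  note ciL = chart_inv_chart[OF C c(4)] and iL = chart_inv_image[OF C c(4)]
  define U where "U = {q \<in> points ambient. (pk q, p2 q) \<in> U0 \<and> p1 q \<in> ?dG \<and> pl q \<in> ?dL}"
  define g where "g z = ?iG (fst z)" for z :: "'e \<times> 'e"
  define l where "l z = ?iL (iso (snd z))" for z :: "'e \<times> 'e"
  define d where "d z = \<phi>\<^sub>G (g z) \<otimes>\<^bsub>D\<^esub> \<phi>\<^sub>L (l z)" for z
  define W where "W = {z. fst z \<in> ?cG ` ?dG \<and> iso (snd z) \<in> ?cL ` ?dL \<and> d z \<in> \<Psi> ` U0}"
  define \<sigma> where "\<sigma> z = (fst (h (d z)), g z, snd (h (d z)), l z)" for z
  have fdEE: "fin_dim TYPE('e \<times> 'e)" by (rule fin_dim_prod[OF fdE fdE])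
  have sg: "smooth_at vspace (mfd G) g z" if "fst z \<in> ?cG ` ?dG" for z
  proof -
    have "smooth_at vspace vspace fst z" by (simp add: smooth_at_vspace[OF fdEE fdE] smooth_pt_fst[OF smooth_pt_ident])
    from smooth_at_compose(1)[OF this smooth_at_chart_inv[OF A c(2) that]] show ?thesis unfolding g_def .
  qed
  have sl: "smooth_at vspace (mfd L) l z" if "iso (snd z) \<in> ?cL ` ?dL" for z
  proof -
    have "smooth_at vspace vspace snd z" by (simp add: smooth_at_vspace[OF fdEE fdE] smooth_pt_snd[OF smooth_pt_ident])
    from smooth_at_compose(1)[OF smooth_at_compose(1)[OF this smooth_at_linear[OF fdE fdQ iso(1)]] smooth_at_chart_inv[OF C c(4) that]]
    show ?thesis unfolding l_def .
  qed
  have sd: "smooth_at vspace (mfd D) d z" if "z \<in> W" for z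
    unfolding d_def using that smooth_at_mult[OF LD smooth_\<phi>_G[OF sg] smooth_\<phi>_L[OF sl]] by (simp add: W_def)
  have sh: "smooth_at vspace (mfd Gs \<times>\<^sub>m mfd G) (\<lambda>z. h (d z)) z" if "z \<in> W" for z
    by (rule smooth_at_compose(1)[OF sd[OF that]]) (use that U0(5) in \<open>auto simp: W_def\<close>)
  have s\<sigma>: "smooth_at vspace ambient \<sigma> z" if z: "z \<in> W" for z
  proof -
    have hp: "h (d z) \<in> points (mfd Gs \<times>\<^sub>m mfd G)" by (rule smooth_atD(4)[OF sh[OF z]])
    obtain k' g' where kg: "h (d z) = (k', g')" by (cases "h (d z)")
    have kg': "k' \<in> points (mfd Gs)" "g' \<in> points (mfd G)" using hp unfolding kg by auto
    have f: "smooth_at (mfd Gs \<times>\<^sub>m mfd G) (mfd Gs) fst (h (d z))" and s: "smooth_at (mfd Gs \<times>\<^sub>m mfd G) (mfd G) snd (h (d z))"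
      unfolding kg by (rule smooth_at_fst[OF B A kg'], rule smooth_at_snd[OF B A kg'])
    have "fst z \<in> ?cG ` ?dG" "iso (snd z) \<in> ?cL ` ?dL" using z unfolding W_def by auto
    from smooth_into_ambient[OF smooth_at_compose(1)[OF sh[OF z] f] sg[OF this(1)] smooth_at_compose(1)[OF sh[OF z] s] sl[OF this(2)]]
    show ?thesis unfolding \<sigma>_def .
  qed
  have Uopen: "openin (mtopology ambient) U"
  proof (subst openin_iff_eventually[OF NA])
    show "U \<subseteq> points ambient" unfolding U_def by blast
    show "\<forall>q\<in>U. \<forall>\<^sub>F r in mnhds ambient q. r \<in> U"
    proof
      fix q assume q: "q \<in> U"
      then have qN: "q \<in> points ambient" and q1: "(pk q, p2 q) \<in> U0" "p1 q \<in> ?dG" "pl q \<in> ?dL" unfolding U_def by auto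
      show "\<forall>\<^sub>F r in mnhds ambient q. r \<in> U"
        using eventually_mnhds_points[OF NA qN]
          smooth_at_eventually_into[OF smooth_at_Pair[OF smooth_pk[OF qN] smooth_p2[OF qN]] eventually_openin[OF U0(1) q1(1) BA]]
          smooth_at_eventually_into[OF smooth_p1[OF qN] eventually_mnhds_chart_dom[OF A c(2) q1(2)]]
          smooth_at_eventually_into[OF smooth_pl[OF qN] eventually_mnhds_chart_dom[OF C c(4) q1(3)]]
        by eventually_elim (simp add: U_def)
    qed
  qed
  have Wopen: "open W"
    unfolding open_subopen[of W]
  proof
    fix z assume z: "z \<in> W"
    then have z1: "fst z \<in> ?cG ` ?dG" "iso (snd z) \<in> ?cL ` ?dL" "d z \<in> \<Psi> ` U0" unfolding W_def by auto
    have 1: "\<forall>\<^sub>F y in nhds z. fst y \<in> ?cG ` ?dG"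
      by (rule smooth_pt_eventually_compose[OF smooth_pt_fst[OF smooth_pt_ident] eventually_chart_image[OF A c(2) z1(1)]])
    have 2: "\<forall>\<^sub>F y in nhds z. iso (snd y) \<in> ?cL ` ?dL"
      by (rule smooth_pt_eventually_compose[OF smooth_pt_linear_comp[OF fdE iso(1) smooth_pt_snd[OF smooth_pt_ident]]
            eventually_chart_image[OF C c(4) z1(2)]])
    have 3: "\<forall>\<^sub>F y in nhds z. d y \<in> \<Psi> ` U0"
      using smooth_at_eventually_into[OF sd[OF z] eventually_openin[OF U0(3) z1(3) E]] by (simp add: mnhds_vspace[OF fdEE])
    have "\<forall>\<^sub>F y in nhds z. y \<in> W" using 1 2 3 by eventually_elim (simp add: W_def)
    then show "\<exists>T. open T \<and> z \<in> T \<and> T \<subseteq> W" unfolding eventually_nhds by (meson subsetI)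
  qed
  have \<sigma>U: "\<sigma> z \<in> GL \<inter> U" "GL_chart p (\<sigma> z) = z" if z: "z \<in> W" for z
  proof -
    have z1: "fst z \<in> ?cG ` ?dG" "iso (snd z) \<in> ?cL ` ?dL" "d z \<in> \<Psi> ` U0" using z unfolding W_def by auto
    obtain u where u: "u \<in> U0" "d z = \<Psi> u" using z1(3) by blast
    then have hu: "h (d z) = u" using U0(4) by simp
    have \<sigma>N: "\<sigma> z \<in> points ambient" by (rule smooth_atD(4)[OF s\<sigma>[OF z]])
    have "\<Psi> (pk (\<sigma> z), p2 (\<sigma> z)) = \<phi>\<^sub>G (p1 (\<sigma> z)) \<otimes>\<^bsub>D\<^esub> \<phi>\<^sub>L (pl (\<sigma> z))"
      unfolding \<sigma>_def hu using u(2) by (simp add: d_def)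
    then show "\<sigma> z \<in> GL \<inter> U"
      using \<sigma>N GL_iff u(1) iG(2)[OF z1(1)] iL(2)[OF z1(2)] by (simp add: U_def \<sigma>_def hu g_def l_def)
    show "GL_chart p (\<sigma> z) = z"
      using iG(1)[OF z1(1)] iL(1)[OF z1(2)] by (simp add: GL_chart_def \<sigma>_def g_def l_def iso(4))
  qed
  have \<sigma>surj: "q \<in> \<sigma> ` W" if q: "q \<in> GL \<inter> U" for q
  proof -
    have q1: "(pk q, p2 q) \<in> U0" "p1 q \<in> ?dG" "pl q \<in> ?dL" and qG: "q \<in> GL" using q unfolding U_def by auto
    let ?z = "GL_chart p q"
    have gz: "g ?z = p1 q" and lz: "l ?z = pl q"
      using ciG[OF q1(2)] ciL[OF q1(3)] by (simp_all add: g_def l_def GL_chart_def iso(3))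
    have dz: "d ?z = \<Psi> (pk q, p2 q)" unfolding d_def gz lz using qG GL_iff by simp
    have "?z \<in> W" unfolding W_def using dz q1 by (simp add: GL_chart_def iso(3))
    moreover have "\<sigma> ?z = q"
      unfolding \<sigma>_def gz lz dz using U0(4) q1(1) by (cases q) simp
    ultimately show ?thesis by (metis imageI)
  qed
  have s\<psi>: "smooth_at ambient vspace (GL_chart p) q" if q: "q \<in> U" for q
  proof -
    have qN: "q \<in> points ambient" and q1: "p1 q \<in> ?dG" "pl q \<in> ?dL" using q unfolding U_def by auto
    show ?thesis
      unfolding GL_chart_def[abs_def]
      by (rule smooth_at_Pair_vspace[OF fdE fdE smooth_at_compose(1)[OF smooth_p1[OF qN] smooth_at_chart[OF A c(2) q1(1)]]
            smooth_at_compose(1)[OF smooth_at_compose(1)[OF smooth_pl[OF qN] smooth_at_chart[OF C c(4) q1(2)]]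
              smooth_at_linear[OF fdQ fdE iso(2)]]])
  qed
  have pU: "p \<in> U" unfolding U_def using pN U0(2) atlas_chart(1)[OF A c(2)] atlas_chart(1)[OF C c(4)] by simp
  show "\<exists>U W \<sigma>. openin (mtopology ambient) U \<and> p \<in> U \<and> open W \<and> \<sigma> ` W = GL \<inter> U \<and>
      (\<forall>x\<in>W. smooth_at vspace ambient \<sigma> x \<and> GL_chart p (\<sigma> x) = x) \<and> (\<forall>q\<in>GL \<inter> U. smooth_at ambient vspace (GL_chart p) q)"
    using Uopen pU Wopen s\<sigma> \<sigma>U \<sigma>surj s\<psi> by (intro exI[of _ U] exI[of _ W] exI[of _ \<sigma>]) blast
qed

end

locale GL_manifold = drinfeld_setup G \<pi> b D \<iota>\<^sub>D \<phi>\<^sub>G \<ll> Gs \<iota>\<^sub>K \<phi>\<^sub>K L \<iota>\<^sub>L \<phi>\<^sub>L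
  for G :: "('g, 'e::real_normed_vector) lie_group" and \<pi> :: "'g \<Rightarrow> 'e bivector"
    and b :: "'e \<times> 'e covector \<Rightarrow> 'e \<times> 'e covector \<Rightarrow> 'e \<times> 'e covector"
    and D :: "('d, 'f::real_normed_vector) lie_group" and \<iota>\<^sub>D :: "'f \<Rightarrow> 'e \<times> 'e covector"
    and \<phi>\<^sub>G :: "'g \<Rightarrow> 'd"
    and \<ll> :: "('e \<times> 'e covector) set"
    and Gs :: "('k, 'p::real_normed_vector) lie_group" and \<iota>\<^sub>K :: "'p \<Rightarrow> 'e covector"
    and \<phi>\<^sub>K :: "'k \<Rightarrow> 'd"
    and L :: "('l, 'q::real_normed_vector) lie_group" and \<iota>\<^sub>L :: "'q \<Rightarrow> 'e \<times> 'e covector"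
    and \<phi>\<^sub>L :: "'l \<Rightarrow> 'd" +
  fixes M :: "('k \<times> 'g \<times> 'g \<times> 'l, 'e \<times> 'e) manifold"
  assumes points_M: "points M = GL" and chart_M: "chart M = GL_chart" and ambient_M: "ambient_smooth M ambient"
begin

lemma manifold_M: "manifold M" and atlas_M: "atlas M"
  using ambient_smoothD(1)[OF ambient_M] manifold_atlas by auto

lemma GL_ambient: "q \<in> GL \<Longrightarrow> q \<in> points ambient"
  using GL_iff by blast

lemma GL_carrier: "q \<in> GL \<Longrightarrow> pk q \<in> carrier Gs" "q \<in> GL \<Longrightarrow> p1 q \<in> carrier G"
  "q \<in> GL \<Longrightarrow> p2 q \<in> carrier G" "q \<in> GL \<Longrightarrow> pl q \<in> carrier L"
  using GL_ambient points_ambient by blast+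

lemma GL_points: "q \<in> GL \<Longrightarrow> pk q \<in> points (mfd Gs)" "q \<in> GL \<Longrightarrow> p1 q \<in> points (mfd G)"
  "q \<in> GL \<Longrightarrow> p2 q \<in> points (mfd G)" "q \<in> GL \<Longrightarrow> pl q \<in> points (mfd L)"
  using GL_carrier lie_groupD(4)[OF LG] lie_groupD(4)[OF LK] lie_groupD(4)[OF LL] by auto

lemma
  assumes "q \<in> GL"
  shows M_pk: "smooth_at M (mfd Gs) pk q" and M_p1: "smooth_at M (mfd G) p1 q"
    and M_p2: "smooth_at M (mfd G) p2 q" and M_pl: "smooth_at M (mfd L) pl q"
proof -
  have qM: "q \<in> points M" using assms points_M by simp
  note r = smooth_at_restrict_submanifold[OF ambient_M qM] and N = GL_ambient[OF assms]
  show "smooth_at M (mfd Gs) pk q" "smooth_at M (mfd G) p1 q" "smooth_at M (mfd G) p2 q" "smooth_at M (mfd L) pl q"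
    by (rule r[OF smooth_pk[OF N]], rule r[OF smooth_p1[OF N]], rule r[OF smooth_p2[OF N]], rule r[OF smooth_pl[OF N]])
qed

lemma smooth_into_M:
  assumes "smooth_at Q (mfd Gs) k x" "smooth_at Q (mfd G) g1 x" "smooth_at Q (mfd G) g2 x" "smooth_at Q (mfd L) l x"
    and "\<forall>\<^sub>F y in mnhds Q x. (k y, g1 y, g2 y, l y) \<in> GL"
  shows "smooth_at Q M (\<lambda>x. (k x, g1 x, g2 x, l x)) x"
  by (rule smooth_at_into_submanifold[OF ambient_M smooth_into_ambient[OF assms(1-4)]]) (simp add: points_M assms(5))

text \<open>By the choice of the charts, \<open>g\<^sub>1\<close> and \<open>l\<close> are the coordinates of \<open>M\<close>.\<close>

lemma
  assumes q: "q \<in> GL"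
  shows tangent_map_p1: "tangent_map M (mfd G) p1 q v = fst v"
    and tangent_map_pl: "tangent_map M (mfd L) pl q v = iso (snd v)"
proof -
  have qM: "q \<in> points M" using q points_M by simp
  note c = GL_points[OF q]
  note A = lie_groupD(3)[OF LG] and C = lie_groupD(3)[OF LL]
  have fdEE: "fin_dim TYPE('e \<times> 'e)" by (rule fin_dim_prod[OF fdE fdE])
  have s: "smooth_at M vspace (GL_chart q) q"
    using smooth_at_chart[OF atlas_M qM atlas_chart(1)[OF atlas_M qM]] chart_M by simp
  have id: "tangent_map M vspace (GL_chart q) q v = v"
    using tangent_map_chart_self[OF atlas_M qM] chart_M by simp
  have f: "smooth_at vspace vspace fst (GL_chart q q)" and sn: "smooth_at vspace vspace snd (GL_chart q q)"
    by (simp_all add: smooth_at_vspace[OF fdEE fdE] smooth_pt_fst[OF smooth_pt_ident] smooth_pt_snd[OF smooth_pt_ident])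
  have "tangent_map M (mfd G) p1 q v = tangent_map M vspace (\<lambda>r. chart (mfd G) (p1 q) (p1 r)) q v"
    using smooth_at_compose(2)[OF M_p1[OF q] smooth_at_chart[OF A c(2) atlas_chart(1)[OF A c(2)]], of v]
    by (simp add: tangent_map_chart_self[OF A c(2)])
  also have "\<dots> = tangent_map M vspace (\<lambda>r. fst (GL_chart q r)) q v" by (simp add: GL_chart_def)
  also have "\<dots> = fst v"
    unfolding smooth_at_compose(2)[OF s f] id
    by (simp add: tangent_map_vspace frechet_derivative_eqI[OF bounded_linear_imp_has_derivative[OF bounded_linear_fst]])
  finally show "tangent_map M (mfd G) p1 q v = fst v" .
  have cl: "smooth_at (mfd L) vspace (chart (mfd L) (pl q)) (pl q)"
    by (rule smooth_at_chart[OF C c(4) atlas_chart(1)[OF C c(4)]])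
  have li: "smooth_at vspace vspace iso (snd (GL_chart q q))" by (rule smooth_at_linear[OF fdE fdQ iso(1)])
  have "tangent_map M (mfd L) pl q v = tangent_map M vspace (\<lambda>r. chart (mfd L) (pl q) (pl r)) q v"
    using smooth_at_compose(2)[OF M_pl[OF q] cl, of v] by (simp add: tangent_map_chart_self[OF C c(4)])
  also have "\<dots> = tangent_map M vspace (\<lambda>r. iso (snd (GL_chart q r))) q v"
    by (simp add: GL_chart_def iso(3))
  also have "\<dots> = iso (snd v)"
    unfolding smooth_at_compose(2)[OF smooth_at_compose(1)[OF s sn] li] smooth_at_compose(2)[OF s sn] id
    by (simp add: tangent_map_vspace frechet_derivative_eqI[OF bounded_linear_imp_has_derivative[OF bounded_linear_snd]]
        frechet_derivative_eqI[OF bounded_linear_imp_has_derivative[OF fin_dim_bounded_linear[OF fdE iso(1)]]])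
  finally show "tangent_map M (mfd L) pl q v = iso (snd v)" .
qed

abbreviation composable :: "(('k \<times> 'g \<times> 'g \<times> 'l) \<times> ('k \<times> 'g \<times> 'g \<times> 'l)) set" where
  "composable \<equiv> {(x, y). x \<in> GL \<and> y \<in> GL \<and> p2 x = p1 y}"

text \<open>A composable pair is determined near a given one by its first arrow and the \<open>l\<close>-coordinate of the
  second, whose \<open>g\<^sub>1\<close>-coordinate is the source of the first.\<close>

lemma exists_composable_manifold:
  "\<exists>C :: (('k \<times> 'g \<times> 'g \<times> 'l) \<times> ('k \<times> 'g \<times> 'g \<times> 'l), 'e \<times> 'e \<times> 'e) manifold.
    points C = composable \<and> embedded_submanifold C (M \<times>\<^sub>m M) \<and> ambient_smooth C (M \<times>\<^sub>m M)"
proof -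
  define \<psi> where "\<psi> c0 c = (fst (chart M (fst c0) (fst c)), snd (chart M (fst c0) (fst c)), snd (chart M (snd c0) (snd c)))"
    for c0 c :: "('k \<times> 'g \<times> 'g \<times> 'l) \<times> ('k \<times> 'g \<times> 'g \<times> 'l)"
  note NA = atlas_prod[OF atlas_M atlas_M]
  note A = lie_groupD(3)[OF LG]
  have fdEE: "fin_dim TYPE('e \<times> 'e)" by (rule fin_dim_prod[OF fdE fdE])
  have fd3: "fin_dim TYPE('e \<times> 'e \<times> 'e)" by (rule fin_dim_prod[OF fdE fdEE])
  have "\<exists>C :: (('k \<times> 'g \<times> 'g \<times> 'l) \<times> ('k \<times> 'g \<times> 'g \<times> 'l), 'e \<times> 'e \<times> 'e) manifold.
    points C = composable \<and> chart C = \<psi> \<and> embedded_submanifold C (M \<times>\<^sub>m M) \<and> ambient_smooth C (M \<times>\<^sub>m M)"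
  proof (rule submanifold_of_parametrizations[OF manifold_prod[OF manifold_M manifold_M] _ fd3])
    show "composable \<subseteq> points (M \<times>\<^sub>m M)" using points_M by auto
    fix c assume c: "c \<in> composable"
    obtain a0 b0 where ab: "c = (a0, b0)" by (cases c)
    have a0: "a0 \<in> GL" "a0 \<in> points M" and b0: "b0 \<in> GL" "b0 \<in> points M" and ab0: "p2 a0 = p1 b0"
      using c points_M unfolding ab by auto
    have gp: "p1 b0 \<in> points (mfd G)" by (rule GL_points(2)[OF b0(1)])
    let ?cG = "chart (mfd G) (p1 b0)" and ?dG = "chart_dom (mfd G) (p1 b0)"
    note ca = chart_inv_chart[OF atlas_M a0(2)] and ia = chart_inv_image[OF atlas_M a0(2)]
    note cb = chart_inv_chart[OF atlas_M b0(2)] and ib = chart_inv_image[OF atlas_M b0(2)]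
    let ?Ia = "chart M a0 ` chart_dom M a0" and ?Ib = "chart M b0 ` chart_dom M b0"
    define ha where "ha w = (fst w, fst (snd w))" for w :: "'e \<times> 'e \<times> 'e"
    define \<alpha> where "\<alpha> w = chart_inv M a0 (ha w)" for w :: "'e \<times> 'e \<times> 'e"
    define hb where "hb w = (?cG (p2 (\<alpha> w)), snd (snd w))" for w :: "'e \<times> 'e \<times> 'e"
    define \<beta> where "\<beta> w = chart_inv M b0 (hb w)" for w :: "'e \<times> 'e \<times> 'e"
    define W where "W = {w. ha w \<in> ?Ia \<and> p2 (\<alpha> w) \<in> ?dG \<and> hb w \<in> ?Ib \<and> p1 (\<beta> w) \<in> ?dG}"
    define U where "U = {c \<in> points (M \<times>\<^sub>m M). fst c \<in> chart_dom M a0 \<and> snd c \<in> chart_dom M b0 \<and>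
        p2 (fst c) \<in> ?dG \<and> p1 (snd c) \<in> ?dG}"
    have W: "ha w \<in> ?Ia" "p2 (\<alpha> w) \<in> ?dG" "hb w \<in> ?Ib" "p1 (\<beta> w) \<in> ?dG" if "w \<in> W" for w
      using that unfolding W_def by auto
    have dom: "x \<in> chart_dom M r \<Longrightarrow> r \<in> points M \<Longrightarrow> x \<in> GL" for x r
      using atlas_chart(2)[OF atlas_M] points_M by blast
    have \<alpha>GL: "\<alpha> w \<in> chart_dom M a0" "\<alpha> w \<in> GL" if "w \<in> W" for w
      using ia(2)[OF W(1)[OF that]] dom a0(2) unfolding \<alpha>_def by auto
    have \<beta>GL: "\<beta> w \<in> chart_dom M b0" "\<beta> w \<in> GL" if "w \<in> W" for w
      using ib(2)[OF W(3)[OF that]] dom b0(2) unfolding \<beta>_def by auto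
    have sf: "smooth_pt (\<lambda>w :: 'e \<times> 'e \<times> 'e. fst w) w" and ss: "smooth_pt (\<lambda>w :: 'e \<times> 'e \<times> 'e. snd (snd w)) w"
      and sm: "smooth_pt (\<lambda>w :: 'e \<times> 'e \<times> 'e. fst (snd w)) w" for w
      by (rule smooth_pt_fst[OF smooth_pt_ident], rule smooth_pt_snd[OF smooth_pt_snd[OF smooth_pt_ident]],
          rule smooth_pt_fst[OF smooth_pt_snd[OF smooth_pt_ident]])
    have sha: "smooth_at vspace vspace ha w" for w
      unfolding smooth_at_vspace[OF fd3 fdEE] ha_def by (rule smooth_pt_Pair[OF sf sm])
    have s\<alpha>: "smooth_at vspace M \<alpha> w" if "ha w \<in> ?Ia" for w
      unfolding \<alpha>_def by (rule smooth_at_compose(1)[OF sha smooth_at_chart_inv[OF atlas_M a0(2) that]])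
    have sp\<alpha>: "smooth_at vspace (mfd G) (\<lambda>w. p2 (\<alpha> w)) w" if "w \<in> W" for w
      by (rule smooth_at_compose(1)[OF s\<alpha>[OF W(1)[OF that]] M_p2[OF \<alpha>GL(2)[OF that]]])
    have shb: "smooth_at vspace vspace hb w" if "w \<in> W" for w
    proof -
      have s2: "smooth_at vspace vspace (\<lambda>w :: 'e \<times> 'e \<times> 'e. snd (snd w)) w"
        unfolding smooth_at_vspace[OF fd3 fdE] by (rule ss)
      show ?thesis
        unfolding hb_def
        by (rule smooth_at_Pair_vspace[OF fdE fdE smooth_at_compose(1)[OF sp\<alpha>[OF that] smooth_at_chart[OF A gp W(2)[OF that]]] s2])
    qed
    have s\<beta>: "smooth_at vspace M \<beta> w" if "w \<in> W" for w
      unfolding \<beta>_def by (rule smooth_at_compose(1)[OF shb[OF that] smooth_at_chart_inv[OF atlas_M b0(2) W(3)[OF that]]])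
    have sp\<beta>: "smooth_at vspace (mfd G) (\<lambda>w. p1 (\<beta> w)) w" if "w \<in> W" for w
      by (rule smooth_at_compose(1)[OF s\<beta>[OF that] M_p1[OF \<beta>GL(2)[OF that]]])
    have Uopen: "openin (mtopology (M \<times>\<^sub>m M)) U"
    proof (subst openin_iff_eventually[OF NA])
      show "U \<subseteq> points (M \<times>\<^sub>m M)" unfolding U_def by blast
      show "\<forall>q\<in>U. \<forall>\<^sub>F r in mnhds (M \<times>\<^sub>m M) q. r \<in> U"
      proof
        fix q assume q: "q \<in> U"
        obtain x y where xy: "q = (x, y)" by (cases q)
        have x: "x \<in> points M" "x \<in> chart_dom M a0" "p2 x \<in> ?dG" and y: "y \<in> points M" "y \<in> chart_dom M b0" "p1 y \<in> ?dG"
          and qN: "q \<in> points (M \<times>\<^sub>m M)" using q unfolding U_def xy by auto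
        have xG: "x \<in> GL" and yG: "y \<in> GL" using x y points_M by auto
        have f: "smooth_at (M \<times>\<^sub>m M) M fst (x, y)" and s: "smooth_at (M \<times>\<^sub>m M) M snd (x, y)"
          by (rule smooth_at_fst[OF atlas_M atlas_M x(1) y(1)], rule smooth_at_snd[OF atlas_M atlas_M x(1) y(1)])
        have f2: "smooth_at (M \<times>\<^sub>m M) (mfd G) (\<lambda>q. p2 (fst q)) (x, y)" and s1: "smooth_at (M \<times>\<^sub>m M) (mfd G) (\<lambda>q. p1 (snd q)) (x, y)"
          by (rule smooth_at_compose(1)[OF f], simp add: M_p2 xG, rule smooth_at_compose(1)[OF s], simp add: M_p1 yG)
        have 1: "\<forall>\<^sub>F r in mnhds (M \<times>\<^sub>m M) (x, y). fst r \<in> chart_dom M a0"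
          by (rule smooth_at_eventually_into[OF f]) (simp add: eventually_mnhds_chart_dom[OF atlas_M a0(2) x(2)])
        have 2: "\<forall>\<^sub>F r in mnhds (M \<times>\<^sub>m M) (x, y). snd r \<in> chart_dom M b0"
          by (rule smooth_at_eventually_into[OF s]) (simp add: eventually_mnhds_chart_dom[OF atlas_M b0(2) y(2)])
        have 3: "\<forall>\<^sub>F r in mnhds (M \<times>\<^sub>m M) (x, y). p2 (fst r) \<in> ?dG"
          by (rule smooth_at_eventually_into[OF f2]) (simp add: eventually_mnhds_chart_dom[OF A gp x(3)])
        have 4: "\<forall>\<^sub>F r in mnhds (M \<times>\<^sub>m M) (x, y). p1 (snd r) \<in> ?dG"
          by (rule smooth_at_eventually_into[OF s1]) (simp add: eventually_mnhds_chart_dom[OF A gp y(3)])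
        show "\<forall>\<^sub>F r in mnhds (M \<times>\<^sub>m M) q. r \<in> U"
          unfolding xy using eventually_mnhds_points[OF NA qN[unfolded xy]] 1 2 3 4 by eventually_elim (simp add: U_def)
      qed
    qed
    have Wopen: "open W"
      unfolding open_subopen[of W]
    proof
      fix w assume w: "w \<in> W"
      note mv = mnhds_vspace[OF fd3]
      have 1: "\<forall>\<^sub>F z in nhds w. ha z \<in> ?Ia"
        using smooth_at_eventually_into[OF sha, of "\<lambda>z. z \<in> ?Ia" w] eventually_chart_image[OF atlas_M a0(2) W(1)[OF w]]
        by (simp add: mv mnhds_vspace[OF fdEE])
      have 2: "\<forall>\<^sub>F z in nhds w. p2 (\<alpha> z) \<in> ?dG"
        using smooth_at_eventually_into[OF sp\<alpha>[OF w] eventually_mnhds_chart_dom[OF A gp W(2)[OF w]]] by (simp add: mv)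
      have 3: "\<forall>\<^sub>F z in nhds w. hb z \<in> ?Ib"
        using smooth_at_eventually_into[OF shb[OF w], of "\<lambda>z. z \<in> ?Ib"] eventually_chart_image[OF atlas_M b0(2) W(3)[OF w]]
        by (simp add: mv mnhds_vspace[OF fdEE])
      have 4: "\<forall>\<^sub>F z in nhds w. p1 (\<beta> z) \<in> ?dG"
        using smooth_at_eventually_into[OF sp\<beta>[OF w] eventually_mnhds_chart_dom[OF A gp W(4)[OF w]]] by (simp add: mv)
      have "\<forall>\<^sub>F z in nhds w. z \<in> W" using 1 2 3 4 by eventually_elim (simp add: W_def)
      then show "\<exists>T. open T \<and> w \<in> T \<and> T \<subseteq> W" unfolding eventually_nhds by (meson subsetI)
    qed
    let ?\<sigma> = "\<lambda>w. (\<alpha> w, \<beta> w)"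
    have \<sigma>U: "?\<sigma> w \<in> composable \<inter> U" "\<psi> c (?\<sigma> w) = w" if w: "w \<in> W" for w
    proof -
      have ca: "chart M a0 (\<alpha> w) = ha w" and cb: "chart M b0 (\<beta> w) = hb w"
        unfolding \<alpha>_def \<beta>_def by (rule ia(1)[OF W(1)[OF w]], rule ib(1)[OF W(3)[OF w]])
      have "?cG (p1 (\<beta> w)) = ?cG (p2 (\<alpha> w))" using cb unfolding chart_M GL_chart_def hb_def by simp
      then have "p1 (\<beta> w) = p2 (\<alpha> w)" using inj_onD[OF atlas_chart(3)[OF A gp]] W(2,4)[OF w] by blast
      then show "?\<sigma> w \<in> composable \<inter> U"
        using \<alpha>GL[OF w] \<beta>GL[OF w] W[OF w] points_M by (simp add: U_def)
      show "\<psi> c (?\<sigma> w) = w" unfolding \<psi>_def ab by (simp add: ca cb ha_def hb_def)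
    qed
    have \<sigma>surj: "q \<in> ?\<sigma> ` W" if q: "q \<in> composable \<inter> U" for q
    proof -
      obtain x y where xy: "q = (x, y)" by (cases q)
      have x: "x \<in> chart_dom M a0" "p2 x \<in> ?dG" and y: "y \<in> chart_dom M b0" "p1 y \<in> ?dG" and e: "p2 x = p1 y"
        using q unfolding U_def xy by auto
      let ?w = "\<psi> c q"
      have ha: "ha ?w = chart M a0 x" unfolding ha_def \<psi>_def ab xy by simp
      have \<alpha>: "\<alpha> ?w = x" unfolding \<alpha>_def ha by (rule ca[OF x(1)])
      have hb: "hb ?w = chart M b0 y" unfolding hb_def \<alpha> e unfolding \<psi>_def ab xy chart_M GL_chart_def by simp
      have \<beta>: "\<beta> ?w = y" unfolding \<beta>_def hb by (rule cb[OF y(1)])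
      have "?w \<in> W" unfolding W_def mem_Collect_eq \<alpha> \<beta> ha hb using x y by blast
      moreover have "q = ?\<sigma> ?w" by (simp only: \<alpha> \<beta>) (rule xy)
      ultimately show ?thesis by (rule image_eqI[rotated])
    qed
    have s\<psi>: "smooth_at (M \<times>\<^sub>m M) vspace (\<psi> c) q" if q: "q \<in> U" for q
    proof -
      obtain x y where xy: "q = (x, y)" by (cases q)
      have x: "x \<in> points M" "x \<in> chart_dom M a0" and y: "y \<in> points M" "y \<in> chart_dom M b0"
        using q unfolding U_def xy by auto
      have f: "smooth_at (M \<times>\<^sub>m M) M fst (x, y)" and s: "smooth_at (M \<times>\<^sub>m M) M snd (x, y)"
        by (rule smooth_at_fst[OF atlas_M atlas_M x(1) y(1)], rule smooth_at_snd[OF atlas_M atlas_M x(1) y(1)])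
      have cf: "smooth_at (M \<times>\<^sub>m M) vspace (\<lambda>q. chart M a0 (fst q)) (x, y)" and cs: "smooth_at (M \<times>\<^sub>m M) vspace (\<lambda>q. chart M b0 (snd q)) (x, y)"
        by (rule smooth_at_compose(1)[OF f], simp add: smooth_at_chart[OF atlas_M a0(2) x(2)],
            rule smooth_at_compose(1)[OF s], simp add: smooth_at_chart[OF atlas_M b0(2) y(2)])
      have pf: "smooth_at vspace vspace fst z" and ps: "smooth_at vspace vspace snd z" for z :: "'e \<times> 'e"
        by (simp_all add: smooth_at_vspace[OF fdEE fdE] smooth_pt_fst[OF smooth_pt_ident] smooth_pt_snd[OF smooth_pt_ident])
      show ?thesis
        unfolding \<psi>_def[abs_def] ab xy fst_conv snd_conv
        by (rule smooth_at_Pair_vspace[OF fdE fdEE smooth_at_compose(1)[OF cf pf]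
              smooth_at_Pair_vspace[OF fdE fdE smooth_at_compose(1)[OF cf ps] smooth_at_compose(1)[OF cs ps]]])
    qed
    have cU: "c \<in> U"
      unfolding U_def ab using a0 b0 ab0 atlas_chart(1)[OF atlas_M a0(2)] atlas_chart(1)[OF atlas_M b0(2)] atlas_chart(1)[OF A gp]
      by simp
    have s\<sigma>: "smooth_at vspace (M \<times>\<^sub>m M) ?\<sigma> w" if "w \<in> W" for w
      by (rule smooth_at_Pair[OF s\<alpha>[OF W(1)[OF that]] s\<beta>[OF that]])
    show "\<exists>U W \<sigma>. openin (mtopology (M \<times>\<^sub>m M)) U \<and> c \<in> U \<and> open W \<and> \<sigma> ` W = composable \<inter> U \<and>
      (\<forall>x\<in>W. smooth_at vspace (M \<times>\<^sub>m M) \<sigma> x \<and> \<psi> c (\<sigma> x) = x) \<and> (\<forall>q\<in>composable \<inter> U. smooth_at (M \<times>\<^sub>m M) vspace (\<psi> c) q)"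
      using Uopen cU Wopen s\<sigma> \<sigma>U \<sigma>surj s\<psi> by (intro exI[of _ U] exI[of _ W] exI[of _ ?\<sigma>]) blast
  qed
  then show ?thesis by blast
qed

end

locale GL_groupoid_setup = GL_manifold G \<pi> b D \<iota>\<^sub>D \<phi>\<^sub>G \<ll> Gs \<iota>\<^sub>K \<phi>\<^sub>K L \<iota>\<^sub>L \<phi>\<^sub>L M
  for G :: "('g, 'e::real_normed_vector) lie_group" and \<pi> :: "'g \<Rightarrow> 'e bivector"
    and b :: "'e \<times> 'e covector \<Rightarrow> 'e \<times> 'e covector \<Rightarrow> 'e \<times> 'e covector"
    and D :: "('d, 'f::real_normed_vector) lie_group" and \<iota>\<^sub>D :: "'f \<Rightarrow> 'e \<times> 'e covector"
    and \<phi>\<^sub>G :: "'g \<Rightarrow> 'd"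
    and \<ll> :: "('e \<times> 'e covector) set"
    and Gs :: "('k, 'p::real_normed_vector) lie_group" and \<iota>\<^sub>K :: "'p \<Rightarrow> 'e covector"
    and \<phi>\<^sub>K :: "'k \<Rightarrow> 'd"
    and L :: "('l, 'q::real_normed_vector) lie_group" and \<iota>\<^sub>L :: "'q \<Rightarrow> 'e \<times> 'e covector"
    and \<phi>\<^sub>L :: "'l \<Rightarrow> 'd" and M :: "('k \<times> 'g \<times> 'g \<times> 'l, 'e \<times> 'e) manifold" +
  fixes C :: "(('k \<times> 'g \<times> 'g \<times> 'l) \<times> ('k \<times> 'g \<times> 'g \<times> 'l), 'e \<times> 'e \<times> 'e) manifold"
  assumes points_C: "points C = composable" and embedded_C: "embedded_submanifold C (M \<times>\<^sub>m M)"
    and ambient_C: "ambient_smooth C (M \<times>\<^sub>m M)"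
begin

lemma atlas_C: "atlas C"
  using ambient_smoothD(1)[OF ambient_C] manifold_atlas by auto

abbreviation \<G> :: "('k \<times> 'g \<times> 'g \<times> 'l, 'e \<times> 'e, 'g, 'e, 'e \<times> 'e \<times> 'e) groupoid" where
  "\<G> \<equiv> GL_groupoid Gs G L M C"

definition inverse :: "'k \<times> 'g \<times> 'g \<times> 'l \<Rightarrow> 'k \<times> 'g \<times> 'g \<times> 'l" where
  "inverse q = (inv\<^bsub>Gs\<^esub> pk q, p2 q, p1 q, inv\<^bsub>L\<^esub> pl q)"

definition compose :: "('k \<times> 'g \<times> 'g \<times> 'l) \<times> ('k \<times> 'g \<times> 'g \<times> 'l) \<Rightarrow> 'k \<times> 'g \<times> 'g \<times> 'l" where
  "compose c = (pk (snd c) \<otimes>\<^bsub>Gs\<^esub> pk (fst c), p1 (fst c), p2 (snd c), pl (fst c) \<otimes>\<^bsub>L\<^esub> pl (snd c))"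

definition unit :: "'g \<Rightarrow> 'k \<times> 'g \<times> 'g \<times> 'l" where
  "unit g = (\<one>\<^bsub>Gs\<^esub>, g, g, \<one>\<^bsub>L\<^esub>)"

lemma groupoid_simps [simp]:
  "arrows \<G> = M" "base \<G> = mfd G" "composables \<G> = C" "src \<G> = p2" "tgt \<G> = p1" "unit_arrow \<G> = unit"
  "inv_arrow \<G> = inverse" "gcomp \<G> x y = compose (x, y)" "(\<lambda>(x, y). gcomp \<G> x y) = compose"
  unfolding GL_groupoid_def
  by (auto simp: fun_eq_iff p1_def p2_def unit_def inverse_def compose_def pk_def pl_def split: prod.split)

lemma inverse_GL: "q \<in> GL \<Longrightarrow> inverse q \<in> GL"
proof -
  assume q: "q \<in> GL"
  interpret D: group D by (rule lie_groupD(1)[OF LD])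
  interpret K: group_hom Gs D \<phi>\<^sub>K by (rule lie_hom_group_hom[OF hom_K LK LD])
  interpret H: group_hom L D \<phi>\<^sub>L by (rule lie_hom_group_hom[OF hom_L LL LD])
  note c = GL_carrier[OF q]
  note d = \<phi>_closed(2)[OF c(1)] \<phi>_closed(1)[OF c(2)] \<phi>_closed(1)[OF c(3)] \<phi>_closed(3)[OF c(4)]
  have eq: "inv\<^bsub>D\<^esub> \<phi>\<^sub>K (pk q) \<otimes>\<^bsub>D\<^esub> \<phi>\<^sub>G (p2 q) = \<phi>\<^sub>G (p1 q) \<otimes>\<^bsub>D\<^esub> \<phi>\<^sub>L (pl q)" using q unfolding GL_iff \<Psi>_def by simp
  have "\<phi>\<^sub>K (pk q) \<otimes>\<^bsub>D\<^esub> \<phi>\<^sub>G (p1 q) = \<phi>\<^sub>K (pk q) \<otimes>\<^bsub>D\<^esub> (\<phi>\<^sub>G (p1 q) \<otimes>\<^bsub>D\<^esub> \<phi>\<^sub>L (pl q)) \<otimes>\<^bsub>D\<^esub> inv\<^bsub>D\<^esub> \<phi>\<^sub>L (pl q)"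
    using d by (simp add: D.m_assoc)
  also have "\<dots> = \<phi>\<^sub>G (p2 q) \<otimes>\<^bsub>D\<^esub> inv\<^bsub>D\<^esub> \<phi>\<^sub>L (pl q)"
    unfolding eq[symmetric] using d by (simp add: D.m_assoc[symmetric])
  finally show ?thesis unfolding GL_iff \<Psi>_def points_ambient inverse_def using c d by simp
qed

lemma compose_GL: "c \<in> composable \<Longrightarrow> compose c \<in> GL"
proof -
  assume c: "c \<in> composable"
  obtain x y where xy: "c = (x, y)" by (cases c)
  have x: "x \<in> GL" and y: "y \<in> GL" and e: "p2 x = p1 y" using c unfolding xy by auto
  interpret D: group D by (rule lie_groupD(1)[OF LD])
  interpret K: group_hom Gs D \<phi>\<^sub>K by (rule lie_hom_group_hom[OF hom_K LK LD])
  interpret H: group_hom L D \<phi>\<^sub>L by (rule lie_hom_group_hom[OF hom_L LL LD])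
  note cx = GL_carrier[OF x] and cy = GL_carrier[OF y]
  note dx = \<phi>_closed(2)[OF cx(1)] \<phi>_closed(1)[OF cx(2)] \<phi>_closed(1)[OF cx(3)] \<phi>_closed(3)[OF cx(4)]
  note dy = \<phi>_closed(2)[OF cy(1)] \<phi>_closed(1)[OF cy(2)] \<phi>_closed(1)[OF cy(3)] \<phi>_closed(3)[OF cy(4)]
  have ex: "inv\<^bsub>D\<^esub> \<phi>\<^sub>K (pk x) \<otimes>\<^bsub>D\<^esub> \<phi>\<^sub>G (p2 x) = \<phi>\<^sub>G (p1 x) \<otimes>\<^bsub>D\<^esub> \<phi>\<^sub>L (pl x)" using x unfolding GL_iff \<Psi>_def by simp
  have ey: "inv\<^bsub>D\<^esub> \<phi>\<^sub>K (pk y) \<otimes>\<^bsub>D\<^esub> \<phi>\<^sub>G (p2 y) = \<phi>\<^sub>G (p2 x) \<otimes>\<^bsub>D\<^esub> \<phi>\<^sub>L (pl y)" using y unfolding GL_iff \<Psi>_def e by simp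
  have "inv\<^bsub>D\<^esub> \<phi>\<^sub>K (pk y \<otimes>\<^bsub>Gs\<^esub> pk x) \<otimes>\<^bsub>D\<^esub> \<phi>\<^sub>G (p2 y) = inv\<^bsub>D\<^esub> \<phi>\<^sub>K (pk x) \<otimes>\<^bsub>D\<^esub> (inv\<^bsub>D\<^esub> \<phi>\<^sub>K (pk y) \<otimes>\<^bsub>D\<^esub> \<phi>\<^sub>G (p2 y))"
    using cx cy dx dy by (simp add: D.inv_mult_group D.m_assoc)
  also have "\<dots> = \<phi>\<^sub>G (p1 x) \<otimes>\<^bsub>D\<^esub> \<phi>\<^sub>L (pl x) \<otimes>\<^bsub>D\<^esub> \<phi>\<^sub>L (pl y)"
    unfolding ey ex[symmetric] using dx dy by (simp add: D.m_assoc)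
  also have "\<dots> = \<phi>\<^sub>G (p1 x) \<otimes>\<^bsub>D\<^esub> \<phi>\<^sub>L (pl x \<otimes>\<^bsub>L\<^esub> pl y)" using cx cy dx dy by (simp add: D.m_assoc)
  finally show ?thesis unfolding GL_iff \<Psi>_def points_ambient compose_def xy using cx cy by simp
qed

lemma unit_GL: "g \<in> carrier G \<Longrightarrow> unit g \<in> GL"
proof -
  assume g: "g \<in> carrier G"
  interpret D: group D by (rule lie_groupD(1)[OF LD])
  interpret K: group_hom Gs D \<phi>\<^sub>K by (rule lie_hom_group_hom[OF hom_K LK LD])
  interpret H: group_hom L D \<phi>\<^sub>L by (rule lie_hom_group_hom[OF hom_L LL LD])
  show ?thesis unfolding GL_iff \<Psi>_def points_ambient unit_def using g \<phi>_closed(1)[OF g] by simp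
qed

lemma smooth_inverse: "q \<in> GL \<Longrightarrow> smooth_at M M inverse q"
  unfolding inverse_def[abs_def]
  by (rule smooth_into_M[OF smooth_at_inv[OF LK M_pk] M_p2 M_p1 smooth_at_inv[OF LL M_pl]], assumption+)
    (rule eventually_mono[OF eventually_mnhds_points[OF atlas_M]], auto simp: points_M inverse_GL[unfolded inverse_def])

lemma smooth_unit: "g \<in> carrier G \<Longrightarrow> smooth_at (mfd G) M unit g"
proof -
  assume g: "g \<in> carrier G"
  note A = lie_groupD(3,4)[OF LG]
  have g': "g \<in> points (mfd G)" using g A by simp
  interpret K: group Gs by (rule lie_groupD(1)[OF LK])
  interpret H: group L by (rule lie_groupD(1)[OF LL])
  have "\<forall>\<^sub>F h in mnhds (mfd G) g. (\<one>\<^bsub>Gs\<^esub>, h, h, \<one>\<^bsub>L\<^esub>) \<in> GL"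
    using eventually_mnhds_points[OF A(1) g'] by eventually_elim (simp add: A(2) unit_GL[unfolded unit_def])
  then show ?thesis
    unfolding unit_def[abs_def]
    by (rule smooth_into_M[OF smooth_at_const_group[OF LK A(1) g' K.one_closed] smooth_at_ident_group[OF LG g]
          smooth_at_ident_group[OF LG g] smooth_at_const_group[OF LL A(1) g' H.one_closed]])
qed

lemma
  assumes c: "c \<in> composable"
  shows C_fst: "smooth_at C M fst c" and C_snd: "smooth_at C M snd c" and C_compose: "smooth_at C M compose c"
proof -
  obtain x y where xy: "c = (x, y)" by (cases c)
  have x: "x \<in> GL" and y: "y \<in> GL" using c unfolding xy by auto
  have cC: "c \<in> points C" using c points_C by simp
  show f: "smooth_at C M fst c" and s: "smooth_at C M snd c"
    by (rule smooth_at_restrict_submanifold[OF ambient_C cC], use x y points_M xy in \<open>simp add: smooth_at_fst[OF atlas_M atlas_M]\<close>,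
        rule smooth_at_restrict_submanifold[OF ambient_C cC], use x y points_M xy in \<open>simp add: smooth_at_snd[OF atlas_M atlas_M]\<close>)
  have x': "fst c \<in> GL" and y': "snd c \<in> GL" using x y xy by auto
  have "\<forall>\<^sub>F c in mnhds C c. (pk (snd c) \<otimes>\<^bsub>Gs\<^esub> pk (fst c), p1 (fst c), p2 (snd c), pl (fst c) \<otimes>\<^bsub>L\<^esub> pl (snd c)) \<in> GL"
    using eventually_mnhds_points[OF atlas_C cC]
  proof eventually_elim
    case (elim c)
    then have "c \<in> composable" using points_C by simp
    from compose_GL[OF this] show ?case unfolding compose_def .
  qed
  then show "smooth_at C M compose c"
    unfolding compose_def[abs_def]
    by (rule smooth_into_M[OF
          smooth_at_mult[OF LK smooth_at_compose(1)[OF s M_pk[OF y']] smooth_at_compose(1)[OF f M_pk[OF x']]]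
          smooth_at_compose(1)[OF f M_p1[OF x']] smooth_at_compose(1)[OF s M_p2[OF y']]
          smooth_at_mult[OF LL smooth_at_compose(1)[OF f M_pl[OF x']] smooth_at_compose(1)[OF s M_pl[OF y']]]])
qed

lemma surj_tgt: "q \<in> GL \<Longrightarrow> surj (tangent_map M (mfd G) p1 q)"
  by (rule surjI[of _ "\<lambda>w. (w, 0)"]) (simp add: tangent_map_p1)

lemma inverse_inverse: "q \<in> GL \<Longrightarrow> inverse (inverse q) = q"
  using GL_carrier[of q] group.inv_inv[OF lie_groupD(1)[OF LK]] group.inv_inv[OF lie_groupD(1)[OF LL]]
  by (cases q) (simp add: inverse_def)

lemma surj_src: "q \<in> GL \<Longrightarrow> surj (tangent_map M (mfd G) p2 q)"
proof -
  assume q: "q \<in> GL"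
  have iq: "inverse q \<in> GL" by (rule inverse_GL[OF q])
  have qM: "q \<in> points M" "inverse q \<in> points M" using q iq points_M by auto
  note si = smooth_inverse[OF q]
  have si': "smooth_at M M inverse (inverse q)" by (rule smooth_inverse[OF iq])
  have s3: "smooth_at M M inverse (inverse (inverse q))" using si inverse_inverse[OF q] by simp
  have "\<forall>\<^sub>F r in mnhds M (inverse q). inverse (inverse r) = r"
    using eventually_mnhds_points[OF atlas_M qM(2)] by eventually_elim (simp add: points_M inverse_inverse)
  from tangent_map_cong[OF this atlas_M qM(2), where N = M]
  have id: "tangent_map M M inverse q (tangent_map M M inverse (inverse q) v) = v" for v
    using smooth_at_compose(2)[OF si' s3, of v] inverse_inverse[OF q] by (simp add: tangent_map_ident[OF atlas_M qM(2)])
  have "p2 = (\<lambda>r. p1 (inverse r))" by (auto simp: fun_eq_iff inverse_def)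
  then have "tangent_map M (mfd G) p2 q (tangent_map M M inverse (inverse q) v) = tangent_map M (mfd G) p1 (inverse q) v" for v
    using smooth_at_compose(2)[OF si M_p1[OF iq]] by (simp add: id)
  note eq = this
  show ?thesis unfolding surj_def
  proof
    fix w
    obtain v where "w = tangent_map M (mfd G) p1 (inverse q) v" using surj_tgt[OF iq] unfolding surj_def by blast
    then have "w = tangent_map M (mfd G) p2 q (tangent_map M M inverse (inverse q) v)" by (simp only: eq)
    then show "\<exists>v. w = tangent_map M (mfd G) p2 q v" by blast
  qed
qed

lemma groupoid: "lie_groupoid \<G>"
proof -
  interpret K: group Gs by (rule lie_groupD(1)[OF LK])
  interpret H: group L by (rule lie_groupD(1)[OF LL])
  note A = lie_groupD(3,4)[OF LG]
  have smooth: "smooth_map M (mfd G) p2" "smooth_map M (mfd G) p1" "smooth_map (mfd G) M unit" "smooth_map M M inverse"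
    "smooth_map C M compose"
    unfolding smooth_map_iff[OF atlas_M A(1)] smooth_map_iff[OF A(1) atlas_M] smooth_map_iff[OF atlas_M atlas_M]
      smooth_map_iff[OF atlas_C atlas_M] points_M points_C A(2)
    using M_p1 M_p2 smooth_unit smooth_inverse C_compose by blast+
  have GLc: "pk q \<in> carrier Gs" "pl q \<in> carrier L" if "q \<in> GL" for q using GL_carrier[OF that] by auto
  have assoc: "compose (compose (x, y), z) = compose (x, compose (y, z))" if "x \<in> GL" "y \<in> GL" "z \<in> GL" for x y z
    using GLc[OF that(1)] GLc[OF that(2)] GLc[OF that(3)] by (simp add: compose_def K.m_assoc H.m_assoc)
  have units: "compose (q, unit (p2 q)) = q" "compose (unit (p1 q), q) = q" "compose (inverse q, q) = unit (p2 q)"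
    "compose (q, inverse q) = unit (p1 q)" if "q \<in> GL" for q
    using GLc[OF that] by (cases q; simp add: compose_def unit_def inverse_def)+
  show ?thesis
    unfolding lie_groupoid_def groupoid_simps points_M points_C A(2)
    using manifold_M lie_groupD(2)[OF LG] smooth surj_tgt surj_src embedded_C assoc units
    by (auto simp: compose_def unit_def inverse_def)
qed

end

section \<open>The two-form\<close>

context drinfeld_setup
begin

lemma RD_compose:
  assumes "smooth_at Q N h x" "smooth_at N (mfd D) f (h x)"
  shows "RD Q (\<lambda>x. f (h x)) x v = RD N f (h x) (tangent_map Q N h x v)"
  by (simp add: RD_def mcR_compose[OF assms])

lemma RD_cong:
  assumes "\<forall>\<^sub>F x in mnhds N p. f x = g x" "atlas N" "p \<in> points N"
  shows "RD N f p = RD N g p"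
  unfolding RD_def[abs_def] mcR_cong[OF assms] ..

lemma pairing_g: "pairing (u, 0) (w, 0) = 0" and pairing_dual: "pairing (0, \<xi>) (0, \<eta>) = 0"
  and pairing_l: "x \<in> \<ll> \<Longrightarrow> y \<in> \<ll> \<Longrightarrow> pairing x y = 0"
  using lagrangian_pairing[OF l_lagr] by simp_all

lemma AdD_one: "AdD \<one>\<^bsub>D\<^esub> x = x"
  by (simp add: AdD_def Ad_one[OF LD] jD)

end

context GL_manifold
begin

abbreviation "\<theta>K \<equiv> RD M (\<lambda>x. \<phi>\<^sub>K (pk x))"
abbreviation "\<theta>2 \<equiv> RD M (\<lambda>x. \<phi>\<^sub>G (p2 x))"
abbreviation "\<theta>L \<equiv> RD M (\<lambda>x. \<phi>\<^sub>L (pl x))"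
abbreviation "\<theta>1 x v \<equiv> AdD (inv\<^bsub>D\<^esub> \<phi>\<^sub>G (p1 x)) (RD M (\<lambda>x. \<phi>\<^sub>G (p1 x)) x v)"
abbreviation "\<omega> \<equiv> omega_L Gs \<iota>\<^sub>K G L \<iota>\<^sub>L M"

lemma
  assumes x: "x \<in> GL"
  shows \<theta>K: "\<theta>K x v = (0, \<iota>\<^sub>K (mcR M Gs pk x v))" and \<theta>2: "\<theta>2 x v = (mcR M G p2 x v, 0)"
    and \<theta>L: "\<theta>L x v = \<iota>\<^sub>L (mcR M L pl x v)" and \<theta>L_in: "\<theta>L x v \<in> \<ll>"
    and \<theta>1: "\<theta>1 x v = (mcL M G p1 x v, 0)"
proof -
  interpret hG: group_hom G D \<phi>\<^sub>G by (rule lie_hom_group_hom[OF hom_G LG LD])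
  show "\<theta>K x v = (0, \<iota>\<^sub>K (mcR M Gs pk x v))" "\<theta>2 x v = (mcR M G p2 x v, 0)"
    and L: "\<theta>L x v = \<iota>\<^sub>L (mcR M L pl x v)"
    by (rule RD_K[OF M_pk[OF x]], rule RD_G[OF M_p2[OF x]], rule RD_L[OF M_pl[OF x]])
  show "\<theta>L x v \<in> \<ll>" unfolding L using \<iota>\<^sub>L(3) by auto
  show "\<theta>1 x v = (mcL M G p1 x v, 0)"
    using AdD_G_g[of "inv\<^bsub>G\<^esub> p1 x"] GL_carrier(2)[OF x]
    by (simp add: RD_G[OF M_p1[OF x]] mcL_eq[OF LG M_p1[OF x]])
qed

lemma omega_eq:
  assumes x: "x \<in> GL"
  shows "\<omega> x v w = 1/2 * (pairing (\<theta>1 x v) (\<theta>L x w) - pairing (\<theta>L x v) (\<theta>1 x w)) +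
    1/2 * (pairing (\<theta>K x v) (\<theta>2 x w) - pairing (\<theta>2 x v) (\<theta>K x w))"
  unfolding \<theta>K[OF x] \<theta>2[OF x] \<theta>L[OF x] \<theta>1[OF x]
  by (simp add: omega_L_def Let_def wedge_pairing_def mcR_def mcL_def pk_def p1_def p2_def pl_def)

lemma linear_forms:
  assumes x: "x \<in> GL"
  shows "linear (\<theta>K x)" "linear (\<theta>2 x)" "linear (\<theta>L x)" "linear (\<theta>1 x)"
proof -
  interpret group D by (rule lie_groupD(1)[OF LD])
  show "linear (\<theta>K x)" "linear (\<theta>2 x)" "linear (\<theta>L x)"
    by (rule linear_RD[OF smooth_\<phi>_K[OF M_pk[OF x]]], rule linear_RD[OF smooth_\<phi>_G[OF M_p2[OF x]]],
        rule linear_RD[OF smooth_\<phi>_L[OF M_pl[OF x]]])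
  have d: "inv\<^bsub>D\<^esub> \<phi>\<^sub>G (p1 x) \<in> carrier D" using \<phi>_closed(1)[OF GL_carrier(2)[OF x]] by simp
  show "linear (\<theta>1 x)"
    using linear_compose[OF linear_RD[OF smooth_\<phi>_G[OF M_p1[OF x]]] linear_AdD[OF d]] by (simp add: comp_def)
qed

text \<open>The Maurer--Cartan form of both sides of \<open>k\<^sup>-\<^sup>1 g\<^sub>2 = g\<^sub>1 l\<close>.\<close>

lemma constraint:
  assumes x: "x \<in> GL"
  shows "AdD (inv\<^bsub>D\<^esub> \<phi>\<^sub>K (pk x)) (\<theta>2 x v - \<theta>K x v) = AdD (\<phi>\<^sub>G (p1 x)) (\<theta>1 x v + \<theta>L x v)"
proof -
  interpret group D by (rule lie_groupD(1)[OF LD])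
  have xM: "x \<in> points M" using x points_M by simp
  note sK = smooth_\<phi>_K[OF M_pk[OF x]] and s1 = smooth_\<phi>_G[OF M_p1[OF x]] and s2 = smooth_\<phi>_G[OF M_p2[OF x]]
    and sL = smooth_\<phi>_L[OF M_pl[OF x]]
  have k: "\<phi>\<^sub>K (pk x) \<in> carrier D" and g: "\<phi>\<^sub>G (p1 x) \<in> carrier D"
    using \<phi>_closed GL_carrier[OF x] by auto
  have "\<forall>\<^sub>F y in mnhds M x. inv\<^bsub>D\<^esub> \<phi>\<^sub>K (pk y) \<otimes>\<^bsub>D\<^esub> \<phi>\<^sub>G (p2 y) = \<phi>\<^sub>G (p1 y) \<otimes>\<^bsub>D\<^esub> \<phi>\<^sub>L (pl y)"
    using eventually_mnhds_points[OF atlas_M xM] by eventually_elim (simp add: points_M GL_iff \<Psi>_def)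
  from fun_cong[OF RD_cong[OF this atlas_M xM], of v]
  have "- AdD (inv\<^bsub>D\<^esub> \<phi>\<^sub>K (pk x)) (\<theta>K x v) + AdD (inv\<^bsub>D\<^esub> \<phi>\<^sub>K (pk x)) (\<theta>2 x v) =
      RD M (\<lambda>x. \<phi>\<^sub>G (p1 x)) x v + AdD (\<phi>\<^sub>G (p1 x)) (\<theta>L x v)"
    unfolding RD_mult[OF smooth_at_inv[OF LD sK] s2] RD_mult[OF s1 sL] RD_inv[OF sK] .
  then show ?thesis by (simp add: AdD_diff[OF inv_closed[OF k]] AdD_add[OF g] AdD_inv(2)[OF g])
qed

text \<open>As \<open>\<gg>\<close>, \<open>\<gg>\<^sup>*\<close> and \<open>\<ll>\<close> are isotropic, pairing the constraint with itself says that the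
  symmetrizations of \<open>\<langle>\<theta>1, \<theta>L\<rangle>\<close> and \<open>\<langle>\<theta>K, \<theta>2\<rangle>\<close> cancel.\<close>

lemma omega_simple:
  assumes x: "x \<in> GL"
  shows "\<omega> x v w = pairing (\<theta>1 x v) (\<theta>L x w) + pairing (\<theta>K x v) (\<theta>2 x w)"
proof -
  interpret group D by (rule lie_groupD(1)[OF LD])
  have k: "inv\<^bsub>D\<^esub> \<phi>\<^sub>K (pk x) \<in> carrier D" and g: "\<phi>\<^sub>G (p1 x) \<in> carrier D"
    using \<phi>_closed GL_carrier[OF x] by auto
  have ar: "1/2 * (g - f) + 1/2 * (b - c) = g + b"
    if "a - b - (c - d) = e + f + (g + h)" "a = 0" "d = 0" "e = 0" "h = 0" for a b c d e f g h :: real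
    using that by (simp add: field_simps)
  have "pairing (\<theta>2 x v - \<theta>K x v) (\<theta>2 x w - \<theta>K x w) = pairing (\<theta>1 x v + \<theta>L x v) (\<theta>1 x w + \<theta>L x w)"
    using AdD_pairing[OF k, of "\<theta>2 x v - \<theta>K x v" "\<theta>2 x w - \<theta>K x w"]
      AdD_pairing[OF g, of "\<theta>1 x v + \<theta>L x v" "\<theta>1 x w + \<theta>L x w"] constraint[OF x] by simp
  moreover have "pairing (\<theta>2 x v) (\<theta>2 x w) = 0" "pairing (\<theta>K x v) (\<theta>K x w) = 0" "pairing (\<theta>1 x v) (\<theta>1 x w) = 0"
    "pairing (\<theta>L x v) (\<theta>L x w) = 0"
    by (simp add: \<theta>2[OF x] pairing_g, simp add: \<theta>K[OF x] pairing_dual, simp add: \<theta>1[OF x] pairing_g,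
        rule pairing_l[OF \<theta>L_in[OF x] \<theta>L_in[OF x]])
  ultimately show ?thesis
    unfolding omega_eq[OF x] pairing_add_left pairing_add_right pairing_diff_left pairing_diff_right by (rule ar)
qed

lemma omega_bilinear:
  assumes x: "x \<in> GL"
  shows "bilinear (\<omega> x)" and "\<omega> x v v = 0"
proof -
  note l = linear_forms[OF x]
  show "bilinear (\<omega> x)"
    unfolding bilinear_def omega_simple[OF x]
    by (intro conjI allI linearI)
      (simp_all add: linear_add[OF l(1)] linear_add[OF l(2)] linear_add[OF l(3)] linear_add[OF l(4)]
        linear_scale[OF l(1)] linear_scale[OF l(2)] linear_scale[OF l(3)] linear_scale[OF l(4)]
        pairing_add_left pairing_add_right pairing_scaleR_left pairing_scaleR_right distrib_left)
  show "\<omega> x v v = 0"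
    unfolding omega_eq[OF x] by (simp add: pairing_commute[of "\<theta>L x v"] pairing_commute[of "\<theta>2 x v"])
qed

text \<open>The component functions of \<open>\<omega>\<close> in a chart. Written with right Maurer--Cartan forms only:
  \<open>g\<^sub>1\<^sup>*\<theta>\<^sup>l\<close> is minus the form \<open>\<theta>\<^sup>r\<close> of \<open>g\<^sub>1\<^sup>-\<^sup>1\<close>.\<close>

definition "cK p x = \<phi>\<^sub>K (pk (chart_inv M p x))"
definition "c2 p x = \<phi>\<^sub>G (p2 (chart_inv M p x))"
definition "cL p x = \<phi>\<^sub>L (pl (chart_inv M p x))"
definition "c1 p x = inv\<^bsub>D\<^esub> \<phi>\<^sub>G (p1 (chart_inv M p x))"

lemma
  assumes p: "p \<in> GL" and x: "x \<in> chart M p ` chart_dom M p"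
  shows chart_inv_GL: "chart_inv M p x \<in> GL"
    and smooth_cK: "smooth_at vspace (mfd D) (cK p) x" and smooth_c2: "smooth_at vspace (mfd D) (c2 p) x"
    and smooth_cL: "smooth_at vspace (mfd D) (cL p) x" and smooth_c1: "smooth_at vspace (mfd D) (c1 p) x"
    and RD_cK: "RD vspace (cK p) x v = \<theta>K (chart_inv M p x) (tangent_map vspace M (chart_inv M p) x v)"
    and RD_c2: "RD vspace (c2 p) x v = \<theta>2 (chart_inv M p x) (tangent_map vspace M (chart_inv M p) x v)"
    and RD_cL: "RD vspace (cL p) x v = \<theta>L (chart_inv M p x) (tangent_map vspace M (chart_inv M p) x v)"
    and RD_c1: "RD vspace (c1 p) x v = - \<theta>1 (chart_inv M p x) (tangent_map vspace M (chart_inv M p) x v)"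
proof -
  have pM: "p \<in> points M" using p points_M by simp
  let ?q = "chart_inv M p x"
  show q: "?q \<in> GL" using chart_inv_image(2)[OF atlas_M pM x] atlas_chart(2)[OF atlas_M pM] points_M by blast
  note ci = smooth_at_chart_inv[OF atlas_M pM x]
  note sK = smooth_\<phi>_K[OF M_pk[OF q]] and s1 = smooth_\<phi>_G[OF M_p1[OF q]] and s2 = smooth_\<phi>_G[OF M_p2[OF q]]
    and sL = smooth_\<phi>_L[OF M_pl[OF q]]
  show "smooth_at vspace (mfd D) (cK p) x" "smooth_at vspace (mfd D) (c2 p) x" "smooth_at vspace (mfd D) (cL p) x"
    "smooth_at vspace (mfd D) (c1 p) x"
    unfolding cK_def[abs_def] c2_def[abs_def] cL_def[abs_def] c1_def[abs_def]
    by (rule smooth_at_compose(1)[OF ci sK], rule smooth_at_compose(1)[OF ci s2], rule smooth_at_compose(1)[OF ci sL],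
        rule smooth_at_inv[OF LD smooth_at_compose(1)[OF ci s1]])
  show "RD vspace (cK p) x v = \<theta>K ?q (tangent_map vspace M (chart_inv M p) x v)"
    "RD vspace (c2 p) x v = \<theta>2 ?q (tangent_map vspace M (chart_inv M p) x v)"
    "RD vspace (cL p) x v = \<theta>L ?q (tangent_map vspace M (chart_inv M p) x v)"
    unfolding cK_def[abs_def] c2_def[abs_def] cL_def[abs_def]
    by (rule RD_compose[OF ci sK], rule RD_compose[OF ci s2], rule RD_compose[OF ci sL])
  show "RD vspace (c1 p) x v = - \<theta>1 ?q (tangent_map vspace M (chart_inv M p) x v)"
    unfolding c1_def[abs_def] RD_inv[OF smooth_at_compose(1)[OF ci s1]] RD_compose[OF ci s1] ..
qed

definition "\<Omega> p x v w = 1/2 * (pairing (RD vspace (cL p) x v) (RD vspace (c1 p) x w) - pairing (RD vspace (c1 p) x v) (RD vspace (cL p) x w)) +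
  1/2 * (pairing (RD vspace (cK p) x v) (RD vspace (c2 p) x w) - pairing (RD vspace (c2 p) x v) (RD vspace (cK p) x w))"

lemma form2_rep_omega:
  assumes p: "p \<in> GL" and x: "x \<in> chart M p ` chart_dom M p"
  shows "form2_rep M p \<omega> x v w = \<Omega> p x v w"
proof -
  have pM: "p \<in> points M" using p points_M by simp
  note q = chart_inv_GL[OF p x] and ii = chart_inv_image[OF atlas_M pM x]
  show ?thesis
    unfolding form2_rep_def Let_def from_chart_eq[OF atlas_M pM ii(2)] ii(1) omega_eq[OF q] \<Omega>_def
      RD_cK[OF p x] RD_c2[OF p x] RD_cL[OF p x] RD_c1[OF p x]
    by (simp add: pairing_minus_left pairing_minus_right)
qed

lemma smooth_pt_\<Omega>:
  assumes p: "p \<in> GL" and x: "x \<in> chart M p ` chart_dom M p"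
  shows "smooth_pt (\<lambda>x. \<Omega> p x v w) x"
proof -
  note s = smooth_pt_RD[OF smooth_cK[OF p x] smooth_pt_const] smooth_pt_RD[OF smooth_c2[OF p x] smooth_pt_const]
    smooth_pt_RD[OF smooth_cL[OF p x] smooth_pt_const] smooth_pt_RD[OF smooth_c1[OF p x] smooth_pt_const]
  note pr = smooth_pt_bounded_bilinear[OF bounded_bilinear_pairing]
  have c: "smooth_pt (\<lambda>x. 1/2 * f x) x" if "smooth_pt f x" for f :: "'e \<times> 'e \<Rightarrow> real"
    by (rule smooth_pt_bounded_linear[OF bounded_linear_mult_right that])
  show ?thesis
    unfolding \<Omega>_def
    by (rule smooth_pt_add[OF c[OF smooth_pt_diff[OF pr[OF s(3,4)] pr[OF s(4,3)]]] c[OF smooth_pt_diff[OF pr[OF s(1,2)] pr[OF s(2,1)]]]])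
qed

lemma two_form_omega: "two_form M \<omega>"
  unfolding two_form_def points_M
proof (intro conjI ballI allI)
  fix p assume p: "p \<in> GL"
  have pM: "p \<in> points M" using p points_M by simp
  show "bilinear (\<omega> p)" "\<omega> p v v = 0" for v using omega_bilinear[OF p] by auto
  fix u v
  show "smooth_on (chart M p ` chart_dom M p) (\<lambda>x. form2_rep M p \<omega> x u v)"
    unfolding smooth_on_iff[OF atlas_chart(4)[OF atlas_M pM]]
  proof
    fix x assume x: "x \<in> chart M p ` chart_dom M p"
    have "\<forall>\<^sub>F y in nhds x. \<Omega> p y u v = form2_rep M p \<omega> y u v"
      using eventually_chart_image[OF atlas_M pM x] by eventually_elim (simp add: form2_rep_omega[OF p])
    with smooth_pt_\<Omega>[OF p x] show "smooth_pt (\<lambda>x. form2_rep M p \<omega> x u v) x" by (rule smooth_pt_cong)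
  qed
qed

text \<open>By the Maurer--Cartan equation \<open>2 d\<omega>\<close> consists of the mixed terms in the expansion of the Cartan
  three-form on \<open>\<theta>1 + \<theta>L\<close> minus those on \<open>\<theta>2 - \<theta>K\<close>. The pure terms vanish, and the two sums are
  conjugate under the adjoint action by the constraint, which preserves the three-form.\<close>

lemma closed_omega: "closed_form M \<omega>"
  unfolding closed_form_def points_M
proof (intro ballI allI)
  fix p u v w assume p: "p \<in> GL"
  interpret group D by (rule lie_groupD(1)[OF LD])
  have pM: "p \<in> points M" using p points_M by simp
  let ?x = "chart M p p"
  have x: "?x \<in> chart M p ` chart_dom M p" using atlas_chart(1)[OF atlas_M pM] by (rule imageI)
  have q: "chart_inv M p ?x = p" by (rule chart_inv_chart[OF atlas_M pM atlas_chart(1)[OF atlas_M pM]])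
  let ?A = "RD vspace (c1 p) ?x" and ?L = "RD vspace (cL p) ?x" and ?K = "RD vspace (cK p) ?x" and ?B = "RD vspace (c2 p) ?x"
  let ?dA = "\<lambda>u v. frechet_derivative (\<lambda>x. RD vspace (c1 p) x v) (at ?x) u"
  let ?dL = "\<lambda>u v. frechet_derivative (\<lambda>x. RD vspace (cL p) x v) (at ?x) u"
  let ?dK = "\<lambda>u v. frechet_derivative (\<lambda>x. RD vspace (cK p) x v) (at ?x) u"
  let ?dB = "\<lambda>u v. frechet_derivative (\<lambda>x. RD vspace (c2 p) x v) (at ?x) u"
  note sA = smooth_c1[OF p x] and sL = smooth_cL[OF p x] and sK = smooth_cK[OF p x] and sB = smooth_c2[OF p x]
  have der: "frechet_derivative (\<lambda>x. form2_rep M p \<omega> x v w) (at ?x) u =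
     1/2 * ((pairing (?L v) (?dA u w) + pairing (?dL u v) (?A w)) - (pairing (?A v) (?dL u w) + pairing (?dA u v) (?L w))) +
     1/2 * ((pairing (?K v) (?dB u w) + pairing (?dK u v) (?B w)) - (pairing (?B v) (?dK u w) + pairing (?dB u v) (?K w)))" for u v w
  proof -
    have "\<forall>\<^sub>F y in nhds ?x. form2_rep M p \<omega> y v w = \<Omega> p y v w"
      using eventually_chart_image[OF atlas_M pM x] by eventually_elim (simp add: form2_rep_omega[OF p])
    then have eq: "frechet_derivative (\<lambda>x. form2_rep M p \<omega> x v w) (at ?x) = frechet_derivative (\<lambda>x. \<Omega> p x v w) (at ?x)"
      by (rule frechet_derivative_cong_eventually)
    note hA = smooth_pt_has_derivative[OF smooth_pt_RD[OF sA smooth_pt_const]]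
      and hL = smooth_pt_has_derivative[OF smooth_pt_RD[OF sL smooth_pt_const]]
      and hK = smooth_pt_has_derivative[OF smooth_pt_RD[OF sK smooth_pt_const]]
      and hB = smooth_pt_has_derivative[OF smooth_pt_RD[OF sB smooth_pt_const]]
    note pr = bounded_bilinear.FDERIV[OF bounded_bilinear_pairing]
    have c: "((\<lambda>x. 1/2 * f x) has_derivative (\<lambda>h. 1/2 * f' h)) (at ?x)" if "(f has_derivative f') (at ?x)"
      for f :: "'e \<times> 'e \<Rightarrow> real" and f' by (rule has_derivative_mult_right[OF that])
    have "((\<lambda>x. \<Omega> p x v w) has_derivative (\<lambda>u.
     1/2 * ((pairing (?L v) (?dA u w) + pairing (?dL u v) (?A w)) - (pairing (?A v) (?dL u w) + pairing (?dA u v) (?L w))) +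
     1/2 * ((pairing (?K v) (?dB u w) + pairing (?dK u v) (?B w)) - (pairing (?B v) (?dK u w) + pairing (?dB u v) (?K w))))) (at ?x)"
      unfolding \<Omega>_def
      by (rule has_derivative_add[OF c[OF has_derivative_diff[OF pr[OF hL hA] pr[OF hA hL]]]
            c[OF has_derivative_diff[OF pr[OF hK hB] pr[OF hB hK]]]])
    then show ?thesis unfolding eq by (simp only: frechet_derivative_eqI)
  qed
  have mA: "?dA z y = ?dA y z + b (?A y) (?A z)" for y z using RD_maurer_cartan[OF sA, where u = z and v = y] b_swap[of "?A y" "?A z"] by (simp add: algebra_simps)
  have mL: "?dL z y = ?dL y z + b (?L y) (?L z)" for y z using RD_maurer_cartan[OF sL, where u = z and v = y] b_swap[of "?L y" "?L z"] by (simp add: algebra_simps)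
  have mK: "?dK z y = ?dK y z + b (?K y) (?K z)" for y z using RD_maurer_cartan[OF sK, where u = z and v = y] b_swap[of "?K y" "?K z"] by (simp add: algebra_simps)
  have mB: "?dB z y = ?dB y z + b (?B y) (?B z)" for y z using RD_maurer_cartan[OF sB, where u = z and v = y] b_swap[of "?B y" "?B z"] by (simp add: algebra_simps)
  have sym: "pairing (?L v) (?dA u w) = pairing (?dA u w) (?L v)" "pairing (?A v) (?dL u w) = pairing (?dL u w) (?A v)"
    "pairing (?K v) (?dB u w) = pairing (?dB u w) (?K v)" "pairing (?B v) (?dK u w) = pairing (?dK u w) (?B v)" for u v w
    by (rule pairing_commute)+
  have sym2: "pairing (RD vspace \<gamma> ?x u) (b y z) = pairing (b y z) (RD vspace \<gamma> ?x u)" for \<gamma> u y z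
    by (rule pairing_commute)
  let ?T = "cartan"
  have ext: "2 * ext_deriv2 M \<omega> p u v w =
    ((?T (?A u) (?A v) (?L w) + ?T (?A v) (?A w) (?L u) - ?T (?A u) (?A w) (?L v)) -
     (?T (?L u) (?L v) (?A w) + ?T (?L v) (?L w) (?A u) - ?T (?L u) (?L w) (?A v))) +
    ((?T (?B u) (?B v) (?K w) + ?T (?B v) (?B w) (?K u) - ?T (?B u) (?B w) (?K v)) -
     (?T (?K u) (?K v) (?B w) + ?T (?K v) (?K w) (?B u) - ?T (?K u) (?K w) (?B v)))"
    unfolding ext_deriv2_def der cartan_def mA[of u v] mA[of u w] mA[of v w]
      mL[of u v] mL[of u w] mL[of v w]
      mK[of u v] mK[of u w] mK[of v w]
      mB[of u v] mB[of u w] mB[of v w]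
    by (simp add: pairing_add_left pairing_add_right sym sym2 algebra_simps)
  let ?t = "tangent_map vspace M (chart_inv M p) ?x"
  have forms: "?A z = - \<theta>1 p (?t z)" "?L z = \<theta>L p (?t z)" "?K z = \<theta>K p (?t z)" "?B z = \<theta>2 p (?t z)" for z
    using RD_c1[OF p x] RD_cL[OF p x] RD_cK[OF p x] RD_c2[OF p x] unfolding q by auto
  have k: "inv\<^bsub>D\<^esub> \<phi>\<^sub>K (pk p) \<in> carrier D" and g: "\<phi>\<^sub>G (p1 p) \<in> carrier D"
    using \<phi>_closed GL_carrier[OF p] by auto
  have con: "AdD (inv\<^bsub>D\<^esub> \<phi>\<^sub>K (pk p)) (?B z - ?K z) = AdD (\<phi>\<^sub>G (p1 p)) (?L z - ?A z)" for z
    using constraint[OF p, of "?t z"] unfolding forms by (simp add: add.commute)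
  have T3: "?T (?L u - ?A u) (?L v - ?A v) (?L w - ?A w) = ?T (?B u - ?K u) (?B v - ?K v) (?B w - ?K w)"
    using AdD_cartan[OF k, of "?B u - ?K u" "?B v - ?K v" "?B w - ?K w"] AdD_cartan[OF g, of "?L u - ?A u" "?L v - ?A v" "?L w - ?A w"]
    unfolding con by simp
  have z: "?T (?A u) (?A v) (?A w) = 0" "?T (?L u) (?L v) (?L w) = 0" "?T (?K u) (?K v) (?K w) = 0" "?T (?B u) (?B v) (?B w) = 0"
    unfolding forms \<theta>1[OF p] \<theta>2[OF p] \<theta>K[OF p]
    by (simp_all add: cartan_g cartan_dual cartan_l \<theta>L_in[OF p] cartan_minus)
  have cyc: "?T (X u) (Y v) (X w) = - ?T (X u) (X w) (Y v)" "?T (Y u) (X v) (X w) = ?T (X v) (X w) (Y u)" for X Y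
    by (rule cartan_swap23, rule cartan_cyclic[symmetric])
  have "2 * ext_deriv2 M \<omega> p u v w = 0"
    unfolding ext using T3 z
    by (simp add: cartan_diff cyc[of ?A ?L] cyc[of ?L ?A] cyc[of ?K ?B] cyc[of ?B ?K])
  then show "ext_deriv2 M \<omega> p u v w = 0" by simp
qed

end

context GL_groupoid_setup
begin

text \<open>On a product of arrows \<open>x\<close> and \<open>y\<close>, the form \<open>\<theta>L\<close> is \<open>\<theta>L\<close> of \<open>x\<close> plus a conjugate of \<open>\<theta>L\<close> of \<open>y\<close>, and
  \<open>\<theta>K\<close> is \<open>\<theta>K\<close> of \<open>y\<close> plus a conjugate of \<open>\<theta>K\<close> of \<open>x\<close>. The constraint at \<open>x\<close> and the one at \<open>y\<close> move these
  conjugations to the middle object \<open>g\<close>; either leaves the term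
  \<open>\<langle>Ad (g\<^sup>-\<^sup>1) \<theta>K, \<theta>L\<rangle>\<close>, with opposite signs.\<close>

lemma multiplicative_omega: "multiplicative \<G> \<omega>"
  unfolding multiplicative_def groupoid_simps points_C pullback2_def
proof (intro ballI allI)
  fix c v w assume c: "c \<in> composable"
  interpret D: group D by (rule lie_groupD(1)[OF LD])
  interpret hG: group_hom G D \<phi>\<^sub>G by (rule lie_hom_group_hom[OF hom_G LG LD])
  interpret hK: group_hom Gs D \<phi>\<^sub>K by (rule lie_hom_group_hom[OF hom_K LK LD])
  interpret hL: group_hom L D \<phi>\<^sub>L by (rule lie_hom_group_hom[OF hom_L LL LD])
  have cC: "c \<in> points C" using c points_C by simp
  obtain x y where xy: "c = (x, y)" by (cases c)
  have x: "x \<in> GL" and y: "y \<in> GL" and e: "p2 x = p1 y" using c unfolding xy by auto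
  have xf: "fst c \<in> GL" and ys: "snd c \<in> GL" using x y xy by auto
  have m: "compose c \<in> GL" by (rule compose_GL[OF c])
  note f = C_fst[OF c] and s = C_snd[OF c] and mm = C_compose[OF c]
  let ?f = "tangent_map C M fst c" and ?s = "tangent_map C M snd c" and ?m = "tangent_map C M compose c"
  note kf = smooth_\<phi>_K[OF M_pk[OF xf]] and ks = smooth_\<phi>_K[OF M_pk[OF ys]] and km = smooth_\<phi>_K[OF M_pk[OF m]]
  note lf = smooth_\<phi>_L[OF M_pl[OF xf]] and ls = smooth_\<phi>_L[OF M_pl[OF ys]] and lm = smooth_\<phi>_L[OF M_pl[OF m]]
  note gf = smooth_\<phi>_G[OF M_p1[OF xf]] and gs = smooth_\<phi>_G[OF M_p1[OF ys]] and gm = smooth_\<phi>_G[OF M_p1[OF m]]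
  note hf = smooth_\<phi>_G[OF M_p2[OF xf]] and hs = smooth_\<phi>_G[OF M_p2[OF ys]] and hm = smooth_\<phi>_G[OF M_p2[OF m]]
  let ?k2 = "\<phi>\<^sub>K (pk y)" and ?l1 = "\<phi>\<^sub>L (pl x)" and ?g = "\<phi>\<^sub>G (p1 y)" and ?k1 = "\<phi>\<^sub>K (pk x)" and ?g1 = "\<phi>\<^sub>G (p1 x)"
  have cl: "?k2 \<in> carrier D" "?l1 \<in> carrier D" "?g \<in> carrier D" "?k1 \<in> carrier D" "?g1 \<in> carrier D"
    using \<phi>_closed GL_carrier[OF x] GL_carrier[OF y] by auto
  have evc: "\<forall>\<^sub>F d in mnhds C c. d \<in> composable" using eventually_mnhds_points[OF atlas_C cC] points_C by simp
  have K: "\<theta>K (compose c) (?m v) = \<theta>K y (?s v) + AdD ?k2 (\<theta>K x (?f v))" for v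
  proof -
    have "\<forall>\<^sub>F d in mnhds C c. \<phi>\<^sub>K (pk (compose d)) = \<phi>\<^sub>K (pk (snd d)) \<otimes>\<^bsub>D\<^esub> \<phi>\<^sub>K (pk (fst d))"
      using evc
    proof eventually_elim
      case (elim d)
      then have "fst d \<in> GL" "snd d \<in> GL" by auto
      then show ?case using GL_carrier by (simp add: compose_def)
    qed
    from fun_cong[OF RD_cong[OF this atlas_C cC], of v]
    show ?thesis
      unfolding RD_compose[OF mm km] RD_mult[OF smooth_at_compose(1)[OF s ks] smooth_at_compose(1)[OF f kf]]
        RD_compose[OF s ks] RD_compose[OF f kf] by (simp add: xy)
  qed
  have Lm: "\<theta>L (compose c) (?m v) = \<theta>L x (?f v) + AdD ?l1 (\<theta>L y (?s v))" for v
  proof -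
    have "\<forall>\<^sub>F d in mnhds C c. \<phi>\<^sub>L (pl (compose d)) = \<phi>\<^sub>L (pl (fst d)) \<otimes>\<^bsub>D\<^esub> \<phi>\<^sub>L (pl (snd d))"
      using evc
    proof eventually_elim
      case (elim d)
      then have "fst d \<in> GL" "snd d \<in> GL" by auto
      then show ?case using GL_carrier by (simp add: compose_def)
    qed
    from fun_cong[OF RD_cong[OF this atlas_C cC], of v]
    show ?thesis
      unfolding RD_compose[OF mm lm] RD_mult[OF smooth_at_compose(1)[OF f lf] smooth_at_compose(1)[OF s ls]]
        RD_compose[OF s ls] RD_compose[OF f lf] by (simp add: xy)
  qed
  have p1m: "p1 (compose d) = p1 (fst d)" and p2m: "p2 (compose d) = p2 (snd d)" for d by (simp_all add: compose_def)
  have T1: "\<theta>1 (compose c) (?m v) = \<theta>1 x (?f v)" for v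
    using RD_compose[OF mm gm, of v] RD_compose[OF f gf, of v] unfolding p1m by (simp add: xy)
  have T2: "\<theta>2 (compose c) (?m v) = \<theta>2 y (?s v)" for v
    using RD_compose[OF mm hm, of v] RD_compose[OF s hs, of v] unfolding p2m by (simp add: xy)
  have mid: "\<theta>1 y (?s v) = AdD (inv\<^bsub>D\<^esub> ?g) (\<theta>2 x (?f v))" for v
  proof -
    have "\<forall>\<^sub>F d in mnhds C c. \<phi>\<^sub>G (p2 (fst d)) = \<phi>\<^sub>G (p1 (snd d))" using evc by eventually_elim auto
    from fun_cong[OF RD_cong[OF this atlas_C cC], of v]
    show ?thesis unfolding RD_compose[OF f hf] RD_compose[OF s gs] by (simp add: xy)
  qed
  let ?a1 = "\<theta>1 x (?f v)" and ?kap = "\<theta>K x (?f v)" and ?lam = "\<theta>L x (?f v)" and ?bg = "\<theta>2 x (?f v)"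
  have 1: "pairing ?a1 (AdD ?l1 (\<theta>L y (?s w))) = pairing (\<theta>1 y (?s v)) (\<theta>L y (?s w)) - pairing (AdD (inv\<^bsub>D\<^esub> ?g) ?kap) (\<theta>L y (?s w))"
  proof -
    have \<lambda>: "AdD ?l1 (\<theta>L y (?s w)) \<in> \<ll>" by (rule AdD_L[OF GL_carrier(4)[OF x] \<theta>L_in[OF y]])
    have "pairing ?a1 (AdD ?l1 (\<theta>L y (?s w))) = pairing (?a1 + ?lam) (AdD ?l1 (\<theta>L y (?s w)))"
      using pairing_l[OF \<theta>L_in[OF x, of "?f v"] \<lambda>] by (simp add: pairing_add_left)
    also have "\<dots> = pairing (AdD (inv\<^bsub>D\<^esub> ?l1) (?a1 + ?lam)) (\<theta>L y (?s w))"
      using AdD_pairing[OF D.inv_closed[OF cl(2)], of "?a1 + ?lam" "AdD ?l1 (\<theta>L y (?s w))"] by (simp add: AdD_inv(1)[OF cl(2)])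
    also have "AdD (inv\<^bsub>D\<^esub> ?l1) (?a1 + ?lam) = AdD (inv\<^bsub>D\<^esub> ?g) (?bg - ?kap)"
    proof -
      have eq: "inv\<^bsub>D\<^esub> ?k1 \<otimes>\<^bsub>D\<^esub> ?g = ?g1 \<otimes>\<^bsub>D\<^esub> ?l1" using x unfolding GL_iff \<Psi>_def e by simp
      have "inv\<^bsub>D\<^esub> ?g = inv\<^bsub>D\<^esub> ?l1 \<otimes>\<^bsub>D\<^esub> (inv\<^bsub>D\<^esub> ?g1 \<otimes>\<^bsub>D\<^esub> inv\<^bsub>D\<^esub> ?k1)"
      proof -
        have "?k1 \<otimes>\<^bsub>D\<^esub> (inv\<^bsub>D\<^esub> ?k1 \<otimes>\<^bsub>D\<^esub> ?g) = ?g" using cl by (simp add: D.m_assoc[symmetric])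
        then have "?g = ?k1 \<otimes>\<^bsub>D\<^esub> (?g1 \<otimes>\<^bsub>D\<^esub> ?l1)" by (simp only: eq)
        then show ?thesis using cl by (simp only: D.inv_mult_group D.m_closed D.m_assoc D.inv_closed)
      qed
      then have "AdD (inv\<^bsub>D\<^esub> ?g) (?bg - ?kap) = AdD (inv\<^bsub>D\<^esub> ?l1) (AdD (inv\<^bsub>D\<^esub> ?g1) (AdD (inv\<^bsub>D\<^esub> ?k1) (?bg - ?kap)))"
        using cl by (simp add: AdD_mult)
      also have "\<dots> = AdD (inv\<^bsub>D\<^esub> ?l1) (?a1 + ?lam)"
        unfolding constraint[OF x] by (simp only: AdD_inv(1)[OF cl(5)])
      finally show ?thesis by simp
    qed
    finally show ?thesis
      unfolding mid AdD_diff[OF D.inv_closed[OF cl(3)]] by (simp add: pairing_diff_left)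
  qed
  have 2: "pairing (AdD ?k2 ?kap) (\<theta>2 y (?s w)) = pairing ?kap (\<theta>2 x (?f w)) + pairing (AdD (inv\<^bsub>D\<^esub> ?g) ?kap) (\<theta>L y (?s w))"
  proof -
    obtain \<xi> where \<xi>: "AdD ?k2 ?kap = (0, \<xi>)" using AdD_K[OF GL_carrier(1)[OF y]] \<theta>K[OF x] by metis
    have "pairing (AdD ?k2 ?kap) (\<theta>2 y (?s w)) = pairing (AdD ?k2 ?kap) (\<theta>2 y (?s w) - \<theta>K y (?s w))"
      unfolding \<xi> by (simp add: \<theta>K[OF y] pairing_diff_right pairing_dual)
    also have "\<dots> = pairing ?kap (AdD (inv\<^bsub>D\<^esub> ?k2) (\<theta>2 y (?s w) - \<theta>K y (?s w)))" by (rule AdD_pairing_inv[OF cl(1)])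
    also have "\<dots> = pairing ?kap (AdD ?g (\<theta>1 y (?s w) + \<theta>L y (?s w)))" unfolding constraint[OF y] ..
    also have "\<dots> = pairing ?kap (\<theta>2 x (?f w)) + pairing ?kap (AdD ?g (\<theta>L y (?s w)))"
      unfolding AdD_add[OF cl(3)] mid AdD_inv(2)[OF cl(3)] by (rule pairing_add_right)
    also have "pairing ?kap (AdD ?g (\<theta>L y (?s w))) = pairing (AdD (inv\<^bsub>D\<^esub> ?g) ?kap) (\<theta>L y (?s w))"
      using AdD_pairing[OF D.inv_closed[OF cl(3)], of ?kap "AdD ?g (\<theta>L y (?s w))"] by (simp add: AdD_inv(1)[OF cl(3)])
    finally show ?thesis .
  qed
  show "\<omega> (compose c) (?m v) (?m w) = \<omega> (fst c) (?f v) (?f w) + \<omega> (snd c) (?s v) (?s w)"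
    unfolding omega_simple[OF m] omega_simple[OF xf] omega_simple[OF ys] T1 T2 K Lm
    using 1 2 by (simp add: xy pairing_add_left pairing_add_right)
qed

end

section \<open>The Dirac structure\<close>

context drinfeld_setup
begin

text \<open>Right translation \<open>\<gg> \<oplus> \<gg>\<^sup>* \<rightarrow> T\<^sub>gG \<oplus> T\<^sup>*\<^sub>gG\<close>. In this trivialization the Dirac structure at \<open>g\<close> is
  \<open>Ad g \<ll>\<close>.\<close>

definition rt :: "'g \<Rightarrow> 'e \<times> 'e covector \<Rightarrow> 'e \<times> 'e covector" where
  "rt g z = (right_inv_vf G (fst z) g, cov_pull (mc_right G g) (snd z))"

lemma
  assumes g: "g \<in> carrier G"
  shows bounded_linear_mc_right: "bounded_linear (mc_right G g)"
    and bounded_linear_right_inv: "bounded_linear (\<lambda>u. right_inv_vf G u g)"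
proof -
  interpret group G by (rule lie_groupD(1)[OF LG])
  show "bounded_linear (mc_right G g)"
    unfolding mc_right_def[abs_def] by (rule fin_dim_bounded_linear[OF fdE linear_dR[OF LG inv_closed[OF g] g]])
  show "bounded_linear (\<lambda>u. right_inv_vf G u g)"
    unfolding right_inv_vf_def by (rule fin_dim_bounded_linear[OF fdE linear_dR[OF LG g one_closed]])
qed

lemma rt_snd_apply: "g \<in> carrier G \<Longrightarrow> blinfun_apply (snd (rt g z)) v = blinfun_apply (snd z) (mc_right G g v)"
  by (simp add: rt_def cov_pull_apply[OF bounded_linear_mc_right])

lemma mc_right_rt: "g \<in> carrier G \<Longrightarrow> mc_right G g (fst (rt g z)) = fst z"
  by (simp add: rt_def mc_right_right_inv_vf[OF LG])

lemma rt_pairing: "g \<in> carrier G \<Longrightarrow> pairing (rt g z) (rt g z') = pairing z z'"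
  by (simp add: pairing_eq rt_snd_apply mc_right_rt)

lemma linear_rt: "g \<in> carrier G \<Longrightarrow> linear (rt g)"
proof -
  assume g: "g \<in> carrier G"
  interpret r: bounded_linear "\<lambda>u. right_inv_vf G u g" by (rule bounded_linear_right_inv[OF g])
  have 1: "snd (rt g (x + y)) = snd (rt g x) + snd (rt g y)" for x y
    by (rule blinfun_eqI) (simp only: blinfun.add_left rt_snd_apply[OF g] snd_add)
  have 2: "snd (rt g (a *\<^sub>R x)) = a *\<^sub>R snd (rt g x)" for a x
    by (rule blinfun_eqI) (simp only: blinfun.scaleR_left rt_snd_apply[OF g] snd_scaleR)
  have 3: "fst (rt g (x + y)) = fst (rt g x) + fst (rt g y)" "fst (rt g (a *\<^sub>R x)) = a *\<^sub>R fst (rt g x)" for a x y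
    by (simp_all add: rt_def r.add r.scaleR)
  have "rt g (x + y) = rt g x + rt g y" for x y
    by (rule prod_eqI) (simp_all only: 1 3 fst_add snd_add)
  moreover have "rt g (a *\<^sub>R x) = a *\<^sub>R rt g x" for a x
    by (rule prod_eqI) (simp_all only: 2 3 fst_scaleR snd_scaleR)
  ultimately show ?thesis by (rule linearI)
qed

lemma surj_rt: "g \<in> carrier G \<Longrightarrow> surj (rt g)"
proof -
  assume g: "g \<in> carrier G"
  have "rt g (mc_right G g (fst y), cov_pull (\<lambda>u. right_inv_vf G u g) (snd y)) = y" for y
    by (rule prod_eqI) (simp add: rt_def right_inv_vf_mc_right[OF LG g], rule blinfun_eqI,
      simp add: rt_snd_apply[OF g] cov_pull_apply[OF bounded_linear_right_inv[OF g]] right_inv_vf_mc_right[OF LG g])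
  then show ?thesis
    by (rule surjI[where f = "\<lambda>y. (mc_right G g (fst y), cov_pull (\<lambda>u. right_inv_vf G u g) (snd y))"])
qed

text \<open>The bivector enters the action of \<open>G\<close> on the double through its right translation to the unit, and
  contraction commutes with translations; so it reappears as the contraction with \<open>\<pi>\<close> at \<open>g\<close>.\<close>

lemma rt_left_inv:
  assumes g: "g \<in> carrier G"
  shows "rt g (AdD (\<phi>\<^sub>G g) (u, \<xi>)) =
    (left_inv_vf G u g + sharp (\<pi> g) (left_inv_form G \<xi> g), left_inv_form G \<xi> g)"
proof -
  interpret group G by (rule lie_groupD(1)[OF LG])
  interpret r: bounded_linear "\<lambda>u. right_inv_vf G u g" by (rule bounded_linear_right_inv[OF g])
  have gp: "g \<in> points (mfd G)" using g lie_groupD(4)[OF LG] by simp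
  have A: "dR G (inv\<^bsub>G\<^esub> g) g = mc_right G g" by (simp add: fun_eq_iff mc_right_def)
  have blL: "bounded_linear (dL G (inv\<^bsub>G\<^esub> g) g)"
    by (rule fin_dim_bounded_linear[OF fdE linear_dL[OF LG inv_closed[OF g] g]])
  have blA: "bounded_linear (Ad G (inv\<^bsub>G\<^esub> g))"
    by (rule fin_dim_bounded_linear[OF fdE linear_Ad[OF LG inv_closed[OF g]]])
  have lf: "cov_pull (mc_right G g) (coAd G g \<xi>) = left_inv_form G \<xi> g"
    by (rule blinfun_eqI)
      (simp add: cov_pull_apply[OF bounded_linear_mc_right[OF g]] coAd_def cov_pull_apply[OF blA]
        left_inv_form_def cov_pull_apply[OF blL] mc_left_eq[OF LG g, symmetric] mc_left_def)
  have "bilinear (\<pi> g)"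
    using poisson_lie gp unfolding poisson_lie_group_def poisson_def bivector_field_def by blast
  then have "linear (\<pi> g (cov_pull (mc_right G g) (coAd G g \<xi>)))" unfolding bilinear_def by blast
  from sharp_push_bivector[where P = "\<pi> g" and \<alpha> = "coAd G g \<xi>", OF fdE fdE bounded_linear_mc_right[OF g] this]
  have sh: "sharp (push_bivector (mc_right G g) (\<pi> g)) (coAd G g \<xi>) = mc_right G g (sharp (\<pi> g) (left_inv_form G \<xi> g))"
    unfolding lf .
  show ?thesis
    unfolding AdD_G[OF g] double_Ad.simps A sh rt_def
    by (simp add: r.add lf right_inv_vf_mc_right[OF LG g] left_inv_vf_eq[OF LG g, symmetric])
qed

lemma e_dirac_eq:
  assumes g: "g \<in> carrier G"
  shows "e_dirac G \<pi> \<ll> g = (\<lambda>x. rt g (AdD (\<phi>\<^sub>G g) x)) ` \<ll>"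
proof -
  note l = linear_compose[OF linear_AdD[OF \<phi>_closed(1)[OF g]] linear_rt[OF g], unfolded comp_def]
  have "e_dirac G \<pi> \<ll> g = (\<lambda>x. - rt g (AdD (\<phi>\<^sub>G g) x)) ` \<ll>"
    unfolding e_dirac_def by (auto simp: rt_left_inv[OF g, symmetric] image_iff)
  also have "\<dots> = (\<lambda>x. rt g (AdD (\<phi>\<^sub>G g) x)) ` uminus ` \<ll>"
    by (simp add: image_image linear_neg[OF l])
  also have "uminus ` \<ll> = \<ll>"
    using subspace_neg[OF l_subspace] by (metis (no_types, opaque_lifting) add.inverse_inverse image_subset_iff imageI subset_antisym subsetI)
  finally show ?thesis .
qed

lemma lagrangian_e_dirac: "g \<in> carrier G \<Longrightarrow> lagrangian (e_dirac G \<pi> \<ll> g)"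
proof -
  assume g: "g \<in> carrier G"
  note d = \<phi>_closed(1)[OF g]
  have "surj (\<lambda>x. rt g (AdD (\<phi>\<^sub>G g) x))"
    unfolding surj_def using surj_rt[OF g] AdD_inv(2)[OF d] by (metis surjD)
  then show ?thesis
    unfolding e_dirac_eq[OF g]
    by (intro lagrangian_image[OF _ _ l_lagr]) (simp_all add: rt_pairing[OF g] AdD_pairing[OF d])
qed

text \<open>The form \<open>\<theta>\<^sup>r\<close> of \<open>G\<close> in the chart at \<open>p\<close>.\<close>

definition "R p = mcR vspace G (chart_inv (mfd G) p)"

context
  fixes p assumes p: "p \<in> carrier G"
begin

lemma p_points: "p \<in> points (mfd G)"
  using p lie_groupD(4)[OF LG] by simp

abbreviation "im \<equiv> chart (mfd G) p ` chart_dom (mfd G) p"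
abbreviation "ci \<equiv> chart_inv (mfd G) p"
abbreviation "x0 \<equiv> chart (mfd G) p p"

lemma x0_im: "x0 \<in> im"
  using atlas_chart(1)[OF lie_groupD(3)[OF LG] p_points] by (rule imageI)

lemma ci_carrier: "x \<in> im \<Longrightarrow> ci x \<in> carrier G"
  using chart_inv_image(2)[OF lie_groupD(3)[OF LG] p_points] atlas_chart(2)[OF lie_groupD(3)[OF LG] p_points]
    lie_groupD(4)[OF LG] by blast

lemma smooth_ci: "x \<in> im \<Longrightarrow> smooth_at vspace (mfd G) ci x"
  by (rule smooth_at_chart_inv[OF lie_groupD(3)[OF LG] p_points])

lemma eventually_im: "x \<in> im \<Longrightarrow> \<forall>\<^sub>F y in nhds x. y \<in> im"
  by (rule eventually_chart_image[OF lie_groupD(3)[OF LG] p_points])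

lemma ci_x0: "ci x0 = p"
  by (rule chart_inv_chart[OF lie_groupD(3)[OF LG] p_points atlas_chart(1)[OF lie_groupD(3)[OF LG] p_points]])

lemma R_linear: "x \<in> im \<Longrightarrow> linear (R p x)"
  unfolding R_def by (rule linear_mcR[OF LG smooth_ci])

lemma R_smooth: "x \<in> im \<Longrightarrow> smooth_pt w x \<Longrightarrow> smooth_pt (\<lambda>x. R p x (w x)) x"
  unfolding R_def by (rule smooth_pt_mcR[OF LG smooth_ci])

lemma R_vf_rep: "x \<in> im \<Longrightarrow> R p x (vf_rep (mfd G) p X x) = mc_right G (ci x) (X (ci x))"
  unfolding R_def by (rule mcR_chart_vf_rep[OF LG p])

lemma form_rep_apply:
  assumes x: "x \<in> im"
  shows "blinfun_apply (form_rep (mfd G) p \<alpha> x) v = blinfun_apply (\<alpha> (ci x)) (tangent_map vspace (mfd G) ci x v)"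
proof -
  note A = lie_groupD(3)[OF LG] and ii = chart_inv_image[OF lie_groupD(3)[OF LG] p_points x]
  have "bounded_linear (tangent_map vspace (mfd G) ci x)" by (rule tangent_map_bounded_linear[OF smooth_ci[OF x]])
  then show ?thesis
    unfolding form_rep_def Let_def from_chart_eq[OF A p_points ii(2)] ii(1) by (rule cov_pull_apply)
qed

lemma form_rep_rt:
  assumes x: "x \<in> im"
  shows "blinfun_apply (form_rep (mfd G) p (\<lambda>q. snd (rt q (z q))) x) v = blinfun_apply (snd (z (ci x))) (R p x v)"
  unfolding form_rep_apply[OF x] rt_snd_apply[OF ci_carrier[OF x]] by (simp add: R_def mcR_def)

text \<open>At the centre of the chart, components agree with the tensor.\<close>

lemma tangent_ci_x0: "tangent_map vspace (mfd G) ci x0 v = v"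
proof -
  note A = lie_groupD(3)[OF LG]
  have "\<forall>\<^sub>F x in nhds x0. chart (mfd G) p (ci x) = x"
    using eventually_im[OF x0_im] by eventually_elim (rule chart_inv_image(1)[OF A p_points])
  from frechet_derivative_cong_eventually[OF this] show ?thesis unfolding tangent_map_eq by (simp add: ci_x0)
qed

lemma vf_rep_x0: "vf_rep (mfd G) p X x0 = X p"
  unfolding vf_rep_def Let_def ci_x0 to_chart_eq by (rule tangent_map_chart_self[OF lie_groupD(3)[OF LG] p_points])

lemma R_x0: "R p x0 v = mc_right G p v"
  by (simp add: R_def mcR_def tangent_ci_x0 ci_x0)

definition "\<gamma> x = \<phi>\<^sub>G (ci x)"

lemma \<gamma>_smooth: "x \<in> im \<Longrightarrow> smooth_at vspace (mfd D) \<gamma> x"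
  unfolding \<gamma>_def by (rule smooth_\<phi>_G[OF smooth_ci])

lemma RD_\<gamma>: "x \<in> im \<Longrightarrow> RD vspace \<gamma> x u = (R p x u, 0)"
  unfolding \<gamma>_def R_def by (rule RD_G[OF smooth_ci])

lemma smooth_section_rt:
  "smooth_on im (vf_rep (mfd G) p (\<lambda>q. fst (rt q (AdD (\<phi>\<^sub>G q) y))))"
  "smooth_on im (form_rep (mfd G) p (\<lambda>q. snd (rt q (AdD (\<phi>\<^sub>G q) y))))"
proof -
  note A = lie_groupD(3)[OF LG]
  note op = atlas_chart(4)[OF A p_points]
  show "smooth_on im (vf_rep (mfd G) p (\<lambda>q. fst (rt q (AdD (\<phi>\<^sub>G q) y))))"
    unfolding smooth_on_iff[OF op]
  proof
    fix x assume x: "x \<in> im"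
    have w: "smooth_pt (\<lambda>x. fst (AdD (\<gamma> x) y)) x" by (rule smooth_pt_fst[OF smooth_pt_AdD[OF \<gamma>_smooth[OF x]]])
    have "\<forall>\<^sub>F x in nhds x. vf_rep (mfd G) p (\<lambda>q. right_inv_vf G (fst (AdD (\<gamma> (chart (mfd G) p q)) y)) q) x =
        vf_rep (mfd G) p (\<lambda>q. fst (rt q (AdD (\<phi>\<^sub>G q) y))) x"
      using eventually_im[OF x]
      by eventually_elim (simp add: vf_rep_def Let_def rt_def \<gamma>_def chart_inv_image(1)[OF A p_points])
    with right_inv_vf_rep[OF LG p w x]
    show "smooth_pt (vf_rep (mfd G) p (\<lambda>q. fst (rt q (AdD (\<phi>\<^sub>G q) y)))) x" by (rule smooth_pt_cong)
  qed
  show "smooth_on im (form_rep (mfd G) p (\<lambda>q. snd (rt q (AdD (\<phi>\<^sub>G q) y))))"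
    unfolding smooth_on_iff[OF op]
  proof
    fix x assume x: "x \<in> im"
    show "smooth_pt (form_rep (mfd G) p (\<lambda>q. snd (rt q (AdD (\<phi>\<^sub>G q) y)))) x"
    proof (rule smooth_pt_blinfun[OF fdE])
      fix v
      have "smooth_pt (\<lambda>x. blinfun_apply (snd (AdD (\<gamma> x) y)) (R p x v)) x"
        by (rule smooth_pt_bounded_bilinear[OF bounded_bilinear_blinfun_apply smooth_pt_snd[OF smooth_pt_AdD[OF \<gamma>_smooth[OF x]]]
              R_smooth[OF x smooth_pt_const]])
      moreover have "\<forall>\<^sub>F x in nhds x. blinfun_apply (snd (AdD (\<gamma> x) y)) (R p x v) =
          blinfun_apply (form_rep (mfd G) p (\<lambda>q. snd (rt q (AdD (\<phi>\<^sub>G q) y))) x) v"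
        using eventually_im[OF x] by eventually_elim (simp add: form_rep_rt \<gamma>_def)
      ultimately show "smooth_pt (\<lambda>x. blinfun_apply (form_rep (mfd G) p (\<lambda>q. snd (rt q (AdD (\<phi>\<^sub>G q) y))) x) v) x"
        by (rule smooth_pt_cong)
    qed
  qed
qed

text \<open>The components of a section of the Dirac structure in the trivialization by right translations.
  They are \<open>Ad g\<close> of a function with values in \<open>\<ll>\<close>, whose derivative again has values in \<open>\<ll>\<close>; so up to
  \<open>Ad p \<ll>\<close>, only the derivative of the adjoint action remains.\<close>

lemma section_components:
  fixes \<sigma> :: "'g \<Rightarrow> 'e \<times> 'e covector"
  assumes \<sigma>: "smooth_section (mfd G) (points (mfd G)) \<sigma>" and E: "\<And>q. q \<in> carrier G \<Longrightarrow> \<sigma> q \<in> e_dirac G \<pi> \<ll> q"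
  defines "X \<equiv> vf_rep (mfd G) p (fst \<circ> \<sigma>)" and "\<alpha> \<equiv> form_rep (mfd G) p (snd \<circ> \<sigma>)"
  obtains s where "smooth_pt X x0" "smooth_pt \<alpha> x0" "smooth_pt s x0" "\<sigma> p = rt p (s x0)" "s x0 \<in> AdD (\<phi>\<^sub>G p) ` \<ll>"
    "\<And>u. R p x0 (frechet_derivative X (at x0) u) =
       fst (frechet_derivative s (at x0) u) - frechet_derivative (\<lambda>x. R p x (X x0)) (at x0) u"
    "\<And>u v. blinfun_apply (frechet_derivative \<alpha> (at x0) u) v =
       blinfun_apply (snd (frechet_derivative s (at x0) u)) (R p x0 v) +
       blinfun_apply (snd (s x0)) (frechet_derivative (\<lambda>x. R p x v) (at x0) u)"
    "\<And>u r. r \<in> AdD (\<phi>\<^sub>G p) ` \<ll> \<Longrightarrow> pairing (frechet_derivative s (at x0) u) r = - cartan (R p x0 u, 0) (s x0) r"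
proof -
  interpret gD: group D by (rule lie_groupD(1)[OF LD])
  note A = lie_groupD(3)[OF LG]
  note op = atlas_chart(4)[OF A p_points]
  have dp: "points (mfd G) \<inter> chart_dom (mfd G) p = chart_dom (mfd G) p"
    using atlas_chart(2)[OF A p_points] by blast
  have sec: "smooth_on im X \<and> smooth_on im \<alpha>"
    using bspec[OF \<sigma>[unfolded smooth_section_def] p_points] unfolding dp X_def \<alpha>_def .
  have X: "smooth_pt X x0" and \<alpha>: "smooth_pt \<alpha> x0"
    by (rule bspec[OF iffD1[OF smooth_on_iff[OF op] conjunct1[OF sec]] x0_im],
        rule bspec[OF iffD1[OF smooth_on_iff[OF op] conjunct2[OF sec]] x0_im])
  define s where "s x = (mc_right G (ci x) (fst (\<sigma> (ci x))), cov_pull (\<lambda>u. right_inv_vf G u (ci x)) (snd (\<sigma> (ci x))))" for x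
  have rs: "rt (ci x) (s x) = \<sigma> (ci x)" if "x \<in> im" for x
    unfolding s_def using ci_carrier[OF that]
    by (intro prod_eqI blinfun_eqI)
      (simp_all add: rt_snd_apply cov_pull_apply[OF bounded_linear_right_inv] right_inv_vf_mc_right[OF LG], simp add: rt_def right_inv_vf_mc_right[OF LG])
  have RX: "R p x (X x) = fst (s x)" if "x \<in> im" for x
    unfolding X_def R_vf_rep[OF that] s_def by simp
  have \<alpha>R: "blinfun_apply (\<alpha> x) v = blinfun_apply (snd (s x)) (R p x v)" if "x \<in> im" for x v
    using rt_snd_apply[OF ci_carrier[OF that], of "s x"] unfolding rs[OF that] \<alpha>_def form_rep_apply[OF that] R_def mcR_def
    by simp
  let ?V = "\<lambda>u. vf_rep (mfd G) p (right_inv_vf G u)"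
  have V: "smooth_pt (?V u) x0" for u
    using right_inv_vf_rep[OF LG p smooth_pt_const x0_im, of u] by simp
  have s2: "blinfun_apply (snd (s x)) u = blinfun_apply (\<alpha> x) (?V u x)" if "x \<in> im" for x u
    unfolding \<alpha>R[OF that] R_vf_rep[OF that] mc_right_right_inv_vf[OF LG ci_carrier[OF that]] ..
  have s_fst: "smooth_pt (\<lambda>x. fst (s x)) x0"
    by (rule smooth_pt_cong[OF R_smooth[OF x0_im X]]) (use eventually_im[OF x0_im] in \<open>eventually_elim, simp add: RX\<close>)
  have s_snd: "smooth_pt (\<lambda>x. snd (s x)) x0"
  proof (rule smooth_pt_blinfun[OF fdE])
    fix u
    show "smooth_pt (\<lambda>x. blinfun_apply (snd (s x)) u) x0"
      by (rule smooth_pt_cong[OF smooth_pt_bounded_bilinear[OF bounded_bilinear_blinfun_apply \<alpha> V[of u]]])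
        (use eventually_im[OF x0_im] in \<open>eventually_elim, simp add: s2\<close>)
  qed
  have s: "smooth_pt s x0" using smooth_pt_Pair[OF s_fst s_snd] by simp
  note hs = smooth_pt_has_derivative[OF s]
  have Dfst: "frechet_derivative (\<lambda>x. fst (s x)) (at x0) u = fst (frechet_derivative s (at x0) u)" for u
    by (simp add: frechet_derivative_eqI[OF has_derivative_fst[OF hs]])
  have Dsnd: "frechet_derivative (\<lambda>x. snd (s x)) (at x0) u = snd (frechet_derivative s (at x0) u)" for u
    by (simp add: frechet_derivative_eqI[OF has_derivative_snd[OF hs]])
  have linR: "\<forall>\<^sub>F x in nhds x0. linear (R p x)" using eventually_im[OF x0_im] by eventually_elim (rule R_linear)
  have 1: "R p x0 (frechet_derivative X (at x0) u) =
       fst (frechet_derivative s (at x0) u) - frechet_derivative (\<lambda>x. R p x (X x0)) (at x0) u" for u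
  proof -
    have "\<forall>\<^sub>F x in nhds x0. R p x (X x) = fst (s x)" using eventually_im[OF x0_im] by eventually_elim (rule RX)
    from frechet_derivative_cong_eventually[OF this]
    have "frechet_derivative (\<lambda>x. R p x (X x)) (at x0) u = fst (frechet_derivative s (at x0) u)" by (simp add: Dfst)
    then show ?thesis
      unfolding operator_apply_derivative[OF fdE linR R_smooth[OF x0_im smooth_pt_const] X] by (simp add: algebra_simps)
  qed
  have 2: "blinfun_apply (frechet_derivative \<alpha> (at x0) u) v =
       blinfun_apply (snd (frechet_derivative s (at x0) u)) (R p x0 v) +
       blinfun_apply (snd (s x0)) (frechet_derivative (\<lambda>x. R p x v) (at x0) u)" for u v
  proof -
    have ev: "\<forall>\<^sub>F x in nhds x0. blinfun_apply (\<alpha> x) v = blinfun_apply (snd (s x)) (R p x v)"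
      using eventually_im[OF x0_im] by eventually_elim (rule \<alpha>R)
    have "frechet_derivative (\<lambda>x. blinfun_apply (\<alpha> x) v) (at x0) u = blinfun_apply (frechet_derivative \<alpha> (at x0) u) v"
      by (simp add: frechet_derivative_eqI[OF bounded_linear.has_derivative[OF blinfun.bounded_linear_left smooth_pt_has_derivative[OF \<alpha>]]])
    moreover have "frechet_derivative (\<lambda>x. blinfun_apply (snd (s x)) (R p x v)) (at x0) u =
        blinfun_apply (snd (s x0)) (frechet_derivative (\<lambda>x. R p x v) (at x0) u) +
        blinfun_apply (snd (frechet_derivative s (at x0) u)) (R p x0 v)"
      using frechet_derivative_eqI[OF bounded_bilinear.FDERIV[OF bounded_bilinear_blinfun_apply has_derivative_snd[OF hs]
            smooth_pt_has_derivative[OF R_smooth[OF x0_im smooth_pt_const, of v]]]] by simp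
    ultimately show ?thesis unfolding frechet_derivative_cong_eventually[OF ev] by simp
  qed
  define l where "l x = AdD (inv\<^bsub>D\<^esub> \<gamma> x) (s x)" for x
  have \<gamma>D: "\<gamma> x \<in> carrier D" if "x \<in> im" for x unfolding \<gamma>_def by (rule \<phi>_closed(1)[OF ci_carrier[OF that]])
  have l_in: "l x \<in> \<ll>" if x: "x \<in> im" for x
  proof -
    obtain y where y: "y \<in> \<ll>" "\<sigma> (ci x) = rt (ci x) (AdD (\<phi>\<^sub>G (ci x)) y)"
      using E[OF ci_carrier[OF x]] unfolding e_dirac_eq[OF ci_carrier[OF x]] by blast
    have "s x = AdD (\<phi>\<^sub>G (ci x)) y"
    proof (rule prod_eqI)
      show "fst (s x) = fst (AdD (\<phi>\<^sub>G (ci x)) y)"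
        unfolding s_def y(2) using mc_right_rt[OF ci_carrier[OF x]] by simp
      show "snd (s x) = snd (AdD (\<phi>\<^sub>G (ci x)) y)"
        unfolding s_def y(2)
        by (rule blinfun_eqI) (simp add: cov_pull_apply[OF bounded_linear_right_inv[OF ci_carrier[OF x]]]
            rt_snd_apply[OF ci_carrier[OF x]] mc_right_right_inv_vf[OF LG ci_carrier[OF x]])
    qed
    then have "l x = y" unfolding l_def \<gamma>_def by (simp add: AdD_inv(1)[OF \<phi>_closed(1)[OF ci_carrier[OF x]]])
    then show ?thesis using y(1) by simp
  qed
  have sl: "s x = AdD (\<gamma> x) (l x)" if "x \<in> im" for x unfolding l_def by (rule AdD_inv(2)[OF \<gamma>D[OF that], symmetric])
  have lsm: "smooth_pt l x0"
    unfolding l_def by (rule smooth_pt_AdD_apply[OF smooth_at_inv[OF LD \<gamma>_smooth[OF x0_im]] s])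
  have Dl: "frechet_derivative l (at x0) u \<in> \<ll>" for u
    unfolding lagrangian_iff[OF l_lagr]
  proof
    fix y assume y: "y \<in> \<ll>"
    have "\<forall>\<^sub>F x in nhds x0. pairing (l x) y = 0"
      using eventually_im[OF x0_im] by eventually_elim (rule pairing_l[OF l_in y])
    from frechet_derivative_cong_eventually[OF this]
    show "pairing (frechet_derivative l (at x0) u) y = 0"
      by (simp add: fun_eq_iff frechet_derivative_eqI[OF bounded_linear.has_derivative[OF
            bounded_bilinear.bounded_linear_left[OF bounded_bilinear_pairing] smooth_pt_has_derivative[OF lsm]]])
  qed
  have linA: "\<forall>\<^sub>F x in nhds x0. linear (AdD (\<gamma> x))"
    using eventually_im[OF x0_im] by eventually_elim (rule linear_AdD[OF \<gamma>D])
  have 3: "pairing (frechet_derivative s (at x0) u) r = - cartan (R p x0 u, 0) (s x0) r" if r: "r \<in> AdD (\<phi>\<^sub>G p) ` \<ll>" for u r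
  proof -
    have ev: "\<forall>\<^sub>F x in nhds x0. s x = AdD (\<gamma> x) (l x)" using eventually_im[OF x0_im] by eventually_elim (rule sl)
    have Ds: "frechet_derivative s (at x0) u = - b (R p x0 u, 0) (s x0) + AdD (\<gamma> x0) (frechet_derivative l (at x0) u)"
      unfolding frechet_derivative_cong_eventually[OF ev]
        operator_apply_derivative[OF fd_double linA smooth_pt_AdD[OF \<gamma>_smooth[OF x0_im]] lsm]
        AdD_derivative[OF \<gamma>_smooth[OF x0_im]] RD_\<gamma>[OF x0_im] sl[OF x0_im, symmetric] ..
    obtain y where y: "y \<in> \<ll>" "r = AdD (\<gamma> x0) y" using r unfolding \<gamma>_def ci_x0 by blast
    have "pairing (AdD (\<gamma> x0) (frechet_derivative l (at x0) u)) r = 0"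
      unfolding y(2) AdD_pairing[OF \<gamma>D[OF x0_im]] by (rule pairing_l[OF Dl y(1)])
    then show ?thesis unfolding Ds cartan_def by (simp add: pairing_add_left pairing_diff_left pairing_minus_left)
  qed
  have 4: "\<sigma> p = rt p (s x0)" using rs[OF x0_im] unfolding ci_x0 by simp
  have 5: "s x0 \<in> AdD (\<phi>\<^sub>G p) ` \<ll>" using sl[OF x0_im] l_in[OF x0_im] unfolding \<gamma>_def ci_x0 by blast
  show thesis by (rule that[OF X \<alpha> s 4 5 1 2 3])
qed

text \<open>Pair the bracket with a third element of the Dirac structure. The derivatives of the components give
  Cartan terms by the previous lemma, and those of the right-invariant frame do by the
  Maurer--Cartan equation. They add up to the Cartan three-form on \<open>Ad p \<ll>\<close>, where it vanishes;
  orthogonality to a lagrangian subspace is membership.\<close>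

lemma courant_in_e_dirac:
  fixes \<sigma> \<tau> :: "'g \<Rightarrow> 'e \<times> 'e covector"
  assumes \<sigma>: "smooth_section (mfd G) (points (mfd G)) \<sigma>" "\<And>q. q \<in> carrier G \<Longrightarrow> \<sigma> q \<in> e_dirac G \<pi> \<ll> q"
    and \<tau>: "smooth_section (mfd G) (points (mfd G)) \<tau>" "\<And>q. q \<in> carrier G \<Longrightarrow> \<tau> q \<in> e_dirac G \<pi> \<ll> q"
  shows "courant_bracket (mfd G) \<sigma> \<tau> p \<in> e_dirac G \<pi> \<ll> p"
  unfolding lagrangian_iff[OF lagrangian_e_dirac[OF p]]
proof
  fix \<rho> assume "\<rho> \<in> e_dirac G \<pi> \<ll> p"
  then obtain r where r: "r \<in> AdD (\<phi>\<^sub>G p) ` \<ll>" "\<rho> = rt p r" unfolding e_dirac_eq[OF p] by blast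
  let ?X = "vf_rep (mfd G) p (fst \<circ> \<sigma>)" and ?\<alpha> = "form_rep (mfd G) p (snd \<circ> \<sigma>)"
  let ?Y = "vf_rep (mfd G) p (fst \<circ> \<tau>)" and ?\<beta> = "form_rep (mfd G) p (snd \<circ> \<tau>)"
  obtain s where s: "smooth_pt ?X x0" "smooth_pt ?\<alpha> x0" "smooth_pt s x0" "\<sigma> p = rt p (s x0)" "s x0 \<in> AdD (\<phi>\<^sub>G p) ` \<ll>"
    and DX: "\<And>u. R p x0 (frechet_derivative ?X (at x0) u) =
       fst (frechet_derivative s (at x0) u) - frechet_derivative (\<lambda>x. R p x (?X x0)) (at x0) u"
    and D\<alpha>: "\<And>u v. blinfun_apply (frechet_derivative ?\<alpha> (at x0) u) v =
       blinfun_apply (snd (frechet_derivative s (at x0) u)) (R p x0 v) +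
       blinfun_apply (snd (s x0)) (frechet_derivative (\<lambda>x. R p x v) (at x0) u)"
    and Ds: "\<And>u r. r \<in> AdD (\<phi>\<^sub>G p) ` \<ll> \<Longrightarrow> pairing (frechet_derivative s (at x0) u) r = - cartan (R p x0 u, 0) (s x0) r"
    using section_components[OF \<sigma>] by blast
  obtain t where t: "smooth_pt ?Y x0" "smooth_pt ?\<beta> x0" "smooth_pt t x0" "\<tau> p = rt p (t x0)" "t x0 \<in> AdD (\<phi>\<^sub>G p) ` \<ll>"
    and DY: "\<And>u. R p x0 (frechet_derivative ?Y (at x0) u) =
       fst (frechet_derivative t (at x0) u) - frechet_derivative (\<lambda>x. R p x (?Y x0)) (at x0) u"
    and D\<beta>: "\<And>u v. blinfun_apply (frechet_derivative ?\<beta> (at x0) u) v =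
       blinfun_apply (snd (frechet_derivative t (at x0) u)) (R p x0 v) +
       blinfun_apply (snd (t x0)) (frechet_derivative (\<lambda>x. R p x v) (at x0) u)"
    and Dt: "\<And>u r. r \<in> AdD (\<phi>\<^sub>G p) ` \<ll> \<Longrightarrow> pairing (frechet_derivative t (at x0) u) r = - cartan (R p x0 u, 0) (t x0) r"
    using section_components[OF \<tau>] by blast
  let ?R' = "\<lambda>u v. frechet_derivative (\<lambda>x. R p x v) (at x0) u"
  let ?Xp = "fst (\<sigma> p)" and ?Yp = "fst (\<tau> p)" and ?Z = "fst \<rho>"
  let ?DX = "frechet_derivative ?X (at x0)" and ?DY = "frechet_derivative ?Y (at x0)"
  let ?D\<alpha> = "frechet_derivative ?\<alpha> (at x0)" and ?D\<beta> = "frechet_derivative ?\<beta> (at x0)"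
  let ?Ds = "frechet_derivative s (at x0)" and ?Dt = "frechet_derivative t (at x0)"
  have X0: "?X x0 = ?Xp" and Y0: "?Y x0 = ?Yp" by (simp_all add: vf_rep_x0)
  have blX: "bounded_linear ?DX" by (rule has_derivative_bounded_linear[OF smooth_pt_has_derivative[OF s(1)]])
  have bl\<alpha>: "bounded_linear ?D\<alpha>" by (rule has_derivative_bounded_linear[OF smooth_pt_has_derivative[OF s(2)]])
  have RX: "R p x0 ?Xp = fst (s x0)" and RY: "R p x0 ?Yp = fst (t x0)" and RZ: "R p x0 ?Z = fst r"
    unfolding R_x0 s(4) t(4) r(2) by (rule mc_right_rt[OF p])+
  have val: "blinfun_apply (snd (\<sigma> p)) v = blinfun_apply (snd (s x0)) (R p x0 v)"
    "blinfun_apply (snd (\<tau> p)) v = blinfun_apply (snd (t x0)) (R p x0 v)"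
    "blinfun_apply (snd \<rho>) v = blinfun_apply (snd r) (R p x0 v)" for v
    unfolding R_x0 s(4) t(4) r(2) by (rule rt_snd_apply[OF p])+
  have R0diff: "R p x0 (v - w) = R p x0 v - R p x0 w" for v w by (rule linear_diff[OF R_linear[OF x0_im]])
  have MC: "?R' u v - ?R' v u = - lie_alg_bracket G (R p x0 u) (R p x0 v)" for u v
    unfolding R_def by (rule maurer_cartan[OF LG smooth_ci[OF x0_im]])
  have bl1: "bounded_linear (\<lambda>v. blinfun_apply (?D\<beta> ?Xp) v + blinfun_apply (snd (\<tau> p)) (?DX v))"
    by (intro bounded_linear_add blinfun.bounded_linear_right bounded_linear_compose[OF blinfun.bounded_linear_right blX])
  have bl2: "bounded_linear (\<lambda>v. blinfun_apply (?D\<alpha> ?Yp) v - blinfun_apply (?D\<alpha> v) ?Yp)"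
    by (intro bounded_linear_sub blinfun.bounded_linear_right bounded_linear_compose[OF blinfun.bounded_linear_left bl\<alpha>])
  have cb: "courant_bracket (mfd G) \<sigma> \<tau> p = (?DY ?Xp - ?DX ?Yp,
      Blinfun (\<lambda>v. blinfun_apply (?D\<beta> ?Xp) v + blinfun_apply (snd (\<tau> p)) (?DX v)) -
      Blinfun (\<lambda>v. blinfun_apply (?D\<alpha> ?Yp) v - blinfun_apply (?D\<alpha> v) ?Yp))"
    unfolding courant_bracket_def lie_bracket_def lie_deriv_form_def ext_deriv1_def comp_def by simp
  have "pairing (courant_bracket (mfd G) \<sigma> \<tau> p) \<rho> =
      blinfun_apply (snd \<rho>) (?DY ?Xp - ?DX ?Yp) +
      (blinfun_apply (?D\<beta> ?Xp) ?Z + blinfun_apply (snd (\<tau> p)) (?DX ?Z) -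
       (blinfun_apply (?D\<alpha> ?Yp) ?Z - blinfun_apply (?D\<alpha> ?Z) ?Yp))"
    unfolding pairing_eq cb by (simp add: blinfun.diff_left bounded_linear_Blinfun_apply[OF bl1] bounded_linear_Blinfun_apply[OF bl2])
  also have "\<dots> = (pairing (?Dt ?Xp) r - pairing (?Ds ?Yp) r + pairing (?Ds ?Z) (t x0)) -
      blinfun_apply (snd r) (?R' ?Xp ?Yp - ?R' ?Yp ?Xp) + blinfun_apply (snd (t x0)) (?R' ?Xp ?Z - ?R' ?Z ?Xp) -
      blinfun_apply (snd (s x0)) (?R' ?Yp ?Z - ?R' ?Z ?Yp)"
    unfolding val D\<alpha> D\<beta> R0diff DX DY X0 Y0 RX RY RZ pairing_eq
    by (simp add: blinfun.diff_right)
  also have "\<dots> = (pairing (?Dt ?Xp) r - pairing (?Ds ?Yp) r + pairing (?Ds ?Z) (t x0)) +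
      cartan (fst (s x0), 0) (fst (t x0), 0) r - cartan (fst (s x0), 0) (fst r, 0) (t x0) + cartan (fst (t x0), 0) (fst r, 0) (s x0)"
    unfolding MC RX RY RZ cartan_def b_g pairing_eq by (simp add: blinfun.minus_right)
  also have "\<dots> = - cartan (fst (s x0), 0) (t x0) r + cartan (fst (t x0), 0) (s x0) r - cartan (fst r, 0) (s x0) (t x0) +
      cartan (fst (s x0), 0) (fst (t x0), 0) r - cartan (fst (s x0), 0) (fst r, 0) (t x0) + cartan (fst (t x0), 0) (fst r, 0) (s x0)"
    unfolding Dt[OF r(1)] Ds[OF r(1)] Ds[OF t(5)] RX RY RZ by simp
  also have "\<dots> = - cartan (s x0) (t x0) r"
  proof -
    define s1 s2 t1 t2 r1 r2 where d: "s1 = (fst (s x0), 0 :: 'e covector)" "s2 = (0 :: 'e, snd (s x0))"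
      "t1 = (fst (t x0), 0 :: 'e covector)" "t2 = (0 :: 'e, snd (t x0))" "r1 = (fst r, 0 :: 'e covector)" "r2 = (0 :: 'e, snd r)"
    have e: "s x0 = s1 + s2" "t x0 = t1 + t2" "r = r1 + r2" unfolding d by (simp_all add: prod_eq_iff)
    have z: "cartan s1 t1 r1 = 0" "cartan s2 t2 r2 = 0" unfolding d by (rule cartan_g, rule cartan_dual)
    have z': "cartan t1 s1 r1 = 0" "cartan r1 s1 t1 = 0" "cartan s1 r1 t1 = 0" "cartan t1 r1 s1 = 0"
      unfolding d by (rule cartan_g)+
    have c: "cartan t1 s1 r2 = - cartan s1 t1 r2" "cartan t1 s2 r1 = - cartan s2 t1 r1" "cartan t1 s2 r2 = - cartan s2 t1 r2"
      "cartan r1 s1 t2 = cartan s1 t2 r1" "cartan r1 s2 t1 = cartan s2 t1 r1" "cartan r1 s2 t2 = cartan s2 t2 r1"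
      "cartan s1 r1 t2 = - cartan s1 t2 r1" "cartan t1 r1 s2 = cartan s2 t1 r1"
      by (rule cartan_swap12, rule cartan_swap12, rule cartan_swap12, rule cartan_cyclic[symmetric], rule cartan_cyclic[symmetric],
          rule cartan_cyclic[symmetric], rule cartan_swap23, rule cartan_cyclic)
    show ?thesis
      unfolding d(1)[symmetric] d(3)[symmetric] d(5)[symmetric] unfolding e cartan_add z z' c by simp
  qed
  also have "\<dots> = 0"
  proof -
    obtain x y z where "x \<in> \<ll>" "y \<in> \<ll>" "z \<in> \<ll>" "s x0 = AdD (\<phi>\<^sub>G p) x" "t x0 = AdD (\<phi>\<^sub>G p) y" "r = AdD (\<phi>\<^sub>G p) z"
      using s(5) t(5) r(1) by blast
    then show ?thesis by (simp add: AdD_cartan[OF \<phi>_closed(1)[OF p]] cartan_l)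
  qed
  finally show "pairing (courant_bracket (mfd G) \<sigma> \<tau> p) \<rho> = 0" .
qed

end

text \<open>A basis of \<open>\<ll>\<close>, moved by \<open>Ad g\<close> and the right translation, is a global frame.\<close>

lemma subbundle_e_dirac: "subbundle (mfd G) (e_dirac G \<pi> \<ll>)"
proof -
  note A = lie_groupD(3,4)[OF LG]
  obtain B :: "'e set" where B: "finite B" "independent B" "span B = UNIV" using fin_dim_basis[OF fdE] .
  obtain h :: "'e \<Rightarrow> 'e \<times> 'e covector" where h: "linear h" "inj h" "range h = \<ll>"
    using lagrangian_parametrization[OF fdE l_subspace l_lagr] by blast
  obtain f where f: "bij_betw f {..<card B} B" using B(1) by (metis bij_betw_from_nat_into_finite lessThan_atLeast0 ex_bij_betw_nat_finite)
  define \<sigma> where "\<sigma> i q = rt q (AdD (\<phi>\<^sub>G q) (h (f i)))" for i :: nat and q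
  have sec: "smooth_section (mfd G) (points (mfd G)) (\<sigma> i)" for i
    unfolding smooth_section_def
  proof
    fix p assume p: "p \<in> points (mfd G)"
    then have pc: "p \<in> carrier G" using A by simp
    have dp: "points (mfd G) \<inter> chart_dom (mfd G) p = chart_dom (mfd G) p"
      using atlas_chart(2)[OF A(1) p] by blast
    show "smooth_on (chart (mfd G) p ` (points (mfd G) \<inter> chart_dom (mfd G) p)) (vf_rep (mfd G) p (fst \<circ> \<sigma> i)) \<and>
      smooth_on (chart (mfd G) p ` (points (mfd G) \<inter> chart_dom (mfd G) p)) (form_rep (mfd G) p (snd \<circ> \<sigma> i))"
      unfolding dp \<sigma>_def comp_def using smooth_section_rt[OF pc] by blast
  qed
  have frame: "inj_on (\<lambda>i. \<sigma> i q) {..<card B} \<and> independent ((\<lambda>i. \<sigma> i q) ` {..<card B}) \<and>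
      span ((\<lambda>i. \<sigma> i q) ` {..<card B}) = e_dirac G \<pi> \<ll> q" if q: "q \<in> points (mfd G)" for q
  proof -
    have qc: "q \<in> carrier G" using q A by simp
    define \<Phi> where "\<Phi> x = rt q (AdD (\<phi>\<^sub>G q) (h x))" for x
    note d = \<phi>_closed(1)[OF qc]
    have lin: "linear \<Phi>"
      using linear_compose[OF linear_compose[OF h(1) linear_AdD[OF d]] linear_rt[OF qc]] unfolding \<Phi>_def comp_def .
    have "x = 0" if "\<Phi> x = 0" for x
    proof -
      have "pairing (h x) y = 0" for y
        using rt_pairing[OF qc, of "AdD (\<phi>\<^sub>G q) (h x)" "AdD (\<phi>\<^sub>G q) y"] that
        by (simp add: AdD_pairing[OF d] \<Phi>_def pairing_zero_left)
      then have "h x = 0" by (rule pairing_nondegenerate[OF fdE])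
      then show ?thesis using linear_injective_0[OF h(1)] h(2) by blast
    qed
    then have inj: "inj \<Phi>" using linear_injective_0[OF lin] by blast
    have \<sigma>\<Phi>: "(\<lambda>i. \<sigma> i q) = (\<lambda>i. \<Phi> (f i))" by (simp add: fun_eq_iff \<sigma>_def \<Phi>_def)
    have img: "(\<lambda>i. \<sigma> i q) ` {..<card B} = \<Phi> ` B"
      unfolding \<sigma>\<Phi> using f by (metis bij_betw_imp_surj_on image_image)
    have "inj_on (\<lambda>i. \<sigma> i q) {..<card B}"
      unfolding \<sigma>\<Phi> using comp_inj_on[OF bij_betw_imp_inj_on[OF f] inj_on_subset[OF inj subset_UNIV]] by (simp add: comp_def)
    moreover have "independent (\<Phi> ` B)"
      using linear_independent_injective_image[OF lin B(2)] inj by (simp add: B(3))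
    moreover have "span (\<Phi> ` B) = e_dirac G \<pi> \<ll> q"
      unfolding linear_span_image[OF lin] B(3) e_dirac_eq[OF qc] unfolding h(3)[symmetric] image_image \<Phi>_def ..
    ultimately show ?thesis unfolding img by blast
  qed
  show ?thesis
    unfolding subbundle_def
    by (rule exI[of _ "card B"], rule ballI, rule exI[of _ "points (mfd G)"], rule exI[of _ \<sigma>])
      (use sec frame openin_points[OF A(1)] in blast)
qed

theorem dirac_e_dirac: "dirac_structure (mfd G) (e_dirac G \<pi> \<ll>)"
  unfolding dirac_structure_def
  using subbundle_e_dirac lagrangian_e_dirac courant_in_e_dirac lie_groupD(4)[OF LG] by simp

end

section \<open>The integrated Dirac structure\<close>

context GL_groupoid_setup
begin

lemma linear_rt_AdD: "g \<in> carrier G \<Longrightarrow> linear (\<lambda>x. rt g (AdD (\<phi>\<^sub>G g) x))"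
  using linear_compose[OF linear_AdD[OF \<phi>_closed(1)] linear_rt] by (simp add: comp_def)

lemma inj_rt_AdD:
  assumes g: "g \<in> carrier G" and eq: "rt g (AdD (\<phi>\<^sub>G g) x) = rt g (AdD (\<phi>\<^sub>G g) y)"
  shows "x = y"
proof -
  have "pairing (x - y) z = 0" for z
    using rt_pairing[OF g, of "AdD (\<phi>\<^sub>G g) x" "AdD (\<phi>\<^sub>G g) z"] rt_pairing[OF g, of "AdD (\<phi>\<^sub>G g) y" "AdD (\<phi>\<^sub>G g) z"]
    by (simp add: eq AdD_pairing[OF \<phi>_closed(1)[OF g]] pairing_diff_left)
  then have "x - y = 0" by (rule pairing_nondegenerate[OF fdE])
  then show ?thesis by simp
qed

context
  fixes g assumes g: "g \<in> carrier G"
begin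

lemma unit_simps: "pk (unit g) = \<one>\<^bsub>Gs\<^esub>" "p1 (unit g) = g" "p2 (unit g) = g" "pl (unit g) = \<one>\<^bsub>L\<^esub>"
  by (simp_all add: unit_def)

lemma constraint_unit: "AdD (\<phi>\<^sub>G g) (\<theta>1 (unit g) v + \<theta>L (unit g) v) = \<theta>2 (unit g) v - \<theta>K (unit g) v"
proof -
  interpret D: group D by (rule lie_groupD(1)[OF LD])
  interpret hK: group_hom Gs D \<phi>\<^sub>K by (rule lie_hom_group_hom[OF hom_K LK LD])
  show ?thesis using constraint[OF unit_GL[OF g], of v] by (simp add: unit_simps AdD_one)
qed

lemma AdD_\<theta>1_unit: "AdD (\<phi>\<^sub>G g) (\<theta>1 (unit g) v) = (mc_right G g (fst v), 0)"
  using RD_G[OF M_p1[OF unit_GL[OF g]], of v] AdD_inv(2)[OF \<phi>_closed(1)[OF g]]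
  by (simp add: unit_simps mcR_def tangent_map_p1[OF unit_GL[OF g]])

lemma \<theta>L_unit: "\<theta>L (unit g) v = \<iota>\<^sub>L (iso (snd v))"
proof -
  interpret H: group L by (rule lie_groupD(1)[OF LL])
  show ?thesis
    by (simp add: \<theta>L[OF unit_GL[OF g]] mcR_def unit_simps tangent_map_pl[OF unit_GL[OF g]] mc_right_def dR_one[OF LL])
qed

lemma tangent_p2_unit: "\<theta>2 (unit g) v = (mc_right G g (tangent_map M (mfd G) p2 (unit g) v), 0)"
  by (simp add: \<theta>2[OF unit_GL[OF g]] mcR_def unit_simps)

text \<open>The \<open>\<gg>\<close>-component of the constraint, with \<open>\<theta>2\<close> zero on the fibre. It determines the first
  coordinate of \<open>a\<close> by the second, so the fibre is a copy of \<open>\<ll>\<close>.\<close>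

lemma algebroid_fibre_iff:
  "a \<in> algebroid_fibre \<G> g \<longleftrightarrow> mc_right G g (fst a) = - fst (AdD (\<phi>\<^sub>G g) (\<theta>L (unit g) a))"
proof -
  have c: "(mc_right G g (fst a), 0) + AdD (\<phi>\<^sub>G g) (\<theta>L (unit g) a) = \<theta>2 (unit g) a - \<theta>K (unit g) a"
    using constraint_unit[of a] by (simp add: AdD_add[OF \<phi>_closed(1)[OF g]] AdD_\<theta>1_unit)
  have "fst (\<theta>K (unit g) a) = 0" by (simp add: \<theta>K[OF unit_GL[OF g]])
  then have "mc_right G g (tangent_map M (mfd G) p2 (unit g) a) = mc_right G g (fst a) + fst (AdD (\<phi>\<^sub>G g) (\<theta>L (unit g) a))"
    using arg_cong[OF c, of fst] by (simp add: tangent_p2_unit)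
  moreover have "u = 0" if "mc_right G g u = 0" for u
    using right_inv_vf_mc_right[OF LG g, of u] linear_0[OF bounded_linear.linear[OF bounded_linear_right_inv[OF g]]]
    unfolding that by simp
  moreover have "mc_right G g 0 = 0"
    by (rule linear_0[OF bounded_linear.linear[OF bounded_linear_mc_right[OF g]]])
  ultimately show ?thesis
    unfolding algebroid_fibre_def groupoid_simps mem_Collect_eq eq_neg_iff_add_eq_0 by metis
qed

lemma
  shows \<theta>L_tangent_unit: "\<theta>L (unit g) (tangent_map (mfd G) M unit g w) = 0"
    and \<theta>2_tangent_unit: "\<theta>2 (unit g) (tangent_map (mfd G) M unit g w) = (mc_right G g w, 0)"
proof -
  interpret H: group L by (rule lie_groupD(1)[OF LL])
  note A = lie_groupD(3,4)[OF LG]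
  have gp: "g \<in> points (mfd G)" using g A by simp
  note x = unit_GL[OF g]
  have "tangent_map (mfd G) (mfd L) (\<lambda>h. pl (unit h)) g w = tangent_map M (mfd L) pl (unit g) (tangent_map (mfd G) M unit g w)"
    by (rule smooth_at_compose(2)[OF smooth_unit[OF g] M_pl[OF x]])
  then have "tangent_map M (mfd L) pl (unit g) (tangent_map (mfd G) M unit g w) = 0"
    by (simp add: unit_def tangent_map_const)
  then show "\<theta>L (unit g) (tangent_map (mfd G) M unit g w) = 0"
    by (simp add: \<theta>L_unit tangent_map_pl[OF x] linear_0[OF \<iota>\<^sub>L(1)])
  have "tangent_map (mfd G) (mfd G) (\<lambda>h. p2 (unit h)) g w = tangent_map M (mfd G) p2 (unit g) (tangent_map (mfd G) M unit g w)"
    by (rule smooth_at_compose(2)[OF smooth_unit[OF g] M_p2[OF x]])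
  then have "tangent_map M (mfd G) p2 (unit g) (tangent_map (mfd G) M unit g w) = w"
    by (simp add: unit_def tangent_map_ident[OF A(1) gp])
  then show "\<theta>2 (unit g) (tangent_map (mfd G) M unit g w) = (mc_right G g w, 0)"
    by (simp add: tangent_p2_unit)
qed

text \<open>On the algebroid fibre \<open>\<theta>2\<close> vanishes, so the constraint expresses both components, \<open>\<theta>1\<close> and \<open>\<theta>K\<close>,
  by \<open>\<theta>L\<close>; on vectors tangent to the units \<open>\<theta>L\<close> vanishes, so only the term \<open>\<langle>\<theta>K, \<theta>2\<rangle>\<close> of \<open>\<omega>\<close> is left.\<close>

lemma delta_omega:
  assumes a: "a \<in> algebroid_fibre \<G> g"
  shows "delta_form \<G> \<omega> g a = - rt g (AdD (\<phi>\<^sub>G g) (\<theta>L (unit g) a))" (is "_ = - rt g ?z")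
proof -
  note x = unit_GL[OF g] and d = \<phi>_closed(1)[OF g]
  note r = linear_0[OF bounded_linear.linear[OF bounded_linear_right_inv[OF g]]]
    linear_neg[OF bounded_linear.linear[OF bounded_linear_right_inv[OF g]]]
  have "tangent_map M (mfd G) p2 (unit g) a = 0" using a unfolding algebroid_fibre_def by simp
  then have "\<theta>2 (unit g) a = 0"
    using linear_0[OF bounded_linear.linear[OF bounded_linear_mc_right[OF g]]] by (simp add: tangent_p2_unit zero_prod_def)
  with constraint_unit[of a] have "(mc_right G g (fst a), 0) + ?z = - \<theta>K (unit g) a"
    by (simp add: AdD_add[OF d] AdD_\<theta>1_unit)
  from arg_cong[OF this, of uminus] have K: "\<theta>K (unit g) a = - ((mc_right G g (fst a), 0) + ?z)" by (simp only: minus_minus)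
  have 1: "\<omega> (unit g) a (tangent_map (mfd G) M unit g w) = - blinfun_apply (snd (rt g ?z)) w" for w
    unfolding omega_simple[OF x] \<theta>L_tangent_unit \<theta>2_tangent_unit K rt_snd_apply[OF g]
    by (simp add: pairing_eq pairing_zero_right blinfun.minus_left)
  have "fst a = right_inv_vf G (mc_right G g (fst a)) g" by (rule right_inv_vf_mc_right[OF LG g, symmetric])
  also have "\<dots> = - fst (rt g ?z)" using a unfolding algebroid_fibre_iff by (simp add: r rt_def)
  finally have 2: "tangent_map M (mfd G) p1 (unit g) a = - fst (rt g ?z)" by (simp add: tangent_map_p1[OF x])
  have 3: "Blinfun (\<lambda>w. - blinfun_apply (snd (rt g ?z)) w) = - snd (rt g ?z)"
    unfolding blinfun.minus_left[symmetric] by (rule blinfun_apply_inverse)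
  show ?thesis unfolding delta_form_def groupoid_simps 1 2 3 by (simp add: prod_eq_iff)
qed

lemma delta_omega_image: "delta_form \<G> \<omega> g ` algebroid_fibre \<G> g = e_dirac G \<pi> \<ll> g"
proof
  have neg: "- rt g (AdD (\<phi>\<^sub>G g) x) = rt g (AdD (\<phi>\<^sub>G g) (- x))" for x
    using linear_neg[OF linear_rt_AdD[OF g]] by simp
  show "delta_form \<G> \<omega> g ` algebroid_fibre \<G> g \<subseteq> e_dirac G \<pi> \<ll> g"
  proof
    fix y assume "y \<in> delta_form \<G> \<omega> g ` algebroid_fibre \<G> g"
    then obtain a where a: "a \<in> algebroid_fibre \<G> g" "y = delta_form \<G> \<omega> g a" by blast
    have "y = rt g (AdD (\<phi>\<^sub>G g) (- \<theta>L (unit g) a))" unfolding a(2) delta_omega[OF a(1)] neg ..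
    moreover have "- \<theta>L (unit g) a \<in> \<ll>" by (rule subspace_neg[OF l_subspace \<theta>L_in[OF unit_GL[OF g]]])
    ultimately show "y \<in> e_dirac G \<pi> \<ll> g" unfolding e_dirac_eq[OF g] by blast
  qed
  show "e_dirac G \<pi> \<ll> g \<subseteq> delta_form \<G> \<omega> g ` algebroid_fibre \<G> g"
  proof
    fix y assume "y \<in> e_dirac G \<pi> \<ll> g"
    then obtain x where x: "x \<in> \<ll>" "y = rt g (AdD (\<phi>\<^sub>G g) x)" unfolding e_dirac_eq[OF g] by blast
    have "- x \<in> \<ll>" by (rule subspace_neg[OF l_subspace x(1)])
    then obtain q where q: "- x = \<iota>\<^sub>L q" using \<iota>\<^sub>L(3) by blast
    define a where "a = (right_inv_vf G (- fst (AdD (\<phi>\<^sub>G g) (- x))) g, iso_inv q)"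
    have \<theta>: "\<theta>L (unit g) a = - x" by (simp add: \<theta>L_unit a_def iso(3) q)
    have a: "a \<in> algebroid_fibre \<G> g"
      unfolding algebroid_fibre_iff \<theta> by (simp add: a_def mc_right_right_inv_vf[OF LG g])
    have "delta_form \<G> \<omega> g a = y" unfolding delta_omega[OF a] \<theta> neg by (simp add: x(2))
    then show "y \<in> delta_form \<G> \<omega> g ` algebroid_fibre \<G> g" using a by blast
  qed
qed

lemma inj_delta_omega: "inj_on (delta_form \<G> \<omega> g) (algebroid_fibre \<G> g)"
proof (rule inj_onI)
  fix a a' assume a: "a \<in> algebroid_fibre \<G> g" "a' \<in> algebroid_fibre \<G> g" and eq: "delta_form \<G> \<omega> g a = delta_form \<G> \<omega> g a'"
  have \<theta>: "\<theta>L (unit g) a = \<theta>L (unit g) a'"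
    by (rule inj_rt_AdD[OF g]) (use eq in \<open>simp only: delta_omega[OF a(1)] delta_omega[OF a(2)] neg_equal_iff_equal\<close>)
  have "iso (snd a) = iso (snd a')" by (rule injD[OF \<iota>\<^sub>L(2) \<theta>[unfolded \<theta>L_unit]])
  from arg_cong[OF this, of iso_inv] have s: "snd a = snd a'" by (simp only: iso(4))
  have "mc_right G g (fst a) = mc_right G g (fst a')" 
    by (rule trans[OF a(1)[unfolded algebroid_fibre_iff \<theta>] a(2)[unfolded algebroid_fibre_iff, symmetric]])
  from arg_cong[OF this, of "\<lambda>u. right_inv_vf G u g"] have "fst a = fst a'" by (simp only: right_inv_vf_mc_right[OF LG g])
  then show "a = a'" using s by (rule prod_eqI)
qed

end

lemma presymplectic_omega: "presymplectic_groupoid \<G> \<omega>"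
  unfolding presymplectic_groupoid_def groupoid_simps lie_groupD(4)[OF LG]
  using groupoid two_form_omega closed_omega multiplicative_omega dim_UNIV_prod[OF fdE fdE] inj_delta_omega by simp

lemma integrates_omega: "integrates_dirac \<G> \<omega> (e_dirac G \<pi> \<ll>)"
  unfolding integrates_dirac_def groupoid_simps lie_groupD(4)[OF LG]
  using dirac_e_dirac delta_omega_image by simp

end

theorem theorem6p6:
  fixes G :: "('g, 'e::real_normed_vector) lie_group" and \<pi> :: "'g \<Rightarrow> 'e bivector"
    and b :: "'e \<times> 'e covector \<Rightarrow> 'e \<times> 'e covector \<Rightarrow> 'e \<times> 'e covector"
    and D :: "('d, 'f::real_normed_vector) lie_group" and \<iota>\<^sub>D :: "'f \<Rightarrow> 'e \<times> 'e covector"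
    and \<phi>\<^sub>G :: "'g \<Rightarrow> 'd"
    and \<ll> :: "('e \<times> 'e covector) set"
    and Gs :: "('k, 'p::real_normed_vector) lie_group" and \<iota>\<^sub>K :: "'p \<Rightarrow> 'e covector"
    and \<phi>\<^sub>K :: "'k \<Rightarrow> 'd"
    and L :: "('l, 'q::real_normed_vector) lie_group" and \<iota>\<^sub>L :: "'q \<Rightarrow> 'e \<times> 'e covector"
    and \<phi>\<^sub>L :: "'l \<Rightarrow> 'd"
  assumes "poisson_lie_group G \<pi>"
    and "double_bracket G \<pi> b"
    and "drinfeld_double G \<pi> b D \<iota>\<^sub>D \<phi>\<^sub>G"
    and "lagrangian_subalgebra b \<ll>"
    and "has_lie_algebra Gs \<iota>\<^sub>K UNIV (dual_bracket G \<pi>)"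
    and "integration Gs \<iota>\<^sub>K D \<iota>\<^sub>D (\<lambda>\<xi>. (0, \<xi>)) \<phi>\<^sub>K"
    and "has_lie_algebra L \<iota>\<^sub>L \<ll> b"
    and "integration L \<iota>\<^sub>L D \<iota>\<^sub>D (\<lambda>x. x) \<phi>\<^sub>L"
  shows "\<exists>(M :: ('k \<times> 'g \<times> 'g \<times> 'l, 'e \<times> 'e) manifold)
           (C :: (('k \<times> 'g \<times> 'g \<times> 'l) \<times> ('k \<times> 'g \<times> 'g \<times> 'l), 'e \<times> 'e \<times> 'e) manifold).
      points M = GL_set Gs G L D \<phi>\<^sub>K \<phi>\<^sub>G \<phi>\<^sub>L \<and>
      embedded_submanifold M (mfd Gs \<times>\<^sub>m mfd G \<times>\<^sub>m mfd G \<times>\<^sub>m mfd L) \<and>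
      (let \<G> = GL_groupoid Gs G L M C; \<omega> = omega_L Gs \<iota>\<^sub>K G L \<iota>\<^sub>L M in
        multiplicative \<G> \<omega> \<and> closed_form M \<omega> \<and>
        presymplectic_groupoid \<G> \<omega> \<and> integrates_dirac \<G> \<omega> (e_dirac G \<pi> \<ll>))"
proof -
  interpret drinfeld_setup G \<pi> b D \<iota>\<^sub>D \<phi>\<^sub>G \<ll> Gs \<iota>\<^sub>K \<phi>\<^sub>K L \<iota>\<^sub>L \<phi>\<^sub>L
    by (rule drinfeld_setup.intro[OF assms])
  obtain M where M: "points M = GL" "chart M = GL_chart" "embedded_submanifold M ambient" "ambient_smooth M ambient"
    using exists_GL_manifold by blast
  interpret GL_manifold G \<pi> b D \<iota>\<^sub>D \<phi>\<^sub>G \<ll> Gs \<iota>\<^sub>K \<phi>\<^sub>K L \<iota>\<^sub>L \<phi>\<^sub>L M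
    by unfold_locales (rule M(1), rule M(2), rule M(4))
  obtain C :: "(('k \<times> 'g \<times> 'g \<times> 'l) \<times> ('k \<times> 'g \<times> 'g \<times> 'l), 'e \<times> 'e \<times> 'e) manifold" where
    C: "points C = composable" "embedded_submanifold C (M \<times>\<^sub>m M)" "ambient_smooth C (M \<times>\<^sub>m M)"
    using exists_composable_manifold by blast
  interpret GL_groupoid_setup G \<pi> b D \<iota>\<^sub>D \<phi>\<^sub>G \<ll> Gs \<iota>\<^sub>K \<phi>\<^sub>K L \<iota>\<^sub>L \<phi>\<^sub>L M C
    by unfold_locales (rule C(1), rule C(2), rule C(3))
  show ?thesis
    unfolding Let_def
    by (rule exI[of _ M], rule exI[of _ C])
      (use M(1,3) multiplicative_omega closed_omega presymplectic_omega integrates_omega in blast)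
qed

end
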